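(* Let $n\ge 1$ and $m\ge 2$ be integers, let $p_1,\dots,p_m>0$ be real numbers, and let $f_j\in H^{p_j}(\mathbf U^n)$ for $j=1,\dots,m$. Then $$\int_{\mathbf U^n}\prod_{j=1}^m|f_j|^{p_j}\,d\mu_{\mathbf{m-2}}\le \prod_{j=1}^m\int_{\mathbf T^n}|f_j|^{p_j}\,dm_n .$$ Equality occurs if and only if either some of the functions $f_j$ are identically equal to zero, or for some point $\zeta\in\mathbf U^n$ and some constants $C_j\neq 0$, $$f_j=C_j\,K_n(\cdot,\zeta)^{2/p_j},\qquad j=1,\dots,m .$$
   Context: $\mathbf U$ is the open unit disc in $\mathbf C$, $\mathbf T=\partial\mathbf U$; $\mathbf U^n$ and $\mathbf T^n$ are the unit polydisc and its distinguished boundary. $dm_n(\omega)=\frac1{(2\pi)^n}d\theta_1\dots d\theta_n$ for $\omega=(e^{i\theta_1},\dots,e^{i\theta_n})\in\mathbf T^n$ is the normalized Haar measure on $\mathbf T^n$. For $p>0$, $H^p(\mathbf U^n)$ is the space of holomorphic functions $f$ on $\mathbf U^n$ with $\|f\|_{H^p(\mathbf U^n)}=\left(\sup_{0\le r<1}\int_{\mathbf T^n}|f(r\omega)|^p\,dm_n(\omega)\right)^{1/p}<\infty$. For $f\in H^p(\mathbf U^n)$, on $\mathbf T^n$ the symbol $f$ denotes the radial boundary function $f(\omega)=\lim_{r\to1}f(r\omega)$, which exists for a.e. $\omega\in\mathbf T^n$ and satisfies $\int_{\mathbf T^n}|f|^p\,dm_n=\|f\|_{H^p(\mathbf U^n)}^p$.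 The measure $\mu_{\mathbf{m-2}}$ on $\mathbf U^n$ is $$d\mu_{\mathbf{m-2}}(z)=\frac{(m-1)^n}{\pi^n}\prod_{k=1}^n(1-|z_k|^2)^{m-2}\,dx_k\,dy_k,\qquad z_k=x_k+iy_k .$$ $K_n(z,\zeta)=\prod_{k=1}^n\frac1{1-z_k\overline{\zeta}_k}$, $z,\zeta\in\mathbf U^n$, is the reproducing kernel of $H^2(\mathbf U^n)$; its powers are $K_n(z,\zeta)^{s}=\prod_{k=1}^n(1-z_k\overline\zeta_k)^{-s}$ with principal branches. *)

theory Defs
  imports "HOL-Analysis.Analysis"
begin

definition polydisc :: "(complex ^ 'n) set" where
  "polydisc = {z. \<forall>k. norm (z $ k) < 1}"

definition torus :: "(complex ^ 'n) set" where
  "torus = {w. \<forall>k. norm (w $ k) = 1}"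

(* Normalized Haar measure: the image of d\<theta> / (2 pi)^n on the box [0, 2 pi]^n
   under \<theta> \<mapsto> (e^{i \<theta>_1}, ..., e^{i \<theta>_n}); uniform_measure divides by the
   volume (2 pi)^n of the box. *)
definition torus_measure :: "(complex ^ 'n) measure" where
  "torus_measure =
     distr (uniform_measure lborel (cbox 0 (\<chi> k. 2 * pi) :: (real ^ 'n) set))
       (restrict_space borel torus) (\<lambda>\<theta>. \<chi> k. cis (\<theta> $ k))"

(* The library has no holomorphy in several variables: f is holomorphic on an open set if at
   each of its points f has a Frechet derivative that is complex linear. *)
definition holomorphic_on_vec :: "(complex ^ 'n \<Rightarrow> complex) \<Rightarrow> (complex ^ 'n) set \<Rightarrow> bool" where
  "holomorphic_on_vec f S \<longleftrightarrow>
     (\<forall>z\<in>S. \<exists>D. (f has_derivative D) (at z) \<and> (\<forall>c v. D (c *s v) = c * D v))"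

(* The p-th power of the H^p norm, with value \<infinity> allowed. *)
definition hardy_norm_powr :: "real \<Rightarrow> (complex ^ 'n \<Rightarrow> complex) \<Rightarrow> ennreal" where
  "hardy_norm_powr p f =
     (SUP r\<in>{0..<1}. \<integral>\<^sup>+ w. ennreal (norm (f (r *\<^sub>R w)) powr p) \<partial>torus_measure)"

(* Elements are total functions whose values outside the polydisc are irrelevant; equality of
   members is therefore always equality on the polydisc. *)
definition hardy_space :: "real \<Rightarrow> (complex ^ 'n \<Rightarrow> complex) set" where
  "hardy_space p = {f. holomorphic_on_vec f polydisc \<and> hardy_norm_powr p f < \<infinity>}"

(* Radial limit; at points of the torus where it does not exist the value is unspecified
   (for f in a Hardy space these points form a null set). *)
definition radial_boundary :: "(complex ^ 'n \<Rightarrow> complex) \<Rightarrow> complex ^ 'n \<Rightarrow> complex" where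
  "radial_boundary f w = Lim (at_left 1) (\<lambda>r. f (r *\<^sub>R w))"

(* Measure on the polydisc with density ((q + 1) / pi)^n \<Prod> (1 - |z_k|^2)^q; lborel on
   complex ^ 'n is dx_1 dy_1 ... dx_n dy_n. *)
definition bergman_measure :: "nat \<Rightarrow> (complex ^ 'n) measure" where
  "bergman_measure q =
     density (restrict_space lborel polydisc)
       (\<lambda>z. ennreal ((real q + 1) ^ CARD('n) / pi ^ CARD('n)
                      * (\<Prod>k\<in>UNIV. (1 - (norm (z $ k))\<^sup>2) ^ q)))"

definition hardy_kernel :: "complex ^ 'n \<Rightarrow> complex ^ 'n \<Rightarrow> complex" where
  "hardy_kernel z \<zeta> = (\<Prod>k\<in>UNIV. 1 / (1 - z $ k * cnj (\<zeta> $ k)))"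

(* Powers of the kernel use the principal branch in each factor, where 1 - z_k cnj \<zeta>_k has
   positive real part; the principal power of the product would be a different function. *)
definition hardy_kernel_powr :: "complex ^ 'n \<Rightarrow> complex ^ 'n \<Rightarrow> real \<Rightarrow> complex" where
  "hardy_kernel_powr z \<zeta> s = (\<Prod>k\<in>UNIV. (1 - z $ k * cnj (\<zeta> $ k)) powr (- of_real s))"

lemma hardy_kernel_powr_1:
  fixes z \<zeta> :: "complex ^ 'n"
  assumes "z \<in> polydisc" "\<zeta> \<in> polydisc"
  shows "hardy_kernel_powr z \<zeta> 1 = hardy_kernel z \<zeta>"
proof -
  have "1 - z $ k * cnj (\<zeta> $ k) \<noteq> 0" for k
  proof -
    have "norm (z $ k * cnj (\<zeta> $ k)) < 1 * 1"
      unfolding norm_mult using assms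
      by (intro mult_strict_mono') (auto simp: polydisc_def)
    then show ?thesis by auto
  qed
  then show ?thesis
    unfolding hardy_kernel_powr_def hardy_kernel_def
    by (intro prod.cong) (auto simp: powr_def exp_minus divide_inverse)
qed

lemma emeasure_torus_measure:
  "emeasure (torus_measure :: (complex ^ 'n) measure) torus = 1"
proof -
  let ?B = "cbox 0 (\<chi> k. 2 * pi) :: (real ^ 'n) set"
  let ?e = "\<lambda>\<theta>. \<chi> k. cis (\<theta> $ k) :: complex ^ 'n"
  have cont: "continuous_on UNIV (?e :: real ^ 'n \<Rightarrow> complex ^ 'n)"
    unfolding cis_conv_exp by (intro continuous_intros)
  have meas: "?e \<in> measurable (uniform_measure lborel ?B) (restrict_space borel torus)"
    using borel_measurable_continuous_onI[OF cont]
    by (auto intro!: measurable_restrict_space2 simp: torus_def)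
  have "(0 :: real ^ 'n) \<bullet> i \<le> (\<chi> k. 2 * pi) \<bullet> i" if "i \<in> Basis" for i :: "real ^ 'n"
    using that by (auto simp: Basis_vec_def inner_axis)
  then have "emeasure lborel ?B = ennreal (\<Prod>i\<in>Basis. (\<chi> k. 2 * pi) \<bullet> (i :: real ^ 'n))"
    by (subst emeasure_lborel_cbox) auto
  moreover have "(\<Prod>i\<in>Basis. (\<chi> k. 2 * pi) \<bullet> (i :: real ^ 'n)) > 0"
    by (intro prod_pos) (auto simp: Basis_vec_def inner_axis)
  ultimately have "emeasure lborel ?B \<noteq> 0" and "emeasure lborel ?B \<noteq> \<infinity>"
    by (metis ennreal_eq_0_iff not_le, metis ennreal_neq_top infinity_ennreal_def)
  moreover have "?e -` torus \<inter> space (uniform_measure lborel ?B) = UNIV"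
    by (auto simp: torus_def)
  ultimately show ?thesis
    unfolding torus_measure_def
    by (subst emeasure_distr[OF meas])
       (auto simp: sets_restrict_space emeasure_uniform_measure ennreal_divide_self top.not_eq_extremum)
qed

end

theory Submission
 imports Defs "HOL-Complex_Analysis.Complex_Analysis"
begin

text \<open>In one variable the inequality is a statement about Taylor coefficients. If $g_j$ is zero free,
then $|g_j|^{p_j} = |h_j|^2$ for a holomorphic $h_j$, so that the integral over the disc is the
weighted Bergman norm of $\prod_j h_j$ and the means over circles are Hardy norms. The
coefficient of $z^N$ in a product of power series is a sum whose weights add up to a binomial
coefficient, which is exactly the weight in the Bergman norm; the Cauchy-Schwarz inequality for
that sum (\<open>hn_mult\<close>) gives the inequality by induction on $m$. Equality in
Cauchy-Schwarz says that all coefficient sequences are geometric with a common ratio, hence that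
every $h_j$ is a multiple of $1/(1-bz)$. Zeros are handled by a zero-free majorant with the same
norm (\<open>riesz_majorant\<close>). This yields \<open>burbea_disc_le\<close> and
\<open>burbea_disc_eq\<close>.

Several variables are reached one coordinate at a time. A product of integrals over circles is
one integral over a torus that has an independent variable for each factor, so the inequality
with one variable fewer can be applied for every fixed choice of these variables
(\<open>tensor\<close>). First this is done for dilated functions, where everything is
continuous up to the boundary, and then the dilation is removed with Fatou's lemma
(\<open>NI_ineq\<close>).

If equality holds, it holds on almost every slice in the last coordinate, so all slices there
are kernels with a parameter \<open>\<alpha>(x)\<close> that depends on the other coordinates; a
priori \<open>\<alpha>\<close> is only holomorphic. Expanding $1/|1-\alpha(x) w|^2$ into a power
series in $w$ turns the mean over the last circle into a sum over $l$ of the functions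
$|F_j(x,0)|^{p_j} |\alpha(x)|^{2l}$. Tensorization, this time with counting measure on the
exponents $l$, shows that equality holds for every choice of exponents
(\<open>extremal_twist\<close>). All exponents equal to zero determine $F_j(x,0)$ by induction.
One exponent equal to one shows by induction that \<open>\<alpha>\<close> times a kernel is a
multiple of a kernel, and the parameters agree because another factor is unchanged. Hence
\<open>\<alpha>\<close> is constant (\<open>extremal_step\<close>).

It remains to identify the norms with integrals over the torus. Almost every point of the torus
has a radial limit because this holds on the slices $\lambda \mapsto f(\lambda\omega)$, where it
follows from a weak-type estimate for the radial maximal function (\<open>fatou_Hp\<close>); the
rotation invariance of the torus transfers the one-variable identity
\<open>hardy_boundary_disc\<close> to $n$ variables (\<open>hardy_boundary_torus\<close>).\<close>

section \<open>Parseval identities on the circle and the disc\<close>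

definition circ :: "complex measure" where
 "circ = distr (uniform_measure lborel {0..2*pi}) (restrict_space borel (sphere 0 1)) cis"

definition berg :: "nat \<Rightarrow> complex measure" where
 "berg q = density (restrict_space lborel (ball 0 1))
  (\<lambda>z. ennreal ((real q + 1) / pi * (1 - (norm z)\<^sup>2) ^ q))"

lemma borel_measurable_cis [measurable]: "cis \<in> borel_measurable borel"
 unfolding cis_conv_exp by measurable

lemma borel_measurable_cnj' [measurable]: "cnj \<in> borel_measurable borel"
 by (intro borel_measurable_continuous_onI continuous_intros)

lemma measurable_cis_circ: "cis \<in> measurable borel (restrict_space borel (sphere 0 1))"
 by (rule measurable_restrict_space2) auto

lemma space_circ [simp]: "space circ = sphere 0 1"
 and sets_circ [measurable_cong]: "sets circ = sets (restrict_space borel (sphere 0 1))"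
 by (auto simp: circ_def space_restrict_space)

lemma borel_measurable_circI: "v \<in> borel_measurable borel \<Longrightarrow> v \<in> borel_measurable circ"
 using measurable_cong_sets[OF sets_circ refl] measurable_restrict_space1 by blast

lemma nn_integral_circ:
 assumes "v \<in> borel_measurable circ"
 shows "(\<integral>\<^sup>+z. v z \<partial>circ) = (\<integral>\<^sup>+t. v (cis t) * indicator {0..2*pi} t \<partial>lborel) / (2 * pi)"
proof -
 have v: "v \<in> borel_measurable (restrict_space borel (sphere 0 1))"
  using assms measurable_cong_sets[OF sets_circ refl] by blast
 have m: "cis \<in> measurable (uniform_measure lborel {0..2*pi}) (restrict_space borel (sphere 0 1))"
  using measurable_cis_circ by simp
 have mv: "(\<lambda>t. v (cis t)) \<in> borel_measurable lborel"
  using measurable_compose[OF measurable_cis_circ v] by simp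
 have "(\<integral>\<^sup>+z. v z \<partial>circ) = (\<integral>\<^sup>+t. v (cis t) \<partial>uniform_measure lborel {0..2*pi})"
  unfolding circ_def by (rule nn_integral_distr[OF m]) (simp add: v)
 also have "\<dots> = (\<integral>\<^sup>+t. v (cis t) * indicator {0..2*pi} t \<partial>lborel) / emeasure lborel {0..2*pi}"
  by (rule nn_integral_uniform_measure) (use mv in auto)
 finally show ?thesis by (simp add: ennreal_mult')
qed

lemma emeasure_circ_space: "emeasure circ (sphere 0 1) = 1"
proof -
 have "emeasure circ (sphere 0 1) = (\<integral>\<^sup>+z. 1 \<partial>circ)"
  by (simp add: nn_integral_const)
 also have "\<dots> = (\<integral>\<^sup>+t. indicator {0..2*pi} t \<partial>lborel) / (2 * pi)"
  by (subst nn_integral_circ) auto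
 also have "\<dots> = ennreal (2 * pi) / ennreal (2 * pi)" by simp
 also have "\<dots> = 1" by (subst divide_ennreal) auto
 finally show ?thesis .
qed

interpretation circ: finite_measure circ
 by standard (simp add: emeasure_circ_space)

lemma circle_rotation_measurable:
 assumes "norm c = 1" shows "(\<lambda>z. c * z) \<in> measurable circ circ"
 unfolding measurable_cong_sets[OF sets_circ sets_circ]
 by (intro measurable_restrict_space3 measurable_restrict_space2)
  (use assms in \<open>auto simp: norm_mult\<close>)

text \<open>Cut the interval of length \<open>2 * pi\<close> at the angle of \<open>c\<close> and move the
two pieces by periodicity.\<close>

lemma nn_integral_circ_rotate:
 assumes v: "v \<in> borel_measurable circ" and c: "norm c = 1"
 shows "(\<integral>\<^sup>+z. v (c * z) \<partial>circ) = (\<integral>\<^sup>+z. v z \<partial>circ)"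
proof -
 obtain a where a: "0 \<le> a" "a < 2 * pi" "c = cis a"
 proof
  show "c = cis (Arg2pi c)"
   using Arg2pi_eq[of c] c by (simp add: cis_conv_exp)
 qed (simp_all add: Arg2pi_ge_0 Arg2pi_lt_2pi)
 have v': "v \<in> borel_measurable (restrict_space borel (sphere 0 1))"
  using v measurable_cong_sets[OF sets_circ refl] by blast
 define W where "W = (\<lambda>t. v (cis t))"
 have W[measurable]: "W \<in> borel_measurable borel"
  unfolding W_def by (rule measurable_compose[OF measurable_cis_circ v'])
 have per: "W (t + 2 * pi) = W t" for t by (simp add: W_def flip: cis_mult)
 have shift: "(\<integral>\<^sup>+t. W t * indicator {l..u} t \<partial>lborel) = (\<integral>\<^sup>+t. W (d + t) * indicator {l - d..u - d} t \<partial>lborel)" for l u d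
  by (subst nn_integral_real_affine[where c=1 and t=d])
   (auto intro!: nn_integral_cong simp: indicator_def)
 have split: "(\<integral>\<^sup>+t. W t * indicator {l..u} t \<partial>lborel) =
  (\<integral>\<^sup>+t. W t * indicator {l..w} t \<partial>lborel) + (\<integral>\<^sup>+t. W t * indicator {w..u} t \<partial>lborel)"
  if "l \<le> w" "w \<le> u" for l w u
 proof -
  have "AE t in lborel. t \<noteq> w" by (rule AE_lborel_singleton)
  then have "(\<integral>\<^sup>+t. W t * indicator {l..u} t \<partial>lborel) =
   (\<integral>\<^sup>+t. W t * indicator {l..w} t + W t * indicator {w..u} t \<partial>lborel)"
   by (intro nn_integral_cong_AE) (use that in \<open>auto simp: indicator_def\<close>)
  then show ?thesis by (simp add: nn_integral_add)
 qed
 have "(\<integral>\<^sup>+t. W (a + t) * indicator {0..2*pi} t \<partial>lborel) = (\<integral>\<^sup>+t. W t * indicator {a..a+2*pi} t \<partial>lborel)"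
  by (subst shift[of _ _ a]) simp
 also have "\<dots> = (\<integral>\<^sup>+t. W t * indicator {a..2*pi} t \<partial>lborel) + (\<integral>\<^sup>+t. W t * indicator {2*pi..a+2*pi} t \<partial>lborel)"
  by (rule split) (use a in auto)
 also have "(\<integral>\<^sup>+t. W t * indicator {2*pi..a+2*pi} t \<partial>lborel) = (\<integral>\<^sup>+t. W t * indicator {0..a} t \<partial>lborel)"
  by (subst shift[of _ _ "2*pi"]) (simp add: add.commute[of "2*pi"] per)
 also have "(\<integral>\<^sup>+t. W t * indicator {a..2*pi} t \<partial>lborel) + (\<integral>\<^sup>+t. W t * indicator {0..a} t \<partial>lborel)
  = (\<integral>\<^sup>+t. W t * indicator {0..2*pi} t \<partial>lborel)"
  by (subst add.commute, rule split[symmetric]) (use a in auto)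
 finally have *: "(\<integral>\<^sup>+t. W (a + t) * indicator {0..2*pi} t \<partial>lborel) = (\<integral>\<^sup>+t. W t * indicator {0..2*pi} t \<partial>lborel)" .
 show ?thesis
  by (subst (1 2) nn_integral_circ)
   (use * v measurable_compose[OF circle_rotation_measurable[OF c] v] in
    \<open>auto simp: W_def a cis_mult\<close>)
qed

lemma distr_circ_rotate:
 assumes c: "norm c = 1"
 shows "distr circ circ (\<lambda>z. c * z) = circ"
proof (rule measure_eqI)
 fix A assume "A \<in> sets (distr circ circ (\<lambda>z. c * z))"
 then have A: "A \<in> sets circ" by simp
 have "emeasure (distr circ circ (\<lambda>z. c * z)) A = (\<integral>\<^sup>+z. indicator A z \<partial>distr circ circ (\<lambda>z. c * z))"
  using A by simp
 also have "\<dots> = (\<integral>\<^sup>+z. indicator A (c * z) \<partial>circ)"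
  by (rule nn_integral_distr[OF circle_rotation_measurable[OF c]]) (use A in auto)
 also have "\<dots> = (\<integral>\<^sup>+z. indicator A z \<partial>circ)"
  by (rule nn_integral_circ_rotate[OF _ c]) (use A in auto)
 finally have e: "emeasure (distr circ circ (\<lambda>z. c * z)) A = (\<integral>\<^sup>+z. indicator A z \<partial>circ)" .
 have "(\<integral>\<^sup>+z. indicator A z \<partial>circ) = emeasure circ A"
  by (rule nn_integral_indicator[OF A])
 with e show "emeasure (distr circ circ (\<lambda>z. c * z)) A = emeasure circ A"
  by (rule trans)
qed (rule sets_distr)

lemma integrable_circ_bounded:
 fixes v :: "complex \<Rightarrow> complex"
 assumes "v \<in> borel_measurable circ" "\<And>z. norm z = 1 \<Longrightarrow> norm (v z) \<le> B"
 shows "integrable circ v"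
 by (rule circ.integrable_const_bound[where B=B]) (use assms in \<open>auto intro!: AE_I2\<close>)

lemma integral_circ_rotate:
 fixes v :: "complex \<Rightarrow> complex"
 assumes v: "v \<in> borel_measurable circ" and c: "norm c = 1"
 shows "(\<integral>z. v (c * z) \<partial>circ) = (\<integral>z. v z \<partial>circ)"
 using integral_distr[OF circle_rotation_measurable[OF c] v] by (simp add: distr_circ_rotate[OF c])

lemma measurable_id_circ: "(\<lambda>z. z) \<in> borel_measurable circ"
 by (rule borel_measurable_circI) simp

lemma circ_orthogonal:
 "(\<integral>z. z ^ j * cnj (z ^ k) \<partial>circ) = (if j = k then 1 else 0)"
proof (cases "j = k")
 case True
 have "(\<integral>z. z ^ j * cnj (z ^ k) \<partial>circ) = (\<integral>z. 1 \<partial>circ)"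
  by (rule Bochner_Integration.integral_cong)
   (auto simp: True complex_norm_square[symmetric] norm_power simp del: complex_cnj_power)
 then show ?thesis using True emeasure_circ_space by (simp add: measure_def)
next
 case False
 define I where "I = (\<integral>z. z ^ j * cnj (z ^ k) \<partial>circ)"
 define t :: real where "t = 1 / (1 + j + k)"
 define c where "c = cis t"
 have nc: "norm c = 1" by (simp add: c_def)
 have "I = (\<integral>z. (c * z) ^ j * cnj ((c * z) ^ k) \<partial>circ)"
  unfolding I_def
  by (rule integral_circ_rotate[symmetric, OF _ nc]) (intro borel_measurable_circI, simp)
 also have "\<dots> = (\<integral>z. c ^ j * cnj (c ^ k) * (z ^ j * cnj (z ^ k)) \<partial>circ)"
  by (simp add: power_mult_distrib algebra_simps)
 also have "\<dots> = c ^ j * cnj (c ^ k) * I"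
  unfolding I_def by (rule integral_mult_right_zero)
 finally have "I * (1 - c ^ j * cnj (c ^ k)) = 0" by (simp add: algebra_simps)
 moreover have "c ^ j * cnj (c ^ k) \<noteq> 1"
 proof
  assume "c ^ j * cnj (c ^ k) = 1"
  moreover have "c ^ j * cnj (c ^ k) = cis ((real j - real k) * t)"
  proof -
   have "c ^ j * cnj (c ^ k) = cis (real j * t + - (real k * t))"
    unfolding c_def by (simp only: Complex.DeMoivre cis_cnj cis_mult)
   also have "real j * t + - (real k * t) = (real j - real k) * t" by (simp add: algebra_simps)
   finally show ?thesis .
  qed
  ultimately have "cis ((real j - real k) * t) = 1" by simp
  then have cs: "cos ((real j - real k) * t) = 1" by (simp add: complex_eq_iff)
  have t0: "0 < t" by (simp add: t_def add_pos_nonneg)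
  have ab: "\<bar>(real j - real k) * t\<bar> < 1"
   by (simp add: t_def abs_mult divide_less_eq add_pos_nonneg)
  have n0: "(real j - real k) * t \<noteq> 0" using t0 False by auto
  have "cos \<bar>(real j - real k) * t\<bar> < cos 0"
   by (rule cos_monotone_0_pi) (use ab n0 pi_gt3 in auto)
  then show False using cs by (simp add: cos_abs_real)
 qed
 ultimately show ?thesis using False by (simp add: I_def)
qed

lemma parseval_abs_summable:
 fixes a :: "nat \<Rightarrow> complex"
 assumes sm: "summable (\<lambda>k. norm (a k))"
 shows "(\<integral>\<^sup>+z. ennreal ((norm (\<Sum>k. a k * z ^ k))\<^sup>2) \<partial>circ) = (\<Sum>k. ennreal ((norm (a k))\<^sup>2))"
proof -
 define s where "s = (\<lambda>n z. \<Sum>k<n. a k * z ^ k)"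
 define B where "B = (\<Sum>k. norm (a k))"
 have sb: "norm (s n z) \<le> B" if "norm z = 1" for n z
 proof -
  have "norm (s n z) \<le> (\<Sum>k<n. norm (a k))"
   unfolding s_def by (rule order_trans[OF norm_sum]) (simp add: norm_mult norm_power that)
  also have "\<dots> \<le> B" unfolding B_def by (rule sum_le_suminf) (use sm in auto)
  finally show ?thesis .
 qed
 have sl: "(\<lambda>n. s n z) \<longlonglongrightarrow> (\<Sum>k. a k * z ^ k)" if "norm z = 1" for z
  unfolding s_def
  by (rule summable_LIMSEQ, rule summable_norm_cancel) (use sm in \<open>simp add: norm_mult norm_power that\<close>)
 have sm_meas: "s n \<in> borel_measurable circ" for n
  unfolding s_def by (rule borel_measurable_circI) simp
 have int_s: "(\<integral>z. s n z * cnj (s n z) \<partial>circ) = (\<Sum>k<n. of_real ((norm (a k))\<^sup>2))" for n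
 proof -
  have "(\<integral>z. s n z * cnj (s n z) \<partial>circ) = (\<integral>z. (\<Sum>j<n. \<Sum>k<n. a j * cnj (a k) * (z ^ j * cnj (z ^ k))) \<partial>circ)"
   unfolding s_def by (rule Bochner_Integration.integral_cong) (simp_all add: sum_product algebra_simps)
  also have "\<dots> = (\<Sum>j<n. \<Sum>k<n. a j * cnj (a k) * (\<integral>z. z ^ j * cnj (z ^ k) \<partial>circ))"
  proof -
   have i: "integrable circ (\<lambda>z. a j * cnj (a k) * (z ^ j * cnj (z ^ k)))" for j k
    by (rule integrable_circ_bounded[where B = "norm (a j * cnj (a k))"])
     (intro borel_measurable_circI, auto simp: norm_mult norm_power)
   show ?thesis
    by (subst Bochner_Integration.integral_sum, intro Bochner_Integration.integrable_sum i,
      intro sum.cong refl, subst Bochner_Integration.integral_sum, rule i,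
      intro sum.cong refl, rule integral_mult_right_zero)
  qed
  also have "\<dots> = (\<Sum>j<n. \<Sum>k<n. if j = k then a j * cnj (a k) else 0)"
   by (intro sum.cong refl) (simp add: circ_orthogonal del: complex_cnj_power)
  also have "\<dots> = (\<Sum>k<n. a k * cnj (a k))" by (simp add: sum.delta')
  finally show ?thesis unfolding complex_norm_square .
 qed
 have lim: "(\<lambda>n. \<integral>z. (norm (s n z))\<^sup>2 \<partial>circ) \<longlonglongrightarrow> (\<integral>z. (norm (\<Sum>k. a k * z ^ k))\<^sup>2 \<partial>circ)"
 proof (rule integral_dominated_convergence[where w="\<lambda>_. B\<^sup>2"])
  show "(\<lambda>z. (norm (\<Sum>k. a k * z ^ k))\<^sup>2) \<in> borel_measurable circ"
   by (rule borel_measurable_circI) simp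
  show "AE z in circ. (\<lambda>n. (norm (s n z))\<^sup>2) \<longlonglongrightarrow> (norm (\<Sum>k. a k * z ^ k))\<^sup>2"
   by (rule AE_I2) (auto intro!: tendsto_intros sl)
  show "AE z in circ. norm ((norm (s n z))\<^sup>2) \<le> B\<^sup>2" for n
   by (rule AE_I2) (auto intro!: power_mono sb)
 qed (use sm_meas in auto)
 have "(\<integral>z. (norm (s n z))\<^sup>2 \<partial>circ) = (\<Sum>k<n. (norm (a k))\<^sup>2)" for n
 proof -
  have "complex_of_real (\<integral>z. (norm (s n z))\<^sup>2 \<partial>circ) = (\<integral>z. complex_of_real ((norm (s n z))\<^sup>2) \<partial>circ)"
   by (rule integral_complex_of_real[symmetric])
  also have "\<dots> = complex_of_real (\<Sum>k<n. (norm (a k))\<^sup>2)"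
   using int_s[of n] by (simp only: complex_norm_square of_real_sum)
  finally show ?thesis by (simp only: of_real_eq_iff)
 qed
 with lim have sums: "(\<lambda>k. (norm (a k))\<^sup>2) sums (\<integral>z. (norm (\<Sum>k. a k * z ^ k))\<^sup>2 \<partial>circ)"
  by (simp add: sums_def)
 have bl: "norm (\<Sum>k. a k * z ^ k) \<le> B" if "norm z = 1" for z
  by (rule LIMSEQ_le_const2[OF tendsto_norm[OF sl[OF that]]]) (use sb[OF that] in auto)
 have "(\<integral>\<^sup>+z. ennreal ((norm (\<Sum>k. a k * z ^ k))\<^sup>2) \<partial>circ) = ennreal (\<integral>z. (norm (\<Sum>k. a k * z ^ k))\<^sup>2 \<partial>circ)"
 proof (rule nn_integral_eq_integral)
  show "integrable circ (\<lambda>z. (norm (\<Sum>k. a k * z ^ k))\<^sup>2)"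
  proof (rule circ.integrable_const_bound[where B="B\<^sup>2"])
   show "(\<lambda>z. (norm (\<Sum>k. a k * z ^ k))\<^sup>2) \<in> borel_measurable circ"
    by (rule borel_measurable_circI) simp
  qed (auto intro!: AE_I2 power_mono bl)
 qed auto
 also have "\<dots> = (\<Sum>k. ennreal ((norm (a k))\<^sup>2))"
  using sums by (subst suminf_ennreal_eq[of _ "\<integral>z. (norm (\<Sum>k. a k * z ^ k))\<^sup>2 \<partial>circ"]) auto
 finally show ?thesis .
qed

lemma fps_abs_summable:
 fixes A :: "complex fps"
 assumes "fps_conv_radius A \<ge> 1" "norm z < 1"
 shows "summable (\<lambda>k. norm (fps_nth A k * z ^ k))"
 using assms abs_summable_in_conv_radius[of z "fps_nth A"]
 unfolding fps_conv_radius_def by (metis ereal_less(3) less_le_trans)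

lemma parseval_circ:
 fixes A :: "complex fps"
 assumes A: "fps_conv_radius A \<ge> 1" and w: "norm w < 1"
 shows "(\<integral>\<^sup>+z. ennreal ((norm (eval_fps A (w * z)))\<^sup>2) \<partial>circ)
  = (\<Sum>k. ennreal ((norm (fps_nth A k))\<^sup>2) * ennreal (((norm w)\<^sup>2) ^ k))"
proof -
 have "(\<integral>\<^sup>+z. ennreal ((norm (eval_fps A (w * z)))\<^sup>2) \<partial>circ)
  = (\<integral>\<^sup>+z. ennreal ((norm (\<Sum>k. (fps_nth A k * w ^ k) * z ^ k))\<^sup>2) \<partial>circ)"
  by (simp add: eval_fps_def power_mult_distrib mult.assoc)
 also have "\<dots> = (\<Sum>k. ennreal ((norm (fps_nth A k * w ^ k))\<^sup>2))"
  by (rule parseval_abs_summable, rule fps_abs_summable[OF A w])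
 also have "\<dots> = (\<Sum>k. ennreal ((norm (fps_nth A k))\<^sup>2) * ennreal (((norm w)\<^sup>2) ^ k))"
  by (simp add: norm_mult norm_power power_mult_distrib ennreal_mult' flip: power_mult)
   (simp add: mult.commute)
 finally show ?thesis .
qed

lemma lborel_complex: "(lborel :: complex measure) = distr (lborel \<Otimes>\<^sub>M lborel) borel (\<lambda>(x,y). Complex x y)"
proof (rule lborel_eqI)
 fix l u :: complex assume le: "\<And>b. b \<in> Basis \<Longrightarrow> l \<bullet> b \<le> u \<bullet> b"
 have m: "(\<lambda>(x,y). Complex x y) \<in> measurable (lborel \<Otimes>\<^sub>M lborel) borel"
  by (simp add: Complex_eq case_prod_beta')
 have le': "Re l \<le> Re u" "Im l \<le> Im u"
  using le[of 1] le[of \<i>] by (auto simp: Basis_complex_def inner_complex_def)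
 have "emeasure (distr (lborel \<Otimes>\<^sub>M lborel) borel (\<lambda>(x,y). Complex x y)) (box l u)
  = emeasure (lborel \<Otimes>\<^sub>M lborel) ({Re l<..<Re u} \<times> {Im l<..<Im u})"
  by (subst emeasure_distr[OF m])
   (auto intro!: arg_cong[where f="emeasure (lborel \<Otimes>\<^sub>M lborel)"] simp: box_def Basis_complex_def inner_complex_def space_pair_measure)
 also have "\<dots> = ennreal (Re u - Re l) * ennreal (Im u - Im l)"
  by (subst lborel.emeasure_pair_measure_Times) (use le' in auto)
 also have "\<dots> = ennreal (\<Prod>b\<in>Basis. (u - l) \<bullet> b)"
  using le' by (simp add: Basis_complex_def inner_complex_def ennreal_mult')
 finally show "emeasure (distr (lborel \<Otimes>\<^sub>M lborel) borel (\<lambda>(x,y). Complex x y)) (box l u) = ennreal (\<Prod>b\<in>Basis. (u - l) \<bullet> b)" .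
qed simp

lemma nn_integral_lborel_complex:
 assumes g[measurable]: "g \<in> borel_measurable borel"
 shows "(\<integral>\<^sup>+z. g z \<partial>(lborel :: complex measure)) = (\<integral>\<^sup>+x. \<integral>\<^sup>+y. g (Complex x y) \<partial>lborel \<partial>lborel)"
  and "(\<integral>\<^sup>+z. g z \<partial>(lborel :: complex measure)) = (\<integral>\<^sup>+y. \<integral>\<^sup>+x. g (Complex x y) \<partial>lborel \<partial>lborel)"
proof -
 have [measurable]: "(\<lambda>p. Complex (fst p) (snd p)) \<in> borel_measurable (lborel \<Otimes>\<^sub>M lborel)"
  "(\<lambda>p. Complex (snd p) (fst p)) \<in> borel_measurable (lborel \<Otimes>\<^sub>M lborel)"
  unfolding Complex_eq by measurable
 have "(\<integral>\<^sup>+z. g z \<partial>(lborel :: complex measure)) = (\<integral>\<^sup>+p. g (Complex (fst p) (snd p)) \<partial>(lborel \<Otimes>\<^sub>M lborel))"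
  by (subst lborel_complex, subst nn_integral_distr) (auto simp: case_prod_beta')
 also have "\<dots> = (\<integral>\<^sup>+x. \<integral>\<^sup>+y. g (Complex x y) \<partial>lborel \<partial>lborel)"
  by (subst lborel.nn_integral_fst[symmetric]) auto
 finally show 1: "(\<integral>\<^sup>+z. g z \<partial>(lborel :: complex measure)) = (\<integral>\<^sup>+x. \<integral>\<^sup>+y. g (Complex x y) \<partial>lborel \<partial>lborel)" .
 show "(\<integral>\<^sup>+z. g z \<partial>(lborel :: complex measure)) = (\<integral>\<^sup>+y. \<integral>\<^sup>+x. g (Complex x y) \<partial>lborel \<partial>lborel)"
  unfolding 1 by (rule lborel_pair.Fubini') (simp add: case_prod_beta')
qed

lemma nn_integral_shear:
 assumes g[measurable]: "g \<in> borel_measurable borel"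
 shows "(\<integral>\<^sup>+z. g (Complex (Re z + t * Im z) (Im z)) \<partial>lborel) = (\<integral>\<^sup>+z. g z \<partial>lborel)"
  and "(\<integral>\<^sup>+z. g (Complex (Re z) (Im z + t * Re z)) \<partial>lborel) = (\<integral>\<^sup>+z. g z \<partial>lborel)"
proof -
 have m1: "(\<lambda>z. g (Complex (Re z + t * Im z) (Im z))) \<in> borel_measurable borel"
  and m2: "(\<lambda>z. g (Complex (Re z) (Im z + t * Re z))) \<in> borel_measurable borel"
  and m3: "(\<lambda>x. g (Complex x y)) \<in> borel_measurable borel"
  and m4: "(\<lambda>x. g (Complex y x)) \<in> borel_measurable borel" for y
  by (simp_all add: Complex_eq)
 show "(\<integral>\<^sup>+z. g (Complex (Re z + t * Im z) (Im z)) \<partial>lborel) = (\<integral>\<^sup>+z. g z \<partial>lborel)"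
  unfolding nn_integral_lborel_complex(2)[OF m1] nn_integral_lborel_complex(2)[OF g]
 proof (rule nn_integral_cong)
  fix y
  show "(\<integral>\<^sup>+x. g (Complex (Re (Complex x y) + t * Im (Complex x y)) (Im (Complex x y))) \<partial>lborel) = (\<integral>\<^sup>+x. g (Complex x y) \<partial>lborel)"
   using nn_integral_real_affine[OF m3, where c=1 and t="t * y"] by (simp add: add.commute)
 qed
 show "(\<integral>\<^sup>+z. g (Complex (Re z) (Im z + t * Re z)) \<partial>lborel) = (\<integral>\<^sup>+z. g z \<partial>lborel)"
  unfolding nn_integral_lborel_complex(1)[OF m2] nn_integral_lborel_complex(1)[OF g]
 proof (rule nn_integral_cong)
  fix y
  show "(\<integral>\<^sup>+x. g (Complex (Re (Complex y x)) (Im (Complex y x) + t * Re (Complex y x))) \<partial>lborel) = (\<integral>\<^sup>+x. g (Complex y x) \<partial>lborel)"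
   using nn_integral_real_affine[OF m4, where c=1 and t="t * y"] by (simp add: add.commute)
 qed
qed

text \<open>A plane rotation is a composition of three shears, and a shear preserves Lebesgue measure
because it translates every line parallel to an axis. For $c = p + iq$ the middle shear has
slope $q$ and the outer ones have slope $-q/(1+p)$; the angle \<open>pi\<close>, where this
breaks down, is two quarter turns.\<close>

lemma nn_integral_lborel_rotate:
 assumes g[measurable]: "g \<in> borel_measurable borel" and c: "norm c = 1"
 shows "(\<integral>\<^sup>+z. g (c * z) \<partial>lborel) = (\<integral>\<^sup>+z. g z \<partial>(lborel :: complex measure))"
proof -
 have main: "(\<integral>\<^sup>+z. g (c * z) \<partial>lborel) = (\<integral>\<^sup>+z. g z \<partial>lborel)"
  if [measurable]: "g \<in> borel_measurable borel" and c: "norm c = 1" and ne: "c \<noteq> -1" for g :: "complex \<Rightarrow> ennreal" and c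
 proof -
  define p q T where "p = Re c" and "q = Im c" and "T = q / (1 + p)"
  have pq: "p\<^sup>2 + q\<^sup>2 = 1" using c unfolding p_def q_def by (simp add: cmod_def)
  have "p \<noteq> -1" using pq ne by (auto simp: p_def q_def complex_eq_iff)
  then have T1: "T * (1 + p) = q" by (auto simp: T_def)
  have T2: "q * T = 1 - p"
  proof -
   have "(q * T) * (1 + p) = q\<^sup>2" using T1 by (simp add: power2_eq_square)
   also have "\<dots> = (1 - p) * (1 + p)" using pq by (simp add: power2_eq_square algebra_simps)
   finally show ?thesis using \<open>p \<noteq> -1\<close> by (metis add.inverse_unique add.commute mult_right_cancel add_eq_0_iff)
  qed
  define S1 where "S1 = (\<lambda>z. Complex (Re z + (- T) * Im z) (Im z))"
  define S2 where "S2 = (\<lambda>z. Complex (Re z) (Im z + q * Re z))"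
  have [measurable]: "S1 \<in> borel_measurable borel" "S2 \<in> borel_measurable borel"
   unfolding S1_def S2_def Complex_eq by measurable
  have comp: "c * z = S1 (S2 (S1 z))" for z
  proof -
   have "Re (S1 (S2 (S1 z))) = (1 - q * T) * Re z - T * (2 - q * T) * Im z"
    by (simp add: S1_def S2_def algebra_simps)
   also have "\<dots> = p * Re z - q * Im z" using T1 unfolding T2 by (simp add: algebra_simps)
   finally have 1: "Re (S1 (S2 (S1 z))) = Re (c * z)" by (simp add: p_def q_def)
   have "Im (S1 (S2 (S1 z))) = (1 - q * T) * Im z + q * Re z"
    by (simp add: S1_def S2_def algebra_simps)
   also have "\<dots> = p * Im z + q * Re z" unfolding T2 by simp
   finally have 2: "Im (S1 (S2 (S1 z))) = Im (c * z)" by (simp add: p_def q_def)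
   show ?thesis using 1 2 by (simp add: complex_eq_iff)
  qed
  have e1: "(\<integral>\<^sup>+z. u (S1 z) \<partial>lborel) = (\<integral>\<^sup>+z. u z \<partial>lborel)" if "u \<in> borel_measurable borel" for u :: "complex \<Rightarrow> ennreal"
   unfolding S1_def by (rule nn_integral_shear(1)[OF that])
  have e2: "(\<integral>\<^sup>+z. u (S2 z) \<partial>lborel) = (\<integral>\<^sup>+z. u z \<partial>lborel)" if "u \<in> borel_measurable borel" for u :: "complex \<Rightarrow> ennreal"
   unfolding S2_def by (rule nn_integral_shear(2)[OF that])
  show ?thesis
   unfolding comp using e1[of "\<lambda>z. g (S1 (S2 z))"] e2[of "\<lambda>z. g (S1 z)"] e1[of g] by simp
 qed
 show ?thesis
 proof (cases "c = -1")
  case True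
  have "(\<integral>\<^sup>+z. g (c * z) \<partial>lborel) = (\<integral>\<^sup>+z. g (\<i> * (\<i> * z)) \<partial>lborel)"
   by (simp add: True flip: mult.assoc)
  also have "\<dots> = (\<integral>\<^sup>+z. g (\<i> * z) \<partial>lborel)"
   by (rule main[of "\<lambda>z. g (\<i> * z)" "\<i>"]) (auto simp: complex_eq_iff)
  also have "\<dots> = (\<integral>\<^sup>+z. g z \<partial>lborel)"
   by (rule main) (auto simp: complex_eq_iff)
  finally show ?thesis .
 qed (use main[OF g c] in auto)
qed

text \<open>Polar coordinates for radial functions: the image of area measure under
\<open>|z|\<^sup>2\<close> is \<open>pi\<close> times Lebesgue measure on the unit interval,
since both measures agree on half lines.\<close>

lemma nn_integral_disc_radial:
 assumes g[measurable]: "g \<in> borel_measurable borel"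
 shows "(\<integral>\<^sup>+z. g ((norm z)\<^sup>2) * indicator (ball 0 1) z \<partial>(lborel :: complex measure))
  = ennreal pi * (\<integral>\<^sup>+t. g t * indicator {0..1} t \<partial>lborel)"
proof -
 define M where "M = distr (density lborel (indicator (ball (0::complex) 1))) borel (\<lambda>z. (norm z)\<^sup>2)"
 define N where "N = density lborel (\<lambda>t::real. ennreal pi * indicator {0..1} t)"
 have int_M: "(\<integral>\<^sup>+t. g t \<partial>M) = (\<integral>\<^sup>+z. g ((norm z)\<^sup>2) * indicator (ball 0 1) z \<partial>(lborel :: complex measure))"
  if [measurable]: "g \<in> borel_measurable borel" for g
  unfolding M_def by (subst nn_integral_distr, simp, simp, subst nn_integral_density)
   (auto simp: mult.commute intro!: borel_measurable_indicator)
 have int_N: "(\<integral>\<^sup>+t. g t \<partial>N) = (\<integral>\<^sup>+t. g t * (ennreal pi * indicator {0..1} t) \<partial>lborel)"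
  if [measurable]: "g \<in> borel_measurable borel" for g
  unfolding N_def by (subst nn_integral_density) (auto simp: mult.commute)
 have M: "emeasure M {x<..} = ennreal (pi - pi * max 0 (min 1 x))" for x
 proof -
  have "emeasure M {x<..} = (\<integral>\<^sup>+t. indicator {x<..} t \<partial>M)"
   by (simp add: M_def)
  also have "\<dots> = (\<integral>\<^sup>+z. indicator (ball (0::complex) 1 \<inter> {z. x < (norm z)\<^sup>2}) z \<partial>lborel)"
   by (rule trans[OF int_M], simp, rule nn_integral_cong) (auto split: split_indicator)
  also have "\<dots> = emeasure lborel (ball (0::complex) 1 \<inter> {z. x < (norm z)\<^sup>2})"
   by (rule nn_integral_indicator) simp
  also have "ball (0::complex) 1 \<inter> {z. x < (norm z)\<^sup>2} = (if x < 0 then ball 0 1 else ball 0 1 - cball 0 (sqrt x))"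
   by (auto simp: real_less_rsqrt real_sqrt_less_iff dist_norm) 
    (smt (verit) zero_le_power2, meson not_le real_sqrt_le_iff real_le_lsqrt norm_ge_zero real_less_lsqrt leD real_le_rsqrt, metis not_le real_sqrt_le_iff real_sqrt_abs abs_norm_cancel)
  also have "emeasure lborel \<dots> = ennreal (pi - pi * max 0 (min 1 x))"
  proof (cases "0 \<le> x \<and> x < 1")
   case True
   have "emeasure lborel (ball (0::complex) 1 - cball 0 (sqrt x)) = emeasure lborel (ball (0::complex) 1) - emeasure lborel (cball (0::complex) (sqrt x))"
   proof (rule emeasure_Diff)
    have lt: "sqrt x < 1" using True by (simp add: real_sqrt_lt_1_iff)
    show "cball (0::complex) (sqrt x) \<subseteq> ball 0 1"
    proof
     fix z :: complex assume "z \<in> cball 0 (sqrt x)"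
     then have "norm z \<le> sqrt x" by simp
     also note lt
     finally show "z \<in> ball 0 1" by simp
    qed
   qed (use True in \<open>auto simp: emeasure_cball\<close>)
   also have "\<dots> = ennreal (pi - pi * x)"
    using True by (simp add: emeasure_cball emeasure_ball unit_ball_vol_2 ennreal_minus)
   finally show ?thesis using True by simp
  next
   case False
   have "x \<ge> 1 \<Longrightarrow> ball (0::complex) 1 - cball 0 (sqrt x) = {}" by auto (smt (verit) real_sqrt_ge_one)
   then have "x \<ge> 1 \<Longrightarrow> emeasure lborel (ball (0::complex) 1 - cball 0 (sqrt x)) = 0" by (metis emeasure_empty)
   then show ?thesis using False by (auto simp: emeasure_ball unit_ball_vol_2)
  qed
  finally show ?thesis .
 qed
 have N: "emeasure N {x<..} = ennreal (pi - pi * max 0 (min 1 x))" for x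
 proof -
  have "emeasure N {x<..} = (\<integral>\<^sup>+t. indicator {x<..} t \<partial>N)"
   by (simp add: N_def)
  also have "\<dots> = (\<integral>\<^sup>+t. ennreal pi * indicator ({0..1} \<inter> {x<..}) t \<partial>lborel)"
   by (subst int_N) (auto intro!: nn_integral_cong simp: indicator_def)
  also have "\<dots> = ennreal pi * emeasure lborel ({0..1} \<inter> {x<..})"
   by (rule nn_integral_cmult_indicator) simp
  also have "{0..1} \<inter> {x<..} = (if x < 0 then {0..1} else {x<..1})" by auto
  also have "emeasure lborel \<dots> = ennreal (1 - max 0 (min 1 x))"
   by (cases "x \<le> 1") auto
  finally show ?thesis by (simp add: algebra_simps flip: ennreal_mult')
 qed
 have "M = N"
  by (rule measure_eqI_lessThan) (auto simp: M N M_def[THEN arg_cong[where f=sets]] N_def[THEN arg_cong[where f=sets]])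
 have "(\<integral>\<^sup>+z. g ((norm z)\<^sup>2) * indicator (ball 0 1) z \<partial>(lborel :: complex measure)) = (\<integral>\<^sup>+t. g t \<partial>M)"
  by (rule int_M[symmetric]) simp
 also have "\<dots> = (\<integral>\<^sup>+t. g t * (ennreal pi * indicator {0..1} t) \<partial>lborel)"
  unfolding \<open>M = N\<close> by (rule int_N) simp
 also have "\<dots> = ennreal pi * (\<integral>\<^sup>+t. g t * indicator {0..1} t \<partial>lborel)"
  by (subst nn_integral_cmult[symmetric]) (auto simp: mult_ac)
 finally show ?thesis .
qed

lemma space_berg [simp]: "space (berg q) = ball 0 1"
 and sets_berg [measurable_cong]: "sets (berg q) = sets (restrict_space borel (ball 0 1))"
 by (auto simp: berg_def space_restrict_space sets_restrict_space)

lemma nn_integral_berg: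
 assumes "v \<in> borel_measurable (berg q)"
 shows "(\<integral>\<^sup>+z. v z \<partial>berg q) =
  (\<integral>\<^sup>+z. ennreal ((real q + 1) / pi * (1 - (norm z)\<^sup>2) ^ q) * v z * indicator (ball 0 1) z \<partial>lborel)"
proof -
 have v: "v \<in> borel_measurable (restrict_space lborel (ball 0 1))"
  using assms by (simp add: measurable_cong_sets[OF sets_berg refl] measurable_restrict_space1 measurable_cong_sets[OF sets_restrict_space_cong[OF sets_lborel] refl])
 have "(\<integral>\<^sup>+z. v z \<partial>berg q) = (\<integral>\<^sup>+z. ennreal ((real q + 1) / pi * (1 - (norm z)\<^sup>2) ^ q) * v z \<partial>restrict_space lborel (ball 0 1))"
  unfolding berg_def by (rule nn_integral_density) (use v in \<open>auto intro!: measurable_restrict_space1\<close>)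
 also have "\<dots> = (\<integral>\<^sup>+z. ennreal ((real q + 1) / pi * (1 - (norm z)\<^sup>2) ^ q) * v z * indicator (ball 0 1) z \<partial>lborel)"
  by (rule nn_integral_restrict_space) simp
 finally show ?thesis .
qed

lemma beta_nat_integral:
 "(\<integral>\<^sup>+t. ennreal (t ^ k * (1 - t) ^ q) * indicator {0..1} t \<partial>lborel) = ennreal (fact k * fact q / fact (k + q + 1))"
proof -
 have "((\<lambda>t. t powr (real (k+1) - 1) * (1 - t) powr (real (q+1) - 1)) has_integral Beta (real (k+1)) (real (q+1))) {0..1}"
  by (rule has_integral_Beta_real) auto
 then have "((\<lambda>t::real. t ^ k * (1 - t) ^ q) has_integral Beta (real (k+1)) (real (q+1))) {0..1}"
  by (rule has_integral_spike[rotated 2, of _ _ _ "{0,1}"]) (auto simp: powr_realpow)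
 moreover have "Beta (real (k+1)) (real (q+1)) = fact k * fact q / fact (k + q + 1)"
  unfolding Beta_def using Gamma_fact[of k, where 'a=real] Gamma_fact[of q, where 'a=real] Gamma_fact[of "k+q+1", where 'a=real]
  by (simp add: add_ac)
 ultimately have hi: "((\<lambda>t::real. t ^ k * (1 - t) ^ q) has_integral fact k * fact q / fact (k + q + 1)) {0..1}" by simp
 show ?thesis
  by (rule nn_integral_has_integral_lebesgue'[OF _ hi]) auto
qed

text \<open>The squared norm of a power series in the weighted Bergman space with reproducing kernel
$(1-z\bar w)^{-a}$: the binomial coefficients are the Taylor coefficients of that kernel. The
case \<open>a = 1\<close> is the Hardy space.\<close>

definition hn :: "nat \<Rightarrow> complex fps \<Rightarrow> ennreal" where
 "hn a A = (\<Sum>k. ennreal ((norm (fps_nth A k))\<^sup>2 / real ((k + a - 1) choose k)))"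

lemma measurable_eval_fps [measurable]: "eval_fps (A :: complex fps) \<in> borel_measurable borel"
 unfolding eval_fps_def by measurable

lemma borel_measurable_bergI: "v \<in> borel_measurable borel \<Longrightarrow> v \<in> borel_measurable (berg q)"
 using measurable_cong_sets[OF sets_berg refl] measurable_restrict_space1 by blast

text \<open>Averaging over rotations makes the integrand radial and diagonal in the coefficients; each
coefficient then contributes a Beta integral.\<close>

lemma parseval_berg:
 assumes A: "fps_conv_radius A \<ge> 1"
 shows "(\<integral>\<^sup>+z. ennreal ((norm (eval_fps A z))\<^sup>2) \<partial>berg q) = hn (q + 2) A"
proof -
 define W where "W = (\<lambda>t::real. ennreal ((real q + 1) / pi * (1 - t) ^ q))"
 define H where "H = (\<lambda>z. ennreal ((norm (eval_fps A z))\<^sup>2))"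
 define F where "F = (\<lambda>z::complex. W ((norm z)\<^sup>2) * H z * indicator (ball 0 1) z)"
 define g where "g = (\<lambda>t::real. \<Sum>k. W t * (ennreal ((norm (fps_nth A k))\<^sup>2) * ennreal (t ^ k)))"
 have [measurable]: "W \<in> borel_measurable borel" "H \<in> borel_measurable borel"
  unfolding W_def H_def by measurable
 have Fm[measurable]: "F \<in> borel_measurable borel"
  unfolding F_def by (intro borel_measurable_times_ennreal borel_measurable_indicator) measurable
 have gm[measurable]: "g \<in> borel_measurable borel"
  unfolding g_def by measurable
 have "(\<integral>\<^sup>+z. H z \<partial>berg q) = (\<integral>\<^sup>+z. F z \<partial>lborel)"
  by (subst nn_integral_berg) (auto simp: F_def W_def intro: borel_measurable_bergI)
 also have "\<dots> = (\<integral>\<^sup>+w. (\<integral>\<^sup>+z. F z \<partial>lborel) \<partial>circ)"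
  by (simp add: emeasure_circ_space)
 also have "\<dots> = (\<integral>\<^sup>+w. (\<integral>\<^sup>+z. F (w * z) \<partial>lborel) \<partial>circ)"
  by (rule nn_integral_cong) (simp add: nn_integral_lborel_rotate)
 also have "\<dots> = (\<integral>\<^sup>+z. (\<integral>\<^sup>+w. F (w * z) \<partial>circ) \<partial>lborel)"
 proof (rule pair_sigma_finite.Fubini')
  show "pair_sigma_finite lborel circ"
   by (intro pair_sigma_finite.intro lborel.sigma_finite_measure_axioms circ.sigma_finite_measure_axioms)
  show "(\<lambda>(z, w). F (w * z)) \<in> borel_measurable (lborel \<Otimes>\<^sub>M circ)"
   using measurable_id_circ by measurable
 qed
 also have "\<dots> = (\<integral>\<^sup>+z. g ((norm z)\<^sup>2) * indicator (ball 0 1) z \<partial>(lborel :: complex measure))"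
 proof (rule nn_integral_cong)
  fix z :: complex
  show "(\<integral>\<^sup>+w. F (w * z) \<partial>circ) = g ((norm z)\<^sup>2) * indicator (ball 0 1) z"
  proof (cases "norm z < 1")
   case True
   have "(\<integral>\<^sup>+w. F (w * z) \<partial>circ) = (\<integral>\<^sup>+w. W ((norm z)\<^sup>2) * H (z * w) \<partial>circ)"
    by (rule nn_integral_cong) (use True in \<open>auto simp: F_def norm_mult mult.commute\<close>)
   also have "\<dots> = W ((norm z)\<^sup>2) * (\<integral>\<^sup>+w. H (z * w) \<partial>circ)"
    by (rule nn_integral_cmult, rule borel_measurable_circI) measurable
   also have "\<dots> = g ((norm z)\<^sup>2)"
    unfolding H_def parseval_circ[OF A True] g_def by simp
   finally show ?thesis using True by simp
  next
   case False
   have "(\<integral>\<^sup>+w. F (w * z) \<partial>circ) = (\<integral>\<^sup>+w. 0 \<partial>circ)"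
    by (rule nn_integral_cong) (use False in \<open>auto simp: F_def norm_mult\<close>)
   then show ?thesis using False by simp
  qed
 qed
 also have "\<dots> = ennreal pi * (\<integral>\<^sup>+t. g t * indicator {0..1} t \<partial>lborel)"
  by (rule nn_integral_disc_radial[OF gm])
 also have "\<dots> = (\<integral>\<^sup>+t. (\<Sum>k. ennreal ((norm (fps_nth A k))\<^sup>2 * (real q + 1)) * (ennreal (t ^ k * (1 - t) ^ q) * indicator {0..1} t)) \<partial>lborel)"
 proof (rule trans[OF nn_integral_cmult[symmetric]])
  show "(\<lambda>t. g t * indicator {0..1} t) \<in> borel_measurable lborel" by measurable
 next
  show "(\<integral>\<^sup>+t. ennreal pi * (g t * indicator {0..1} t) \<partial>lborel) = (\<integral>\<^sup>+t. (\<Sum>k. ennreal ((norm (fps_nth A k))\<^sup>2 * (real q + 1)) * (ennreal (t ^ k * (1 - t) ^ q) * indicator {0..1} t)) \<partial>lborel)"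
  proof (rule nn_integral_cong)
  fix t :: real
  show "ennreal pi * (g t * indicator {0..1} t) = (\<Sum>k. ennreal ((norm (fps_nth A k))\<^sup>2 * (real q + 1)) * (ennreal (t ^ k * (1 - t) ^ q) * indicator {0..1} t))"
  proof (cases "t \<in> {0..1}")
   case True
   have "ennreal pi * (W t * (ennreal ((norm (fps_nth A k))\<^sup>2) * ennreal (t ^ k)))
    = ennreal ((norm (fps_nth A k))\<^sup>2 * (real q + 1)) * ennreal (t ^ k * (1 - t) ^ q)" for k
   proof -
    define c where "c = (real q + 1) / pi"
    have c: "c \<ge> 0" "real q + 1 = pi * c" by (auto simp: c_def)
    have nn: "0 \<le> (1 - t) ^ q" "0 \<le> t ^ k" using True by auto
    have "pi * (c * (1 - t) ^ q * ((norm (fps_nth A k))\<^sup>2 * t ^ k)) = (norm (fps_nth A k))\<^sup>2 * (pi * c) * (t ^ k * (1 - t) ^ q)"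
     by (simp add: algebra_simps)
    then have "ennreal (pi * (c * (1 - t) ^ q * ((norm (fps_nth A k))\<^sup>2 * t ^ k))) = ennreal ((norm (fps_nth A k))\<^sup>2 * (pi * c) * (t ^ k * (1 - t) ^ q))"
     by (rule arg_cong)
    then show ?thesis
     unfolding W_def c_def[symmetric] c(2) using c(1) nn by (simp add: ennreal_mult)
   qed
   then show ?thesis using True by (simp add: g_def flip: ennreal_suminf_cmult)
  qed simp
  qed
 qed
 also have "\<dots> = (\<Sum>k. ennreal ((norm (fps_nth A k))\<^sup>2 * (real q + 1)) * ennreal (fact k * fact q / fact (k + q + 1)))"
  by (subst nn_integral_suminf, measurable, subst nn_integral_cmult, measurable) (simp only: beta_nat_integral)
 also have "\<dots> = hn (q + 2) A"
  unfolding hn_def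
 proof (rule suminf_cong)
  fix k
  define D Fk Fq and x :: real where "D = (fact (k + q + 1) :: real)" and "Fk = (fact k :: real)"
   and "Fq = (fact q :: real)" and "x = (norm (fps_nth A k))\<^sup>2"
  have pos: "D > 0" "Fk > 0" "Fq > 0" "x \<ge> 0" by (auto simp: D_def Fk_def Fq_def x_def)
  have "real ((k + (q + 2) - 1) choose k) = D / (Fk * ((real q + 1) * Fq))"
   using binomial_fact[of k "k + q + 1", where 'a=real] by (simp add: D_def Fk_def Fq_def algebra_simps)
  then have "x / real ((k + (q + 2) - 1) choose k) = (x * (real q + 1)) * (Fk * Fq / D)"
   using pos by simp
  then have "ennreal (x / real ((k + (q + 2) - 1) choose k)) = ennreal (x * (real q + 1)) * ennreal (Fk * Fq / D)"
   using ennreal_mult[of "x * (real q + 1)" "Fk * Fq / D"] pos by simp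
  then show "ennreal ((norm (fps_nth A k))\<^sup>2 * (real q + 1)) * ennreal (fact k * fact q / fact (k + q + 1))
   = ennreal ((norm (fps_nth A k))\<^sup>2 / real ((k + (q + 2) - 1) choose k))"
   unfolding D_def Fk_def Fq_def x_def by simp
 qed
 finally show ?thesis unfolding H_def .
qed

definition mean1 :: "real \<Rightarrow> (complex \<Rightarrow> complex) \<Rightarrow> real \<Rightarrow> ennreal" where
 "mean1 p f r = (\<integral>\<^sup>+z. ennreal (norm (f (of_real r * z)) powr p) \<partial>circ)"

definition N1 :: "real \<Rightarrow> (complex \<Rightarrow> complex) \<Rightarrow> ennreal" where
 "N1 p f = (SUP r\<in>{0..<1}. mean1 p f r)"

lemma mean1_le_N1: "0 \<le> r \<Longrightarrow> r < 1 \<Longrightarrow> mean1 p f r \<le> N1 p f"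
 unfolding N1_def by (rule SUP_upper) simp

lemma mean1_2:
 assumes A: "fps_conv_radius A \<ge> 1" and h: "\<And>z. norm z < 1 \<Longrightarrow> h z = eval_fps A z" and r: "0 \<le> r" "r < 1"
 shows "mean1 2 h r = (\<Sum>k. ennreal ((norm (fps_nth A k))\<^sup>2) * ennreal ((r\<^sup>2) ^ k))"
proof -
 have "mean1 2 h r = (\<integral>\<^sup>+z. ennreal ((norm (eval_fps A (of_real r * z)))\<^sup>2) \<partial>circ)"
  unfolding mean1_def by (rule nn_integral_cong) (use r in \<open>auto simp: h norm_mult\<close>)
 then show ?thesis using parseval_circ[OF A, of "of_real r"] r by simp
qed

lemma N1_2:
 assumes A: "fps_conv_radius A \<ge> 1" and h: "\<And>z. norm z < 1 \<Longrightarrow> h z = eval_fps A z"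
 shows "N1 2 h = hn 1 A"
proof (rule antisym)
 show "N1 2 h \<le> hn 1 A"
  unfolding N1_def
 proof (rule SUP_least)
  fix r :: real assume "r \<in> {0..<1}"
  then have r: "0 \<le> r" "r < 1" by auto
  have m: "mean1 2 h r = (\<Sum>k. ennreal ((norm (fps_nth A k))\<^sup>2) * ennreal ((r\<^sup>2) ^ k))"
   by (rule mean1_2[OF A _ r]) (rule h)
  show "mean1 2 h r \<le> hn 1 A"
   unfolding m hn_def
  proof (intro suminf_le summableI)
   fix k
   have "(r\<^sup>2) ^ k \<le> 1" using r by (simp add: power_le_one)
   then have "(norm (fps_nth A k))\<^sup>2 * (r\<^sup>2) ^ k \<le> (norm (fps_nth A k))\<^sup>2 * 1"
    by (intro mult_left_mono) auto
   then show "ennreal ((norm (fps_nth A k))\<^sup>2) * ennreal ((r\<^sup>2) ^ k) \<le> ennreal ((norm (fps_nth A k))\<^sup>2 / real ((k + 1 - 1) choose k))"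
    by (simp flip: ennreal_mult)
  qed
 qed
 show "hn 1 A \<le> N1 2 h"
  unfolding hn_def suminf_eq_SUP
 proof (rule SUP_least)
  fix n
  define r where "r = (\<lambda>i. 1 - 1 / real (Suc i))"
  have r01: "0 \<le> r i" "r i < 1" for i by (auto simp: r_def field_simps)
  have rl: "r \<longlonglongrightarrow> 1"
   unfolding r_def using LIMSEQ_inverse_real_of_nat_add_minus[of 1] by (simp add: inverse_eq_divide)
  have "(\<lambda>i. ennreal (\<Sum>k<n. (norm (fps_nth A k))\<^sup>2 * ((r i)\<^sup>2) ^ k)) \<longlonglongrightarrow> ennreal (\<Sum>k<n. (norm (fps_nth A k))\<^sup>2 * (1\<^sup>2) ^ k)"
   by (intro tendsto_intros rl)
  moreover have "ennreal (\<Sum>k<n. (norm (fps_nth A k))\<^sup>2 * ((r i)\<^sup>2) ^ k) \<le> N1 2 h" for i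
  proof -
   have "ennreal (\<Sum>k<n. (norm (fps_nth A k))\<^sup>2 * ((r i)\<^sup>2) ^ k) = (\<Sum>k<n. ennreal ((norm (fps_nth A k))\<^sup>2) * ennreal (((r i)\<^sup>2) ^ k))"
    by (subst sum_ennreal[symmetric]) (auto simp: ennreal_mult)
   also have "\<dots> \<le> mean1 2 h (r i)"
    by (subst mean1_2[OF A h r01], assumption, rule sum_le_suminf) auto
   also have "\<dots> \<le> N1 2 h" by (rule mean1_le_N1[OF r01])
   finally show ?thesis .
  qed
  ultimately have "ennreal (\<Sum>k<n. (norm (fps_nth A k))\<^sup>2 * (1\<^sup>2) ^ k) \<le> N1 2 h"
   by (intro LIMSEQ_le_const2) auto
  then show "(\<Sum>k<n. ennreal ((norm (fps_nth A k))\<^sup>2 / real ((k + 1 - 1) choose k))) \<le> N1 2 h"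
   by (simp add: sum_ennreal)
 qed
qed

section \<open>The coefficient inequality\<close>

text \<open>Expanding the square around the weighted mean, so that the defect in Cauchy-Schwarz becomes
visible as a variance.\<close>

lemma weighted_variance:
 fixes \<xi> :: "nat \<Rightarrow> complex" and w :: "nat \<Rightarrow> real"
 assumes "finite K" "K \<noteq> {}" and w: "\<And>k. k \<in> K \<Longrightarrow> w k > 0"
 defines "W \<equiv> \<Sum>k\<in>K. w k" and "S \<equiv> \<Sum>k\<in>K. w k *\<^sub>R \<xi> k"
 shows "(\<Sum>k\<in>K. w k * (norm (\<xi> k - S /\<^sub>R W))\<^sup>2) = (\<Sum>k\<in>K. w k * (norm (\<xi> k))\<^sup>2) - (norm S)\<^sup>2 / W"
proof -
 have W: "W > 0" unfolding W_def by (rule sum_pos) (use assms in auto)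
 have "(\<Sum>k\<in>K. w k * (norm (\<xi> k - S /\<^sub>R W))\<^sup>2)
  = (\<Sum>k\<in>K. w k * (norm (\<xi> k))\<^sup>2 - 2 * ((w k *\<^sub>R \<xi> k) \<bullet> (S /\<^sub>R W)) + w k * (norm (S /\<^sub>R W))\<^sup>2)"
 proof (rule sum.cong)
  fix k
  have "(norm (\<xi> k - M))\<^sup>2 = (norm (\<xi> k))\<^sup>2 - 2 * (\<xi> k \<bullet> M) + (norm M)\<^sup>2" for M
   by (simp add: power2_norm_eq_inner inner_diff_left inner_diff_right inner_commute)
  from this[of "S /\<^sub>R W"]
  show "w k * (norm (\<xi> k - S /\<^sub>R W))\<^sup>2 = w k * (norm (\<xi> k))\<^sup>2 - 2 * ((w k *\<^sub>R \<xi> k) \<bullet> (S /\<^sub>R W)) + w k * (norm (S /\<^sub>R W))\<^sup>2"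
   by (simp only: right_diff_distrib distrib_left inner_scaleR_left mult.left_commute)
 qed simp
 also have "\<dots> = (\<Sum>k\<in>K. w k * (norm (\<xi> k))\<^sup>2) - 2 * (S \<bullet> (S /\<^sub>R W)) + W * (norm (S /\<^sub>R W))\<^sup>2"
  unfolding sum.distrib sum_subtractf W_def S_def inner_sum_left sum_distrib_left sum_distrib_right by simp
 also have "S \<bullet> (S /\<^sub>R W) = (norm S)\<^sup>2 / W"
  by (simp add: power2_norm_eq_inner field_simps)
 also have "W * (norm (S /\<^sub>R W))\<^sup>2 = (norm S)\<^sup>2 / W"
  using W by (simp add: power_mult_distrib power2_eq_square field_simps abs_of_pos)
 finally show ?thesis by simp
qed

lemma weighted_cauchy_schwarz:
 fixes \<xi> :: "nat \<Rightarrow> complex" and w :: "nat \<Rightarrow> real"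
 assumes K: "finite K" "K \<noteq> {}" and w: "\<And>k. k \<in> K \<Longrightarrow> w k > 0"
 defines "W \<equiv> \<Sum>k\<in>K. w k" and "S \<equiv> \<Sum>k\<in>K. w k *\<^sub>R \<xi> k"
 shows "(norm S)\<^sup>2 / W \<le> (\<Sum>k\<in>K. w k * (norm (\<xi> k))\<^sup>2)"
  and "(norm S)\<^sup>2 / W = (\<Sum>k\<in>K. w k * (norm (\<xi> k))\<^sup>2) \<longleftrightarrow> (\<forall>k\<in>K. \<forall>l\<in>K. \<xi> k = \<xi> l)"
proof -
 note var = weighted_variance[OF K, where w=w and \<xi>=\<xi>, OF w, folded W_def S_def]
 have W: "W > 0" unfolding W_def by (rule sum_pos) (use assms in auto)
 have nn: "0 \<le> w k * (norm (\<xi> k - S /\<^sub>R W))\<^sup>2" if "k \<in> K" for k using w[OF that] by simp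
 show "(norm S)\<^sup>2 / W \<le> (\<Sum>k\<in>K. w k * (norm (\<xi> k))\<^sup>2)"
  using var sum_nonneg[of K "\<lambda>k. w k * (norm (\<xi> k - S /\<^sub>R W))\<^sup>2"] nn by simp
 have e1: "(norm S)\<^sup>2 / W = (\<Sum>k\<in>K. w k * (norm (\<xi> k))\<^sup>2) \<longleftrightarrow> (\<Sum>k\<in>K. w k * (norm (\<xi> k - S /\<^sub>R W))\<^sup>2) = 0"
  using var by linarith
 have e2: "(\<Sum>k\<in>K. w k * (norm (\<xi> k - S /\<^sub>R W))\<^sup>2) = 0 \<longleftrightarrow> (\<forall>k\<in>K. w k * (norm (\<xi> k - S /\<^sub>R W))\<^sup>2 = 0)"
  by (rule sum_nonneg_eq_0_iff) (use K nn in auto)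
 have e3: "(\<forall>k\<in>K. w k * (norm (\<xi> k - S /\<^sub>R W))\<^sup>2 = 0) \<longleftrightarrow> (\<forall>k\<in>K. \<xi> k = S /\<^sub>R W)"
 proof (rule ball_cong[OF refl])
  fix k assume "k \<in> K"
  from w[OF this] show "(w k * (norm (\<xi> k - S /\<^sub>R W))\<^sup>2 = 0) = (\<xi> k = S /\<^sub>R W)"
   unfolding mult_eq_0_iff by simp
 qed
 have e4: "(\<forall>k\<in>K. \<xi> k = S /\<^sub>R W) \<longleftrightarrow> (\<forall>k\<in>K. \<forall>l\<in>K. \<xi> k = \<xi> l)"
 proof
  assume eq: "\<forall>k\<in>K. \<forall>l\<in>K. \<xi> k = \<xi> l"
  show "\<forall>k\<in>K. \<xi> k = S /\<^sub>R W"
  proof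
   fix k assume k: "k \<in> K"
   have "S = (\<Sum>l\<in>K. w l *\<^sub>R \<xi> k)" unfolding S_def
    by (rule sum.cong[OF refl]) (metis eq k)
   also have "\<dots> = W *\<^sub>R \<xi> k" by (simp add: W_def scaleR_sum_left)
   finally have "S = W *\<^sub>R \<xi> k" .
   then show "\<xi> k = S /\<^sub>R W" using W by simp
  qed
 next
  assume *: "\<forall>k\<in>K. \<xi> k = S /\<^sub>R W"
  show "\<forall>k\<in>K. \<forall>l\<in>K. \<xi> k = \<xi> l"
  proof (intro ballI)
   fix k l assume "k \<in> K" "l \<in> K"
   then have "\<xi> k = S /\<^sub>R W" "\<xi> l = S /\<^sub>R W" using * by blast+
   then show "\<xi> k = \<xi> l" by (rule trans[OF _ sym])
  qed
 qed
 show "(norm S)\<^sup>2 / W = (\<Sum>k\<in>K. w k * (norm (\<xi> k))\<^sup>2) \<longleftrightarrow> (\<forall>k\<in>K. \<forall>l\<in>K. \<xi> k = \<xi> l)"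
  by (rule trans[OF e1 trans[OF e2 trans[OF e3 e4]]])
qed

lemma ennreal_suminf_finite_summable:
 fixes x :: "nat \<Rightarrow> real"
 assumes "\<And>k. 0 \<le> x k" "(\<Sum>k. ennreal (x k)) < \<infinity>"
 shows "summable x" "(\<Sum>k. ennreal (x k)) = ennreal (suminf x)"
proof -
 show s: "summable x" by (rule summable_suminf_not_top[OF assms(1)]) (use assms(2) in \<open>simp add: less_top\<close>)
 show "(\<Sum>k. ennreal (x k)) = ennreal (suminf x)"
  by (rule suminf_ennreal2[OF assms(1) s])
qed

text \<open>The $N$-th coefficient of \<open>A * B\<close> is $\sum_{k\le N} c_k \xi_k$ with weights $c_k =
\binom{k+a-1}{k}$, and these weights add up to $\binom{N+a}{N}$, the weight of $N$ on the left.
Cauchy-Schwarz therefore loses nothing in the weights, and it is an equality exactly when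
\<open>\<xi>\<close> is constant for every $N$.\<close>

lemma hn_mult:
 fixes A B :: "complex fps"
 assumes a: "a \<ge> 1" and fin: "hn a A < \<infinity>" "hn 1 B < \<infinity>"
 shows "hn (a + 1) (A * B) \<le> hn a A * hn 1 B"
  and "hn (a + 1) (A * B) = hn a A * hn 1 B \<longleftrightarrow>
   (\<forall>N. \<forall>k\<le>N. fps_nth A k * fps_nth B (N - k) = of_nat ((k + a - 1) choose k) * (fps_nth A 0 * fps_nth B N))"
proof -
 define c where "c = (\<lambda>k. real ((k + a - 1) choose k))"
 have c0: "c k > 0" for k using a by (simp add: c_def)
 define x where "x = (\<lambda>k. (norm (fps_nth A k))\<^sup>2 / c k)"
 define y where "y = (\<lambda>k. (norm (fps_nth B k))\<^sup>2)"
 have x0: "0 \<le> x k" and y0: "0 \<le> y k" for k using c0[of k] by (auto simp: x_def y_def)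
 have hA: "hn a A = (\<Sum>k. ennreal (x k))" and hB: "hn 1 B = (\<Sum>k. ennreal (y k))"
  by (auto simp: hn_def x_def y_def c_def)
 note sx = ennreal_suminf_finite_summable[of x, OF x0 fin(1)[unfolded hA]]
 note sy = ennreal_suminf_finite_summable[of y, OF y0 fin(2)[unfolded hB]]
 define v where "v = (\<lambda>N. \<Sum>k\<le>N. x k * y (N - k))"
 have v: "v sums (suminf x * suminf y)"
  unfolding v_def by (rule Cauchy_product_sums) (use sx sy x0 y0 in auto)
 define u where "u = (\<lambda>N. (norm (fps_nth (A * B) N))\<^sup>2 / real ((N + a) choose N))"
 have u0: "0 \<le> u N" for N by (simp add: u_def)
 have hu: "hn (a + 1) (A * B) = (\<Sum>k. ennreal (u k))" by (simp add: hn_def u_def)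
 have csum: "(\<Sum>k\<le>N. c k) = real ((N + a) choose N)" for N
  using sum_choose_lower[of "a - 1" N] a by (simp add: c_def add.commute flip: of_nat_sum)
 \<comment> \<open>Dividing by the weight makes the coefficient of the product a weighted mean of these numbers.\<close>
 define \<xi> where "\<xi> = (\<lambda>N k. fps_nth A k * fps_nth B (N - k) / of_real (c k))"
 have S: "(\<Sum>k\<le>N. c k *\<^sub>R \<xi> N k) = fps_nth (A * B) N" for N
  using c0 by (simp add: fps_mult_nth \<xi>_def scaleR_conv_of_real atLeast0AtMost less_imp_neq[symmetric])
 have V: "(\<Sum>k\<le>N. c k * (norm (\<xi> N k))\<^sup>2) = v N" for N
  unfolding v_def
 proof (rule sum.cong)
  fix k
  show "c k * (norm (\<xi> N k))\<^sup>2 = x k * y (N - k)"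
   using c0[of k] by (simp add: \<xi>_def x_def y_def norm_mult norm_divide power2_eq_square)
 qed simp
 have uv: "u N \<le> v N" and uv_eq: "u N = v N \<longleftrightarrow> (\<forall>k\<le>N. \<forall>l\<le>N. \<xi> N k = \<xi> N l)" for N
  using weighted_cauchy_schwarz[of "{..N}" c "\<xi> N"] c0 unfolding S V csum u_def by auto
 have su: "summable u"
  by (rule summable_comparison_test'[OF sums_summable[OF v], of 0]) (use uv u0 in auto)
 have hue: "hn (a + 1) (A * B) = ennreal (suminf u)"
  unfolding hu by (rule suminf_ennreal2) (use u0 su in auto)
 have rhs: "hn a A * hn 1 B = ennreal (suminf v)"
  unfolding hA hB sx(2) sy(2) sums_unique[OF v, symmetric]
  by (rule ennreal_mult[symmetric]) (auto intro!: suminf_nonneg sx sy x0 y0)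
 show "hn (a + 1) (A * B) \<le> hn a A * hn 1 B"
  unfolding hue rhs by (intro ennreal_leI suminf_le uv su sums_summable[OF v])
 have "hn (a + 1) (A * B) = hn a A * hn 1 B \<longleftrightarrow> suminf u = suminf v"
  unfolding hue rhs by (rule ennreal_inj) (auto intro!: suminf_nonneg su sums_summable[OF v] u0 order_trans[OF u0 uv])
 also have "\<dots> \<longleftrightarrow> (\<forall>N. u N = v N)"
 proof
  assume eq: "suminf u = suminf v"
  have "(\<Sum>N. v N - u N) = 0"
   using suminf_diff[OF sums_summable[OF v] su] eq by simp
  then show "\<forall>N. u N = v N"
   using suminf_eq_zero_iff[of "\<lambda>N. v N - u N"] uv summable_diff[OF sums_summable[OF v] su] by simp
 qed presburger
 also have "\<dots> \<longleftrightarrow> (\<forall>N. \<forall>k\<le>N. fps_nth A k * fps_nth B (N - k) = of_nat ((k + a - 1) choose k) * (fps_nth A 0 * fps_nth B N))"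
 proof -
  have "(\<forall>k\<le>N. \<forall>l\<le>N. \<xi> N k = \<xi> N l) \<longleftrightarrow> (\<forall>k\<le>N. \<xi> N k = \<xi> N 0)" for N
  proof
   assume *: "\<forall>k\<le>N. \<xi> N k = \<xi> N 0"
   show "\<forall>k\<le>N. \<forall>l\<le>N. \<xi> N k = \<xi> N l" using * by metis
  qed blast
  moreover have "\<xi> N k = \<xi> N 0 \<longleftrightarrow> fps_nth A k * fps_nth B (N - k) = of_nat ((k + a - 1) choose k) * (fps_nth A 0 * fps_nth B N)" for N k
   using c0[of k] by (auto simp: \<xi>_def c_def field_simps)
  ultimately show ?thesis unfolding uv_eq by simp
 qed
 finally show "hn (a + 1) (A * B) = hn a A * hn 1 B \<longleftrightarrow>
   (\<forall>N. \<forall>k\<le>N. fps_nth A k * fps_nth B (N - k) = of_nat ((k + a - 1) choose k) * (fps_nth A 0 * fps_nth B N))" .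
qed

lemma hn_eq_0_iff: "a \<ge> 1 \<Longrightarrow> hn a A = 0 \<longleftrightarrow> A = 0"
 unfolding hn_def by (subst suminf_eq_zero_iff) (auto simp: fps_eq_iff divide_le_0_iff)

text \<open>The equality condition for \<open>N = k + 1\<close> links consecutive coefficients and leaves
one free ratio.\<close>

lemma hn_mult_eq_geometric:
 fixes A B :: "complex fps"
 assumes a: "a \<ge> 1" and fin: "hn a A < \<infinity>" "hn 1 B < \<infinity>"
  and nz: "fps_nth A 0 \<noteq> 0" "fps_nth B 0 \<noteq> 0"
  and eq: "hn (a + 1) (A * B) = hn a A * hn 1 B"
 shows "\<exists>b. (\<forall>k. fps_nth B k = fps_nth B 0 * b ^ k) \<and>
  (\<forall>k. fps_nth A k = fps_nth A 0 * of_nat ((k + a - 1) choose k) * b ^ k)"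
proof -
 have *: "fps_nth A k * fps_nth B (N - k) = of_nat ((k + a - 1) choose k) * (fps_nth A 0 * fps_nth B N)" if "k \<le> N" for N k
  using hn_mult(2)[OF a fin] eq that by blast
 define b where "b = fps_nth B 1 / fps_nth B 0"
 have A1: "fps_nth A 1 = of_nat a * fps_nth A 0 * b"
  using *[of 1 1] nz a by (simp add: b_def field_simps)
 have "fps_nth B (Suc k) = b * fps_nth B k" for k
  using *[of 1 "Suc k"] A1 nz a by simp
 then have B: "fps_nth B k = fps_nth B 0 * b ^ k" for k
  by (induction k) (simp_all add: algebra_simps)
 moreover have "fps_nth A k = fps_nth A 0 * of_nat ((k + a - 1) choose k) * b ^ k" for k
  using *[of k k] nz B[of k] by simp
 ultimately show ?thesis by blast
qed

lemma hn_prod_le: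
 fixes A :: "nat \<Rightarrow> complex fps"
 assumes "m \<ge> 1" and fin: "\<And>j. j \<in> {1..m} \<Longrightarrow> hn 1 (A j) < \<infinity>"
 shows "hn m (\<Prod>j=1..m. A j) \<le> (\<Prod>j=1..m. hn 1 (A j))"
 using assms
proof (induction m rule: nat_induct_at_least)
 case (Suc m)
 have IH: "hn m (\<Prod>j=1..m. A j) \<le> (\<Prod>j=1..m. hn 1 (A j))" by (rule Suc.IH) (use Suc.prems in auto)
 also have "\<dots> < \<infinity>" using Suc.prems by (simp add: ennreal_prod_eq_top less_top[symmetric])
 finally have f: "hn m (\<Prod>j=1..m. A j) < \<infinity>" .
 have "hn (m + 1) ((\<Prod>j=1..m. A j) * A (Suc m)) \<le> hn m (\<Prod>j=1..m. A j) * hn 1 (A (Suc m))"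
  by (rule hn_mult(1)) (use Suc f in auto)
 also have "\<dots> \<le> (\<Prod>j=1..m. hn 1 (A j)) * hn 1 (A (Suc m))"
  by (rule mult_right_mono[OF IH]) simp
 finally show ?case using Suc by simp
qed simp

lemma fps_prod_nth_0: "fps_nth (prod A J) 0 = (\<Prod>j\<in>J. fps_nth (A j) 0)"
 by (induction J rule: infinite_finite_induct) auto

lemma fps_prod_geometric_nth_1:
 fixes A :: "nat \<Rightarrow> complex fps"
 assumes "\<And>j. j \<in> {1..m} \<Longrightarrow> fps_nth (A j) 1 = fps_nth (A j) 0 * b"
 shows "fps_nth (\<Prod>j=1..m. A j) 1 = (\<Prod>j=1..m. fps_nth (A j) 0) * (of_nat m * b)"
 using assms by (induction m) (auto simp: fps_mult_nth_1 fps_prod_nth_0 algebra_simps)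

text \<open>Split off the last factor. Equality forces equality for the first \<open>m\<close> factors and
for the final product; both provide a ratio, and comparing the coefficients of degree one of the
partial product identifies the two.\<close>

lemma hn_prod_eq_geometric:
 fixes A :: "nat \<Rightarrow> complex fps"
 assumes "m \<ge> 2" and fin: "\<And>j. j \<in> {1..m} \<Longrightarrow> hn 1 (A j) < \<infinity>"
  and nz: "\<And>j. j \<in> {1..m} \<Longrightarrow> fps_nth (A j) 0 \<noteq> 0"
  and eq: "hn m (\<Prod>j=1..m. A j) = (\<Prod>j=1..m. hn 1 (A j))"
 shows "\<exists>b. \<forall>j\<in>{1..m}. \<forall>k. fps_nth (A j) k = fps_nth (A j) 0 * b ^ k"
 using assms
proof (induction m rule: nat_induct_at_least)
 case base
 have e: "(\<Prod>j=1..2. A j) = A 1 * A 2" "(\<Prod>j=1..2. hn 1 (A j)) = hn 1 (A 1) * hn 1 (A 2)"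
  by (simp_all add: numeral_2_eq_2)
 have "hn (1 + 1) (A 1 * A 2) = hn 1 (A 1) * hn 1 (A 2)"
  using base(3) unfolding e one_add_one .
 from hn_mult_eq_geometric[OF _ _ _ _ _ this] base
 obtain b where b: "\<And>k. fps_nth (A 2) k = fps_nth (A 2) 0 * b ^ k" "\<And>k. fps_nth (A 1) k = fps_nth (A 1) 0 * b ^ k"
  by auto
 have s: "{1..2::nat} = {1,2}" by auto
 show ?case unfolding s
 proof (intro exI ballI allI)
  fix j k :: nat assume "j \<in> {1, 2}"
  then consider "j = 1" | "j = 2" by blast
  then show "fps_nth (A j) k = fps_nth (A j) 0 * b ^ k"
   by cases (hypsubst, rule b)+
 qed
next
 case (Suc m)
 define F where "F = (\<Prod>j=1..m. A j)"
 have m1: "m \<ge> 1" using Suc.hyps by simp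
 have le: "hn m F \<le> (\<Prod>j=1..m. hn 1 (A j))" unfolding F_def by (rule hn_prod_le[OF m1]) (use Suc.prems in auto)
 also have "\<dots> < \<infinity>" using Suc.prems by (simp add: ennreal_prod_eq_top less_top[symmetric])
 finally have f: "hn m F < \<infinity>" .
 have FS: "(\<Prod>j=1..Suc m. A j) = F * A (Suc m)" unfolding F_def by simp
 have e: "hn (m + 1) (F * A (Suc m)) = (\<Prod>j=1..m. hn 1 (A j)) * hn 1 (A (Suc m))"
  using Suc.prems(3) unfolding FS by simp
 have le2: "hn (m + 1) (F * A (Suc m)) \<le> hn m F * hn 1 (A (Suc m))"
  by (rule hn_mult(1)[OF m1 f]) (use Suc.prems in auto)
 have pos: "hn 1 (A (Suc m)) \<noteq> 0" "hn 1 (A (Suc m)) < \<infinity>"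
  using Suc.prems(1,2)[of "Suc m"] by (auto simp: hn_eq_0_iff)
 have "(\<Prod>j=1..m. hn 1 (A j)) * hn 1 (A (Suc m)) \<le> hn m F * hn 1 (A (Suc m))" using e le2 by simp
 then have "(\<Prod>j=1..m. hn 1 (A j)) \<le> hn m F"
  using pos ennreal_mult_le_mult_iff[of "hn 1 (A (Suc m))"] by (metis infinity_ennreal_def less_irrefl mult.commute)
 then have eqF: "hn m F = (\<Prod>j=1..m. hn 1 (A j))" using le by simp
 have "\<exists>b. \<forall>j\<in>{1..m}. \<forall>k. fps_nth (A j) k = fps_nth (A j) 0 * b ^ k"
  by (rule Suc.IH[OF _ _ eqF[unfolded F_def]]) (use Suc.prems(1,2) in auto)
 then obtain b where b: "\<forall>j\<in>{1..m}. \<forall>k. fps_nth (A j) k = fps_nth (A j) 0 * b ^ k"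
  by blast
 have F0: "fps_nth F 0 = (\<Prod>j=1..m. fps_nth (A j) 0)" by (simp add: F_def fps_prod_nth_0)
 have F0nz: "fps_nth F 0 \<noteq> 0" unfolding F0 using Suc.prems(2) by simp
 have "hn (m + 1) (F * A (Suc m)) = hn m F * hn 1 (A (Suc m))" using e eqF by simp
 have "fps_nth (A (Suc m)) 0 \<noteq> 0" by (rule Suc.prems(2)) simp
 from hn_mult_eq_geometric[OF m1 f pos(2) F0nz this \<open>hn (m + 1) (F * A (Suc m)) = hn m F * hn 1 (A (Suc m))\<close>]
 obtain b' where b': "\<And>k. fps_nth (A (Suc m)) k = fps_nth (A (Suc m)) 0 * b' ^ k"
  "\<And>k. fps_nth F k = fps_nth F 0 * of_nat ((k + m - 1) choose k) * b' ^ k"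
  by blast
 have "fps_nth F 1 = fps_nth F 0 * (of_nat m * b)"
  unfolding F0 unfolding F_def by (rule fps_prod_geometric_nth_1) (metis b power_one_right)
 then have "b = b'" using b'(2)[of 1] F0nz m1 by simp
 then have "\<forall>j\<in>{1..Suc m}. \<forall>k. fps_nth (A j) k = fps_nth (A j) 0 * b ^ k"
  using b b'(1) by (metis atLeastAtMost_iff le_Suc_eq)
 then show ?case by blast
qed

lemma hn_prod_geometric:
 fixes A :: "nat \<Rightarrow> complex fps"
 assumes "m \<ge> 1" and fin: "\<And>j. j \<in> {1..m} \<Longrightarrow> hn 1 (A j) < \<infinity>"
  and geo: "\<And>j k. j \<in> {1..m} \<Longrightarrow> fps_nth (A j) k = fps_nth (A j) 0 * b ^ k"
 shows "hn m (\<Prod>j=1..m. A j) = (\<Prod>j=1..m. hn 1 (A j)) \<and>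
  (\<forall>k. fps_nth (\<Prod>j=1..m. A j) k = (\<Prod>j=1..m. fps_nth (A j) 0) * of_nat ((k + m - 1) choose k) * b ^ k)"
 using assms
proof (induction m rule: nat_induct_at_least)
 case base
 have "fps_nth (A 1) k = fps_nth (A 1) 0 * b ^ k" for k by (rule base(2)) simp
 note g = this[unfolded One_nat_def]
 show ?case by (simp, intro allI, rule g)
next
 case (Suc m)
 define F where "F = (\<Prod>j=1..m. A j)"
 define G where "G = A (Suc m)"
 have IH: "hn m F = (\<Prod>j=1..m. hn 1 (A j))"
  "\<And>k. fps_nth F k = (\<Prod>j=1..m. fps_nth (A j) 0) * of_nat ((k + m - 1) choose k) * b ^ k"
 proof -
  have "j \<in> {1..m} \<Longrightarrow> j \<in> {1..Suc m}" for j by simp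
  note Suc.IH[OF Suc.prems(1)[OF this] Suc.prems(2)[OF this]]
  then show "hn m F = (\<Prod>j=1..m. hn 1 (A j))"
   "\<And>k. fps_nth F k = (\<Prod>j=1..m. fps_nth (A j) 0) * of_nat ((k + m - 1) choose k) * b ^ k"
   unfolding F_def by blast+
 qed
 have G: "\<And>k. fps_nth G k = fps_nth G 0 * b ^ k"
  unfolding G_def by (rule Suc.prems(2)) simp
 have f: "hn m F < \<infinity>" "hn 1 G < \<infinity>"
  using Suc.prems(1) by (auto simp: IH(1) G_def ennreal_prod_eq_top less_top[symmetric])
 have F0: "fps_nth F 0 = (\<Prod>j=1..m. fps_nth (A j) 0)" by (simp add: F_def fps_prod_nth_0)
 have k: "fps_nth F k * fps_nth G (N - k) = of_nat ((k + m - 1) choose k) * (fps_nth F 0 * fps_nth G N)" if "k \<le> N" for N k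
 proof -
  have "b ^ k * b ^ (N - k) = b ^ N" using that by (simp flip: power_add)
  then show ?thesis
   unfolding IH(2)[of k] F0[symmetric] G[of "N - k"] G[of N] by (simp add: algebra_simps)
 qed
 have 1: "hn (m + 1) (F * G) = hn m F * hn 1 G"
  using hn_mult(2)[OF Suc.hyps f] k by blast
 have 2: "fps_nth (F * G) N = fps_nth F 0 * fps_nth G 0 * of_nat ((N + m) choose N) * b ^ N" for N
 proof -
  have "fps_nth (F * G) N = (\<Sum>k=0..N. of_nat ((k + m - 1) choose k) * (fps_nth F 0 * fps_nth G N))"
   unfolding fps_mult_nth by (rule sum.cong) (auto simp: k)
  also have "\<dots> = of_nat (\<Sum>k\<le>N. (m - 1 + k) choose k) * (fps_nth F 0 * fps_nth G N)"
   using Suc.hyps by (simp add: sum_distrib_right atLeast0AtMost add.commute)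
  also have "\<dots> = of_nat ((N + m) choose N) * (fps_nth F 0 * fps_nth G N)"
   unfolding sum_choose_lower using Suc.hyps by (simp add: add.commute)
  also have "\<dots> = fps_nth F 0 * fps_nth G 0 * of_nat ((N + m) choose N) * b ^ N"
   unfolding G[of N] by (simp add: algebra_simps)
  finally show ?thesis .
 qed
 have FS: "(\<Prod>j=1..Suc m. A j) = F * G" unfolding F_def G_def by simp
 show ?case unfolding FS using 1 2 F0 IH(1) by (simp add: G_def)
qed

section \<open>Zero-free majorants in the disc\<close>

lemma norm_Blaschke_sq:
 "(norm (1 - cnj a * z))\<^sup>2 - (norm (z - a))\<^sup>2 = (1 - (norm a)\<^sup>2) * (1 - (norm z)\<^sup>2)"
 unfolding cmod_power2 by (simp add: power2_eq_square algebra_simps)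

lemma norm_Blaschke_le: "norm a < 1 \<Longrightarrow> norm z \<le> 1 \<Longrightarrow> norm (z - a) \<le> norm (1 - cnj a * z)"
 and norm_Blaschke_eq: "norm z = 1 \<Longrightarrow> norm (z - a) = norm (1 - cnj a * z)"
proof -
 show "norm (z - a) \<le> norm (1 - cnj a * z)" if "norm a < 1" "norm z \<le> 1"
 proof -
  have "0 \<le> (1 - (norm a)\<^sup>2) * (1 - (norm z)\<^sup>2)"
   using that by (intro mult_nonneg_nonneg) (auto simp: power_le_one)
  then have "(norm (z - a))\<^sup>2 \<le> (norm (1 - cnj a * z))\<^sup>2" using norm_Blaschke_sq[of a z] by linarith
  then show ?thesis by (rule power2_le_imp_le) simp
 qed
 show "norm (z - a) = norm (1 - cnj a * z)" if "norm z = 1"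
 proof -
  have "(norm (z - a))\<^sup>2 = (norm (1 - cnj a * z))\<^sup>2" using norm_Blaschke_sq[of a z] that by simp
  then show ?thesis by (rule power2_eq_imp_eq) auto
 qed
qed

lemma one_minus_mult_nz:
 fixes a z :: complex
 assumes "norm a \<le> 1" "norm z < 1" shows "1 - a * z \<noteq> 0"
proof
 assume "1 - a * z = 0"
 then have "norm a * norm z = 1" by (metis norm_mult norm_one right_minus_eq)
 moreover have "norm a * norm z \<le> 1 * norm z" by (rule mult_right_mono) (use assms in auto)
 ultimately show False using assms by simp
qed

text \<open>Replace each zero $a$ in the disc by its reflection, that is, multiply by the inverse Blaschke
factor $(1-\bar a z)/(z-a)$, which has modulus one on the circle and at least one inside. The
induction is on the number of zeros in the disc; the larger radius \<open>R\<close> keeps that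
number finite.\<close>

lemma divide_out_zeros:
 assumes "R > 1" "F holomorphic_on ball 0 R" "\<exists>z\<in>ball 0 R. F z \<noteq> 0"
 shows "\<exists>g. g holomorphic_on ball 0 R \<and> (\<forall>z\<in>ball 0 1. g z \<noteq> 0) \<and>
  (\<forall>z\<in>cball 0 1. norm (F z) \<le> norm (g z)) \<and> (\<forall>z\<in>sphere 0 1. norm (F z) = norm (g z))"
 using assms
proof (induction "card {z \<in> ball 0 1. F z = 0}" arbitrary: F rule: less_induct)
 case less
 let ?S = "ball (0::complex) R"
 show ?case
 proof (cases "\<exists>a\<in>ball 0 1. F a = 0")
  case False
  then show ?thesis using less.prems by (intro exI[of _ F]) auto
 next
  case True
  then obtain a where a: "norm a < 1" "F a = 0" by auto
  have aS: "a \<in> ?S" using a less.prems by auto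
  have nc: "\<not> F constant_on ?S"
   using less.prems(3) aS a unfolding constant_on_def by metis
  have "finite {z \<in> cball 0 1. F z = 0}"
   by (rule holomorphic_compact_finite_zeros[OF less.prems(2) _ _ _ _ nc]) (use less.prems(1) in auto)
  then have fin: "finite {z \<in> ball 0 1. F z = 0}"
   by (rule finite_subset[rotated]) auto
  obtain g0 r n where g0: "0 < n" "0 < r" "ball a r \<subseteq> ?S" "g0 holomorphic_on ball a r"
   "\<And>w. w \<in> ball a r \<Longrightarrow> F w = (w - a) ^ n * g0 w" "\<And>w. w \<in> ball a r \<Longrightarrow> g0 w \<noteq> 0"
   using holomorphic_factor_zero_nonconstant[OF less.prems(2) open_ball connected_ball aS a(2) nc] by metis
  define G where "G = (\<lambda>z. if z \<in> ball a r then g0 z else F z / (z - a) ^ n)"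
  have FG: "F z = (z - a) ^ n * G z" if "z \<in> ?S" for z
   unfolding G_def using g0(2,5) that by auto
  have "G holomorphic_on ball a r"
   by (rule holomorphic_transform[OF g0(4)]) (simp add: G_def)
  moreover have "G holomorphic_on ?S - {a}"
  proof (rule holomorphic_transform)
   show "(\<lambda>z. F z / (z - a) ^ n) holomorphic_on ?S - {a}"
    by (intro holomorphic_intros holomorphic_on_subset[OF less.prems(2)]) auto
   show "F z / (z - a) ^ n = G z" if "z \<in> ?S - {a}" for z
    using FG[of z] that by auto
  qed
  ultimately have "G holomorphic_on ball a r \<union> (?S - {a})"
   by (rule holomorphic_on_Un) auto
  moreover have "ball a r \<union> (?S - {a}) = ?S" using g0(2,3) by auto
  ultimately have Gh: "G holomorphic_on ?S" by simp
  have Ga: "G a \<noteq> 0" using g0 by (simp add: G_def)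
  define F1 where "F1 = (\<lambda>z. (1 - cnj a * z) ^ n * G z)"
  have F1h: "F1 holomorphic_on ?S" unfolding F1_def by (intro holomorphic_intros Gh)
  have nz: "1 - cnj a * z \<noteq> 0" if "norm z < 1" for z
   by (rule one_minus_mult_nz) (use a that in auto)
  have "{z \<in> ball 0 1. F1 z = 0} \<subset> {z \<in> ball 0 1. F z = 0}"
  proof
   show "{z \<in> ball 0 1. F1 z = 0} \<subseteq> {z \<in> ball 0 1. F z = 0}"
    using nz FG less.prems(1) by (auto simp: F1_def)
   have "a \<notin> {z \<in> ball 0 1. F1 z = 0}" using Ga nz[of a] a by (auto simp: F1_def)
   then show "{z \<in> ball 0 1. F1 z = 0} \<noteq> {z \<in> ball 0 1. F z = 0}" using a by auto
  qed
  then have c1: "card {z \<in> ball 0 1. F1 z = 0} < card {z \<in> ball 0 1. F z = 0}"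
   by (rule psubset_card_mono[OF fin])
  have c2: "\<exists>z\<in>?S. F1 z \<noteq> 0" using Ga nz[of a] a aS by (auto simp: F1_def)
  obtain g where g: "g holomorphic_on ?S" "\<forall>z\<in>ball 0 1. g z \<noteq> 0"
   "\<forall>z\<in>cball 0 1. norm (F1 z) \<le> norm (g z)" "\<forall>z\<in>sphere 0 1. norm (F1 z) = norm (g z)"
   using less.hyps[OF c1 less.prems(1) F1h c2] by blast
  have l: "norm (F z) \<le> norm (F1 z)" if "norm z \<le> 1" for z
   using norm_Blaschke_le[OF a(1) that] that less.prems(1)
   by (auto simp: FG F1_def norm_mult norm_power intro!: mult_right_mono power_mono)
  have e: "norm (F z) = norm (F1 z)" if "norm z = 1" for z
   using norm_Blaschke_eq[OF that, of a] that less.prems(1)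
   by (auto simp: FG F1_def norm_mult norm_power)
  show ?thesis
  proof (intro exI[of _ g] conjI ballI)
   fix z :: complex assume z: "z \<in> cball 0 1"
   have "norm (F z) \<le> norm (F1 z)" by (rule l) (use z in simp)
   also have "\<dots> \<le> norm (g z)" using g(3) z by blast
   finally show "norm (F z) \<le> norm (g z)" .
  next
   fix z :: complex assume z: "z \<in> sphere 0 1"
   have "norm (F z) = norm (F1 z)" by (rule e) (use z in simp)
   also have "\<dots> = norm (g z)" using g(4) z by blast
   finally show "norm (F z) = norm (g z)" .
  qed (use g in blast)+
 qed
qed

lemma ball_fps_expansion:
 assumes "h holomorphic_on ball 0 1"
 shows "fps_conv_radius (fps_expansion h 0) \<ge> 1"
  and "norm z < 1 \<Longrightarrow> h z = eval_fps (fps_expansion h 0) z"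
proof -
 have h: "h holomorphic_on eball 0 1" using assms by (simp add: one_ereal_def)
 show "fps_conv_radius (fps_expansion h 0) \<ge> 1" by (rule conv_radius_fps_expansion[OF h])
 show "norm z < 1 \<Longrightarrow> h z = eval_fps (fps_expansion h 0) z"
  using eval_fps_expansion'[OF h, of z] by (simp add: one_ereal_def)
qed

text \<open>A zero-free function on the disc has a holomorphic logarithm, so any real power of its modulus
is the square of a modulus.\<close>

lemma half_power:
 assumes "g holomorphic_on ball 0 1" "\<And>z. z \<in> ball 0 1 \<Longrightarrow> g z \<noteq> 0"
 shows "\<exists>h. h holomorphic_on ball 0 1 \<and> (\<forall>z\<in>ball 0 1. h z \<noteq> 0) \<and>
  (\<forall>z\<in>ball 0 1. norm (g z) powr p = (norm (h z))\<^sup>2)"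
proof -
 obtain L where L: "L holomorphic_on ball 0 1" "\<And>z. z \<in> ball 0 1 \<Longrightarrow> g z = exp (L z)"
  using contractible_imp_holomorphic_log[OF assms(1) convex_imp_contractible[OF convex_ball] assms(2)] by metis
 have "norm (g z) powr p = (norm (exp (of_real (p / 2) * L z)))\<^sup>2" if "z \<in> ball 0 1" for z
  unfolding L(2)[OF that] norm_exp_eq_Re by (simp add: powr_def power2_eq_square flip: exp_add)
 then show ?thesis
  by (intro exI[of _ "\<lambda>z. exp (of_real (p / 2) * L z)"]) (auto intro!: holomorphic_intros L)
qed

lemma measurable_dilate_circ:
 fixes F :: "complex \<Rightarrow> 'a :: topological_space"
 assumes "continuous_on (ball 0 R) F" "0 \<le> r" "r < R"
 shows "(\<lambda>z. F (of_real r * z)) \<in> borel_measurable circ"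
proof -
 have "continuous_on (sphere 0 1) (\<lambda>z. F (of_real r * z))"
  by (rule continuous_on_compose2[OF assms(1)])
   (use assms in \<open>auto intro!: continuous_intros simp: norm_mult\<close>)
 then show ?thesis
  unfolding measurable_cong_sets[OF sets_circ refl] by (rule borel_measurable_continuous_on_restrict)
qed

lemma circ_mean_tendsto:
 fixes u :: "nat \<Rightarrow> complex \<Rightarrow> complex"
 assumes "\<And>n. u n \<in> borel_measurable circ" "v \<in> borel_measurable circ" and p: "p > 0"
  and B: "\<And>n z. norm z = 1 \<Longrightarrow> norm (u n z) \<le> B"
  and lim: "\<And>z. norm z = 1 \<Longrightarrow> (\<lambda>n. u n z) \<longlonglongrightarrow> v z"
 shows "(\<lambda>n. \<integral>\<^sup>+z. ennreal (norm (u n z) powr p) \<partial>circ) \<longlonglongrightarrow> (\<integral>\<^sup>+z. ennreal (norm (v z) powr p) \<partial>circ)"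
proof (rule nn_integral_dominated_convergence[where w="\<lambda>_. ennreal (B powr p)"])
 show "AE z in circ. ennreal (norm (u n z) powr p) \<le> ennreal (B powr p)" for n
  by (rule AE_I2) (use p B in \<open>auto intro!: ennreal_leI powr_mono2\<close>)
 show "(\<integral>\<^sup>+z. ennreal (B powr p) \<partial>circ) < \<infinity>"
  by (simp add: emeasure_circ_space)
 show "AE z in circ. (\<lambda>n. ennreal (norm (u n z) powr p)) \<longlonglongrightarrow> ennreal (norm (v z) powr p)"
  by (rule AE_I2) (use p lim in \<open>auto intro!: tendsto_ennrealI tendsto_powr2 tendsto_norm tendsto_const\<close>)
qed (use assms in measurable)

lemma mean1_cong:
 assumes "\<And>z. norm z < 1 \<Longrightarrow> norm (f z) powr p = norm (h z) powr q" "0 \<le> r" "r < 1"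
 shows "mean1 p f r = mean1 q h r"
 unfolding mean1_def by (rule nn_integral_cong) (use assms in \<open>auto simp: norm_mult\<close>)

lemma mean1_mono_fun:
 assumes "\<And>z. norm z = r \<Longrightarrow> norm (f z) \<le> norm (g z)" "0 \<le> r" "p \<ge> 0"
 shows "mean1 p f r \<le> mean1 p g r"
 unfolding mean1_def
 by (rule nn_integral_mono) (use assms in \<open>auto intro!: ennreal_leI powr_mono2 simp: norm_mult\<close>)

lemma N1_cong:
 assumes "\<And>z. norm z < 1 \<Longrightarrow> norm (f z) powr p = norm (h z) powr q"
 shows "N1 p f = N1 q h"
 unfolding N1_def by (rule SUP_cong) (use assms in \<open>auto intro!: mean1_cong\<close>)

lemma mean1_tendsto:
 assumes F: "continuous_on (ball 0 R) F" and p: "p > 0"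
  and s: "s \<longlonglongrightarrow> t" "\<And>n. 0 \<le> s n" "\<And>n. s n \<le> t" "t < R"
 shows "(\<lambda>n. mean1 p F (s n)) \<longlonglongrightarrow> mean1 p F t"
proof -
 have t0: "0 \<le> t" using s(2,3) order_trans by blast
 have "compact (F ` cball 0 t)"
  by (rule compact_continuous_image[OF continuous_on_subset[OF F]]) (use s(4) in auto)
 then obtain B where B: "\<And>z. norm z \<le> t \<Longrightarrow> norm (F z) \<le> B"
  using compact_imp_bounded[THEN bounded_iff[THEN iffD1]] by fastforce
 show ?thesis
  unfolding mean1_def
 proof (rule circ_mean_tendsto[OF _ _ p])
  show "(\<lambda>z. F (of_real (s n) * z)) \<in> borel_measurable circ" for n
   by (rule measurable_dilate_circ[OF F s(2)]) (use s(3,4) in \<open>auto intro: order.strict_trans1\<close>)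
  show "(\<lambda>z. F (of_real t * z)) \<in> borel_measurable circ"
   by (rule measurable_dilate_circ[OF F t0 s(4)])
  show "norm (F (of_real (s n) * z)) \<le> B" if "norm z = 1" for n z
   by (rule B) (use that s(2,3)[of n] in \<open>simp add: norm_mult\<close>)
  show "(\<lambda>n. F (of_real (s n) * z)) \<longlonglongrightarrow> F (of_real t * z)" if "norm z = 1" for z
  proof (rule isCont_tendsto_compose[of _ F])
   show "isCont F (of_real t * z)"
    using continuous_on_interior[OF F] t0 s(4) that by (simp add: norm_mult)
  qed (intro tendsto_intros s)
 qed
qed

lemma approach_one: "(\<lambda>n. 1 - c / real (Suc n)) \<longlonglongrightarrow> 1"
 using tendsto_diff[OF tendsto_const[of 1] LIMSEQ_Suc[OF lim_const_over_n[of c]]] by simp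

lemma N1_le_boundary_mean:
 assumes R: "R > 1" and g: "g holomorphic_on ball 0 R" "\<And>z. z \<in> ball 0 1 \<Longrightarrow> g z \<noteq> 0" and p: "p > 0"
 shows "N1 p g \<le> mean1 p g 1"
proof -
 have g1: "g holomorphic_on ball 0 1" by (rule holomorphic_on_subset[OF g(1)]) (use R in auto)
 obtain h where h: "h holomorphic_on ball 0 1" "\<And>z. z \<in> ball 0 1 \<Longrightarrow> norm (g z) powr p = (norm (h z))\<^sup>2"
  using half_power[OF g1 g(2), of p] by auto
 note A = ball_fps_expansion[OF h(1)]
 have eq: "mean1 p g r = (\<Sum>k. ennreal ((norm (fps_nth (fps_expansion h 0) k))\<^sup>2) * ennreal ((r\<^sup>2) ^ k))"
  if r: "0 \<le> r" "r < 1" for r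
 proof -
  have "mean1 p g r = mean1 2 h r"
   by (rule mean1_cong) (use h(2) r in auto)
  also have "\<dots> = (\<Sum>k. ennreal ((norm (fps_nth (fps_expansion h 0) k))\<^sup>2) * ennreal ((r\<^sup>2) ^ k))"
   by (rule mean1_2[OF A(1) _ r]) (rule A(2))
  finally show ?thesis .
 qed
 have mono: "mean1 p g r \<le> mean1 p g s" if "0 \<le> r" "r \<le> s" "s < 1" for r s
  unfolding eq[OF that(1) order.strict_trans1[OF that(2,3)]] eq[OF order_trans[OF that(1,2)] that(3)]
  by (intro suminf_le mult_left_mono ennreal_leI power_mono summableI) (use that in auto)
 show ?thesis
  unfolding N1_def
 proof (rule SUP_least)
  fix r :: real assume r: "r \<in> {0..<1}"
  define s where "s = (\<lambda>n. 1 - (1 - r) / real (Suc n))"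
  have s: "r \<le> s n" "s n < 1" for n
   using r mult_right_mono[of 1 "real (Suc n)" "1 - r"] by (auto simp: s_def field_simps)
  have sl: "s \<longlonglongrightarrow> 1"
   unfolding s_def by (rule approach_one)
  have "(\<lambda>n. mean1 p g (s n)) \<longlonglongrightarrow> mean1 p g 1"
   by (rule mean1_tendsto[OF holomorphic_on_imp_continuous_on[OF g(1)] p sl])
    (use s r R in \<open>auto intro: order_trans less_imp_le\<close>)
  then show "mean1 p g r \<le> mean1 p g 1"
   by (rule LIMSEQ_le_const) (use mono s r in auto)
 qed
qed

lemma N1_le_boundary_mean':
 assumes R: "R > 1" and F: "F holomorphic_on ball 0 R" "\<exists>z\<in>ball 0 R. F z \<noteq> 0" and p: "p > 0"
 shows "\<exists>g. g holomorphic_on ball 0 1 \<and> (\<forall>z\<in>ball 0 1. g z \<noteq> 0) \<and>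
  (\<forall>z\<in>ball 0 1. norm (F z) \<le> norm (g z)) \<and> N1 p g \<le> mean1 p F 1"
proof -
 obtain g where g: "g holomorphic_on ball 0 R" "\<forall>z\<in>ball 0 1. g z \<noteq> 0"
   "\<forall>z\<in>cball 0 1. norm (F z) \<le> norm (g z)" "\<forall>z\<in>sphere 0 1. norm (F z) = norm (g z)"
  using divide_out_zeros[OF R F] by auto
 have "N1 p g \<le> mean1 p g 1" by (rule N1_le_boundary_mean[OF R g(1) _ p]) (use g in auto)
 also have "\<dots> = mean1 p F 1" unfolding mean1_def by (rule nn_integral_cong) (use g in auto)
 finally have "N1 p g \<le> mean1 p F 1" .
 moreover have "g holomorphic_on ball 0 1" by (rule holomorphic_on_subset[OF g(1)]) (use R in auto)
 ultimately show ?thesis using g by (intro exI[of _ g]) auto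
qed

lemma dilate_holomorphic:
 assumes "f holomorphic_on ball 0 1" "0 < s" "s < 1"
 shows "(\<lambda>z. f (of_real s * z)) holomorphic_on ball 0 (1 / s)"
 by (rule holomorphic_on_compose_gen[OF _ assms(1), unfolded o_def])
  (use assms in \<open>auto intro!: holomorphic_intros simp: norm_mult field_simps\<close>)

lemma mean1_dilate: "mean1 p (\<lambda>z. f (of_real s * z)) r = mean1 p f (s * r)"
 unfolding mean1_def by (simp add: mult.assoc)

text \<open>Circular means increase with the radius for every \<open>p > 0\<close>: on a slightly larger
disc the function has a zero-free majorant with the same modulus on the boundary circle, and for
that one the mean is a power series in \<open>r\<^sup>2\<close> with nonnegative coefficients.\<close>

lemma mean1_mono:
 assumes f: "f holomorphic_on ball 0 1" and p: "p > 0" and r: "0 \<le> r" "r \<le> s" "s < 1"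
 shows "mean1 p f r \<le> mean1 p f s"
proof (cases "r = s")
 case False
 then have s: "0 < s" "r < s" using r by auto
 define F where "F = (\<lambda>z. f (of_real s * z))"
 have F: "F holomorphic_on ball 0 (1 / s)" unfolding F_def by (rule dilate_holomorphic[OF f s(1) r(3)])
 have R: "1 / s > 1" using s r by simp
 have rs: "0 \<le> r / s" "r / s < 1" using s r by auto
 have "mean1 p F (r / s) \<le> mean1 p F 1"
 proof (cases "\<exists>z\<in>ball 0 (1 / s). F z \<noteq> 0")
  case True
  from N1_le_boundary_mean'[OF R F True p] obtain g where g: "\<forall>z\<in>ball 0 1. norm (F z) \<le> norm (g z)" "N1 p g \<le> mean1 p F 1"
   by auto
  have "mean1 p F (r / s) \<le> mean1 p g (r / s)"
   by (rule mean1_mono_fun) (use g rs p in auto)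
  also have "\<dots> \<le> N1 p g" by (rule mean1_le_N1[OF rs])
  finally show ?thesis using g(2) by (rule order_trans)
 next
  case False
  have "F (of_real (r / s) * z) = 0" if "norm z = 1" for z
  proof -
   have "norm (of_real (r / s) * z) < 1 / s" using that rs R by (simp only: norm_mult norm_of_real)
   then show ?thesis using False by auto
  qed
  then have "mean1 p F (r / s) = (\<integral>\<^sup>+z. 0 \<partial>circ)"
   unfolding mean1_def by (intro nn_integral_cong) (simp del: of_real_divide)
  then show ?thesis by simp
 qed
 then show ?thesis using s by (simp add: F_def mean1_dilate)
qed simp

text \<open>Bounds every coefficient of the square root by the norm; the estimate is uniform over a bounded
set of functions, which is what a normal family argument needs.\<close>

lemma pointwise_bound:
 assumes g: "g holomorphic_on ball 0 1" "\<And>z. z \<in> ball 0 1 \<Longrightarrow> g z \<noteq> 0" and p: "p > 0"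
  and N: "N1 p g \<le> ennreal N" "0 \<le> N" and z: "norm z < 1"
 shows "norm (g z) \<le> (N / (1 - norm z)\<^sup>2) powr (1 / p)"
proof -
 obtain h where h: "h holomorphic_on ball 0 1" "\<And>z. z \<in> ball 0 1 \<Longrightarrow> norm (g z) powr p = (norm (h z))\<^sup>2"
  using half_power[OF g, of p] by auto
 note A = ball_fps_expansion[OF h(1)]
 define a where "a = (\<lambda>k. norm (fps_nth (fps_expansion h 0) k))"
 have "N1 p g = N1 2 h" by (rule N1_cong) (use h(2) in auto)
 also have "\<dots> = hn 1 (fps_expansion h 0)" by (rule N1_2[OF A(1)]) (rule A(2))
 finally have hn: "hn 1 (fps_expansion h 0) \<le> ennreal N" using N by simp
 have ak: "a k \<le> sqrt N" for k
 proof -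
  have "ennreal ((a k)\<^sup>2) = (\<Sum>i\<in>{k}. ennreal ((a i)\<^sup>2))" by simp
  also have "\<dots> \<le> (\<Sum>i. ennreal ((a i)\<^sup>2))"
   by (rule sum_le_suminf) auto
  also have "\<dots> = hn 1 (fps_expansion h 0)" by (simp add: hn_def a_def)
  also note hn
  finally have "(a k)\<^sup>2 \<le> N" using N(2) by simp
  then show ?thesis by (rule real_le_rsqrt)
 qed
 have sm: "summable (\<lambda>k. sqrt N * norm z ^ k)" by (intro summable_mult summable_geometric) (use z in simp)
 have "norm (h z) = norm (\<Sum>k. fps_nth (fps_expansion h 0) k * z ^ k)"
  using A(2)[OF z] by (simp add: eval_fps_def)
 also have "\<dots> \<le> (\<Sum>k. sqrt N * norm z ^ k)"
  by (rule norm_suminf_le[OF _ sm]) (use ak in \<open>auto simp: norm_mult norm_power a_def intro!: mult_right_mono\<close>)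
 also have "\<dots> = sqrt N / (1 - norm z)"
  using z by (subst suminf_mult) (auto simp: suminf_geometric summable_geometric)
 finally have hz: "norm (h z) \<le> sqrt N / (1 - norm z)" .
 have "norm (g z) powr p = (norm (h z))\<^sup>2" using h(2) z by simp
 also have "\<dots> \<le> (sqrt N / (1 - norm z))\<^sup>2" by (rule power_mono[OF hz]) simp
 also have "\<dots> = N / (1 - norm z)\<^sup>2" using N(2) by (simp add: power_divide)
 finally have "(norm (g z) powr p) powr (1 / p) \<le> (N / (1 - norm z)\<^sup>2) powr (1 / p)"
  by (rule powr_mono2[rotated 2]) (use p in auto)
 then show ?thesis using p by (simp add: powr_powr)
qed

text \<open>A substitute for the Blaschke factorization without infinite products. The dilated functions
have finitely many zeros, which can be divided out; by Montel's theorem the resulting zero-free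
functions have a subsequence that converges locally uniformly, and by Hurwitz's theorem the
limit is zero free, because it dominates a function that does not vanish identically.\<close>

theorem riesz_majorant:
 assumes f: "f holomorphic_on ball 0 1" "\<exists>z\<in>ball 0 1. f z \<noteq> 0" and p: "p > 0" and fin: "N1 p f < \<infinity>"
 shows "\<exists>g. g holomorphic_on ball 0 1 \<and> (\<forall>z\<in>ball 0 1. g z \<noteq> 0) \<and>
  (\<forall>z\<in>ball 0 1. norm (f z) \<le> norm (g z)) \<and> N1 p g \<le> N1 p f"
proof -
 let ?D = "ball (0::complex) 1"
 obtain N where N: "N1 p f = ennreal N" "0 \<le> N" using fin by (cases "N1 p f") auto
 obtain z0 where z0: "z0 \<in> ?D" "f z0 \<noteq> 0" using f(2) by auto
 \<comment> \<open>The radii exceed the modulus of a point where the function is not zero, so no dilation vanishes identically on the disc.\<close>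
 define \<rho> where "\<rho> = (\<lambda>n. 1 - (1 - norm z0) / real (Suc (Suc n)))"
 have \<rho>: "norm z0 < \<rho> n" "\<rho> n < 1" for n
 proof -
  have "(1 - norm z0) / real (Suc (Suc n)) < (1 - norm z0) / 1"
   using z0 by (intro divide_strict_left_mono) auto
  then show "norm z0 < \<rho> n" by (simp add: \<rho>_def)
  show "\<rho> n < 1" using z0 by (simp add: \<rho>_def)
 qed
 have \<rho>0: "0 < \<rho> n" for n using \<rho>[of n] norm_ge_zero[of z0] by linarith
 have \<rho>l: "\<rho> \<longlonglongrightarrow> 1"
  unfolding \<rho>_def by (rule LIMSEQ_Suc[OF approach_one])
 have "\<exists>g. g holomorphic_on ?D \<and> (\<forall>z\<in>?D. g z \<noteq> 0) \<and>
  (\<forall>z\<in>?D. norm (f (of_real (\<rho> n) * z)) \<le> norm (g z)) \<and> N1 p g \<le> ennreal N" for n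
 proof -
  have nz: "\<exists>z\<in>ball 0 (1 / \<rho> n). f (of_real (\<rho> n) * z) \<noteq> 0"
   by (rule bexI[of _ "z0 / of_real (\<rho> n)"]) (use z0 \<rho>0[of n] in \<open>auto simp: norm_divide divide_strict_right_mono\<close>)
  obtain g where g: "g holomorphic_on ?D" "\<forall>z\<in>?D. g z \<noteq> 0"
   "\<forall>z\<in>?D. norm (f (of_real (\<rho> n) * z)) \<le> norm (g z)" "N1 p g \<le> mean1 p (\<lambda>z. f (of_real (\<rho> n) * z)) 1"
   using N1_le_boundary_mean'[OF _ dilate_holomorphic[OF f(1) \<rho>0[of n] \<rho>(2)] nz p] \<rho>(2)[of n] \<rho>0[of n] by auto
  have "mean1 p (\<lambda>z. f (of_real (\<rho> n) * z)) 1 \<le> N1 p f"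
   unfolding mean1_dilate using mean1_le_N1[of "\<rho> n"] \<rho>(2)[of n] \<rho>0[of n] by simp
  then show ?thesis using g N by auto
 qed
 then obtain g where g: "\<And>n. g n holomorphic_on ?D" "\<And>n z. z \<in> ?D \<Longrightarrow> g n z \<noteq> 0"
  "\<And>n z. z \<in> ?D \<Longrightarrow> norm (f (of_real (\<rho> n) * z)) \<le> norm (g n z)" "\<And>n. N1 p (g n) \<le> ennreal N"
  by metis
 define \<Phi> where "\<Phi> = (\<lambda>z::complex. (N / (1 - norm z)\<^sup>2) powr (1 / p))"
 have gb: "norm (g n z) \<le> \<Phi> z" if "z \<in> ?D" for n z
  unfolding \<Phi>_def by (rule pointwise_bound[OF g(1,2) p g(4) N(2)]) (use that in auto)
 define H where "H = {h. h holomorphic_on ?D \<and> (\<forall>z\<in>?D. norm (h z) \<le> \<Phi> z)}"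
 have bd: "\<exists>B. \<forall>h\<in>H. \<forall>z\<in>K. norm (h z) \<le> B" if K: "compact K" "K \<subseteq> ?D" for K
 proof -
  have "continuous_on K \<Phi>"
   unfolding \<Phi>_def using K(2) p N(2)
   by (intro continuous_intros continuous_on_powr') (auto simp: zero_less_divide_iff)
  then have "bounded (\<Phi> ` K)" by (intro compact_imp_bounded compact_continuous_image K)
  then obtain B where B: "\<And>z. z \<in> K \<Longrightarrow> \<bar>\<Phi> z\<bar> \<le> B" unfolding bounded_iff by auto
  show ?thesis
  proof (intro exI[of _ B] ballI)
   fix h z assume "h \<in> H" "z \<in> K"
   then have "norm (h z) \<le> \<Phi> z" using K(2) unfolding H_def by auto
   also have "\<Phi> z \<le> B" using B[OF \<open>z \<in> K\<close>] by simp
   finally show "norm (h z) \<le> B" .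
  qed
 qed
 have rng: "range g \<subseteq> H" unfolding H_def using g(1) gb by auto
 obtain G \<sigma> where G: "G holomorphic_on ?D" "strict_mono (\<sigma> :: nat \<Rightarrow> nat)"
  "\<And>z. z \<in> ?D \<Longrightarrow> (\<lambda>n. g (\<sigma> n) z) \<longlonglongrightarrow> G z"
  "\<And>K. \<lbrakk>compact K; K \<subseteq> ?D\<rbrakk> \<Longrightarrow> uniform_limit K (g \<circ> \<sigma>) G sequentially"
  using Montel[of ?D H g, OF _ _ bd rng] by (auto simp: H_def)
 have fG: "norm (f z) \<le> norm (G z)" if z: "z \<in> ?D" for z
 proof (rule LIMSEQ_le)
  have "isCont f (of_real 1 * z)"
   using z holomorphic_on_imp_continuous_on[OF f(1)] by (simp add: continuous_on_eq_continuous_at[OF open_ball])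
  then have "(\<lambda>n. f (of_real (\<rho> (\<sigma> n)) * z)) \<longlonglongrightarrow> f (of_real 1 * z)"
   by (rule isCont_tendsto_compose) (intro tendsto_intros LIMSEQ_subseq_LIMSEQ[OF \<rho>l G(2), unfolded o_def])
  then show "(\<lambda>n. norm (f (of_real (\<rho> (\<sigma> n)) * z))) \<longlonglongrightarrow> norm (f z)"
   by (intro tendsto_norm) simp
  show "(\<lambda>n. norm (g (\<sigma> n) z)) \<longlonglongrightarrow> norm (G z)"
   by (intro tendsto_norm G z)
 qed (use g(3) z in auto)
 have Gnz: "G z \<noteq> 0" if z: "z \<in> ?D" for z
 proof (cases "G constant_on ?D")
  case True
  then have "G z = G z0" using z z0 unfolding constant_on_def by auto
  then show ?thesis using fG[OF z0(1)] z0(2) by auto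
 next
  case False
  show ?thesis
   by (rule Hurwitz_no_zeros[of ?D "g \<circ> \<sigma>" G]) (use g G False z in auto)
 qed
 have "mean1 p G r \<le> ennreal N" if r: "0 \<le> r" "r < 1" for r
 proof -
  obtain B where B': "\<forall>h\<in>H. \<forall>z\<in>sphere 0 r. norm (h z) \<le> B"
  proof -
   have "sphere (0::complex) r \<subseteq> ball 0 1" using r by auto
   from bd[OF compact_sphere this] show thesis using that by blast
  qed
  have B: "norm (h z) \<le> B" if "h \<in> H" "norm z = r" for h z
   using B' that by simp
  have "(\<lambda>n. mean1 p (g (\<sigma> n)) r) \<longlonglongrightarrow> mean1 p G r"
   unfolding mean1_def
  proof (rule circ_mean_tendsto[OF _ _ p])
   show "(\<lambda>z. g (\<sigma> n) (of_real r * z)) \<in> borel_measurable circ" for n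
    by (rule measurable_dilate_circ[OF holomorphic_on_imp_continuous_on[OF g(1)] r])
   show "(\<lambda>z. G (of_real r * z)) \<in> borel_measurable circ"
    by (rule measurable_dilate_circ[OF holomorphic_on_imp_continuous_on[OF G(1)] r])
   show "norm (g (\<sigma> n) (of_real r * z)) \<le> B" if "norm z = 1" for n z
    by (rule B) (use rng that r in \<open>auto simp: norm_mult\<close>)
   show "(\<lambda>n. g (\<sigma> n) (of_real r * z)) \<longlonglongrightarrow> G (of_real r * z)" if "norm z = 1" for z
    by (rule G(3)) (use that r in \<open>simp add: norm_mult\<close>)
  qed
  moreover have "mean1 p (g (\<sigma> n)) r \<le> ennreal N" for n
   using mean1_le_N1[OF r] g(4) by (rule order_trans)
  ultimately show ?thesis by (intro LIMSEQ_le_const2) auto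
 qed
 then have "N1 p G \<le> N1 p f" unfolding N1_def[of p G] N by (intro SUP_least) auto
 then show ?thesis using G(1) Gnz fG by (intro exI[of _ G]) auto
qed

section \<open>The inequality and its extremals in one variable\<close>

lemma fps_conv_radius_prod_ge_1:
 assumes "\<And>j. j \<in> J \<Longrightarrow> fps_conv_radius (A j :: complex fps) \<ge> 1"
 shows "fps_conv_radius (prod A J) \<ge> 1"
 using assms
proof (induction J rule: infinite_finite_induct)
 case (insert x F)
 have "1 \<le> min (fps_conv_radius (A x)) (fps_conv_radius (prod A F))"
  using insert by simp
 also have "\<dots> \<le> fps_conv_radius (A x * prod A F)" by (rule fps_conv_radius_mult)
 finally show ?case using insert by simp
qed simp_all

lemma eval_fps_prod:
 assumes "\<And>j. j \<in> J \<Longrightarrow> fps_conv_radius (A j :: complex fps) \<ge> 1" "norm z < 1"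
 shows "eval_fps (prod A J) z = (\<Prod>j\<in>J. eval_fps (A j) z)"
 using assms(1)
proof (induction J rule: infinite_finite_induct)
 case (insert x F)
 have z: "ereal (norm z) < 1" using assms(2) by simp
 have 1: "ereal (norm z) < fps_conv_radius (A x)"
  by (rule less_le_trans[OF z insert.prems]) simp
 have 2: "ereal (norm z) < fps_conv_radius (prod A F)"
  by (rule less_le_trans[OF z fps_conv_radius_prod_ge_1]) (use insert.prems in simp)
 show ?case using insert eval_fps_mult[OF 1 2] by simp
qed simp_all

lemma half_power_fps:
 assumes g: "g holomorphic_on ball 0 1" "\<And>z. z \<in> ball 0 1 \<Longrightarrow> g z \<noteq> 0"
 shows "\<exists>A. fps_conv_radius A \<ge> 1 \<and> (\<forall>z\<in>ball 0 1. eval_fps A z \<noteq> 0) \<and>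
  (\<forall>z\<in>ball 0 1. norm (g z) powr p = (norm (eval_fps A z))\<^sup>2) \<and> N1 p g = hn 1 A"
proof -
 obtain h where h: "h holomorphic_on ball 0 1" "\<And>z. z \<in> ball 0 1 \<Longrightarrow> h z \<noteq> 0"
  "\<And>z. z \<in> ball 0 1 \<Longrightarrow> norm (g z) powr p = (norm (h z))\<^sup>2"
  using half_power[OF g, of p] by auto
 note A = ball_fps_expansion[OF h(1)]
 have "N1 p g = N1 2 h" by (rule N1_cong) (use h(3) in auto)
 also have "\<dots> = hn 1 (fps_expansion h 0)" by (rule N1_2[OF A(1)]) (rule A(2))
 finally show ?thesis
  using A h(2,3) by (intro exI[of _ "fps_expansion h 0"]) auto
qed

lemma N1_eq_0_imp:
 assumes f: "f holomorphic_on ball 0 1" and p: "p > 0" and "N1 p f = 0" and z: "z \<in> ball 0 1"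
 shows "f z = 0"
proof (rule ccontr)
 assume "f z \<noteq> 0"
 then obtain g where g: "g holomorphic_on ball 0 1" "\<And>z. z \<in> ball 0 1 \<Longrightarrow> g z \<noteq> 0" "N1 p g \<le> N1 p f"
  using riesz_majorant[OF f bexI[OF _ z] p] assms(3) by auto
 from half_power_fps[OF g(1,2), of p] obtain A where A: "\<forall>z\<in>ball 0 1. eval_fps A z \<noteq> 0" "N1 p g = hn 1 A"
  by auto
 have "hn 1 A = 0" using g(3) A(2) assms(3) by simp
 then have "A = 0" using hn_eq_0_iff[of 1 A] by simp
 then show False using A(1) by (metis centre_in_ball eval_fps_0 zero_less_one)
qed

lemma zero_free_product:
 fixes A :: "nat \<Rightarrow> complex fps" and g :: "nat \<Rightarrow> complex \<Rightarrow> complex"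
 assumes m: "m \<ge> 2" and A: "\<And>j. j \<in> {1..m} \<Longrightarrow> fps_conv_radius (A j) \<ge> 1"
  and g: "\<And>j z. j \<in> {1..m} \<Longrightarrow> z \<in> ball 0 1 \<Longrightarrow> norm (g j z) powr p j = (norm (eval_fps (A j) z))\<^sup>2"
 shows "(\<integral>\<^sup>+z. ennreal (\<Prod>j=1..m. norm (g j z) powr p j) \<partial>berg (m - 2)) = hn m (\<Prod>j=1..m. A j)"
proof -
 have "(\<integral>\<^sup>+z. ennreal (\<Prod>j=1..m. norm (g j z) powr p j) \<partial>berg (m - 2)) =
  (\<integral>\<^sup>+z. ennreal ((norm (eval_fps (\<Prod>j=1..m. A j) z))\<^sup>2) \<partial>berg (m - 2))"
 proof (rule nn_integral_cong)
  fix z assume "z \<in> space (berg (m - 2))"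
  then have z: "z \<in> ball 0 1" by simp
  have "(\<Prod>j=1..m. norm (g j z) powr p j) = (\<Prod>j=1..m. (norm (eval_fps (A j) z))\<^sup>2)"
   by (rule prod.cong[OF refl]) (rule g[OF _ z])
  also have "\<dots> = (norm (\<Prod>j=1..m. eval_fps (A j) z))\<^sup>2"
   by (simp only: prod_norm[symmetric] prod_power_distrib)
  also have "(\<Prod>j=1..m. eval_fps (A j) z) = eval_fps (\<Prod>j=1..m. A j) z"
   by (rule eval_fps_prod[symmetric]) (use A z in auto)
  finally show "ennreal (\<Prod>j=1..m. norm (g j z) powr p j) = ennreal ((norm (eval_fps (\<Prod>j=1..m. A j) z))\<^sup>2)"
   by simp
 qed
 also have "\<dots> = hn (m - 2 + 2) (\<Prod>j=1..m. A j)"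
  by (rule parseval_berg[OF fps_conv_radius_prod_ge_1]) (rule A)
 also have "m - 2 + 2 = m" using m by simp
 finally show ?thesis .
qed

text \<open>The square roots of the zero-free majorants: everything about the given functions that the
coefficient inequality can see.\<close>

lemma burbea_disc_aux:
 fixes f :: "nat \<Rightarrow> complex \<Rightarrow> complex"
 assumes m: "m \<ge> 2" and p': "\<forall>j\<in>{1..m}. p j > 0"
  and f': "\<forall>j\<in>{1..m}. f j holomorphic_on ball 0 1"
  and nz': "\<forall>j\<in>{1..m}. \<exists>z\<in>ball 0 1. f j z \<noteq> 0"
  and fin': "\<forall>j\<in>{1..m}. N1 (p j) (f j) < \<infinity>"
 shows "\<exists>A. (\<forall>j\<in>{1..m}. fps_conv_radius (A j) \<ge> 1 \<and> (\<forall>z\<in>ball 0 1. eval_fps (A j) z \<noteq> 0) \<and>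
   (\<forall>z\<in>ball 0 1. norm (f j z) powr p j \<le> (norm (eval_fps (A j) z))\<^sup>2) \<and> hn 1 (A j) \<le> N1 (p j) (f j)) \<and>
  (\<integral>\<^sup>+z. ennreal (\<Prod>j=1..m. (norm (eval_fps (A j) z))\<^sup>2) \<partial>berg (m - 2)) = hn m (\<Prod>j=1..m. A j)"
proof -
 note p = p'[rule_format] and f = f'[rule_format] and nz = nz'[rule_format] and fin = fin'[rule_format]
 have "\<exists>A. fps_conv_radius A \<ge> 1 \<and> (\<forall>z\<in>ball 0 1. eval_fps A z \<noteq> 0) \<and>
  (\<forall>z\<in>ball 0 1. norm (f j z) powr p j \<le> (norm (eval_fps A z))\<^sup>2) \<and> hn 1 A \<le> N1 (p j) (f j)" if j: "j \<in> {1..m}" for j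
 proof -
  obtain g where g: "g holomorphic_on ball 0 1" "\<And>z. z \<in> ball 0 1 \<Longrightarrow> g z \<noteq> 0"
   "\<And>z. z \<in> ball 0 1 \<Longrightarrow> norm (f j z) \<le> norm (g z)" "N1 (p j) g \<le> N1 (p j) (f j)"
   using riesz_majorant[OF f[OF j] nz[OF j] p[OF j] fin[OF j]] by auto
  obtain A where A: "fps_conv_radius A \<ge> 1" "\<forall>z\<in>ball 0 1. eval_fps A z \<noteq> 0"
   "\<forall>z\<in>ball 0 1. norm (g z) powr p j = (norm (eval_fps A z))\<^sup>2" "N1 (p j) g = hn 1 A"
   using half_power_fps[OF g(1,2), of "p j"] by auto
  have "norm (f j z) powr p j \<le> (norm (eval_fps A z))\<^sup>2" if z: "z \<in> ball 0 1" for z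
  proof -
   have "norm (f j z) powr p j \<le> norm (g z) powr p j"
    by (rule powr_mono2) (use p[OF j] g(3)[OF z] in auto)
   then show ?thesis using A(3) z by simp
  qed
  then show ?thesis using A g(4) by (intro exI[of _ A]) auto
 qed
 then obtain A where A: "\<And>j. j \<in> {1..m} \<Longrightarrow> fps_conv_radius (A j) \<ge> 1 \<and> (\<forall>z\<in>ball 0 1. eval_fps (A j) z \<noteq> 0) \<and>
  (\<forall>z\<in>ball 0 1. norm (f j z) powr p j \<le> (norm (eval_fps (A j) z))\<^sup>2) \<and> hn 1 (A j) \<le> N1 (p j) (f j)"
  by metis
 have "(\<integral>\<^sup>+z. ennreal (\<Prod>j=1..m. (norm (eval_fps (A j) z)) powr 2) \<partial>berg (m - 2)) = hn m (\<Prod>j=1..m. A j)"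
  by (rule zero_free_product[OF m]) (use A in auto)
 then have "(\<integral>\<^sup>+z. ennreal (\<Prod>j=1..m. (norm (eval_fps (A j) z))\<^sup>2) \<partial>berg (m - 2)) = hn m (\<Prod>j=1..m. A j)"
  by simp
 then show ?thesis using A by (intro exI[of _ A]) blast
qed

theorem burbea_disc_le:
 fixes f :: "nat \<Rightarrow> complex \<Rightarrow> complex"
 assumes m: "m \<ge> 2" and p: "\<And>j. j \<in> {1..m} \<Longrightarrow> p j > 0"
  and f: "\<And>j. j \<in> {1..m} \<Longrightarrow> f j holomorphic_on ball 0 1"
 shows "(\<integral>\<^sup>+z. ennreal (\<Prod>j=1..m. norm (f j z) powr p j) \<partial>berg (m - 2)) \<le> (\<Prod>j=1..m. N1 (p j) (f j))"
proof -
 consider (zero) j where "j \<in> {1..m}" "\<forall>z\<in>ball 0 1. f j z = 0"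
  | (inf) j where "j \<in> {1..m}" "\<forall>j\<in>{1..m}. N1 (p j) (f j) \<noteq> 0" "N1 (p j) (f j) = \<infinity>"
  | (fin) "\<forall>j\<in>{1..m}. \<exists>z\<in>ball 0 1. f j z \<noteq> 0" "\<forall>j\<in>{1..m}. N1 (p j) (f j) < \<infinity>"
 proof (cases "\<exists>j\<in>{1..m}. \<forall>z\<in>ball 0 1. f j z = 0")
  case False
  have n0: "\<forall>j\<in>{1..m}. N1 (p j) (f j) \<noteq> 0"
  proof
   fix j assume j: "j \<in> {1..m}"
   show "N1 (p j) (f j) \<noteq> 0" using N1_eq_0_imp[OF f[OF j] p[OF j]] False j by blast
  qed
  show thesis
  proof (cases "\<exists>j\<in>{1..m}. N1 (p j) (f j) = \<infinity>")
   case True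
   then show thesis using inf n0 by blast
  next
   case F2: False
   show thesis by (rule fin) (use False F2 in \<open>auto simp: less_top\<close>)
  qed
 qed (use zero in blast)
 then show ?thesis
 proof cases
  case zero
  have "(\<integral>\<^sup>+z. ennreal (\<Prod>j=1..m. norm (f j z) powr p j) \<partial>berg (m - 2)) = (\<integral>\<^sup>+z. 0 \<partial>berg (m - 2))"
  proof (rule nn_integral_cong)
   fix z assume "z \<in> space (berg (m - 2))"
   then have "norm (f j z) powr p j = 0" using zero by simp
   then have "(\<Prod>j=1..m. norm (f j z) powr p j) = 0" using zero(1) by (intro prod_zero) auto
   then show "ennreal (\<Prod>j=1..m. norm (f j z) powr p j) = 0" by (simp only: ennreal_0)
  qed
  then show ?thesis by simp
 next
  case inf
  then have "(\<Prod>j=1..m. N1 (p j) (f j)) = \<infinity>"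
   by (auto simp: ennreal_prod_eq_top)
  then show ?thesis by simp
 next
  case fin
  obtain A where A: "\<And>j. j \<in> {1..m} \<Longrightarrow> fps_conv_radius (A j) \<ge> 1"
   "\<And>j z. j \<in> {1..m} \<Longrightarrow> z \<in> ball 0 1 \<Longrightarrow> eval_fps (A j) z \<noteq> 0"
   "\<And>j z. j \<in> {1..m} \<Longrightarrow> z \<in> ball 0 1 \<Longrightarrow> norm (f j z) powr p j \<le> (norm (eval_fps (A j) z))\<^sup>2"
   "\<And>j. j \<in> {1..m} \<Longrightarrow> hn 1 (A j) \<le> N1 (p j) (f j)"
   "(\<integral>\<^sup>+z. ennreal (\<Prod>j=1..m. (norm (eval_fps (A j) z))\<^sup>2) \<partial>berg (m - 2)) = hn m (\<Prod>j=1..m. A j)"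
  proof -
   have "\<forall>j\<in>{1..m}. p j > 0" "\<forall>j\<in>{1..m}. f j holomorphic_on ball 0 1" using p f by blast+
   from burbea_disc_aux[OF m this fin]
   show thesis by (elim exE conjE) (rule that, blast+)
  qed
  have "(\<integral>\<^sup>+z. ennreal (\<Prod>j=1..m. norm (f j z) powr p j) \<partial>berg (m - 2))
   \<le> (\<integral>\<^sup>+z. ennreal (\<Prod>j=1..m. (norm (eval_fps (A j) z))\<^sup>2) \<partial>berg (m - 2))"
   by (intro nn_integral_mono ennreal_leI prod_mono) (use A(3) in auto)
  also have "\<dots> = hn m (\<Prod>j=1..m. A j)" by (rule A(5))
  also have "\<dots> \<le> (\<Prod>j=1..m. hn 1 (A j))"
  proof (rule hn_prod_le)
   show "hn 1 (A j) < \<infinity>" if "j \<in> {1..m}" for j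
    by (rule le_less_trans[OF A(4)[OF that]]) (use fin(2) that in blast)
  qed (use m in simp)
  also have "\<dots> \<le> (\<Prod>j=1..m. N1 (p j) (f j))" by (intro prod_mono_ennreal A(4))
  finally show ?thesis .
 qed
qed

lemma norm_powr_of_real: "w \<noteq> 0 \<Longrightarrow> norm (w powr of_real s) = norm (w :: complex) powr s"
 by (simp add: powr_def)

text \<open>Otherwise the open mapping theorem would place an open set in the image.\<close>

lemma constant_modulus_imp_constant:
 assumes "f holomorphic_on ball 0 1" "\<And>z. z \<in> ball 0 1 \<Longrightarrow> norm (f z) = c"
 shows "\<exists>C. \<forall>z\<in>ball 0 1. f z = C"
proof -
 have "f constant_on ball 0 1"
  by (rule maximum_modulus_principle[OF assms(1), where U="ball 0 1" and \<xi>=0]) (use assms(2) in auto)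
 then show ?thesis unfolding constant_on_def by auto
qed

lemma eval_fps_geometric:
 assumes "\<And>k. fps_nth A k = a * (b :: complex) ^ k" "norm b \<le> 1" "norm z < 1"
 shows "eval_fps A z = a / (1 - b * z)"
proof -
 have "norm (b * z) < 1"
  using mult_right_mono[OF assms(2) norm_ge_zero[of z]] assms(3) by (simp add: norm_mult)
 then have "(\<lambda>k. a * (b * z) ^ k) sums (a * (1 / (1 - b * z)))"
  by (intro sums_mult geometric_sums)
 moreover have "(\<lambda>k. fps_nth A k * z ^ k) = (\<lambda>k. a * (b * z) ^ k)"
  by (rule ext) (simp add: assms(1) power_mult_distrib)
 ultimately show ?thesis unfolding eval_fps_def by (simp add: sums_iff)
qed

lemma hn_1_geometric:
 assumes "\<And>k. fps_nth A k = a * (b :: complex) ^ k"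
 shows "hn 1 A = (\<Sum>k. ennreal ((norm a)\<^sup>2) * ennreal (((norm b)\<^sup>2) ^ k))"
proof -
 have "(norm (fps_nth A k))\<^sup>2 / real (k + 1 - 1 choose k) = (norm a)\<^sup>2 * ((norm b)\<^sup>2) ^ k" for k
  unfolding assms[of k] by (simp add: norm_mult norm_power power_mult_distrib flip: power_mult) (simp add: mult.commute)
 then show ?thesis unfolding hn_def by (simp add: ennreal_mult')
qed

lemma hn_1_geometric_finite:
 assumes "\<And>k. fps_nth A k = a * (b :: complex) ^ k" "a \<noteq> 0"
 shows "hn 1 A < \<infinity> \<longleftrightarrow> norm b < 1"
proof -
 have "hn 1 A = (\<Sum>k. ennreal ((norm a)\<^sup>2 * ((norm b)\<^sup>2) ^ k))"
  unfolding hn_1_geometric[OF assms(1)] by (simp add: ennreal_mult')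
 also have "\<dots> < \<infinity> \<longleftrightarrow> summable (\<lambda>k. (norm a)\<^sup>2 * ((norm b)\<^sup>2) ^ k)"
 proof
  assume "(\<Sum>k. ennreal ((norm a)\<^sup>2 * ((norm b)\<^sup>2) ^ k)) < \<infinity>"
  then show "summable (\<lambda>k. (norm a)\<^sup>2 * ((norm b)\<^sup>2) ^ k)"
   by (intro summable_suminf_not_top) (auto simp: less_top)
 next
  assume "summable (\<lambda>k. (norm a)\<^sup>2 * ((norm b)\<^sup>2) ^ k)"
  then show "(\<Sum>k. ennreal ((norm a)\<^sup>2 * ((norm b)\<^sup>2) ^ k)) < \<infinity>"
   by (subst suminf_ennreal2) auto
 qed
 also have "\<dots> \<longleftrightarrow> norm b < 1"
  using assms(2) by (simp add: summable_cmult_iff summable_geometric_iff power_less_one_iff abs_square_less_1)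
 finally show ?thesis .
qed

lemma emeasure_berg_open_pos:
 assumes U: "open U" "U \<subseteq> ball 0 1" "U \<noteq> {}"
 shows "emeasure (berg q) U > 0"
proof (rule ccontr)
 assume "\<not> emeasure (berg q) U > 0"
 then have z: "emeasure (berg q) U = 0" by (simp add: not_less)
 have Um: "U \<in> sets (berg q)" using U by (auto simp: sets_berg sets_restrict_space)
 define D where "D = (\<lambda>z::complex. ennreal ((real q + 1) / pi * (1 - (norm z)\<^sup>2) ^ q))"
 have "emeasure (berg q) U = (\<integral>\<^sup>+z. indicator U z \<partial>berg q)" using Um by simp
 also have "\<dots> = (\<integral>\<^sup>+z. D z * indicator U z * indicator (ball 0 1) z \<partial>lborel)"
  unfolding D_def by (rule nn_integral_berg) (use Um in simp)
 finally have "(\<integral>\<^sup>+z. D z * indicator U z * indicator (ball 0 1) z \<partial>lborel) = 0" using z by simp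
 moreover have "(\<lambda>z. D z * indicator U z * indicator (ball 0 1) z) \<in> borel_measurable lborel"
 proof -
  have "D \<in> borel_measurable lborel" unfolding D_def by measurable
  then show ?thesis using U(1) by (intro borel_measurable_times_ennreal borel_measurable_indicator) auto
 qed
 ultimately have "AE z in lborel. D z * indicator U z * indicator (ball 0 1) z = 0"
  by (subst (asm) nn_integral_0_iff_AE) auto
 then have "AE z in lborel. z \<notin> U"
 proof eventually_elim
  case (elim z)
  show ?case
  proof
   assume zU: "z \<in> U"
   then have "(norm z)\<^sup>2 < 1" using U(2) by (auto simp: abs_square_less_1)
   then have "0 < (real q + 1) / pi * (1 - (norm z)\<^sup>2) ^ q" by (intro mult_pos_pos divide_pos_pos zero_less_power) auto
   then have "D z > 0" by (simp add: D_def)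
   then show False using elim zU U(2) by (auto simp: indicator_def split: if_splits)
  qed
 qed
 then have "U \<in> null_sets lborel" using U(1) by (subst (asm) AE_iff_null_sets[symmetric]) auto
 then have "U = {}" using U(1) by (metis null_sets_completionI open_not_negligible negligible_iff_null_sets)
 then show False using U(3) by simp
qed

text \<open>Equality forces equality for the coefficients of the majorants, so these are geometric, and it
forces the functions to have the same modulus as their majorants everywhere. Multiplying by the
inverse kernel gives a function of constant modulus.\<close>

theorem burbea_disc_eq:
 fixes f :: "nat \<Rightarrow> complex \<Rightarrow> complex"
 assumes m: "m \<ge> 2" and p: "\<And>j. j \<in> {1..m} \<Longrightarrow> p j > 0"
  and f: "\<And>j. j \<in> {1..m} \<Longrightarrow> f j holomorphic_on ball 0 1"
  and nz: "\<And>j. j \<in> {1..m} \<Longrightarrow> \<exists>z\<in>ball 0 1. f j z \<noteq> 0"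
  and fin: "\<And>j. j \<in> {1..m} \<Longrightarrow> N1 (p j) (f j) < \<infinity>"
  and eq: "(\<integral>\<^sup>+z. ennreal (\<Prod>j=1..m. norm (f j z) powr p j) \<partial>berg (m - 2)) = (\<Prod>j=1..m. N1 (p j) (f j))"
 shows "\<exists>b. norm b < 1 \<and> (\<forall>j\<in>{1..m}. \<exists>C. \<forall>z\<in>ball 0 1. f j z = C * (1 - b * z) powr (- of_real (2 / p j)))"
proof -
 obtain A where A: "\<And>j. j \<in> {1..m} \<Longrightarrow> fps_conv_radius (A j) \<ge> 1"
  "\<And>j z. j \<in> {1..m} \<Longrightarrow> z \<in> ball 0 1 \<Longrightarrow> eval_fps (A j) z \<noteq> 0"
  "\<And>j z. j \<in> {1..m} \<Longrightarrow> z \<in> ball 0 1 \<Longrightarrow> norm (f j z) powr p j \<le> (norm (eval_fps (A j) z))\<^sup>2"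
  "\<And>j. j \<in> {1..m} \<Longrightarrow> hn 1 (A j) \<le> N1 (p j) (f j)"
  "(\<integral>\<^sup>+z. ennreal (\<Prod>j=1..m. (norm (eval_fps (A j) z))\<^sup>2) \<partial>berg (m - 2)) = hn m (\<Prod>j=1..m. A j)"
 proof -
  have "\<forall>j\<in>{1..m}. p j > 0" "\<forall>j\<in>{1..m}. f j holomorphic_on ball 0 1"
   "\<forall>j\<in>{1..m}. \<exists>z\<in>ball 0 1. f j z \<noteq> 0" "\<forall>j\<in>{1..m}. N1 (p j) (f j) < \<infinity>"
   using p f nz fin by blast+
  from burbea_disc_aux[OF m this]
  show thesis by (elim exE conjE) (rule that, blast+)
 qed
 have hfin: "hn 1 (A j) < \<infinity>" if "j \<in> {1..m}" for j using A(4)[OF that] fin[OF that] by (rule le_less_trans)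
 define u where "u = (\<lambda>z. \<Prod>j=1..m. norm (f j z) powr p j)"
 define v where "v = (\<lambda>z. \<Prod>j=1..m. (norm (eval_fps (A j) z))\<^sup>2)"
 have uv: "u z \<le> v z" if "z \<in> ball 0 1" for z unfolding u_def v_def
  by (intro prod_mono) (use A(3) that in auto)
 have i1: "(\<integral>\<^sup>+z. ennreal (u z) \<partial>berg (m - 2)) \<le> (\<integral>\<^sup>+z. ennreal (v z) \<partial>berg (m - 2))"
  by (intro nn_integral_mono ennreal_leI uv) simp
 have i2: "hn m (\<Prod>j=1..m. A j) \<le> (\<Prod>j=1..m. hn 1 (A j))" by (rule hn_prod_le) (use m hfin in auto)
 have i3: "(\<Prod>j=1..m. hn 1 (A j)) \<le> (\<Prod>j=1..m. N1 (p j) (f j))" by (intro prod_mono_ennreal A(4))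
 have iv: "(\<integral>\<^sup>+z. ennreal (v z) \<partial>berg (m - 2)) = hn m (\<Prod>j=1..m. A j)" unfolding v_def by (rule A(5))
 have iu: "(\<integral>\<^sup>+z. ennreal (u z) \<partial>berg (m - 2)) = (\<Prod>j=1..m. N1 (p j) (f j))" unfolding u_def by (rule eq)
 have e1: "hn m (\<Prod>j=1..m. A j) = (\<Prod>j=1..m. hn 1 (A j))" using i1 i2 i3 iv iu by (metis antisym order_trans)
 have e2: "(\<integral>\<^sup>+z. ennreal (u z) \<partial>berg (m - 2)) = (\<integral>\<^sup>+z. ennreal (v z) \<partial>berg (m - 2))"
  using i1 i2 i3 iv iu by (metis antisym order_trans)
 have A0: "fps_nth (A j) 0 \<noteq> 0" if "j \<in> {1..m}" for j
  using A(2)[OF that, of 0] by (simp add: eval_fps_at_0)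
 obtain b where b: "\<And>j k. j \<in> {1..m} \<Longrightarrow> fps_nth (A j) k = fps_nth (A j) 0 * b ^ k"
  using hn_prod_eq_geometric[OF m hfin A0 e1] by metis
 have m1: "1 \<in> {1..m}" using m by simp
 have b1: "norm b < 1" using hn_1_geometric_finite[OF b[OF m1] A0[OF m1]] hfin[OF m1] by simp
 have hA: "eval_fps (A j) z = fps_nth (A j) 0 / (1 - b * z)" if "j \<in> {1..m}" "z \<in> ball 0 1" for j z
  by (rule eval_fps_geometric[OF b[OF that(1)]]) (use b1 that in auto)
  have cu: "continuous_on (ball 0 1) u" unfolding u_def
  using p by (intro continuous_intros continuous_on_powr' holomorphic_on_imp_continuous_on f) (auto simp: less_imp_neq)
 have nz1: "1 - b * z \<noteq> 0" if "z \<in> ball 0 1" for z by (rule one_minus_mult_nz) (use b1 that in auto)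
 have cv: "continuous_on (ball 0 1) v"
 proof -
  have "continuous_on (ball 0 1) (\<lambda>z. \<Prod>j=1..m. (norm (fps_nth (A j) 0 / (1 - b * z)))\<^sup>2)"
   by (intro continuous_intros) (use nz1 in auto)
  then show ?thesis
   by (rule continuous_on_eq) (auto simp: v_def hA intro!: prod.cong)
 qed
 \<comment> \<open>Continuous functions with equal integrals, one of which dominates the other, agree everywhere.\<close>
 have uv_eq: "u z = v z" if z: "z \<in> ball 0 1" for z
 proof (rule ccontr)
  assume ne: "u z \<noteq> v z"
  define w where "w = (\<lambda>z. v z - u z)"
  have cw: "continuous_on (ball 0 1) w" unfolding w_def by (intro continuous_intros cu cv)
  have m_u: "(\<lambda>z. ennreal (u z)) \<in> borel_measurable (berg (m - 2))"
   and m_w: "(\<lambda>z. ennreal (w z)) \<in> borel_measurable (berg (m - 2))"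
   unfolding measurable_cong_sets[OF sets_berg refl]
   using borel_measurable_continuous_on_restrict[OF cu] borel_measurable_continuous_on_restrict[OF cw] by measurable
  have w0: "0 \<le> w z" "0 \<le> u z" if "z \<in> ball 0 1" for z using uv[OF that] by (auto simp: w_def u_def intro!: prod_nonneg)
  have "(\<integral>\<^sup>+z. ennreal (v z) \<partial>berg (m - 2)) = (\<integral>\<^sup>+z. ennreal (u z) + ennreal (w z) \<partial>berg (m - 2))"
   by (rule nn_integral_cong) (use w0 in \<open>auto simp: w_def simp flip: ennreal_plus\<close>)
  also have "\<dots> = (\<integral>\<^sup>+z. ennreal (u z) \<partial>berg (m - 2)) + (\<integral>\<^sup>+z. ennreal (w z) \<partial>berg (m - 2))"
   by (rule nn_integral_add[OF m_u m_w])
  finally have s: "(\<integral>\<^sup>+z. ennreal (u z) \<partial>berg (m - 2)) = (\<integral>\<^sup>+z. ennreal (u z) \<partial>berg (m - 2)) + (\<integral>\<^sup>+z. ennreal (w z) \<partial>berg (m - 2))"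
   unfolding e2 .
  have "(\<integral>\<^sup>+z. ennreal (u z) \<partial>berg (m - 2)) < \<infinity>"
   unfolding iu using fin by (simp add: ennreal_prod_eq_top less_top[symmetric])
  then have "(\<integral>\<^sup>+z. ennreal (w z) \<partial>berg (m - 2)) = 0"
   using s by (metis add.right_neutral ennreal_add_left_cancel infinity_ennreal_def less_irrefl)
  then have ae: "AE z in berg (m - 2). ennreal (w z) = 0" using m_w by (simp add: nn_integral_0_iff_AE)
  have "w z > 0" using ne w0[OF z] by (auto simp: w_def)
  then obtain d where d: "d > 0" "\<And>y. y \<in> ball 0 1 \<Longrightarrow> dist y z < d \<Longrightarrow> dist (w y) (w z) < w z"
   using cw z unfolding continuous_on_iff by metis
  define U where "U = ball z d \<inter> ball 0 1"
  have U: "open U" "z \<in> U" "U \<subseteq> ball 0 1" using d(1) z by (auto simp: U_def)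
  have wU: "w y > 0" if "y \<in> U" for y
   using d(2)[of y] that by (auto simp: U_def dist_commute dist_real_def abs_if split: if_splits)
  have "AE y in berg (m - 2). y \<notin> U"
   using ae by eventually_elim (metis wU ennreal_eq_zero_iff less_irrefl less_imp_le)
  moreover have "U \<in> sets (berg (m - 2))" using U by (auto simp: sets_berg sets_restrict_space)
  ultimately have "U \<in> null_sets (berg (m - 2))" by (simp only: AE_iff_null_sets)
  then have "emeasure (berg (m - 2)) U = 0" by (rule null_setsD1)
  moreover have "emeasure (berg (m - 2)) U > 0" by (rule emeasure_berg_open_pos) (use U in auto)
  ultimately show False by simp
 qed
 have fe: "norm (f j z) powr p j = (norm (eval_fps (A j) z))\<^sup>2" if j: "j \<in> {1..m}" and z: "z \<in> ball 0 1" for j z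
 proof (rule ccontr)
  assume "norm (f j z) powr p j \<noteq> (norm (eval_fps (A j) z))\<^sup>2"
  then have lt: "norm (f j z) powr p j < (norm (eval_fps (A j) z))\<^sup>2" using A(3)[OF j z] by simp
  have "norm (f j z) powr p j * (\<Prod>i\<in>{1..m}-{j}. norm (f i z) powr p i)
   \<le> norm (f j z) powr p j * (\<Prod>i\<in>{1..m}-{j}. (norm (eval_fps (A i) z))\<^sup>2)"
   by (intro mult_left_mono prod_mono) (use A(3) z in auto)
  also have "\<dots> < (norm (eval_fps (A j) z))\<^sup>2 * (\<Prod>i\<in>{1..m}-{j}. (norm (eval_fps (A i) z))\<^sup>2)"
   by (rule mult_strict_right_mono[OF lt], rule prod_pos) (use A(2) z in auto)
  finally have "norm (f j z) powr p j * (\<Prod>i\<in>{1..m}-{j}. norm (f i z) powr p i) < \<dots>" .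
  then have "u z < v z" unfolding u_def v_def using j by (simp add: prod.remove[of _ j])
  then show False using uv_eq[OF z] by simp
 qed
 have "\<exists>C. \<forall>z\<in>ball 0 1. f j z = C * (1 - b * z) powr (- of_real (2 / p j))" if j: "j \<in> {1..m}" for j
 proof -
  define Q where "Q = (\<lambda>z. f j z * (1 - b * z) powr of_real (2 / p j))"
  have re: "Re (1 - b * z) > 0" if "z \<in> ball 0 1" for z
  proof -
   have "norm (b * z) < 1 * 1" unfolding norm_mult by (rule mult_strict_mono') (use b1 that in auto)
   then show ?thesis using complex_Re_le_cmod[of "b * z"] by simp
  qed
  have "Q holomorphic_on ball 0 1" unfolding Q_def
   by (intro holomorphic_intros f[OF j]) (use re in \<open>auto simp: complex_nonpos_Reals_iff less_le_not_le\<close>)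
  moreover have "norm (Q z) = ((norm (fps_nth (A j) 0))\<^sup>2) powr (1 / p j)" if z: "z \<in> ball 0 1" for z
  proof -
   have n0: "norm (1 - b * z) > 0" using nz1[OF z] by simp
   have "norm (f j z) = (norm (f j z) powr p j) powr (1 / p j)"
    using p[OF j] by (simp add: powr_powr)
   also have "\<dots> = ((norm (fps_nth (A j) 0))\<^sup>2 / (norm (1 - b * z))\<^sup>2) powr (1 / p j)"
    unfolding fe[OF j z] hA[OF j z] by (simp add: norm_divide power_divide)
   also have "\<dots> = ((norm (fps_nth (A j) 0))\<^sup>2) powr (1 / p j) / ((norm (1 - b * z))\<^sup>2) powr (1 / p j)"
    by (rule powr_divide)
   also have "((norm (1 - b * z))\<^sup>2) powr (1 / p j) = norm (1 - b * z) powr (2 / p j)"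
    using n0 by (simp add: powr_powr flip: powr_numeral)
   finally show ?thesis unfolding Q_def norm_mult norm_powr_of_real[OF nz1[OF z]] using n0 by simp
  qed
  ultimately obtain C where C: "\<forall>z\<in>ball 0 1. Q z = C" using constant_modulus_imp_constant by blast
  have "f j z = C * (1 - b * z) powr (- of_real (2 / p j))" if z: "z \<in> ball 0 1" for z
   using C z nz1[OF z] by (auto simp: Q_def powr_minus field_simps)
  then show ?thesis by blast
 qed
 then show ?thesis using b1 by blast
qed

lemma kernel_power_norm:
 fixes b z C :: complex
 assumes "norm b < 1" "norm z < 1" "p > 0"
 shows "norm (C * (1 - b * z) powr (- of_real (2 / p))) powr p = norm C powr p / (norm (1 - b * z))\<^sup>2"
proof -
 have nz: "1 - b * z \<noteq> 0" by (rule one_minus_mult_nz) (use assms in auto)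
 have "norm (C * (1 - b * z) powr (- of_real (2 / p))) = norm C * norm (1 - b * z) powr (- (2 / p))"
  using norm_powr_of_real[OF nz, of "- (2 / p)"] by (simp add: norm_mult)
 also have "\<dots> powr p = norm C powr p * (norm (1 - b * z) powr (- (2 / p))) powr p"
  by (rule powr_mult)
 also have "(norm (1 - b * z) powr (- (2 / p))) powr p = norm (1 - b * z) powr (- 2)"
  using assms by (simp add: powr_powr)
 also have "\<dots> = 1 / (norm (1 - b * z))\<^sup>2" using nz by (simp add: powr_minus divide_inverse)
 finally show ?thesis by simp
qed

lemma kernel_power_fps:
 fixes b C :: complex
 assumes "norm b < 1" "p > 0"
 defines "A \<equiv> Abs_fps (\<lambda>k. of_real (sqrt (norm C powr p)) * (b::complex) ^ k)"
 shows "fps_conv_radius A \<ge> 1"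
  "z \<in> ball 0 1 \<Longrightarrow> norm (C * (1 - b * z) powr (- of_real (2 / p))) powr p = (norm (eval_fps A z))\<^sup>2"
  "N1 p (\<lambda>z. C * (1 - b * z) powr (- of_real (2 / p))) = hn 1 A"
proof -
 have A: "fps_nth A k = of_real (sqrt (norm C powr p)) * b ^ k" for k by (simp add: A_def)
 show r: "fps_conv_radius A \<ge> 1"
  unfolding fps_conv_radius_def
 proof (rule conv_radius_geI_ex)
  fix r :: real assume r: "0 < r" "ereal r < 1"
  have "norm (b * of_real r) < 1 * 1" unfolding norm_mult by (rule mult_strict_mono') (use assms r in auto)
  then have "summable (\<lambda>k. of_real (sqrt (norm C powr p)) * (b * of_real r) ^ k)"
   by (intro summable_mult summable_geometric) simp
  then show "\<exists>z. norm z = r \<and> summable (\<lambda>n. fps_nth A n * z ^ n)"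
   using r by (intro exI[of _ "of_real r"]) (auto simp: A power_mult_distrib mult.assoc)
 qed
 show 2: "norm (C * (1 - b * z) powr (- of_real (2 / p))) powr p = (norm (eval_fps A z))\<^sup>2" if z: "z \<in> ball 0 1" for z
 proof -
  have z': "norm z < 1" using z by simp
  have "eval_fps A z = of_real (sqrt (norm C powr p)) / (1 - b * z)"
   by (rule eval_fps_geometric[OF A]) (use assms z' in auto)
  then show ?thesis
   unfolding kernel_power_norm[OF assms(1) z' assms(2)] by (simp add: norm_divide power_divide)
 qed
 have "N1 p (\<lambda>z. C * (1 - b * z) powr (- of_real (2 / p))) = N1 2 (eval_fps A)"
  by (rule N1_cong) (use 2 in auto)
 also have "\<dots> = hn 1 A" by (rule N1_2[OF r]) simp
 finally show "N1 p (\<lambda>z. C * (1 - b * z) powr (- of_real (2 / p))) = hn 1 A" .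
qed

text \<open>The kernel functions have geometric coefficients, for which each step of the coefficient
inequality is sharp.\<close>

lemma burbea_disc_kernel:
 fixes b :: complex and C :: "nat \<Rightarrow> complex"
 assumes m: "m \<ge> 2" and p: "\<And>j. j \<in> {1..m} \<Longrightarrow> p j > 0" and b: "norm b < 1"
 shows "(\<integral>\<^sup>+z. ennreal (\<Prod>j=1..m. norm (C j * (1 - b * z) powr (- of_real (2 / p j))) powr p j) \<partial>berg (m - 2))
  = (\<Prod>j=1..m. N1 (p j) (\<lambda>z. C j * (1 - b * z) powr (- of_real (2 / p j))))"
proof -
 define A where "A = (\<lambda>j. Abs_fps (\<lambda>k. of_real (sqrt (norm (C j) powr p j)) * b ^ k))"
 have K1: "fps_conv_radius (A j) \<ge> 1" if "j \<in> {1..m}" for j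
  unfolding A_def by (rule kernel_power_fps(1)[OF b p[OF that]])
 have K2: "norm (C j * (1 - b * z) powr (- of_real (2 / p j))) powr p j = (norm (eval_fps (A j) z))\<^sup>2"
  if "j \<in> {1..m}" "z \<in> ball 0 1" for j z
  unfolding A_def by (rule kernel_power_fps(2)[OF b p[OF that(1)] that(2)])
 have K3: "N1 (p j) (\<lambda>z. C j * (1 - b * z) powr (- of_real (2 / p j))) = hn 1 (A j)" if "j \<in> {1..m}" for j
  unfolding A_def by (rule kernel_power_fps(3)[OF b p[OF that]])
 have fin: "hn 1 (A j) < \<infinity>" if "j \<in> {1..m}" for j
 proof (cases "C j = 0")
  case True
  then have "A j = 0" using p[OF that] by (simp add: A_def fps_eq_iff)
  then have "hn 1 (A j) = 0" using hn_eq_0_iff[of 1 "A j"] by simp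
  then show ?thesis by simp
 next
  case False
  then show ?thesis
   using hn_1_geometric_finite[of "A j" "of_real (sqrt (norm (C j) powr p j))" b] b by (simp add: A_def)
 qed
 have "(\<integral>\<^sup>+z. ennreal (\<Prod>j=1..m. norm (C j * (1 - b * z) powr (- of_real (2 / p j))) powr p j) \<partial>berg (m - 2))
  = hn m (\<Prod>j=1..m. A j)"
  by (rule zero_free_product[OF m K1 K2])
 also have "\<dots> = (\<Prod>j=1..m. hn 1 (A j))"
 proof -
  have "fps_nth (A j) k = fps_nth (A j) 0 * b ^ k" for j k by (simp add: A_def)
  moreover have "1 \<le> m" using m by simp
  ultimately show ?thesis using hn_prod_geometric[of m A b, OF _ fin] by blast
 qed
 also have "\<dots> = (\<Prod>j=1..m. N1 (p j) (\<lambda>z. C j * (1 - b * z) powr (- of_real (2 / p j))))"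
  by (rule prod.cong[OF refl]) (rule K3[symmetric])
 finally show ?thesis .
qed

section \<open>Radial limits in the disc\<close>

lemma emeasure_countable_UN_le:
 assumes C: "countable C" and X: "\<And>i. i \<in> C \<Longrightarrow> X i \<in> sets M"
 shows "emeasure M (\<Union>i\<in>C. X i) \<le> (\<integral>\<^sup>+i. emeasure M (X i) \<partial>count_space C)"
proof -
 have [measurable]: "(\<Union>i\<in>C. X i) \<in> sets M" by (rule sets.countable_UN'[OF C]) (use X in auto)
 have "emeasure M (\<Union>i\<in>C. X i) = (\<integral>\<^sup>+x. indicator (\<Union>i\<in>C. X i) x \<partial>M)" by simp
 also have "\<dots> \<le> (\<integral>\<^sup>+x. \<integral>\<^sup>+i. indicator (X i) x \<partial>count_space C \<partial>M)"
 proof (rule nn_integral_mono)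
  fix x
  show "indicator (\<Union>i\<in>C. X i) x \<le> (\<integral>\<^sup>+i. (indicator (X i) x :: ennreal) \<partial>count_space C)"
  proof (cases "x \<in> (\<Union>i\<in>C. X i)")
   case True
   then obtain i where "i \<in> C" "x \<in> X i" by blast
   then show ?thesis
    using nn_integral_ge_point[of i C "\<lambda>i. indicator (X i) x :: ennreal"] True by simp
  qed simp
 qed
 also have "\<dots> = (\<integral>\<^sup>+i. \<integral>\<^sup>+x. indicator (X i) x \<partial>M \<partial>count_space C)"
  by (rule nn_integral_count_space_nn_integral[OF C]) (use X in auto)
 also have "\<dots> = (\<integral>\<^sup>+i. emeasure M (X i) \<partial>count_space C)"
  by (rule nn_integral_cong) (use X in auto)
 finally show ?thesis .
qed

text \<open>Vitali's covering lemma. The set where the maximal function is large need not be measurable, so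
the estimate is stated for a Borel set that contains it.\<close>

lemma maximal_weak_type:
 fixes \<nu> :: "real measure"
 assumes sets: "sets \<nu> = sets borel" and fin: "emeasure \<nu> UNIV < \<infinity>" and l: "l > 0"
 shows "\<exists>W\<in>sets borel. {x. \<exists>s>0. emeasure \<nu> (cball x s) > ennreal (2 * s * l)} \<subseteq> W \<and>
  ennreal l * emeasure lborel W \<le> 5 * emeasure \<nu> UNIV"
proof -
 define T where "T = {x. \<exists>s>0. emeasure \<nu> (cball x s) > ennreal (2 * s * l)}"
 obtain t where t: "emeasure \<nu> UNIV = ennreal t" "0 \<le> t" using fin by (cases "emeasure \<nu> UNIV") auto
 have "\<forall>x\<in>T. \<exists>s. 0 < s \<and> emeasure \<nu> (cball x s) > ennreal (2 * s * l)"
  unfolding T_def by blast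
 from bchoice[OF this] obtain s where s: "\<And>x. x \<in> T \<Longrightarrow> 0 < s x \<and> emeasure \<nu> (cball x (s x)) > ennreal (2 * s x * l)"
  by blast
 have bd: "s x \<le> t / (2 * l)" if "x \<in> T" for x
 proof -
  have "ennreal (2 * s x * l) < emeasure \<nu> (cball x (s x))" using s[OF that] by blast
  also have "\<dots> \<le> emeasure \<nu> UNIV" by (rule emeasure_mono) (auto simp: sets)
  finally have "2 * s x * l < t" unfolding t(1) using t(2) s[OF that] l by (subst (asm) ennreal_less_iff) auto
  then show ?thesis using l by (simp add: field_simps)
 qed
 obtain C where C: "countable C" "C \<subseteq> T" "pairwise (\<lambda>i j. disjnt (cball i (s i)) (cball j (s j))) C"
  "T \<subseteq> (\<Union>i\<in>C. cball i (5 * s i))"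
 proof (rule Vitali_covering_lemma_cballs[where S=T and K=T and a="\<lambda>x. x" and r=s and B="t / (2 * l)"])
  show "T \<subseteq> (\<Union>i\<in>T. cball i (s i))" using s by (auto intro!: bexI simp: less_imp_le)
  show "0 < s i \<and> s i \<le> t / (2 * l)" if "i \<in> T" for i using s[OF that] bd[OF that] by blast
 qed auto
 define W where "W = (\<Union>i\<in>C. cball i (5 * s i))"
 have Wb: "W \<in> sets borel" unfolding W_def by (rule sets.countable_UN'[OF C(1)]) auto
 have "ennreal l * emeasure lborel W \<le> ennreal l * (\<integral>\<^sup>+i. emeasure lborel (cball i (5 * s i)) \<partial>count_space C)"
  unfolding W_def by (intro mult_left_mono emeasure_countable_UN_le C(1)) auto
 also have "\<dots> = (\<integral>\<^sup>+i. ennreal l * emeasure lborel (cball i (5 * s i)) \<partial>count_space C)"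
  by (rule nn_integral_cmult[symmetric]) auto
 also have "\<dots> \<le> (\<integral>\<^sup>+i. 5 * emeasure \<nu> (cball i (s i)) \<partial>count_space C)"
 proof (rule nn_integral_mono)
  fix i assume "i \<in> space (count_space C)"
  then have i: "i \<in> T" using C(2) by auto
  then have s0: "0 < s i" using s by blast
  have "emeasure lborel (cball i (5 * s i)) = ennreal (10 * s i)"
   using s0 by (simp add: cball_eq_atLeastAtMost)
  then have "ennreal l * emeasure lborel (cball i (5 * s i)) = ennreal (5 * (2 * s i * l))"
   using l s0 by (simp flip: ennreal_mult add: algebra_simps)
  also have "\<dots> = 5 * ennreal (2 * s i * l)"
   using l s0 ennreal_mult[of 5 "2 * s i * l"] by simp
  also have "\<dots> \<le> 5 * emeasure \<nu> (cball i (s i))"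
   by (rule mult_left_mono) (use s[OF i] in auto)
  finally show "ennreal l * emeasure lborel (cball i (5 * s i)) \<le> 5 * emeasure \<nu> (cball i (s i))" .
 qed
 also have "\<dots> = 5 * (\<integral>\<^sup>+i. emeasure \<nu> (cball i (s i)) \<partial>count_space C)"
  by (rule nn_integral_cmult) auto
 also have "(\<integral>\<^sup>+i. emeasure \<nu> (cball i (s i)) \<partial>count_space C) = emeasure \<nu> (\<Union>i\<in>C. cball i (s i))"
  by (rule emeasure_UN_countable[symmetric])
   (use C in \<open>auto simp: sets disjoint_family_on_def pairwise_def disjnt_def\<close>)
 also have "\<dots> \<le> emeasure \<nu> UNIV" by (rule emeasure_mono) (auto simp: sets)
 finally have "ennreal l * emeasure lborel W \<le> 5 * emeasure \<nu> UNIV" by (simp add: mult_left_mono)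
 then show ?thesis using Wb C(4) unfolding T_def[symmetric] W_def[symmetric] by blast
qed

text \<open>Dominate the Poisson kernel by a sum over dyadic balls around its centre; the balls have measure
at most \<open>2 * s * l\<close> and the resulting series is geometric.\<close>

lemma poisson_le_maximal:
 fixes \<nu> :: "real measure"
 assumes sets: "sets \<nu> = sets borel" and d: "d > 0" and l: "l \<ge> 0"
  and M: "\<And>s. s > 0 \<Longrightarrow> emeasure \<nu> (cball x s) \<le> ennreal (2 * s * l)"
 shows "(\<integral>\<^sup>+t. ennreal (d / (d\<^sup>2 + (t - x)\<^sup>2)) \<partial>\<nu>) \<le> ennreal (16 * l)"
proof -
 have [measurable]: "cball x s \<in> sets \<nu>" for s by (simp add: sets)
 have pw: "ennreal (d / (d\<^sup>2 + (t - x)\<^sup>2)) \<le> (\<Sum>k. ennreal (4 / (4 ^ k * d)) * indicator (cball x (2 ^ k * d)) t)" for t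
 proof -
  define P where "P = (\<lambda>k. \<bar>t - x\<bar> \<le> 2 ^ k * d)"
  have "\<exists>k. P k"
  proof -
   obtain k :: nat where "\<bar>t - x\<bar> / d < 2 ^ k" using real_arch_pow[of 2 "\<bar>t - x\<bar> / d"] by auto
   then show ?thesis using d by (intro exI[of _ k]) (simp add: P_def field_simps)
  qed
  define k where "k = (LEAST k. P k)"
  have k: "P k" unfolding k_def by (rule LeastI_ex) fact
  have "d / (d\<^sup>2 + (t - x)\<^sup>2) \<le> 4 / (4 ^ k * d)"
  proof (cases k)
   case 0
   have "d / (d\<^sup>2 + (t - x)\<^sup>2) \<le> d / d\<^sup>2" using d by (intro divide_left_mono) (auto simp: add_pos_nonneg)
   also have "\<dots> \<le> 4 / d" using d by (simp add: power2_eq_square field_simps)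
   finally show ?thesis using 0 by simp
  next
   case (Suc i)
   have "\<not> P i" unfolding k_def[symmetric] using not_less_Least[of i P] Suc unfolding k_def by simp
   then have "2 ^ i * d \<le> \<bar>t - x\<bar>" by (simp add: P_def)
   then have "(2 ^ i * d)\<^sup>2 \<le> \<bar>t - x\<bar>\<^sup>2" by (rule power_mono) (use d in simp)
   then have "4 ^ i * d\<^sup>2 \<le> (t - x)\<^sup>2" by (simp add: power_mult_distrib power_mult[symmetric] mult.commute[of i] power_mult)
   then have "d / (d\<^sup>2 + (t - x)\<^sup>2) \<le> d / (4 ^ i * d\<^sup>2)"
    using d by (intro divide_left_mono) (auto simp: add_pos_nonneg add_nonneg_nonneg intro!: order_trans[OF \<open>4 ^ i * d\<^sup>2 \<le> (t - x)\<^sup>2\<close>] mult_pos_pos)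
   also have "\<dots> = 4 / (4 ^ k * d)" using d Suc by (simp add: power2_eq_square)
   finally show ?thesis .
  qed
  then have "ennreal (d / (d\<^sup>2 + (t - x)\<^sup>2)) \<le> (\<Sum>i\<in>{k}. ennreal (4 / (4 ^ i * d)) * indicator (cball x (2 ^ i * d)) t)"
   using k by (simp add: P_def dist_real_def abs_minus_commute indicator_def ennreal_leI)
  also have "\<dots> \<le> (\<Sum>k. ennreal (4 / (4 ^ k * d)) * indicator (cball x (2 ^ k * d)) t)"
   by (rule sum_le_suminf) auto
  finally show ?thesis .
 qed
 have "(\<integral>\<^sup>+t. ennreal (d / (d\<^sup>2 + (t - x)\<^sup>2)) \<partial>\<nu>) \<le> (\<integral>\<^sup>+t. (\<Sum>k. ennreal (4 / (4 ^ k * d)) * indicator (cball x (2 ^ k * d)) t) \<partial>\<nu>)"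
  by (rule nn_integral_mono) (rule pw)
 also have "\<dots> = (\<Sum>k. ennreal (4 / (4 ^ k * d)) * emeasure \<nu> (cball x (2 ^ k * d)))"
  by (subst nn_integral_suminf) (auto simp: nn_integral_cmult_indicator)
 also have "\<dots> \<le> (\<Sum>k. ennreal (8 * l * (1/2) ^ k))"
 proof (intro suminf_le summableI)
  fix k
  have "ennreal (4 / (4 ^ k * d)) * emeasure \<nu> (cball x (2 ^ k * d)) \<le> ennreal (4 / (4 ^ k * d)) * ennreal (2 * (2 ^ k * d) * l)"
   by (intro mult_left_mono M) (use d in auto)
  also have "\<dots> = ennreal (4 / (4 ^ k * d) * (2 * (2 ^ k * d) * l))"
   by (rule ennreal_mult[symmetric]) (use d l in auto)
  also have "4 / (4 ^ k * d) * (2 * (2 ^ k * d) * l) = 8 * l * (1/2) ^ k"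
  proof -
   have "(4::real) ^ k = 2 ^ k * 2 ^ k" by (simp flip: power_mult_distrib)
   then show ?thesis using d by (simp add: power_divide field_simps)
  qed
  finally show "ennreal (4 / (4 ^ k * d)) * emeasure \<nu> (cball x (2 ^ k * d)) \<le> ennreal (8 * l * (1/2) ^ k)" .
 qed
 also have "\<dots> = ennreal (16 * l)"
 proof (rule suminf_ennreal_eq)
  have "(\<lambda>k. 8 * l * (1/2) ^ k) sums (8 * l * (1 / (1 - 1/2)))"
   by (intro sums_mult geometric_sums) auto
  then show "(\<lambda>k. 8 * l * (1/2) ^ k) sums (16 * l)" by simp
 qed (use l in auto)
 finally show ?thesis .
qed

text \<open>Cauchy's formula for $G(z) = F(z)(1-|a|^2)/(1-\bar a z)$, which agrees with $F$ at $a$ and turns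
the Cauchy kernel into the Poisson kernel in modulus.\<close>

lemma poisson_ineq:
 assumes F: "F holomorphic_on ball 0 R" "R > 1" and a: "norm a < 1"
 shows "ennreal (norm (F a)) \<le> (\<integral>\<^sup>+z. ennreal ((1 - (norm a)\<^sup>2) / (norm (z - a))\<^sup>2 * norm (F z)) \<partial>circ)"
proof -
 define G where "G = (\<lambda>z. F z * of_real (1 - (norm a)\<^sup>2) / (1 - cnj a * z))"
 have nz: "1 - cnj a * z \<noteq> 0" if "norm z \<le> 1" for z
 proof
  assume "1 - cnj a * z = 0"
  then have "norm a * norm z = 1" by (metis norm_mult norm_one right_minus_eq complex_mod_cnj)
  moreover have "norm a * norm z \<le> norm a * 1" by (rule mult_left_mono) (use that in auto)
  ultimately show False using a by simp
 qed
 have Fc: "continuous_on (cball 0 1) F"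
  by (rule holomorphic_on_imp_continuous_on[OF holomorphic_on_subset[OF F(1)]]) (use F(2) in auto)
 have Gc: "continuous_on (cball 0 1) G"
  unfolding G_def by (intro continuous_intros Fc) (use nz in auto)
 have Gh: "G holomorphic_on ball 0 1"
  unfolding G_def by (intro holomorphic_intros holomorphic_on_subset[OF F(1)]) (use nz F(2) in auto)
 have "((\<lambda>u. G u / (u - a)) has_contour_integral (2 * of_real pi * \<i> * G a)) (circlepath 0 1)"
  by (rule Cauchy_integral_circlepath[OF Gc Gh]) (use a in simp)
 then have "((\<lambda>t. G (circlepath 0 1 t) / (circlepath 0 1 t - a) * vector_derivative (circlepath 0 1) (at t within {0..1})) has_integral (2 * of_real pi * \<i> * G a)) {0..1}"
  unfolding has_contour_integral_def .
 then have hi: "((\<lambda>t. (2 * of_real pi * \<i>) * (G (cis (2 * pi * t)) / (cis (2 * pi * t) - a) * cis (2 * pi * t))) has_integral (2 * of_real pi * \<i> * G a)) {0..1}"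
 proof (rule has_integral_eq[rotated])
  fix t :: real assume t: "t \<in> {0..1}"
  have vd: "vector_derivative (circlepath 0 1) (at t within {0..1}) = 2 * of_real pi * \<i> * cis (2 * pi * t)"
   using vector_derivative_circlepath01[of t 0 1] t by (simp add: cis_conv_exp mult_ac)
  have cp: "circlepath 0 1 t = cis (2 * pi * t)"
   by (simp add: circlepath cis_conv_exp mult_ac)
  show "G (circlepath 0 1 t) / (circlepath 0 1 t - a) * vector_derivative (circlepath 0 1) (at t within {0..1})
   = (2 * of_real pi * \<i>) * (G (cis (2 * pi * t)) / (cis (2 * pi * t) - a) * cis (2 * pi * t))"
   unfolding vd cp by (simp only: mult_ac)
 qed
 have hi2: "((\<lambda>t. G (cis (2 * pi * t)) / (cis (2 * pi * t) - a) * cis (2 * pi * t)) has_integral G a) {0..1}"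
  using has_integral_mult_right[OF hi, of "1 / (2 * of_real pi * \<i>)"] by (simp add: field_simps)
 have Ga: "G a = F a"
 proof -
  have "1 - cnj a * a = of_real (1 - (norm a)\<^sup>2)" using complex_norm_square[of a] by (simp add: mult.commute)
  moreover have "(norm a)\<^sup>2 \<noteq> 1" using a by (simp add: abs_square_eq_1)
  moreover have "1 - cnj a * a \<noteq> 0" by (rule nz) (use a in simp)
  ultimately show ?thesis unfolding G_def by (metis nonzero_mult_div_cancel_right)
 qed
 define k where "k = (\<lambda>z. (1 - (norm a)\<^sup>2) / (norm (z - a))\<^sup>2 * norm (F z))"
 have za: "z - a \<noteq> 0" if "norm z = 1" for z using that a by auto
 have nk: "norm (G z / (z - a) * z) = k z" if z: "norm z = 1" for z
 proof -
  have e: "norm (1 - cnj a * z) = norm (z - a)" using norm_Blaschke_eq[OF z, of a] by simp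
  have c: "norm (complex_of_real (1 - (norm a)\<^sup>2)) = 1 - (norm a)\<^sup>2"
   unfolding norm_of_real using a by (simp add: power_le_one)
  show ?thesis unfolding G_def k_def norm_mult norm_divide c e z by (simp add: power2_eq_square)
 qed
 have kc: "continuous_on (sphere 0 1) k"
  unfolding k_def by (intro continuous_intros continuous_on_subset[OF Fc]) (use za in auto)
 have kcc: "continuous_on {0..1} (\<lambda>t. k (cis (2 * pi * t)))"
  by (rule continuous_on_compose2[OF kc]) (auto intro!: continuous_intros simp: cis_conv_exp)
 have "norm (F a) = norm (integral {0..1} (\<lambda>t. G (cis (2 * pi * t)) / (cis (2 * pi * t) - a) * cis (2 * pi * t)))"
  using integral_unique[OF hi2] Ga by simp
 also have "\<dots> \<le> integral {0..1} (\<lambda>t. k (cis (2 * pi * t)))"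
  by (rule integral_norm_bound_integral)
   (use hi2 kcc nk in \<open>auto intro: integrable_continuous_interval simp: has_integral_integrable\<close>)
 finally have 1: "norm (F a) \<le> integral {0..1} (\<lambda>t. k (cis (2 * pi * t)))" .
 have k0: "0 \<le> k z" for z unfolding k_def using a by (simp add: power_le_one)
 have m: "(\<lambda>z. ennreal (k z)) \<in> borel_measurable circ"
  unfolding measurable_cong_sets[OF sets_circ refl]
  using borel_measurable_continuous_on_restrict[OF kc] by measurable
 have mk: "(\<lambda>t. ennreal (k (cis t)) * indicator {0..2*pi} t) \<in> borel_measurable borel"
 proof -
  have "(\<lambda>z. ennreal (k z)) \<in> borel_measurable (restrict_space borel (sphere 0 1))"
   using m by (simp add: measurable_cong_sets[OF sets_circ refl])
  from measurable_compose[OF measurable_cis_circ this] show ?thesis by measurable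
 qed
 have "(\<integral>\<^sup>+z. ennreal (k z) \<partial>circ) = (\<integral>\<^sup>+t. ennreal (k (cis t)) * indicator {0..2*pi} t \<partial>lborel) / (2 * pi)"
  by (rule nn_integral_circ[OF m])
 also have "(\<integral>\<^sup>+t. ennreal (k (cis t)) * indicator {0..2*pi} t \<partial>lborel)
  = ennreal \<bar>2 * pi\<bar> * (\<integral>\<^sup>+t. ennreal (k (cis (0 + 2 * pi * t))) * indicator {0..2*pi} (0 + 2 * pi * t) \<partial>lborel)"
  by (rule nn_integral_real_affine[OF mk]) simp
 also have "(\<integral>\<^sup>+t. ennreal (k (cis (0 + 2 * pi * t))) * indicator {0..2*pi} (0 + 2 * pi * t) \<partial>lborel)
  = (\<integral>\<^sup>+t. ennreal (k (cis (2 * pi * t))) * indicator {0..1} t \<partial>lborel)"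
 proof -
  have np: "\<not> pi \<le> 0" using pi_gt_zero by linarith
  show ?thesis by (rule nn_integral_cong) (auto simp: indicator_def zero_le_mult_iff np)
 qed
 also have "\<dots> = ennreal (integral {0..1} (\<lambda>t. k (cis (2 * pi * t))))"
  by (rule nn_integral_has_integral_lebesgue'[OF k0])
   (rule integrable_integral[OF integrable_continuous_interval[OF kcc]])
 also have "ennreal \<bar>2 * pi\<bar> * \<dots> / ennreal (2 * pi) = \<dots>"
  by (simp add: ennreal_times_divide[symmetric] ennreal_mult_divide_eq mult.commute[of "ennreal (2 * pi)"])
 finally have 2: "(\<integral>\<^sup>+z. ennreal (k z) \<partial>circ) = ennreal (integral {0..1} (\<lambda>t. k (cis (2 * pi * t))))" .
 have "ennreal (norm (F a)) \<le> (\<integral>\<^sup>+z. ennreal (k z) \<partial>circ)" unfolding 2 by (rule ennreal_leI[OF 1])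
 then show ?thesis unfolding k_def .
qed

lemma sin_ge_half: "0 \<le> u \<Longrightarrow> u \<le> pi / 2 \<Longrightarrow> u / 2 \<le> sin u"
proof -
 assume u: "0 \<le> u" "u \<le> pi / 2"
 show ?thesis
 proof (cases "u \<le> pi / 3")
  case True
  have "sin 0 - 0 / 2 \<le> sin u - u / 2"
  proof (rule DERIV_nonneg_imp_nondecreasing[OF u(1)])
   fix x assume x: "0 \<le> x" "x \<le> u"
   have "cos (pi / 3) \<le> cos x" by (rule cos_monotone_0_pi_le) (use x True in auto)
   then show "\<exists>y. ((\<lambda>u. sin u - u / 2) has_real_derivative y) (at x) \<and> 0 \<le> y"
    by (intro exI[of _ "cos x - 1 / 2"]) (auto intro!: derivative_eq_intros simp: cos_60)
  qed
  then show ?thesis by simp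
 next
  case False
  have "sin (pi / 3) \<le> sin u" by (rule sin_monotone_2pi_le) (use u False in auto)
  moreover have "u / 2 \<le> 4 / 5" using u pi_less_4 pi_approx by simp
  moreover have "8 / 5 \<le> sqrt 3" by (rule real_le_rsqrt) (simp add: power2_eq_square)
  then have "4 / 5 \<le> sqrt 3 / 2" by simp
  ultimately show ?thesis by (simp add: sin_60)
 qed
qed

text \<open>On the circle the distance of angles is taken modulo \<open>2 * pi\<close>; for two angles in
one period, one of the three nearest translates realizes it.\<close>

lemma poisson_kernel_bound:
 assumes r: "1 / 2 \<le> r" "r < 1" and t: "t \<in> {0..2*pi}" "\<theta> \<in> {0..2*pi}"
 defines "d \<equiv> 1 - r"
 shows "(1 - r\<^sup>2) / (norm (cis t - of_real r * cis \<theta>))\<^sup>2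
  \<le> 16 * (\<Sum>j\<in>{-1,0,1::int}. d / (d\<^sup>2 + (t - (\<theta> + 2 * pi * j))\<^sup>2))"
proof -
 have d: "d > 0" using r by (simp add: d_def)
 obtain j :: int where j: "j \<in> {-1,0,1}" "\<bar>t - (\<theta> + 2 * pi * j)\<bar> \<le> pi"
 proof -
  consider "t - \<theta> < - pi" | "\<bar>t - \<theta>\<bar> \<le> pi" | "t - \<theta> > pi" by linarith
  then show thesis
  proof cases
   case 1 then show thesis using t by (intro that[of "-1"]) (auto simp: abs_if)
  next
   case 2 then show thesis by (intro that[of 0]) auto
  next
   case 3 then show thesis using t by (intro that[of 1]) (auto simp: abs_if)
  qed
 qed
 define y where "y = t - (\<theta> + 2 * pi * j)"
 have y: "\<bar>y\<bar> \<le> pi" using j by (simp add: y_def)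
 have cosy: "cos (t - \<theta>) = cos y"
 proof -
  have "cos (t - \<theta>) = cos (y + 2 * pi * of_int j)" by (simp add: y_def algebra_simps)
  also have "\<dots> = cos y" using j(1) by (auto simp: cos_add sin_add)
  finally show ?thesis .
 qed
 have "(norm (cis t - of_real r * cis \<theta>))\<^sup>2 = (cos t - r * cos \<theta>)\<^sup>2 + (sin t - r * sin \<theta>)\<^sup>2"
  by (simp add: cmod_power2)
 also have "\<dots> = ((cos t)\<^sup>2 + (sin t)\<^sup>2) + r\<^sup>2 * ((cos \<theta>)\<^sup>2 + (sin \<theta>)\<^sup>2) - 2 * r * (cos t * cos \<theta> + sin t * sin \<theta>)"
 proof -
  have "(a - r * c)\<^sup>2 + (b - r * d)\<^sup>2 = (a\<^sup>2 + b\<^sup>2) + r\<^sup>2 * (c\<^sup>2 + d\<^sup>2) - 2 * r * (a * c + b * d)" for a b c d :: real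
   by (simp add: power2_eq_square algebra_simps)
  then show ?thesis .
 qed
 also have "\<dots> = 1 + r\<^sup>2 - 2 * r * cos y" unfolding cosy[symmetric] cos_diff sin_cos_squared_add2 by simp
 also have "\<dots> = d\<^sup>2 + 4 * r * (sin (y / 2))\<^sup>2"
 proof -
  have cd: "cos y = 1 - 2 * (sin (y / 2))\<^sup>2" using cos_double_sin[of "y / 2"] by simp
  show ?thesis unfolding cd by (simp add: d_def power2_eq_square algebra_simps)
 qed
 finally have eq: "(norm (cis t - of_real r * cis \<theta>))\<^sup>2 = d\<^sup>2 + 4 * r * (sin (y / 2))\<^sup>2" .
 have "\<bar>y\<bar> / 4 \<le> sin (\<bar>y\<bar> / 2)" using sin_ge_half[of "\<bar>y\<bar> / 2"] y by simp
 also have "sin (\<bar>y\<bar> / 2) \<le> \<bar>sin (y / 2)\<bar>" by (auto simp: abs_if)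
 finally have "(\<bar>y\<bar> / 4)\<^sup>2 \<le> \<bar>sin (y / 2)\<bar>\<^sup>2" by (rule power_mono) simp
 then have s: "y\<^sup>2 / 16 \<le> (sin (y / 2))\<^sup>2" by (simp add: power_divide)
 have "2 * (sin (y / 2))\<^sup>2 \<le> 4 * r * (sin (y / 2))\<^sup>2" by (rule mult_right_mono) (use r in auto)
 note X = this
 have aux: "(D + Y) / 8 \<le> D + X" if "2 * S \<le> X" "Y / 16 \<le> S" "0 \<le> D" for D Y X S :: real
  using that by argo
 have lower: "(d\<^sup>2 + y\<^sup>2) / 8 \<le> (norm (cis t - of_real r * cis \<theta>))\<^sup>2"
  unfolding eq by (rule aux[OF X s zero_le_power2])
 have pos: "0 < d\<^sup>2 + y\<^sup>2" using d by (simp add: add_pos_nonneg)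
 have "(1 - r\<^sup>2) / (norm (cis t - of_real r * cis \<theta>))\<^sup>2 \<le> (2 * d) / ((d\<^sup>2 + y\<^sup>2) / 8)"
 proof (rule frac_le)
  show "1 - r\<^sup>2 \<le> 2 * d" using zero_le_power2[of "1 - r"] by (simp add: d_def power2_eq_square algebra_simps)
 qed (use d lower pos in auto)
 also have "\<dots> = 16 * (d / (d\<^sup>2 + y\<^sup>2))" by simp
 also have "\<dots> \<le> 16 * (\<Sum>j\<in>{-1,0,1::int}. d / (d\<^sup>2 + (t - (\<theta> + 2 * pi * j))\<^sup>2))"
  using j(1) d unfolding y_def
  by (intro mult_left_mono member_le_sum[where f="\<lambda>j. d / (d\<^sup>2 + (t - (\<theta> + 2 * pi * j))\<^sup>2)"]) (auto intro!: divide_nonneg_pos add_pos_nonneg)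
 finally show ?thesis .
qed

text \<open>A weak-type estimate for the radial maximal function. On the circle, the Poisson integral of
$|F|$ is dominated by the maximal function of its periodic density on three adjacent periods.
Only the fact that the bound is linear in \<open>e\<close> for fixed \<open>\<eta>\<close>
matters later; the constant collects the factors of the preceding bounds.\<close>

lemma radial_maximal_dilated:
 assumes F: "F holomorphic_on ball 0 R" "R > 1" and e: "e > 0" "mean1 2 F 1 \<le> ennreal (e\<^sup>2)" and eta: "\<eta> > 0"
 defines "B \<equiv> {z \<in> sphere 0 1. \<exists>r\<in>{1/2..<1}. norm (F (of_real r * z)) > \<eta>}"
 assumes B: "B \<in> sets circ"
 shows "emeasure circ B \<le> ennreal (1920 * e / \<eta>)"
proof -
 have Fc: "continuous_on (cball 0 1) F"
  by (rule holomorphic_on_imp_continuous_on[OF holomorphic_on_subset[OF F(1)]]) (use F(2) in auto)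
 have Fcis: "continuous_on UNIV (\<lambda>t. F (cis t))"
  by (rule continuous_on_compose2[OF Fc]) (auto intro!: continuous_intros simp: cis_conv_exp)
 have Fm[measurable]: "(\<lambda>t. F (cis t)) \<in> borel_measurable borel"
  by (rule borel_measurable_continuous_onI[OF Fcis])
 have Fmc: "F \<in> borel_measurable circ"
  unfolding measurable_cong_sets[OF sets_circ refl]
  by (rule borel_measurable_continuous_on_restrict[OF continuous_on_subset[OF Fc]]) auto
 define \<nu> where "\<nu> = density lborel (\<lambda>t. ennreal (norm (F (cis t))) * indicator {0..2*pi} t)"
 have sets\<nu>: "sets \<nu> = sets borel" by (simp add: \<nu>_def)
 have "(\<integral>\<^sup>+z. ennreal (norm (F z)) \<partial>circ) \<le> (\<integral>\<^sup>+z. ennreal (e / 2) + ennreal (1 / (2 * e)) * ennreal (norm (F z) powr 2) \<partial>circ)"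
 proof (rule nn_integral_mono)
  fix z
  have "0 \<le> (norm (F z) - e)\<^sup>2" by simp
  then have "2 * e * norm (F z) \<le> e\<^sup>2 + (norm (F z))\<^sup>2" by (simp add: power2_eq_square algebra_simps)
  then have "norm (F z) \<le> e / 2 + 1 / (2 * e) * norm (F z) powr 2"
   using e by (simp add: field_simps power2_eq_square)
  then have "ennreal (norm (F z)) \<le> ennreal (e / 2 + 1 / (2 * e) * norm (F z) powr 2)" by (rule ennreal_leI)
  then show "ennreal (norm (F z)) \<le> ennreal (e / 2) + ennreal (1 / (2 * e)) * ennreal (norm (F z) powr 2)"
   using e(1) ennreal_plus[of "e / 2" "1 / (2 * e) * norm (F z) powr 2"] ennreal_mult[of "1 / (2 * e)" "norm (F z) powr 2"]
   by (simp del: powr_numeral)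
 qed
 also have "\<dots> = ennreal (e / 2) + ennreal (1 / (2 * e)) * (\<integral>\<^sup>+z. ennreal (norm (F z) powr 2) \<partial>circ)"
  using Fmc by (subst nn_integral_add) (auto simp: nn_integral_cmult emeasure_circ_space)
 also have "\<dots> \<le> ennreal (e / 2) + ennreal (1 / (2 * e)) * ennreal (e\<^sup>2)"
  using e(2) unfolding mean1_def by (intro add_left_mono mult_left_mono) auto
 also have "\<dots> = ennreal e"
  using e(1) by (simp add: power2_eq_square flip: ennreal_mult ennreal_plus)
 finally have L1: "(\<integral>\<^sup>+z. ennreal (norm (F z)) \<partial>circ) \<le> ennreal e" .
 have two_pi: "ennreal (2 * pi) * (x / ennreal (2 * pi)) = x" for x
  by (simp add: ennreal_times_divide ennreal_mult_divide_eq mult.commute[of "ennreal (2 * pi)"])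
 have nuU: "emeasure \<nu> UNIV = ennreal (2 * pi) * (\<integral>\<^sup>+z. ennreal (norm (F z)) \<partial>circ)"
 proof -
  have "emeasure \<nu> UNIV = (\<integral>\<^sup>+t. ennreal (norm (F (cis t))) * indicator {0..2*pi} t \<partial>lborel)"
   unfolding \<nu>_def by (subst emeasure_density) auto
  also have "\<dots> = ennreal (2 * pi) * (\<integral>\<^sup>+z. ennreal (norm (F z)) \<partial>circ)"
   using Fmc by (subst nn_integral_circ) (auto simp: two_pi)
  finally show ?thesis .
 qed
 also have "\<dots> \<le> ennreal (2 * pi) * ennreal e" by (rule mult_left_mono[OF L1]) simp
 also have "\<dots> = ennreal (2 * pi * e)" using e by (simp add: ennreal_mult)
 finally have nu_le: "emeasure \<nu> UNIV \<le> ennreal (2 * pi * e)" .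
 \<comment> \<open>Three translates, the factor 16 of the kernel and the factor 16 of the maximal function give 768, and 768 / (2 * pi) is at most 128.\<close>
 define l where "l = \<eta> / 128"
 have l: "l > 0" using eta by (simp add: l_def)
 obtain W where W: "W \<in> sets borel" "{x. \<exists>s>0. emeasure \<nu> (cball x s) > ennreal (2 * s * l)} \<subseteq> W"
  "ennreal l * emeasure lborel W \<le> 5 * emeasure \<nu> UNIV"
  using maximal_weak_type[OF sets\<nu> le_less_trans[OF nu_le] l] by auto
 define V where "V = (\<lambda>j::int. (\<lambda>x. x + 2 * pi * j) -` W)"
 have Vm[measurable]: "V j \<in> sets borel" for j
  unfolding V_def by (rule measurable_sets_borel[OF _ W(1)]) simp
 have Vl: "emeasure lborel (V j) = emeasure lborel W" for j
 proof -
  have "emeasure lborel W = (\<integral>\<^sup>+x. indicator W x \<partial>lborel)" using W(1) by simp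
  also have "\<dots> = ennreal \<bar>1\<bar> * (\<integral>\<^sup>+x. indicator W (2 * pi * j + 1 * x) \<partial>lborel)"
   by (rule nn_integral_real_affine) (use W(1) in auto)
  also have "(\<integral>\<^sup>+x. indicator W (2 * pi * j + 1 * x) \<partial>lborel) = (\<integral>\<^sup>+x. indicator (V j) x \<partial>lborel)"
   by (rule nn_integral_cong) (auto simp: V_def indicator_def add.commute)
  finally show ?thesis by simp
 qed
 have main: "\<theta> \<in> (\<Union>j\<in>{-1,0,1}. V j)" if th: "\<theta> \<in> {0..2*pi}" "cis \<theta> \<in> B" for \<theta>
 proof (rule ccontr)
  assume no: "\<theta> \<notin> (\<Union>j\<in>{-1,0,1}. V j)"
  obtain r where r: "1/2 \<le> r" "r < 1" "norm (F (of_real r * cis \<theta>)) > \<eta>" using th(2) by (auto simp: B_def)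
  define a where "a = of_real r * cis \<theta>"
  define d where "d = 1 - r"
  have d: "d > 0" using r by (simp add: d_def)
  have na: "norm a = r" using r by (simp add: a_def norm_mult)
  have max: "(\<integral>\<^sup>+t. ennreal (d / (d\<^sup>2 + (t - (\<theta> + 2 * pi * j))\<^sup>2)) \<partial>\<nu>) \<le> ennreal (16 * l)" if "j \<in> {-1,0,1}" for j :: int
  proof (rule poisson_le_maximal[OF sets\<nu> d])
   have "\<theta> + 2 * pi * j \<notin> W" using no that by (auto simp: V_def)
   then show "emeasure \<nu> (cball (\<theta> + 2 * pi * j) s) \<le> ennreal (2 * s * l)" if "s > 0" for s
    using W(2) that by (force simp: not_less)
  qed (use l in simp)
  have "ennreal (norm (F a)) \<le> (\<integral>\<^sup>+z. ennreal ((1 - r\<^sup>2) / (norm (z - a))\<^sup>2 * norm (F z)) \<partial>circ)"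
   using poisson_ineq[OF F, of a] na r by simp
  also have "\<dots> = (\<integral>\<^sup>+t. ennreal ((1 - r\<^sup>2) / (norm (cis t - a))\<^sup>2 * norm (F (cis t))) * indicator {0..2*pi} t \<partial>lborel) / (2 * pi)"
  proof (rule nn_integral_circ)
   have [measurable]: "(\<lambda>z. (1 - r\<^sup>2) / (norm (z - a))\<^sup>2) \<in> borel_measurable circ"
    by (rule borel_measurable_circI) measurable
   show "(\<lambda>z. ennreal ((1 - r\<^sup>2) / (norm (z - a))\<^sup>2 * norm (F z))) \<in> borel_measurable circ"
    using Fmc by measurable
  qed
  also have "(\<integral>\<^sup>+t. ennreal ((1 - r\<^sup>2) / (norm (cis t - a))\<^sup>2 * norm (F (cis t))) * indicator {0..2*pi} t \<partial>lborel)
   \<le> (\<integral>\<^sup>+t. (\<Sum>j\<in>{-1,0,1::int}. 16 * ennreal (d / (d\<^sup>2 + (t - (\<theta> + 2 * pi * j))\<^sup>2))) * (ennreal (norm (F (cis t))) * indicator {0..2*pi} t) \<partial>lborel)"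
  proof (rule nn_integral_mono)
   fix t
   have nn: "0 \<le> d / (d\<^sup>2 + (t - (\<theta> + 2 * pi * j))\<^sup>2)" for j using d by simp
   show "ennreal ((1 - r\<^sup>2) / (norm (cis t - a))\<^sup>2 * norm (F (cis t))) * indicator {0..2*pi} t \<le>
    (\<Sum>j\<in>{-1,0,1::int}. 16 * ennreal (d / (d\<^sup>2 + (t - (\<theta> + 2 * pi * j))\<^sup>2))) * (ennreal (norm (F (cis t))) * indicator {0..2*pi} t)"
   proof (cases "t \<in> {0..2*pi}")
    case True
    have "ennreal ((1 - r\<^sup>2) / (norm (cis t - a))\<^sup>2 * norm (F (cis t))) \<le> ennreal (16 * (\<Sum>j\<in>{-1,0,1::int}. d / (d\<^sup>2 + (t - (\<theta> + 2 * pi * j))\<^sup>2)) * norm (F (cis t)))"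
     unfolding a_def d_def by (intro ennreal_leI mult_right_mono poisson_kernel_bound r(1,2) True th(1)) simp
    also have "\<dots> = ennreal (16 * (\<Sum>j\<in>{-1,0,1::int}. d / (d\<^sup>2 + (t - (\<theta> + 2 * pi * j))\<^sup>2))) * ennreal (norm (F (cis t)))"
     by (rule ennreal_mult; intro mult_nonneg_nonneg sum_nonneg nn norm_ge_zero) simp
    also have "ennreal (16 * (\<Sum>j\<in>{-1,0,1::int}. d / (d\<^sup>2 + (t - (\<theta> + 2 * pi * j))\<^sup>2))) = (\<Sum>j\<in>{-1,0,1::int}. 16 * ennreal (d / (d\<^sup>2 + (t - (\<theta> + 2 * pi * j))\<^sup>2)))"
    proof -
     define x where "x = (\<lambda>j::int. d / (d\<^sup>2 + (t - (\<theta> + 2 * pi * j))\<^sup>2))"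
     have "ennreal (16 * (\<Sum>j\<in>{-1,0,1}. x j)) = 16 * ennreal (\<Sum>j\<in>{-1,0,1}. x j)"
      using ennreal_mult[of 16 "\<Sum>j\<in>{-1,0,1}. x j"] by (simp only: sum_nonneg x_def nn) simp
     also have "ennreal (\<Sum>j\<in>{-1,0,1}. x j) = (\<Sum>j\<in>{-1,0,1}. ennreal (x j))"
      by (rule sum_ennreal[symmetric]) (simp only: x_def nn)
     finally show ?thesis unfolding sum_distrib_left x_def .
    qed
    finally show ?thesis using True by simp
   qed simp
  qed
  also have "\<dots> = (\<integral>\<^sup>+t. (\<Sum>j\<in>{-1,0,1::int}. 16 * ennreal (d / (d\<^sup>2 + (t - (\<theta> + 2 * pi * j))\<^sup>2))) \<partial>\<nu>)"
   unfolding \<nu>_def by (subst nn_integral_density) (auto simp: mult.commute)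
  also have "\<dots> = (\<Sum>j\<in>{-1,0,1::int}. 16 * (\<integral>\<^sup>+t. ennreal (d / (d\<^sup>2 + (t - (\<theta> + 2 * pi * j))\<^sup>2)) \<partial>\<nu>))"
   by (subst nn_integral_sum) (auto simp: nn_integral_cmult measurable_cong_sets[OF sets\<nu> refl])
  also have "\<dots> \<le> (\<Sum>j\<in>{-1,0,1::int}. 16 * ennreal (16 * l))"
   by (intro sum_mono mult_left_mono max) auto
  also have "\<dots> = ennreal (768 * l)" using l ennreal_mult[of 48 "16 * l"] by (simp add: algebra_simps flip: ennreal_plus ennreal_mult)
  finally have "ennreal (norm (F a)) \<le> ennreal (768 * l) / ennreal (2 * pi)" by (simp add: divide_right_mono_ennreal)
  also have "\<dots> = ennreal (768 * l / (2 * pi))" using l by (subst divide_ennreal) auto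
  also have "\<dots> \<le> ennreal (128 * l)"
  proof (rule ennreal_leI)
   have "768 * l / (2 * pi) \<le> 768 * l / (2 * 3)" using l pi_gt3 by (intro divide_left_mono) auto
   then show "768 * l / (2 * pi) \<le> 128 * l" by simp
  qed
  finally have "norm (F a) \<le> \<eta>" using eta by (simp add: l_def)
  then show False using r(3) by (simp add: a_def)
 qed
 have "emeasure circ B = (\<integral>\<^sup>+z. indicator B z \<partial>circ)" using B by simp
 also have "\<dots> = (\<integral>\<^sup>+t. indicator B (cis t) * indicator {0..2*pi} t \<partial>lborel) / (2 * pi)"
  by (rule nn_integral_circ) (use B in simp)
 also have "(\<integral>\<^sup>+t. indicator B (cis t) * indicator {0..2*pi} t \<partial>lborel) \<le> (\<integral>\<^sup>+t. indicator (\<Union>j\<in>{-1,0,1}. V j) t \<partial>lborel)"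
  by (rule nn_integral_mono) (use main in \<open>auto simp: indicator_def\<close>)
 also have "\<dots> = emeasure lborel (\<Union>j\<in>{-1,0,1}. V j)" by (rule nn_integral_indicator) simp
 also have "\<dots> \<le> (\<Sum>j\<in>{-1,0,1::int}. emeasure lborel (V j))" by (rule emeasure_subadditive_finite) auto
 also have "\<dots> = 3 * emeasure lborel W" by (simp add: Vl flip: distrib_right)
 finally have 1: "emeasure circ B \<le> 3 * emeasure lborel W / ennreal (2 * pi)" by (simp add: divide_right_mono_ennreal)
 have "ennreal l * emeasure lborel W \<le> 5 * ennreal (2 * pi * e)"
  using W(3) nu_le by (meson mult_left_mono order_trans zero_le)
 also have "\<dots> = ennreal l * ennreal (10 * pi * e / l)"
  using l e(1) ennreal_mult[of 5 "2 * pi * e"] by (simp add: mult.assoc flip: ennreal_mult)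
 finally have "emeasure lborel W \<le> ennreal (10 * pi * e / l)"
  using l by (subst (asm) ennreal_mult_le_mult_iff) auto
 then have "3 * emeasure lborel W / ennreal (2 * pi) \<le> 3 * ennreal (10 * pi * e / l) / ennreal (2 * pi)"
  by (intro divide_right_mono_ennreal mult_left_mono) auto
 also have "\<dots> = ennreal (3 * (10 * pi * e / l) / (2 * pi))"
  using l e ennreal_mult[of 3 "10 * pi * e / l"] by (subst divide_ennreal[symmetric]) auto
 also have "3 * (10 * pi * e / l) / (2 * pi) = 1920 * e / \<eta>" using eta by (simp add: l_def field_simps)
 finally show ?thesis using 1 by (rule order_trans[rotated])
qed

lemma radial_cauchy_limit:
 fixes g :: "real \<Rightarrow> complex"
 assumes "\<And>e. e > 0 \<Longrightarrow> \<exists>d<1. \<forall>r s. d < r \<and> r < 1 \<and> d < s \<and> s < 1 \<longrightarrow> norm (g r - g s) \<le> e"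
 shows "\<exists>L. (g \<longlongrightarrow> L) (at_left 1)"
proof -
 define r where "r = (\<lambda>n. 1 - 1 / real (Suc n))"
 have r1: "r n < 1" for n by (simp add: r_def)
 have rl: "r \<longlonglongrightarrow> 1" unfolding r_def by (rule approach_one)
 have ev: "\<forall>\<^sub>F n in sequentially. d < r n" if "d < 1" for d
  using rl that by (rule order_tendstoD(1))
 have "Cauchy (\<lambda>n. g (r n))"
 proof (rule metric_CauchyI)
  fix e :: real assume e: "e > 0"
  obtain d where d: "d < 1" "\<forall>r s. d < r \<and> r < 1 \<and> d < s \<and> s < 1 \<longrightarrow> norm (g r - g s) \<le> e / 2"
   using assms[of "e / 2"] e by auto
  obtain M where M: "\<And>n. n \<ge> M \<Longrightarrow> d < r n" using ev[OF d(1)] unfolding eventually_sequentially by blast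
  show "\<exists>M. \<forall>m\<ge>M. \<forall>n\<ge>M. dist (g (r m)) (g (r n)) < e"
  proof (intro exI[of _ M] allI impI)
   fix m n assume "m \<ge> M" "n \<ge> M"
   then have "norm (g (r m) - g (r n)) \<le> e / 2" using d(2) M r1 by blast
   then show "dist (g (r m)) (g (r n)) < e" using e by (simp add: dist_norm)
  qed
 qed
 then obtain L where L: "(\<lambda>n. g (r n)) \<longlonglongrightarrow> L" using Cauchy_convergent_iff convergent_def by blast
 have "(g \<longlongrightarrow> L) (at_left 1)"
 proof (rule tendstoI)
  fix e :: real assume e: "e > 0"
  obtain d where d: "d < 1" "\<forall>r s. d < r \<and> r < 1 \<and> d < s \<and> s < 1 \<longrightarrow> norm (g r - g s) \<le> e / 2"
   using assms[of "e / 2"] e by auto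
  show "\<forall>\<^sub>F x in at_left 1. dist (g x) L < e"
  proof (rule eventually_at_leftI[of d])
   fix x assume x: "x \<in> {d<..<1}"
   have "(\<lambda>n. norm (g x - g (r n))) \<longlonglongrightarrow> norm (g x - L)" by (intro tendsto_intros L)
   moreover have "\<forall>\<^sub>F n in sequentially. norm (g x - g (r n)) \<le> e / 2"
    using ev[OF d(1)] by eventually_elim (use d(2) x r1 in auto)
   ultimately have "norm (g x - L) \<le> e / 2" by (intro tendsto_upperbound) auto
   then show "dist (g x) L < e" using e by (simp add: dist_norm)
  qed (use d in auto)
 qed
 then show ?thesis by blast
qed

lemma at_left_1_sequence:
 assumes "(g \<longlongrightarrow> L) (at_left (1::real))" "\<And>n. r n < 1" "r \<longlonglongrightarrow> 1"
 shows "(\<lambda>n. g (r n)) \<longlonglongrightarrow> L"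
proof (rule filterlim_compose[OF assms(1)])
 show "filterlim r (at_left 1) sequentially"
  using assms(2,3) unfolding filterlim_at by (simp add: less_imp_neq)
qed

definition fps_tail :: "nat \<Rightarrow> complex fps \<Rightarrow> complex fps" where
 "fps_tail n A = Abs_fps (\<lambda>k. if k < n then 0 else fps_nth A k)"

lemma fps_tail:
 assumes A: "fps_conv_radius A \<ge> 1"
 shows "fps_conv_radius (fps_tail n A) \<ge> 1"
  and "norm z < 1 \<Longrightarrow> eval_fps A z = (\<Sum>k<n. fps_nth A k * z ^ k) + eval_fps (fps_tail n A) z"
proof -
 have sm: "summable (\<lambda>k. fps_nth (fps_tail n A) k * z ^ k)" if "norm z < 1" for z
  by (rule summable_comparison_test'[OF fps_abs_summable[OF A that], of 0]) (simp add: fps_tail_def)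
 show "fps_conv_radius (fps_tail n A) \<ge> 1"
  unfolding fps_conv_radius_def
  by (rule conv_radius_geI_ex') (rule sm, simp)
 show "eval_fps A z = (\<Sum>k<n. fps_nth A k * z ^ k) + eval_fps (fps_tail n A) z" if z: "norm z < 1"
 proof -
  have sA: "summable (\<lambda>k. fps_nth A k * z ^ k)" by (rule summable_norm_cancel[OF fps_abs_summable[OF A z]])
  have "eval_fps (fps_tail n A) z = (\<Sum>k. fps_nth A (k + n) * z ^ (k + n)) + (\<Sum>k<n. fps_nth (fps_tail n A) k * z ^ k)"
   unfolding eval_fps_def by (subst suminf_split_initial_segment[OF sm[OF z], of n]) (simp add: fps_tail_def)
  also have "(\<Sum>k<n. fps_nth (fps_tail n A) k * z ^ k) = 0" by (rule sum.neutral) (simp add: fps_tail_def)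
  finally show ?thesis
   unfolding eval_fps_def by (subst suminf_split_initial_segment[OF sA, of n]) simp
 qed
qed

lemma hn_tail_small:
 assumes fin: "hn 1 A < \<infinity>" and e: "e > 0"
 shows "\<exists>n. hn 1 (fps_tail n A) \<le> ennreal e"
proof -
 define x where "x = (\<lambda>k. (norm (fps_nth A k))\<^sup>2)"
 have x0: "0 \<le> x k" for k by (simp add: x_def)
 have "(\<Sum>k. ennreal (x k)) < \<infinity>" using fin by (simp add: hn_def x_def)
 note s = ennreal_suminf_finite_summable[OF x0 this]
 obtain n where n: "norm (\<Sum>i. x (i + n)) < e" using suminf_exist_split[OF e s(1)] by auto
 define y where "y = (\<lambda>k. if k < n then 0 else x k)"
 have sy: "summable y" by (rule summable_comparison_test'[OF s(1), of 0]) (simp add: y_def x0)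
 have "hn 1 (fps_tail n A) = (\<Sum>k. ennreal (y k))"
  unfolding hn_def by (rule suminf_cong) (simp add: fps_tail_def y_def x_def)
 also have "\<dots> = ennreal (suminf y)" by (rule suminf_ennreal2) (use sy x0 in \<open>auto simp: y_def\<close>)
 also have "suminf y = (\<Sum>i. x (i + n))"
  by (subst suminf_split_initial_segment[OF sy, of n]) (simp add: y_def)
 also have "ennreal \<dots> \<le> ennreal e" using n by (intro ennreal_leI) simp
 finally show ?thesis by blast
qed

lemma radial_sup_set_measurable:
 fixes h :: "complex \<Rightarrow> complex"
 assumes h: "continuous_on (ball 0 1) h" and S: "S \<subseteq> {0..<1}"
 shows "{z \<in> sphere 0 1. \<exists>r\<in>S. norm (h (of_real r * z)) > \<eta>} \<in> sets circ"
proof -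
 define U where "U = {w \<in> ball 0 1. norm (h w) > \<eta>}"
 have "open U"
 proof -
  have "open (ball 0 1 \<inter> (\<lambda>w. norm (h w)) -` {\<eta><..})"
   by (rule continuous_open_preimage) (auto intro!: continuous_intros h)
  moreover have "U = ball 0 1 \<inter> (\<lambda>w. norm (h w)) -` {\<eta><..}" by (auto simp: U_def)
  ultimately show ?thesis by simp
 qed
 then have "open (\<Union>r\<in>S. (\<lambda>z. of_real r * z) -` U)"
  by (intro open_UN ballI open_vimage) (auto intro!: continuous_intros)
 then have "(\<Union>r\<in>S. (\<lambda>z. of_real r * z) -` U) \<in> sets borel" by simp
 moreover have "{z \<in> sphere 0 1. \<exists>r\<in>S. norm (h (of_real r * z)) > \<eta>} = sphere 0 1 \<inter> (\<Union>r\<in>S. (\<lambda>z. of_real r * z) -` U)"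
 proof (rule set_eqI)
  fix z :: complex
  have "of_real r * z \<in> ball 0 1" if "r \<in> S" "norm z = 1" for r
  proof -
   have "0 \<le> r" "r < 1" using S that(1) by auto
   then show ?thesis using that(2) by (simp add: norm_mult)
  qed
  then show "z \<in> {z \<in> sphere 0 1. \<exists>r\<in>S. norm (h (of_real r * z)) > \<eta>} \<longleftrightarrow>
   z \<in> sphere 0 1 \<inter> (\<Union>r\<in>S. (\<lambda>z. of_real r * z) -` U)"
   unfolding U_def by fastforce
 qed
 ultimately show ?thesis unfolding sets_circ sets_restrict_space by blast
qed

text \<open>Apply the estimate to dilations and let the radius increase to one.\<close>

lemma radial_maximal:
 assumes A: "fps_conv_radius A \<ge> 1" and e: "e > 0" "hn 1 A \<le> ennreal (e\<^sup>2)" and eta: "\<eta> > 0"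
 defines "B \<equiv> {z \<in> sphere 0 1. \<exists>r\<in>{1/2..<1}. norm (eval_fps A (of_real r * z)) > \<eta>}"
 shows "B \<in> sets circ" "emeasure circ B \<le> ennreal (1920 * e / \<eta>)"
proof -
 define h where "h = eval_fps A"
 have hh: "h holomorphic_on ball 0 1"
  unfolding h_def
 proof (rule holomorphic_on_eval_fps)
  show "ball (0 :: complex) 1 \<subseteq> eball 0 (fps_conv_radius A)"
  proof (rule subsetI)
   fix x :: complex assume "x \<in> ball 0 1"
   then have "ereal (dist 0 x) < 1" by simp
   also note A
   finally show "x \<in> eball 0 (fps_conv_radius A)" by (simp add: in_eball_iff)
  qed
 qed
 have hc: "continuous_on (ball 0 1) h" by (rule holomorphic_on_imp_continuous_on[OF hh])
 show Bm: "B \<in> sets circ" unfolding B_def h_def[symmetric] by (rule radial_sup_set_measurable[OF hc]) auto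
 define R where "R = (\<lambda>n. 1 - 1 / real (Suc n))"
 have R1: "R n < 1" for n by (simp add: R_def)
 define C where "C = (\<lambda>n. {z \<in> sphere 0 1. \<exists>r\<in>{1/2..<R n}. norm (h (of_real r * z)) > \<eta>})"
 have Cm: "C n \<in> sets circ" for n unfolding C_def
  by (rule radial_sup_set_measurable[OF hc]) (use R1[of n] in auto)
 have inc: "incseq C"
 proof (rule incseq_SucI)
  fix n have "R n \<le> R (Suc n)" by (simp add: R_def frac_le)
  then show "C n \<subseteq> C (Suc n)" unfolding C_def by fastforce
 qed
 have UC: "(\<Union>n. C n) = B"
 proof
  have "{1/2..<R n} \<subseteq> {1/2..<1}" for n using R1[of n] by auto
  then show "(\<Union>n. C n) \<subseteq> B" unfolding C_def B_def h_def by blast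
  show "B \<subseteq> (\<Union>n. C n)"
  proof
   fix z assume "z \<in> B"
   then obtain r where r: "z \<in> sphere 0 1" "1/2 \<le> r" "r < 1" "norm (h (of_real r * z)) > \<eta>"
    by (auto simp: B_def h_def)
   have "R \<longlonglongrightarrow> 1" unfolding R_def by (rule approach_one)
   then have "\<forall>\<^sub>F n in sequentially. r < R n" using r(3) by (rule order_tendstoD(1))
   then obtain n where "r < R n" unfolding eventually_sequentially by blast
   then have "z \<in> C n" using r by (auto simp: C_def)
   then show "z \<in> (\<Union>n. C n)" by blast
  qed
 qed
 have bd: "emeasure circ (C n) \<le> ennreal (1920 * e / \<eta>)" for n
 proof (cases "R n \<le> 1 / 2")
  case True
  then have "C n = {}" by (auto simp: C_def)
  then show ?thesis by simp
 next
  case False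
  define F where "F = (\<lambda>z. h (of_real (R n) * z))"
  have Fh: "F holomorphic_on ball 0 (1 / R n)"
   unfolding F_def by (rule dilate_holomorphic[OF hh]) (use False R1[of n] in auto)
  have RR: "1 / R n > 1" using False R1[of n] by simp
  define C' where "C' = {z \<in> sphere 0 1. \<exists>r\<in>{1/2..<1}. norm (F (of_real r * z)) > \<eta>}"
  have C'm: "C' \<in> sets circ" unfolding C'_def
   by (rule radial_sup_set_measurable[OF holomorphic_on_imp_continuous_on[OF holomorphic_on_subset[OF Fh]]])
    (use RR in auto)
  have "mean1 2 F 1 = mean1 2 h (R n)" unfolding F_def mean1_dilate by simp
  also have "\<dots> \<le> N1 2 h" by (rule mean1_le_N1) (use False R1[of n] in auto)
  also have "\<dots> = hn 1 A" unfolding h_def by (rule N1_2[OF A]) simp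
  finally have m: "mean1 2 F 1 \<le> ennreal (e\<^sup>2)" using e(2) by (rule order_trans)
  have "C n \<subseteq> C'"
  proof
   fix z assume "z \<in> C n"
   then obtain r where r: "z \<in> sphere 0 1" "1/2 \<le> r" "r < R n" "norm (h (of_real r * z)) > \<eta>"
    by (auto simp: C_def)
   have "r * R n \<le> r * 1" by (rule mult_left_mono) (use R1[of n] r in auto)
   then have "r \<le> r / R n" using False by (simp add: field_simps)
   moreover have "r / R n < 1" using r False by simp
   moreover have "F (of_real (r / R n) * z) = h (of_real r * z)" using False by (simp add: F_def)
   moreover have "r / R n \<in> {1/2..<1}" unfolding atLeastLessThan_iff using calculation(1,2) r(2) by linarith
   ultimately show "z \<in> C'" using r(1,4) unfolding C'_def
    by (intro CollectI conjI bexI[of _ "r / R n"]) (simp_all only:)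
  qed
  then have "emeasure circ (C n) \<le> emeasure circ C'" by (rule emeasure_mono[OF _ C'm])
  also have "\<dots> \<le> ennreal (1920 * e / \<eta>)"
   using radial_maximal_dilated[OF Fh RR e(1) m eta] C'm unfolding C'_def by blast
  finally show ?thesis .
 qed
 have "emeasure circ B = (SUP n. emeasure circ (C n))"
  unfolding UC[symmetric] by (rule SUP_emeasure_incseq[symmetric]) (use Cm inc in auto)
 also have "\<dots> \<le> ennreal (1920 * e / \<eta>)" by (rule SUP_least) (rule bd)
 finally show "emeasure circ B \<le> ennreal (1920 * e / \<eta>)" .
qed

text \<open>A power series is a polynomial plus a tail of small norm. The polynomial is continuous, and
outside a set of small measure the tail is uniformly small on the radius; hence the Cauchy
criterion holds almost everywhere.\<close>

theorem fatou_H2: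
 assumes A: "fps_conv_radius A \<ge> 1" and fin: "hn 1 A < \<infinity>"
 shows "AE z in circ. \<exists>L. ((\<lambda>r. eval_fps A (of_real r * z)) \<longlongrightarrow> L) (at_left 1)"
proof -
 have "\<exists>n. hn 1 (fps_tail n A) \<le> ennreal ((1 / real (Suc i))\<^sup>2)" for i
  by (rule hn_tail_small[OF fin]) simp
 then obtain n where n: "\<And>i. hn 1 (fps_tail (n i) A) \<le> ennreal ((1 / real (Suc i))\<^sup>2)" by metis
 define T where "T = (\<lambda>i. fps_tail (n i) A)"
 define B where "B = (\<lambda>k i. {z \<in> sphere 0 1. \<exists>r\<in>{1/2..<1}. norm (eval_fps (T i) (of_real r * z)) > 1 / real (Suc k)})"
 have Tr: "fps_conv_radius (T i) \<ge> 1" for i unfolding T_def by (rule fps_tail(1)[OF A])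
 have Bm: "B k i \<in> sets circ" and Be: "emeasure circ (B k i) \<le> ennreal (1920 * (1 / real (Suc i)) / (1 / real (Suc k)))" for k i
  unfolding B_def using radial_maximal[OF Tr[of i], of "1 / real (Suc i)" "1 / real (Suc k)"] n[of i] unfolding T_def by auto
 have null: "(\<Inter>i. B k i) \<in> null_sets circ" for k
 proof -
  have m: "(\<Inter>i. B k i) \<in> sets circ" using Bm by blast
  have "(\<lambda>i. ennreal (1920 * (1 / real (Suc i)) / (1 / real (Suc k)))) \<longlonglongrightarrow> ennreal (1920 * 0 / (1 / real (Suc k)))"
   by (intro tendsto_ennrealI tendsto_divide tendsto_mult tendsto_const LIMSEQ_Suc[OF lim_const_over_n]) simp
  moreover have "emeasure circ (\<Inter>i. B k i) \<le> ennreal (1920 * (1 / real (Suc i)) / (1 / real (Suc k)))" for i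
   by (rule order_trans[OF emeasure_mono Be]) (use Bm in auto)
  ultimately have "emeasure circ (\<Inter>i. B k i) \<le> ennreal (1920 * 0 / (1 / real (Suc k)))"
   by (intro LIMSEQ_le_const) auto
  then show ?thesis using m by (simp add: null_sets_def)
 qed
 have "AE z in circ. \<forall>k. z \<notin> (\<Inter>i. B k i)"
  unfolding AE_all_countable using null AE_not_in by blast
 then show ?thesis
 proof (rule AE_mp, intro AE_I2 impI)
  fix z :: complex assume "z \<in> space circ" and z: "\<forall>k. z \<notin> (\<Inter>i. B k i)"
  then have z1: "norm z = 1" by simp
  show "\<exists>L. ((\<lambda>r. eval_fps A (of_real r * z)) \<longlongrightarrow> L) (at_left 1)"
  proof (rule radial_cauchy_limit)
   fix e :: real assume e: "e > 0"
   obtain k where k: "1 / real (Suc k) < e / 3" using reals_Archimedean[of "e / 3"] e by (auto simp: inverse_eq_divide)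
   obtain i where i: "z \<notin> B k i" using z by blast
   define q where "q = (\<lambda>r. \<Sum>j<n i. fps_nth A j * (of_real r * z) ^ j)"
   have tail: "norm (eval_fps (T i) (of_real r * z)) \<le> e / 3" if "1/2 \<le> r" "r < 1" for r
   proof -
     have "norm (eval_fps (T i) (of_real r * z)) \<le> 1 / real (Suc k)"
     proof (rule ccontr)
      assume "\<not> norm (eval_fps (T i) (of_real r * z)) \<le> 1 / real (Suc k)"
      then have "norm (eval_fps (T i) (of_real r * z)) > 1 / real (Suc k)" by linarith
      then have "z \<in> B k i" unfolding B_def using that z1 by (intro CollectI conjI bexI[of _ r]) auto
      then show False using i by blast
     qed
     then show ?thesis using k by linarith
    qed
   have eq: "eval_fps A (of_real r * z) = q r + eval_fps (T i) (of_real r * z)" if "0 \<le> r" "r < 1" for r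
    unfolding q_def T_def by (rule fps_tail(2)[OF A]) (use that z1 in \<open>simp add: norm_mult\<close>)
   have "isCont q 1" unfolding q_def by (intro continuous_intros)
   then obtain d where d: "d > 0" "\<And>r. dist r 1 < d \<Longrightarrow> dist (q r) (q 1) < e / 6"
    using e unfolding continuous_at_eps_delta by (metis divide_pos_pos zero_less_numeral)
   show "\<exists>d<1. \<forall>r s. d < r \<and> r < 1 \<and> d < s \<and> s < 1 \<longrightarrow> norm (eval_fps A (of_real r * z) - eval_fps A (of_real s * z)) \<le> e"
   proof (intro exI[of _ "max (1/2) (1 - d)"] conjI allI impI)
    fix r s assume rs: "max (1 / 2) (1 - d) < r \<and> r < 1 \<and> max (1 / 2) (1 - d) < s \<and> s < 1"
    have "dist (q r) (q 1) < e / 6" "dist (q s) (q 1) < e / 6"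
    proof -
     have "dist r 1 < d" "dist s 1 < d" using rs by (auto simp: dist_real_def)
     then show "dist (q r) (q 1) < e / 6" "dist (q s) (q 1) < e / 6" by (blast intro: d(2))+
    qed
    then have "norm (q r - q s) \<le> e / 3"
     using dist_triangle2[of "q r" "q s" "q 1"] by (simp add: dist_norm)
    moreover have "norm (eval_fps (T i) (of_real r * z)) \<le> e / 3" "norm (eval_fps (T i) (of_real s * z)) \<le> e / 3"
    proof -
     have "1 / 2 \<le> r" "r < 1" "1 / 2 \<le> s" "s < 1" using rs by auto
     then show "norm (eval_fps (T i) (of_real r * z)) \<le> e / 3" "norm (eval_fps (T i) (of_real s * z)) \<le> e / 3"
      by (blast intro: tail)+
    qed
    moreover have "eval_fps A (of_real r * z) - eval_fps A (of_real s * z) = (q r - q s) + (eval_fps (T i) (of_real r * z) - eval_fps (T i) (of_real s * z))"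
     using rs by (simp add: eq)
    ultimately show "norm (eval_fps A (of_real r * z) - eval_fps A (of_real s * z)) \<le> e"
     using norm_triangle_ineq[of "q r - q s" "eval_fps (T i) (of_real r * z) - eval_fps (T i) (of_real s * z)"]
      norm_triangle_ineq4[of "eval_fps (T i) (of_real r * z)" "eval_fps (T i) (of_real s * z)"] by simp
   qed (use d in auto)
  qed
 qed
qed

lemma fatou_H2_hol:
 assumes h: "h holomorphic_on ball 0 1" and fin: "N1 2 h < \<infinity>"
 shows "AE z in circ. \<exists>L. ((\<lambda>r. h (of_real r * z)) \<longlongrightarrow> L) (at_left 1)"
proof -
 note A = ball_fps_expansion[OF h]
 have "hn 1 (fps_expansion h 0) < \<infinity>" using fin N1_2[OF A(1), of h] A(2) by metis
 from fatou_H2[OF A(1) this] show ?thesis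
 proof (rule AE_mp, intro AE_I2 impI)
  fix z :: complex assume "z \<in> space circ"
  then have z: "norm z = 1" by simp
  assume "\<exists>L. ((\<lambda>r. eval_fps (fps_expansion h 0) (of_real r * z)) \<longlongrightarrow> L) (at_left 1)"
  then obtain L where L: "((\<lambda>r. eval_fps (fps_expansion h 0) (of_real r * z)) \<longlongrightarrow> L) (at_left 1)" by blast
  have "\<forall>\<^sub>F r in at_left (1::real). r \<in> {0<..<1}" by (rule eventually_at_leftI[of 0]) auto
  then have "\<forall>\<^sub>F r in at_left (1::real). eval_fps (fps_expansion h 0) (of_real r * z) = h (of_real r * z)"
   by eventually_elim (rule A(2)[symmetric], use z in \<open>simp add: norm_mult\<close>)
  with L have "((\<lambda>r. h (of_real r * z)) \<longlongrightarrow> L) (at_left 1)" by (rule Lim_transform_eventually)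
  then show "\<exists>L. ((\<lambda>r. h (of_real r * z)) \<longlongrightarrow> L) (at_left 1)" by blast
 qed
qed

text \<open>Write \<open>f = b * u ^ k\<close>, where \<open>g = u ^ k\<close> is the zero-free majorant and
\<open>b = f / g\<close> is bounded by one. For \<open>k\<close> at least \<open>2 / p\<close>
both \<open>u\<close> and \<open>b\<close> have bounded square means, so their radial limits
exist almost everywhere.\<close>

theorem fatou_Hp:
 assumes f: "f holomorphic_on ball 0 1" and p: "p > 0" and fin: "N1 p f < \<infinity>"
 shows "AE z in circ. \<exists>L. ((\<lambda>r. f (of_real r * z)) \<longlongrightarrow> L) (at_left 1)"
proof (cases "\<exists>z\<in>ball 0 1. f z \<noteq> 0")
 case False
 show ?thesis
 proof (rule AE_I2)
  fix z :: complex assume "z \<in> space circ"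
  then have z: "norm z = 1" by simp
  have "\<forall>\<^sub>F r in at_left (1::real). r \<in> {0<..<1}" by (rule eventually_at_leftI[of 0]) auto
  then have "\<forall>\<^sub>F r in at_left (1::real). 0 = f (of_real r * z)"
   by eventually_elim (use False z in \<open>auto simp: norm_mult\<close>)
  then have "((\<lambda>r. f (of_real r * z)) \<longlongrightarrow> 0) (at_left 1)" by (rule Lim_transform_eventually[OF tendsto_const])
  then show "\<exists>L. ((\<lambda>r. f (of_real r * z)) \<longlongrightarrow> L) (at_left 1)" by blast
 qed
next
 case True
 obtain g where g: "g holomorphic_on ball 0 1" "\<And>z. z \<in> ball 0 1 \<Longrightarrow> g z \<noteq> 0"
  "\<And>z. z \<in> ball 0 1 \<Longrightarrow> norm (f z) \<le> norm (g z)" "N1 p g \<le> N1 p f"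
  using riesz_majorant[OF f True p fin] by auto
 obtain L where L: "L holomorphic_on ball 0 1" "\<And>z. z \<in> ball 0 1 \<Longrightarrow> g z = exp (L z)"
  using contractible_imp_holomorphic_log[OF g(1) convex_imp_contractible[OF convex_ball] g(2)] by metis
 obtain k :: nat where k0: "2 / p < real k" using reals_Archimedean2 by blast
 then have kpos: "k > 0" using p by (cases k) (auto simp: divide_less_0_iff not_less)
 then have k: "2 / real k \<le> p" "real k > 0" using k0 p by (auto simp: field_simps)
 define u where "u = (\<lambda>z. exp (L z / of_nat k))"
 have uh: "u holomorphic_on ball 0 1" unfolding u_def by (intro holomorphic_intros L) (use kpos in simp)
 have uk: "u z ^ k = g z" if "z \<in> ball 0 1" for z
  using L(2)[OF that] kpos by (simp add: u_def exp_of_nat_mult[symmetric])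
 have un: "norm (u z) powr 2 \<le> 1 + norm (g z) powr p" if z: "z \<in> ball 0 1" for z
 proof -
  have "norm (u z) powr 2 = norm (g z) powr (2 / real k)"
   unfolding uk[OF z, symmetric] norm_power using kpos
   by (subst powr_realpow[symmetric]) (auto simp: u_def powr_powr)
  also have "\<dots> \<le> 1 + norm (g z) powr p"
  proof (cases "norm (g z) \<le> 1")
   case True
   then have "norm (g z) powr (2 / real k) \<le> 1 powr (2 / real k)" by (intro powr_mono2) auto
   then show ?thesis using powr_ge_zero[of "norm (g z)" p] by (simp only: powr_one_eq_one)
  next
   case False
   then have "norm (g z) powr (2 / real k) \<le> norm (g z) powr p" using k by (intro powr_mono) auto
   then show ?thesis by simp
  qed
  finally show ?thesis .
 qed
 have "N1 2 u \<le> 1 + N1 p g"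
  unfolding N1_def[of 2 u]
 proof (rule SUP_least)
  fix r :: real assume r: "r \<in> {0..<1}"
  have m: "(\<lambda>z. ennreal (norm (g (of_real r * z)) powr p)) \<in> borel_measurable circ"
  proof -
   have [measurable]: "(\<lambda>z. g (of_real r * z)) \<in> borel_measurable circ"
    by (rule measurable_dilate_circ[OF holomorphic_on_imp_continuous_on[OF g(1)]]) (use r in auto)
   show ?thesis by measurable
  qed
  have "mean1 2 u r \<le> (\<integral>\<^sup>+z. 1 + ennreal (norm (g (of_real r * z)) powr p) \<partial>circ)"
   unfolding mean1_def
  proof (rule nn_integral_mono)
   fix z assume "z \<in> space circ"
   then have "of_real r * z \<in> ball 0 1" using r by (simp add: norm_mult)
   then have "ennreal (norm (u (of_real r * z)) powr 2) \<le> ennreal (1 + norm (g (of_real r * z)) powr p)"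
    by (intro ennreal_leI un)
   then show "ennreal (norm (u (of_real r * z)) powr 2) \<le> 1 + ennreal (norm (g (of_real r * z)) powr p)" by simp
  qed
  also have "\<dots> = 1 + mean1 p g r"
   unfolding mean1_def using m by (subst nn_integral_add) (auto simp: emeasure_circ_space)
  also have "\<dots> \<le> 1 + N1 p g" using r by (intro add_left_mono mean1_le_N1) auto
  finally show "mean1 2 u r \<le> 1 + N1 p g" .
 qed
 also have "\<dots> < \<infinity>" using le_less_trans[OF g(4) fin] by (simp add: ennreal_add_less_top)
 finally have uf: "N1 2 u < \<infinity>" .
 define b where "b = (\<lambda>z. f z / g z)"
 have bh: "b holomorphic_on ball 0 1" unfolding b_def by (intro holomorphic_intros f g(1)) (use g(2) in auto)
 have bn: "norm (b z) \<le> 1" if "z \<in> ball 0 1" for z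
  using g(2,3)[OF that] by (simp add: b_def norm_divide)
 have "N1 2 b \<le> 1"
  unfolding N1_def
 proof (rule SUP_least)
  fix r :: real assume r: "r \<in> {0..<1}"
  have "mean1 2 b r \<le> (\<integral>\<^sup>+z. 1 \<partial>circ)"
   unfolding mean1_def
  proof (rule nn_integral_mono)
   fix z assume "z \<in> space circ"
   then have "of_real r * z \<in> ball 0 1" using r by (simp add: norm_mult)
   then have "norm (b (of_real r * z)) powr 2 \<le> 1 powr 2" by (intro powr_mono2 bn) auto
   then show "ennreal (norm (b (of_real r * z)) powr 2) \<le> 1" by (metis ennreal_1 ennreal_leI powr_one_eq_one)
  qed
  then show "mean1 2 b r \<le> 1" by (simp add: emeasure_circ_space)
 qed
 then have bf: "N1 2 b < \<infinity>" by (rule le_less_trans) simp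
 from fatou_H2_hol[OF uh uf] fatou_H2_hol[OF bh bf] show ?thesis
 proof (rule AE_mp[OF AE_conjI], intro AE_I2 impI)
  fix z :: complex assume "z \<in> space circ"
  then have z: "norm z = 1" by simp
  assume "(\<exists>L. ((\<lambda>r. u (of_real r * z)) \<longlongrightarrow> L) (at_left 1)) \<and> (\<exists>L. ((\<lambda>r. b (of_real r * z)) \<longlongrightarrow> L) (at_left 1))"
  then obtain L1 L2 where L12: "((\<lambda>r. u (of_real r * z)) \<longlongrightarrow> L1) (at_left 1)" "((\<lambda>r. b (of_real r * z)) \<longlongrightarrow> L2) (at_left 1)" by blast
  have lim: "((\<lambda>r. b (of_real r * z) * u (of_real r * z) ^ k) \<longlongrightarrow> L2 * L1 ^ k) (at_left 1)"
   by (intro tendsto_intros L12)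
  have "\<forall>\<^sub>F r in at_left (1::real). r \<in> {0<..<1}" by (rule eventually_at_leftI[of 0]) auto
  then have "\<forall>\<^sub>F r in at_left (1::real). b (of_real r * z) * u (of_real r * z) ^ k = f (of_real r * z)"
  proof eventually_elim
   case (elim r)
   then have "of_real r * z \<in> ball 0 1" using z by (simp add: norm_mult)
   then show ?case using uk g(2) by (simp add: b_def)
  qed
  with lim have "((\<lambda>r. f (of_real r * z)) \<longlongrightarrow> L2 * L1 ^ k) (at_left 1)" by (rule Lim_transform_eventually)
  then show "\<exists>L. ((\<lambda>r. f (of_real r * z)) \<longlongrightarrow> L) (at_left 1)" by blast
 qed
qed

text \<open>The inequality \<open>\<le>\<close> is Fatou's lemma. For the converse,
\<open>|f|\<^sup>p\<close> is bounded by the squared modulus of a function with square summable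
coefficients; splitting off a tail of small norm bounds the mean of \<open>|f|\<^sup>p\<close>
by the mean of a bounded truncation and a small error that is uniform in the radius. The
truncation converges by dominated convergence.\<close>

theorem hardy_boundary_disc:
 assumes f: "f holomorphic_on ball 0 1" and p: "p > 0" and fin: "N1 p f < \<infinity>"
 shows "(\<integral>\<^sup>+z. ennreal (norm (Lim (at_left 1) (\<lambda>r. f (of_real r * z))) powr p) \<partial>circ) = N1 p f"
proof -
 define r where "r = (\<lambda>n. 1 - 1 / real (Suc n))"
 have r1: "0 \<le> r n" "r n < 1" for n by (auto simp: r_def)
 have rl: "r \<longlonglongrightarrow> 1" unfolding r_def by (rule approach_one)
 have fc: "continuous_on (ball 0 1) f" by (rule holomorphic_on_imp_continuous_on[OF f])
 have fm[measurable]: "(\<lambda>z. f (of_real (r n) * z)) \<in> borel_measurable circ" for n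
  by (rule measurable_dilate_circ[OF fc r1])
 define F where "F = (\<lambda>z. lim (\<lambda>n. f (of_real (r n) * z)))"
 have Fm[measurable]: "F \<in> borel_measurable circ" unfolding F_def by measurable
 have conv: "AE z in circ. (\<lambda>n. f (of_real (r n) * z)) \<longlonglongrightarrow> F z \<and> Lim (at_left 1) (\<lambda>r. f (of_real r * z)) = F z"
  using fatou_Hp[OF f p fin]
 proof (rule AE_mp, intro AE_I2 impI)
  fix z assume "\<exists>L. ((\<lambda>r. f (of_real r * z)) \<longlongrightarrow> L) (at_left 1)"
  then obtain L where L: "((\<lambda>r. f (of_real r * z)) \<longlongrightarrow> L) (at_left 1)" by blast
  have "(\<lambda>n. f (of_real (r n) * z)) \<longlonglongrightarrow> L" by (rule at_left_1_sequence[OF L r1(2) rl])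
  moreover have "Lim (at_left 1) (\<lambda>r. f (of_real r * z)) = L" by (rule tendsto_Lim[OF _ L]) simp
  ultimately show "(\<lambda>n. f (of_real (r n) * z)) \<longlonglongrightarrow> F z \<and> Lim (at_left 1) (\<lambda>r. f (of_real r * z)) = F z"
   unfolding F_def by (simp add: limI)
 qed
 have "(\<integral>\<^sup>+z. ennreal (norm (Lim (at_left 1) (\<lambda>r. f (of_real r * z))) powr p) \<partial>circ) = (\<integral>\<^sup>+z. ennreal (norm (F z) powr p) \<partial>circ)"
  by (rule nn_integral_cong_AE) (use conv in \<open>auto elim: eventually_mono\<close>)
 also have "\<dots> = N1 p f"
 proof (rule antisym)
  have "(\<integral>\<^sup>+z. ennreal (norm (F z) powr p) \<partial>circ) = (\<integral>\<^sup>+z. liminf (\<lambda>n. ennreal (norm (f (of_real (r n) * z)) powr p)) \<partial>circ)"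
  proof (rule nn_integral_cong_AE, use conv in eventually_elim)
   fix z assume "(\<lambda>n. f (of_real (r n) * z)) \<longlonglongrightarrow> F z \<and> Lim (at_left 1) (\<lambda>r. f (of_real r * z)) = F z"
   then have "(\<lambda>n. ennreal (norm (f (of_real (r n) * z)) powr p)) \<longlonglongrightarrow> ennreal (norm (F z) powr p)"
    using p by (intro tendsto_ennrealI tendsto_powr2 tendsto_norm tendsto_const) auto
   then show "ennreal (norm (F z) powr p) = liminf (\<lambda>n. ennreal (norm (f (of_real (r n) * z)) powr p))"
    by (intro lim_imp_Liminf[symmetric]) auto
  qed
  also have "\<dots> \<le> liminf (\<lambda>n. mean1 p f (r n))"
   unfolding mean1_def by (rule nn_integral_liminf) measurable
  also have "\<dots> \<le> N1 p f"
  proof (rule Liminf_le)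
   show "\<forall>\<^sub>F n in sequentially. mean1 p f (r n) \<le> N1 p f"
    by (rule always_eventually) (intro allI mean1_le_N1 r1)
  qed simp
  finally show "(\<integral>\<^sup>+z. ennreal (norm (F z) powr p) \<partial>circ) \<le> N1 p f" .
 next
  show "N1 p f \<le> (\<integral>\<^sup>+z. ennreal (norm (F z) powr p) \<partial>circ)"
  proof (cases "\<exists>z\<in>ball 0 1. f z \<noteq> 0")
   case False
   have "mean1 p f s = 0" if "0 \<le> s" "s < 1" for s
   proof -
    have "mean1 p f s = (\<integral>\<^sup>+z. 0 \<partial>circ)" unfolding mean1_def
     by (rule nn_integral_cong) (use False that in \<open>auto simp: norm_mult\<close>)
    then show ?thesis by simp
   qed
   then have "N1 p f \<le> 0" unfolding N1_def by (intro SUP_least) auto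
   then show ?thesis by simp
  next
   case True
   obtain g where g: "g holomorphic_on ball 0 1" "\<And>z. z \<in> ball 0 1 \<Longrightarrow> g z \<noteq> 0"
    "\<And>z. z \<in> ball 0 1 \<Longrightarrow> norm (f z) \<le> norm (g z)" "N1 p g \<le> N1 p f"
    using riesz_majorant[OF f True p fin] by auto
   obtain A where A: "fps_conv_radius A \<ge> 1"
    "\<And>z. z \<in> ball 0 1 \<Longrightarrow> norm (g z) powr p = (norm (eval_fps A z))\<^sup>2" "N1 p g = hn 1 A"
    using half_power_fps[OF g(1,2), of p] by blast
   have hA: "hn 1 A < \<infinity>" using A(3) le_less_trans[OF g(4) fin] by simp
   show ?thesis
   proof (rule ennreal_le_epsilon)
    fix e :: real assume e: "0 < e"
    obtain n where n: "hn 1 (fps_tail n A) \<le> ennreal (e / 2)" using hn_tail_small[OF hA, of "e / 2"] e by auto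
    define T where "T = fps_tail n A"
    have Tr: "fps_conv_radius T \<ge> 1" unfolding T_def by (rule fps_tail(1)[OF A(1)])
    define q where "q = (\<lambda>z. \<Sum>k<n. fps_nth A k * z ^ k)"
    \<comment> \<open>The head of the series is bounded by a constant, and (s + t)^2 is at most 2 s^2 + 2 t^2.\<close>
    define K where "K = 2 * (\<Sum>k<n. norm (fps_nth A k))\<^sup>2"
    have qb: "2 * (norm (q z))\<^sup>2 \<le> K" if "norm z \<le> 1" for z
    proof -
     have "norm (q z) \<le> (\<Sum>k<n. norm (fps_nth A k))"
      unfolding q_def
     proof (rule order_trans[OF norm_sum sum_mono])
      fix k show "norm (fps_nth A k * z ^ k) \<le> norm (fps_nth A k)"
       using power_le_one[OF norm_ge_zero that, of k] by (simp add: norm_mult norm_power mult_left_le)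
     qed
     then have "(norm (q z))\<^sup>2 \<le> (\<Sum>k<n. norm (fps_nth A k))\<^sup>2" by (rule power_mono) simp
     then show ?thesis by (simp add: K_def)
    qed
    have pw: "norm (f z) powr p \<le> min (norm (f z) powr p) K + 2 * (norm (eval_fps T z))\<^sup>2" if z: "z \<in> ball 0 1" for z
    proof -
     have "norm (f z) powr p \<le> norm (g z) powr p" by (intro powr_mono2) (use p g(3)[OF z] in auto)
     also have "\<dots> = (norm (q z + eval_fps T z))\<^sup>2"
      unfolding A(2)[OF z] q_def T_def using fps_tail(2)[OF A(1), of z n] z by simp
     also have "\<dots> \<le> (norm (q z) + norm (eval_fps T z))\<^sup>2" by (intro power_mono norm_triangle_ineq) simp
     also have "\<dots> \<le> 2 * (norm (q z))\<^sup>2 + 2 * (norm (eval_fps T z))\<^sup>2"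
      using zero_le_power2[of "norm (q z) - norm (eval_fps T z)"] by (simp add: power2_eq_square algebra_simps)
     also have "\<dots> \<le> K + 2 * (norm (eval_fps T z))\<^sup>2" using qb[of z] z by simp
     finally show ?thesis by (auto simp: min_def)
    qed
    have mT: "(\<lambda>z. ennreal ((norm (eval_fps T (of_real s * z))) powr 2)) \<in> borel_measurable circ" for s
     by (rule borel_measurable_circI) measurable
    define I where "I = (\<lambda>n. \<integral>\<^sup>+z. ennreal (min (norm (f (of_real (r n) * z)) powr p) K) \<partial>circ)"
    have step: "mean1 p f (r n) \<le> I n + ennreal e" for n
    proof -
     have "mean1 p f (r n) \<le> (\<integral>\<^sup>+z. ennreal (min (norm (f (of_real (r n) * z)) powr p) K) + 2 * ennreal ((norm (eval_fps T (of_real (r n) * z))) powr 2) \<partial>circ)"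
      unfolding mean1_def
     proof (rule nn_integral_mono)
      fix z assume "z \<in> space circ"
      then have "of_real (r n) * z \<in> ball 0 1" using r1[of n] by (simp add: norm_mult)
      from ennreal_leI[OF pw[OF this]]
      show "ennreal (norm (f (of_real (r n) * z)) powr p) \<le> ennreal (min (norm (f (of_real (r n) * z)) powr p) K) + 2 * ennreal ((norm (eval_fps T (of_real (r n) * z))) powr 2)"
       using ennreal_mult[of 2 "(norm (eval_fps T (of_real (r n) * z)))\<^sup>2"] by (simp add: K_def ennreal_plus)
     qed
     also have "\<dots> = I n + 2 * mean1 2 (eval_fps T) (r n)"
      unfolding I_def mean1_def using mT[of "r n"] by (subst nn_integral_add) (auto simp: nn_integral_cmult)
     also have "mean1 2 (eval_fps T) (r n) \<le> N1 2 (eval_fps T)" by (rule mean1_le_N1[OF r1])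
     also have "N1 2 (eval_fps T) = hn 1 T" by (rule N1_2[OF Tr]) simp
     also have "hn 1 T \<le> ennreal (e / 2)" using n by (simp add: T_def)
     also have "2 * ennreal (e / 2) = ennreal e" using e ennreal_mult[of 2 "e / 2"] by simp
     finally show ?thesis by (simp add: add_left_mono mult_left_mono)
    qed
    have "I \<longlonglongrightarrow> (\<integral>\<^sup>+z. ennreal (min (norm (F z) powr p) K) \<partial>circ)"
     unfolding I_def
    proof (rule nn_integral_dominated_convergence[where w="\<lambda>_. ennreal K"])
     show "(\<integral>\<^sup>+z. ennreal K \<partial>circ) < \<infinity>" by (simp add: emeasure_circ_space)
     show "AE z in circ. (\<lambda>n. ennreal (min (norm (f (of_real (r n) * z)) powr p) K)) \<longlonglongrightarrow> ennreal (min (norm (F z) powr p) K)"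
      using conv
     proof eventually_elim
      case (elim z)
      then show ?case
       using p by (intro tendsto_ennrealI tendsto_min tendsto_powr2 tendsto_norm tendsto_const) auto
     qed
    qed (auto intro!: AE_I2 ennreal_leI)
    then have lim: "(\<lambda>n. I n + ennreal e) \<longlonglongrightarrow> (\<integral>\<^sup>+z. ennreal (min (norm (F z) powr p) K) \<partial>circ) + ennreal e"
     by (intro tendsto_add tendsto_const)
    have "mean1 p f s \<le> (\<integral>\<^sup>+z. ennreal (min (norm (F z) powr p) K) \<partial>circ) + ennreal e" if s: "0 \<le> s" "s < 1" for s
    proof (rule tendsto_lowerbound[OF lim])
     have "\<forall>\<^sub>F n in sequentially. s < r n" using rl s(2) by (rule order_tendstoD(1))
     then show "\<forall>\<^sub>F n in sequentially. mean1 p f s \<le> I n + ennreal e"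
     proof eventually_elim
      case (elim n)
      have "mean1 p f s \<le> mean1 p f (r n)" by (rule mean1_mono[OF f p s(1)]) (use elim r1 in auto)
      then show ?case using step by (rule order_trans)
     qed
    qed simp
    then have "N1 p f \<le> (\<integral>\<^sup>+z. ennreal (min (norm (F z) powr p) K) \<partial>circ) + ennreal e"
     unfolding N1_def by (intro SUP_least) auto
    also have "\<dots> \<le> (\<integral>\<^sup>+z. ennreal (norm (F z) powr p) \<partial>circ) + ennreal e"
     by (intro add_right_mono nn_integral_mono ennreal_leI) simp
    finally show "N1 p f \<le> (\<integral>\<^sup>+z. ennreal (norm (F z) powr p) \<partial>circ) + ennreal e" .
   qed
  qed
 qed
 finally show ?thesis .
qed

section \<open>Tensorization of the inequality\<close>

lemma nn_integral_le_eq_imp_AE_eq: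
 assumes [measurable]: "f \<in> borel_measurable M" "g \<in> borel_measurable M"
  and le: "\<And>x. x \<in> space M \<Longrightarrow> f x \<le> g x" and eq: "(\<integral>\<^sup>+x. f x \<partial>M) = (\<integral>\<^sup>+x. g x \<partial>M)"
  and fin: "(\<integral>\<^sup>+x. g x \<partial>M) < \<infinity>"
 shows "AE x in M. f x = g x"
proof -
 have "(\<integral>\<^sup>+x. g x - f x \<partial>M) = (\<integral>\<^sup>+x. g x \<partial>M) - (\<integral>\<^sup>+x. f x \<partial>M)"
  by (rule nn_integral_diff) (use fin eq le in \<open>auto intro!: AE_I2\<close>)
 also have "\<dots> = 0" using eq fin by simp
 finally have "AE x in M. g x - f x = 0" by (subst (asm) nn_integral_0_iff_AE) auto
 moreover have "AE x in M. f x \<le> g x" by (rule AE_I2) (rule le)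
 moreover have "AE x in M. g x \<noteq> \<infinity>" by (rule nn_integral_PInf_AE) (use fin in auto)
 ultimately show ?thesis
 proof eventually_elim
  case (elim x)
  then have "g x \<le> f x" using ennreal_minus_eq_0 by blast
  then show ?case using elim(2) by simp
 qed
qed

text \<open>A product of integrals is one integral over a power of \<open>N\<close>, with a separate
variable for each factor. After exchanging the order of integration the assumption applies to
every fixed choice of these variables. This replaces Minkowski's inequality, and equality is
inherited by almost every choice.\<close>

lemma tensor:
 fixes M :: "'x measure" and N :: "'w measure" and u :: "'j \<Rightarrow> 'x \<Rightarrow> 'w \<Rightarrow> ennreal"
 assumes M: "sigma_finite_measure M" and N: "sigma_finite_measure N" and J: "finite J"
  and u: "\<And>j. j \<in> J \<Longrightarrow> (\<lambda>(x, w). u j x w) \<in> borel_measurable (M \<Otimes>\<^sub>M N)"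
  and c: "\<And>j. j \<in> J \<Longrightarrow> c j \<in> borel_measurable N"
  and le: "\<And>\<omega>. (\<And>j. j \<in> J \<Longrightarrow> \<omega> j \<in> space N) \<Longrightarrow> (\<integral>\<^sup>+x. (\<Prod>j\<in>J. u j x (\<omega> j)) \<partial>M) \<le> (\<Prod>j\<in>J. c j (\<omega> j))"
 shows "(\<integral>\<^sup>+x. (\<Prod>j\<in>J. \<integral>\<^sup>+w. u j x w \<partial>N) \<partial>M) \<le> (\<Prod>j\<in>J. \<integral>\<^sup>+w. c j w \<partial>N)" (is "?L \<le> ?R")
  and "(\<integral>\<^sup>+x. (\<Prod>j\<in>J. \<integral>\<^sup>+w. u j x w \<partial>N) \<partial>M) = (\<Prod>j\<in>J. \<integral>\<^sup>+w. c j w \<partial>N) \<Longrightarrow> (\<Prod>j\<in>J. \<integral>\<^sup>+w. c j w \<partial>N) < \<infinity> \<Longrightarrow>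
   AE \<omega> in PiM J (\<lambda>_. N). (\<integral>\<^sup>+x. (\<Prod>j\<in>J. u j x (\<omega> j)) \<partial>M) = (\<Prod>j\<in>J. c j (\<omega> j))"
  and "(\<integral>\<^sup>+x. (\<Prod>j\<in>J. \<integral>\<^sup>+w. u j x w \<partial>N) \<partial>M) = (\<integral>\<^sup>+x. \<integral>\<^sup>+\<omega>. (\<Prod>j\<in>J. u j x (\<omega> j)) \<partial>PiM J (\<lambda>_. N) \<partial>M)"
proof -
 interpret M: sigma_finite_measure M by fact
 interpret N: sigma_finite_measure N by fact
 interpret P: product_sigma_finite "\<lambda>_. N" by standard
 interpret PJ: sigma_finite_measure "PiM J (\<lambda>_. N)" by (rule P.sigma_finite[OF J])
 interpret MP: pair_sigma_finite M "PiM J (\<lambda>_. N)" by standard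
 have ux: "u j x \<in> borel_measurable N" if "j \<in> J" "x \<in> space M" for j x
  using measurable_Pair2[OF u[OF that(1)] that(2)] by simp
 have meas[measurable]: "(\<lambda>p. \<Prod>j\<in>J. u j (fst p) (snd p j)) \<in> borel_measurable (M \<Otimes>\<^sub>M PiM J (\<lambda>_. N))"
 proof (rule borel_measurable_prod_ennreal)
  fix j assume j: "j \<in> J"
  have "(\<lambda>p. (fst p, snd p j)) \<in> measurable (M \<Otimes>\<^sub>M PiM J (\<lambda>_. N)) (M \<Otimes>\<^sub>M N)"
   using j by measurable
  from measurable_compose[OF this u[OF j]]
  show "(\<lambda>p. u j (fst p) (snd p j)) \<in> borel_measurable (M \<Otimes>\<^sub>M PiM J (\<lambda>_. N))" by simp
 qed
 have cm[measurable]: "(\<lambda>\<omega>. \<Prod>j\<in>J. c j (\<omega> j)) \<in> borel_measurable (PiM J (\<lambda>_. N))"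
  by (rule borel_measurable_prod_ennreal) (use c in measurable)
 have fm: "(\<lambda>\<omega>. \<integral>\<^sup>+x. (\<Prod>j\<in>J. u j x (\<omega> j)) \<partial>M) \<in> borel_measurable (PiM J (\<lambda>_. N))"
 proof -
  have "(\<lambda>(\<omega>, x). \<Prod>j\<in>J. u j x (\<omega> j)) \<in> borel_measurable (PiM J (\<lambda>_. N) \<Otimes>\<^sub>M M)"
   using measurable_compose[OF measurable_pair_swap' meas] by (simp add: case_prod_beta')
  then show ?thesis by (rule M.borel_measurable_nn_integral)
 qed
 show L: "?L = (\<integral>\<^sup>+x. \<integral>\<^sup>+\<omega>. (\<Prod>j\<in>J. u j x (\<omega> j)) \<partial>PiM J (\<lambda>_. N) \<partial>M)"
  by (rule nn_integral_cong) (subst P.product_nn_integral_prod[OF J], auto simp: ux)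
 also have "\<dots> = (\<integral>\<^sup>+\<omega>. \<integral>\<^sup>+x. (\<Prod>j\<in>J. u j x (\<omega> j)) \<partial>M \<partial>PiM J (\<lambda>_. N))"
  by (rule MP.Fubini'[symmetric]) (simp add: case_prod_beta')
 finally have L2: "?L = (\<integral>\<^sup>+\<omega>. \<integral>\<^sup>+x. (\<Prod>j\<in>J. u j x (\<omega> j)) \<partial>M \<partial>PiM J (\<lambda>_. N))" .
 have R: "?R = (\<integral>\<^sup>+\<omega>. (\<Prod>j\<in>J. c j (\<omega> j)) \<partial>PiM J (\<lambda>_. N))"
  by (rule P.product_nn_integral_prod[OF J c, symmetric])
 have le': "(\<integral>\<^sup>+x. (\<Prod>j\<in>J. u j x (\<omega> j)) \<partial>M) \<le> (\<Prod>j\<in>J. c j (\<omega> j))" if "\<omega> \<in> space (PiM J (\<lambda>_. N))" for \<omega>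
  by (rule le) (use that in \<open>auto simp: space_PiM PiE_iff\<close>)
 show "?L \<le> ?R" unfolding L2 R by (rule nn_integral_mono) (rule le')
 show "AE \<omega> in PiM J (\<lambda>_. N). (\<integral>\<^sup>+x. (\<Prod>j\<in>J. u j x (\<omega> j)) \<partial>M) = (\<Prod>j\<in>J. c j (\<omega> j))"
  if "?L = ?R" "?R < \<infinity>"
  by (rule nn_integral_le_eq_imp_AE_eq[OF fm cm le']) (use that in \<open>auto simp: L2 R\<close>)
qed

lemma SUP_mult_incseq:
 fixes a b :: "nat \<Rightarrow> ennreal"
 assumes "incseq a" "incseq b"
 shows "(SUP n. a n) * (SUP n. b n) = (SUP n. a n * b n)"
proof (rule antisym)
 have "(SUP n. a n) * (SUP n. b n) = (SUP n. SUP k. a n * b k)"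
  unfolding SUP_mult_right_ennreal SUP_mult_left_ennreal by (rule SUP_commute)
 also have "\<dots> \<le> (SUP n. a n * b n)"
 proof (intro SUP_least)
  fix n k
  have "a n * b k \<le> a (max n k) * b (max n k)"
   by (intro mult_mono) (use assms in \<open>auto simp: incseq_def\<close>)
  also have "\<dots> \<le> (SUP n. a n * b n)" by (rule SUP_upper) simp
  finally show "a n * b k \<le> (SUP n. a n * b n)" .
 qed
 finally show "(SUP n. a n) * (SUP n. b n) \<le> (SUP n. a n * b n)" .
 show "(SUP n. a n * b n) \<le> (SUP n. a n) * (SUP n. b n)"
  by (intro SUP_least mult_mono SUP_upper) auto
qed

lemma incseq_prod_ennreal:
 fixes a :: "'j \<Rightarrow> nat \<Rightarrow> ennreal"
 assumes "\<And>j. j \<in> J \<Longrightarrow> incseq (a j)"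
 shows "incseq (\<lambda>n. \<Prod>j\<in>J. a j n)"
 unfolding incseq_def by (intro allI impI prod_mono_ennreal) (use assms in \<open>auto simp: incseq_def\<close>)

lemma prod_SUP_incseq:
 fixes a :: "'j \<Rightarrow> nat \<Rightarrow> ennreal"
 assumes "finite J" "\<And>j. j \<in> J \<Longrightarrow> incseq (a j)"
 shows "(\<Prod>j\<in>J. SUP n. a j n) = (SUP n. \<Prod>j\<in>J. a j n)"
 using assms
proof (induction J rule: finite_induct)
 case (insert j J)
 have "(SUP n. a j n) * (SUP n. \<Prod>j\<in>J. a j n) = (SUP n. a j n * (\<Prod>j\<in>J. a j n))"
  by (rule SUP_mult_incseq) (use insert.prems in \<open>auto intro: incseq_prod_ennreal\<close>)
 then show ?case using insert by simp
qed simp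

lemma emeasure_berg_space: "emeasure (berg q) (ball 0 1) = 1"
proof -
 have "emeasure (berg q) (ball 0 1) = (\<integral>\<^sup>+z. ennreal ((norm (eval_fps 1 z))\<^sup>2) \<partial>berg q)"
  by simp
 also have "\<dots> = hn (q + 2) 1" by (rule parseval_berg) simp
 also have "\<dots> = (\<Sum>k\<in>{0}. ennreal ((norm (fps_nth (1::complex fps) k))\<^sup>2 / real ((k + (q + 2) - 1) choose k)))"
  unfolding hn_def by (rule suminf_finite) auto
 finally show ?thesis by simp
qed

interpretation berg: finite_measure "berg q" for q
 by standard (simp add: emeasure_berg_space)

interpretation circs: product_sigma_finite "\<lambda>_. circ"
 by standard

interpretation bergs: product_sigma_finite "\<lambda>_. berg q" for q
 by standard

text \<open>Points of a polydisc with coordinates in a set \<open>I\<close> are functions on the whole index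
type whose values outside \<open>I\<close> are irrelevant; in this way the number of variables
can change in an induction.\<close>

definition polyd :: "'i set \<Rightarrow> ('i \<Rightarrow> complex) set" where
 "polyd I = {x. \<forall>i\<in>I. norm (x i) < 1}"

text \<open>The functions for which the one-variable theory can be used in each coordinate. The exponent and
the holomorphic function may depend on the slice, so that the class contains
\<open>|F|\<^sup>p\<close> and also products such as \<open>|F|\<^sup>p
|\<alpha>|\<^sup>2\<close>, and is stable when a coordinate is fixed.\<close>

definition slice_mod :: "'i set \<Rightarrow> (('i \<Rightarrow> complex) \<Rightarrow> real) \<Rightarrow> bool" where
 "slice_mod I u \<longleftrightarrow> continuous_on (polyd I) u \<and> (\<forall>x\<in>polyd I. 0 \<le> u x) \<and>
  (\<forall>x y. (\<forall>i\<in>I. x i = y i) \<longrightarrow> u x = u y) \<and>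
  (\<forall>x\<in>polyd I. \<forall>i\<in>I. \<exists>h p. h holomorphic_on ball 0 1 \<and> p > 0 \<and>
    (\<forall>w\<in>ball 0 1. u (x(i := w)) = norm (h w) powr p))"

definition dil :: "('i \<Rightarrow> real) \<Rightarrow> ('i \<Rightarrow> complex) \<Rightarrow> 'i \<Rightarrow> complex" where
 "dil \<rho> x = (\<lambda>i. of_real (\<rho> i) * x i)"

definition meanI :: "'i set \<Rightarrow> ('i \<Rightarrow> real) \<Rightarrow> (('i \<Rightarrow> complex) \<Rightarrow> real) \<Rightarrow> ennreal" where
 "meanI I \<rho> u = (\<integral>\<^sup>+x. ennreal (u (dil \<rho> x)) \<partial>PiM I (\<lambda>_. circ))"

definition NI :: "'i set \<Rightarrow> (('i \<Rightarrow> complex) \<Rightarrow> real) \<Rightarrow> ennreal" where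
 "NI I u = (SUP r\<in>{0..<1}. meanI I (\<lambda>_. r) u)"

lemma measurable_polyd:
 fixes u :: "('i::finite \<Rightarrow> complex) \<Rightarrow> 'b :: topological_space"
 assumes u: "continuous_on (polyd I) u" and G: "\<And>i. (\<lambda>a. G a i) \<in> borel_measurable M"
  and GI: "\<And>a. a \<in> space M \<Longrightarrow> G a \<in> polyd I"
 shows "(\<lambda>a. u (G a)) \<in> borel_measurable M"
proof -
 have "G \<in> borel_measurable M" by (rule measurable_coordinatewise_then_product[OF G])
 then have "G \<in> measurable M (restrict_space borel (polyd I))"
  by (rule measurable_restrict_space2[rotated]) (use GI in auto)
 then show ?thesis
  using borel_measurable_continuous_on_restrict[OF u] by (rule measurable_compose)
qed

lemma measurable_coord:
 assumes "\<And>i. i \<in> I \<Longrightarrow> sets (M i) = sets (restrict_space borel (S i))"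
 shows "(\<lambda>x. x i :: complex) \<in> borel_measurable (PiM I M)"
proof (cases "i \<in> I")
 case True
 have "(\<lambda>z. z) \<in> borel_measurable (M i)"
  unfolding measurable_cong_sets[OF assms[OF True] refl] by (rule measurable_restrict_space1) simp
 from this show ?thesis
  by (rule measurable_compose[where f="\<lambda>x. x i" and g="\<lambda>z. z", OF measurable_component_singleton[OF True]])
next
 case False
 have "(\<lambda>x. undefined :: complex) \<in> borel_measurable (PiM I M)" by simp
 then show ?thesis
  by (rule measurable_cong[THEN iffD1, rotated]) (use False in \<open>auto simp: space_PiM PiE_def extensional_def\<close>)
qed

lemma measurable_coord_circ [measurable]: "(\<lambda>x. x i) \<in> borel_measurable (PiM I (\<lambda>_. circ))"
 by (rule measurable_coord) (rule sets_circ)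

lemma measurable_coord_berg [measurable]: "(\<lambda>x. x i) \<in> borel_measurable (PiM I (\<lambda>_. berg q))"
 by (rule measurable_coord) (rule sets_berg)

lemma measurable_id_circ' [measurable]: "(\<lambda>z. z) \<in> borel_measurable circ"
 by (rule measurable_id_circ)

lemma measurable_id_berg' [measurable]: "(\<lambda>z. z) \<in> borel_measurable (berg q)"
 by (rule borel_measurable_bergI) simp

lemma dil_upd: "dil \<rho> (x(k := w)) = (dil \<rho> x)(k := of_real (\<rho> k) * w)"
 by (auto simp: dil_def)

lemma norm_less_one_mult: "0 \<le> r \<Longrightarrow> r < 1 \<Longrightarrow> norm w \<le> 1 \<Longrightarrow> norm (of_real r * w :: complex) < 1"
 using mult_left_le[of "norm w" r] by (simp add: norm_mult)

lemma norm_less_one_mult': "0 \<le> r \<Longrightarrow> r \<le> 1 \<Longrightarrow> norm w < 1 \<Longrightarrow> norm (of_real r * w :: complex) < 1"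
 using mult_left_le_one_le[of "norm w" r] by (simp add: norm_mult)

lemma polyd_upd: "x \<in> polyd I \<Longrightarrow> norm w < 1 \<Longrightarrow> x(k := w) \<in> polyd (insert k I)"
 by (auto simp: polyd_def)

lemma polyd_upd': "x \<in> polyd I \<Longrightarrow> norm w < 1 \<Longrightarrow> x(k := w) \<in> polyd I"
 by (auto simp: polyd_def)

lemma polyd_circs: "x \<in> space (PiM I (\<lambda>_. circ)) \<Longrightarrow> (\<forall>i. 0 \<le> \<rho> i \<and> \<rho> i < 1) \<Longrightarrow> dil \<rho> x \<in> polyd I"
 by (auto simp: polyd_def dil_def space_PiM PiE_iff intro!: norm_less_one_mult)

lemma polyd_bergs: "x \<in> space (PiM I (\<lambda>_. berg q)) \<Longrightarrow> x \<in> polyd I"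
 by (auto simp: polyd_def space_PiM PiE_iff)

lemma polyd_dil: "x \<in> polyd I \<Longrightarrow> (\<forall>i. 0 \<le> \<rho> i \<and> \<rho> i \<le> 1) \<Longrightarrow> dil \<rho> x \<in> polyd I"
 by (auto simp: polyd_def dil_def intro!: norm_less_one_mult')

lemma slice_modD:
 assumes "slice_mod I u"
 shows "continuous_on (polyd I) u" "x \<in> polyd I \<Longrightarrow> 0 \<le> u x" "(\<And>i. i \<in> I \<Longrightarrow> x i = y i) \<Longrightarrow> u x = u y"
 using assms by (auto simp: slice_mod_def)

lemma slice_mod_slice:
 assumes u: "slice_mod (insert k I) u" and x: "x \<in> polyd I"
 shows "\<exists>h p. h holomorphic_on ball 0 1 \<and> p > 0 \<and> (\<forall>w\<in>ball 0 1. u (x(k := w)) = norm (h w) powr p)"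
proof -
 have "x(k := 0) \<in> polyd (insert k I)" by (rule polyd_upd[OF x]) simp
 then have "\<exists>h p. h holomorphic_on ball 0 1 \<and> p > 0 \<and> (\<forall>w\<in>ball 0 1. u ((x(k := 0))(k := w)) = norm (h w) powr p)"
  using u unfolding slice_mod_def by blast
 then show ?thesis by simp
qed

lemma continuous_on_upd:
 "continuous_on S (\<lambda>x. x(k := a))" for S :: "('i \<Rightarrow> complex) set"
proof (rule continuous_on_coordinatewise_then_product)
 fix i
 have "continuous_on S (\<lambda>x. x i)"
  by (rule continuous_on_subset[OF continuous_on_product_coordinates subset_UNIV])
 then show "continuous_on S (\<lambda>x. (x(k := a)) i)" by (cases "i = k") auto
qed

lemma slice_mod_upd:
 assumes u: "slice_mod (insert k I) u" and k: "k \<notin> I" and a: "norm a < 1"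
 shows "slice_mod I (\<lambda>x. u (x(k := a)))"
 unfolding slice_mod_def
proof (intro conjI ballI allI impI)
 show "continuous_on (polyd I) (\<lambda>x. u (x(k := a)))"
  by (rule continuous_on_compose2[OF slice_modD(1)[OF u] continuous_on_upd]) (use a in \<open>auto intro: polyd_upd\<close>)
 show "0 \<le> u (x(k := a))" if "x \<in> polyd I" for x
  by (rule slice_modD(2)[OF u]) (use that a in \<open>auto intro: polyd_upd\<close>)
 show "u (x(k := a)) = u (y(k := a))" if "\<forall>i\<in>I. x i = y i" for x y
  by (rule slice_modD(3)[OF u]) (use that in auto)
 fix x i assume x: "x \<in> polyd I" and i: "i \<in> I"
 have "\<exists>h p. h holomorphic_on ball 0 1 \<and> p > 0 \<and> (\<forall>w\<in>ball 0 1. u ((x(k := a))(i := w)) = norm (h w) powr p)"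
  using u polyd_upd[OF x a, of k] i unfolding slice_mod_def by blast
 moreover have "(x(k := a))(i := w) = (x(i := w))(k := a)" for w using i k by (auto simp: fun_upd_twist)
 ultimately show "\<exists>h p. h holomorphic_on ball 0 1 \<and> p > 0 \<and> (\<forall>w\<in>ball 0 1. u ((x(i := w))(k := a)) = norm (h w) powr p)"
  by simp
qed

text \<open>The one-variable theorem for the dilated function, whose norm is at most its mean over the
circle of radius \<open>r\<close>.\<close>

lemma disc_slice_ineq:
 fixes v :: "nat \<Rightarrow> complex \<Rightarrow> real"
 assumes m: "m \<ge> 2" and v: "\<And>j. j \<in> {1..m} \<Longrightarrow> \<exists>h p. h holomorphic_on ball 0 1 \<and> p > 0 \<and> (\<forall>w\<in>ball 0 1. v j w = norm (h w) powr p)"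
  and r: "0 \<le> r" "r < 1"
 shows "(\<integral>\<^sup>+w. (\<Prod>j=1..m. ennreal (v j (of_real r * w))) \<partial>berg (m - 2)) \<le> (\<Prod>j=1..m. \<integral>\<^sup>+w. ennreal (v j (of_real r * w)) \<partial>circ)"
proof -
 obtain h p where hp: "\<And>j. j \<in> {1..m} \<Longrightarrow> h j holomorphic_on ball 0 1 \<and> p j > 0 \<and> (\<forall>w\<in>ball 0 1. v j w = norm (h j w) powr p j)"
  using v by metis
 define H where "H = (\<lambda>j w. h j (of_real r * w))"
 have Hh: "H j holomorphic_on ball 0 1" if "j \<in> {1..m}" for j
  unfolding H_def
  by (rule holomorphic_on_compose_gen[OF _ conjunct1[OF hp[OF that]], unfolded o_def])
   (use r norm_less_one_mult' in \<open>auto intro!: holomorphic_intros\<close>)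
 have "(\<integral>\<^sup>+w. (\<Prod>j=1..m. ennreal (v j (of_real r * w))) \<partial>berg (m - 2)) = (\<integral>\<^sup>+w. ennreal (\<Prod>j=1..m. norm (H j w) powr p j) \<partial>berg (m - 2))"
 proof (rule nn_integral_cong)
  fix w assume "w \<in> space (berg (m - 2))"
  then have w: "of_real r * w \<in> ball 0 1" using r norm_less_one_mult'[of r w] by simp
  have "(\<Prod>j=1..m. ennreal (v j (of_real r * w))) = (\<Prod>j=1..m. ennreal (norm (H j w) powr p j))"
   by (rule prod.cong[OF refl]) (use hp w in \<open>auto simp: H_def\<close>)
  then show "(\<Prod>j=1..m. ennreal (v j (of_real r * w))) = ennreal (\<Prod>j=1..m. norm (H j w) powr p j)"
   by (simp add: prod_ennreal)
 qed
 also have "\<dots> \<le> (\<Prod>j=1..m. N1 (p j) (H j))"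
  by (rule burbea_disc_le[OF m]) (use hp Hh in auto)
 also have "\<dots> \<le> (\<Prod>j=1..m. \<integral>\<^sup>+w. ennreal (v j (of_real r * w)) \<partial>circ)"
 proof (rule prod_mono_ennreal)
  fix j assume j: "j \<in> {1..m}"
  have "N1 (p j) (H j) \<le> mean1 (p j) (h j) r"
   unfolding N1_def
  proof (rule SUP_least)
   fix s :: real assume s: "s \<in> {0..<1}"
   have "mean1 (p j) (H j) s = mean1 (p j) (h j) (r * s)" unfolding H_def by (rule mean1_dilate)
   also have "\<dots> \<le> mean1 (p j) (h j) r"
    by (rule mean1_mono) (use hp[OF j] r s in \<open>auto intro: mult_left_le\<close>)
   finally show "mean1 (p j) (H j) s \<le> mean1 (p j) (h j) r" .
  qed
  also have "\<dots> = (\<integral>\<^sup>+w. ennreal (v j (of_real r * w)) \<partial>circ)"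
   unfolding mean1_def by (rule nn_integral_cong) (use hp[OF j] r norm_less_one_mult in \<open>auto simp: norm_mult\<close>)
  finally show "N1 (p j) (H j) \<le> (\<integral>\<^sup>+w. ennreal (v j (of_real r * w)) \<partial>circ)" .
 qed
 finally show ?thesis .
qed

lemma slice_mean_mono:
 assumes v: "\<exists>h p. h holomorphic_on ball 0 1 \<and> p > 0 \<and> (\<forall>w\<in>ball 0 1. v w = norm (h w) powr p)"
  and r: "0 \<le> r" "r \<le> s" "s < 1"
 shows "(\<integral>\<^sup>+w. ennreal (v (of_real r * w)) \<partial>circ) \<le> (\<integral>\<^sup>+w. ennreal (v (of_real s * w)) \<partial>circ)"
proof -
 obtain h p where hp: "h holomorphic_on ball 0 1" "p > 0" "\<And>w. w \<in> ball 0 1 \<Longrightarrow> v w = norm (h w) powr p"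
  using v by auto
 have eq: "(\<integral>\<^sup>+w. ennreal (v (of_real t * w)) \<partial>circ) = mean1 p h t" if "0 \<le> t" "t < 1" for t
  unfolding mean1_def by (rule nn_integral_cong) (use hp(3) that in \<open>auto simp: norm_mult\<close>)
 show ?thesis using mean1_mono[OF hp(1,2) r] eq r by simp
qed

lemma meanI_insert_measurable:
 fixes u :: "('i::finite \<Rightarrow> complex) \<Rightarrow> real"
 assumes u: "slice_mod (insert k I) u" and \<rho>: "\<forall>i. 0 \<le> \<rho> i \<and> \<rho> i < 1"
 shows "(\<lambda>p. ennreal (u (dil \<rho> ((fst p)(k := snd p))))) \<in> borel_measurable (PiM I (\<lambda>_. circ) \<Otimes>\<^sub>M circ)"
  and "(\<lambda>p. ennreal (u ((dil \<rho> (fst p))(k := of_real (\<rho> k) * snd p)))) \<in> borel_measurable (PiM I (\<lambda>_. berg q) \<Otimes>\<^sub>M circ)"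
  and "(\<lambda>x. ennreal (u (dil \<rho> x))) \<in> borel_measurable (PiM (insert k I) (\<lambda>_. circ))"
  and "(\<lambda>x. ennreal (u (dil \<rho> x))) \<in> borel_measurable (PiM (insert k I) (\<lambda>_. berg q))"
proof -
 have 1: "(\<lambda>p. u (dil \<rho> ((fst p)(k := snd p)))) \<in> borel_measurable (PiM I (\<lambda>_. circ) \<Otimes>\<^sub>M circ)"
 proof (rule measurable_polyd[OF slice_modD(1)[OF u]])
  show "(\<lambda>p. dil \<rho> ((fst p)(k := snd p)) i) \<in> borel_measurable (PiM I (\<lambda>_. circ) \<Otimes>\<^sub>M circ)" for i
   by (cases "i = k") (simp_all add: dil_def)
  show "dil \<rho> ((fst p)(k := snd p)) \<in> polyd (insert k I)" if "p \<in> space (PiM I (\<lambda>_. circ) \<Otimes>\<^sub>M circ)" for p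
   unfolding dil_upd
   by (rule polyd_upd[OF polyd_circs]) (use that \<rho> in \<open>auto simp: space_pair_measure intro!: norm_less_one_mult\<close>)
 qed
 show "(\<lambda>p. ennreal (u (dil \<rho> ((fst p)(k := snd p))))) \<in> borel_measurable (PiM I (\<lambda>_. circ) \<Otimes>\<^sub>M circ)"
  using 1 by measurable
 have 2: "(\<lambda>p. u ((dil \<rho> (fst p))(k := of_real (\<rho> k) * snd p))) \<in> borel_measurable (PiM I (\<lambda>_. berg q) \<Otimes>\<^sub>M circ)"
 proof (rule measurable_polyd[OF slice_modD(1)[OF u]])
  show "(\<lambda>p. ((dil \<rho> (fst p))(k := of_real (\<rho> k) * snd p)) i) \<in> borel_measurable (PiM I (\<lambda>_. berg q) \<Otimes>\<^sub>M circ)" for i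
   by (cases "i = k") (simp_all add: dil_def)
  show "(dil \<rho> (fst p))(k := of_real (\<rho> k) * snd p) \<in> polyd (insert k I)" if "p \<in> space (PiM I (\<lambda>_. berg q) \<Otimes>\<^sub>M circ)" for p
   by (rule polyd_upd[OF polyd_dil[OF polyd_bergs]])
    (use that \<rho> in \<open>auto simp: space_pair_measure less_imp_le intro!: norm_less_one_mult\<close>)
 qed
 show "(\<lambda>p. ennreal (u ((dil \<rho> (fst p))(k := of_real (\<rho> k) * snd p)))) \<in> borel_measurable (PiM I (\<lambda>_. berg q) \<Otimes>\<^sub>M circ)"
  using 2 by measurable
 have 3: "(\<lambda>x. u (dil \<rho> x)) \<in> borel_measurable (PiM (insert k I) (\<lambda>_. circ))"
 proof (rule measurable_polyd[OF slice_modD(1)[OF u]])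
  show "dil \<rho> x \<in> polyd (insert k I)" if "x \<in> space (PiM (insert k I) (\<lambda>_. circ))" for x
   by (rule polyd_circs[OF that \<rho>])
 qed (simp add: dil_def)
 then show "(\<lambda>x. ennreal (u (dil \<rho> x))) \<in> borel_measurable (PiM (insert k I) (\<lambda>_. circ))" by measurable
 have 4: "(\<lambda>x. u (dil \<rho> x)) \<in> borel_measurable (PiM (insert k I) (\<lambda>_. berg q))"
 proof (rule measurable_polyd[OF slice_modD(1)[OF u]])
  show "dil \<rho> x \<in> polyd (insert k I)" if "x \<in> space (PiM (insert k I) (\<lambda>_. berg q))" for x
   by (rule polyd_dil[OF polyd_bergs[OF that]]) (use \<rho> in \<open>auto simp: less_imp_le\<close>)
 qed (simp add: dil_def)
 then show "(\<lambda>x. ennreal (u (dil \<rho> x))) \<in> borel_measurable (PiM (insert k I) (\<lambda>_. berg q))" by measurable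
qed

lemma meanI_insert:
 fixes u :: "('i::finite \<Rightarrow> complex) \<Rightarrow> real"
 assumes u: "slice_mod (insert k I) u" and k: "k \<notin> I" and \<rho>: "\<forall>i. 0 \<le> \<rho> i \<and> \<rho> i < 1"
 shows "meanI (insert k I) \<rho> u = (\<integral>\<^sup>+x. \<integral>\<^sup>+w. ennreal (u ((dil \<rho> x)(k := of_real (\<rho> k) * w))) \<partial>circ \<partial>PiM I (\<lambda>_. circ))"
  and "meanI (insert k I) \<rho> u = (\<integral>\<^sup>+w. meanI I \<rho> (\<lambda>x. u (x(k := of_real (\<rho> k) * w))) \<partial>circ)"
 unfolding meanI_def
 using circs.product_nn_integral_insert[OF finite k meanI_insert_measurable(3)[OF u \<rho>]]
  circs.product_nn_integral_insert_rev[OF finite k meanI_insert_measurable(3)[OF u \<rho>]]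
 by (simp_all add: dil_upd)

lemma meanI_mono:
 fixes u :: "('i::finite \<Rightarrow> complex) \<Rightarrow> real"
 assumes "slice_mod I u" and \<rho>: "\<forall>i. 0 \<le> \<rho> i \<and> \<rho> i \<le> \<rho>' i \<and> \<rho>' i < 1"
 shows "meanI I \<rho> u \<le> meanI I \<rho>' u"
 using finite[of I] assms(1)
proof (induction I arbitrary: u rule: finite_induct)
 case empty
 have "u (dil \<rho> x) = u (dil \<rho>' x)" for x by (rule slice_modD(3)[OF empty]) simp
 then show ?case by (simp add: meanI_def)
next
 case (insert k I)
 note u = insert.prems
 have r1: "\<forall>i. 0 \<le> \<rho> i \<and> \<rho> i < 1" and r2: "\<forall>i. 0 \<le> \<rho>' i \<and> \<rho>' i < 1"
  using \<rho> by (auto intro: order_trans le_less_trans)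
 define \<rho>1 where "\<rho>1 = \<rho>(k := \<rho>' k)"
 have r3: "\<forall>i. 0 \<le> \<rho>1 i \<and> \<rho>1 i < 1" using r1 r2 by (simp add: \<rho>1_def)
 have d1: "(dil \<rho> x)(k := w) = (dil \<rho>1 x)(k := w)" for x w by (auto simp: dil_def \<rho>1_def)
 have "meanI (insert k I) \<rho> u \<le> meanI (insert k I) \<rho>1 u"
  unfolding meanI_insert(1)[OF u insert.hyps(2) r1] meanI_insert(1)[OF u insert.hyps(2) r3] d1
 proof (rule nn_integral_mono)
  fix x assume "x \<in> space (PiM I (\<lambda>_. circ))"
  then have x: "dil \<rho>1 x \<in> polyd I" by (rule polyd_circs[OF _ r3])
  show "(\<integral>\<^sup>+w. ennreal (u ((dil \<rho>1 x)(k := of_real (\<rho> k) * w))) \<partial>circ) \<le> (\<integral>\<^sup>+w. ennreal (u ((dil \<rho>1 x)(k := of_real (\<rho>1 k) * w))) \<partial>circ)"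
   by (rule slice_mean_mono[where v="\<lambda>w. u ((dil \<rho>1 x)(k := w))", OF slice_mod_slice[OF u x]])
    (use \<rho> in \<open>auto simp: \<rho>1_def\<close>)
 qed
 also have "\<dots> = (\<integral>\<^sup>+w. meanI I \<rho>1 (\<lambda>x. u (x(k := of_real (\<rho>' k) * w))) \<partial>circ)"
  by (subst meanI_insert(2)[OF u insert.hyps(2) r3]) (simp add: \<rho>1_def)
 also have "\<dots> = (\<integral>\<^sup>+w. meanI I \<rho> (\<lambda>x. u (x(k := of_real (\<rho>' k) * w))) \<partial>circ)"
  unfolding meanI_def d1 ..
 also have "\<dots> \<le> (\<integral>\<^sup>+w. meanI I \<rho>' (\<lambda>x. u (x(k := of_real (\<rho>' k) * w))) \<partial>circ)"
 proof (rule nn_integral_mono)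
  fix w assume "w \<in> space circ"
  then have "norm (of_real (\<rho>' k) * w) < 1" using r2[rule_format, of k] by (simp add: norm_mult)
  then show "meanI I \<rho> (\<lambda>x. u (x(k := of_real (\<rho>' k) * w))) \<le> meanI I \<rho>' (\<lambda>x. u (x(k := of_real (\<rho>' k) * w)))"
   by (intro insert.IH slice_mod_upd[OF u insert.hyps(2)])
 qed
 also have "\<dots> = meanI (insert k I) \<rho>' u" by (rule meanI_insert(2)[OF u insert.hyps(2) r2, symmetric])
 finally show ?case .
qed

lemma meanI_le_NI:
 fixes u :: "('i::finite \<Rightarrow> complex) \<Rightarrow> real"
 assumes u: "slice_mod I u" and \<rho>: "\<forall>i. 0 \<le> \<rho> i \<and> \<rho> i < 1"
 shows "meanI I \<rho> u \<le> NI I u"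
proof -
 define r where "r = Max (range \<rho>)"
 have r: "\<rho> i \<le> r" for i unfolding r_def by (rule Max_ge) auto
 have "r \<in> range \<rho>" unfolding r_def by (rule Max_in) auto
 then have r1: "0 \<le> r" "r < 1" using \<rho> by auto
 have "meanI I \<rho> u \<le> meanI I (\<lambda>_. r) u"
  by (rule meanI_mono[OF u]) (use \<rho> r r1 in auto)
 also have "\<dots> \<le> NI I u" unfolding NI_def by (rule SUP_upper) (use r1 in auto)
 finally show ?thesis .
qed

lemma NI_eq_SUP_seq:
 fixes u :: "('i::finite \<Rightarrow> complex) \<Rightarrow> real"
 assumes u: "slice_mod I u"
 shows "NI I u = (SUP n. meanI I (\<lambda>_. 1 - 1 / real (Suc n)) u)"
proof (rule antisym)
 show "NI I u \<le> (SUP n. meanI I (\<lambda>_. 1 - 1 / real (Suc n)) u)"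
  unfolding NI_def
 proof (rule SUP_least)
  fix r :: real assume r: "r \<in> {0..<1}"
  have "\<forall>\<^sub>F n in sequentially. r < 1 - 1 / real (Suc n)" using approach_one[of 1] r by (intro order_tendstoD(1)) auto
  then obtain n where "r < 1 - 1 / real (Suc n)" unfolding eventually_sequentially by blast
  then have "meanI I (\<lambda>_. r) u \<le> meanI I (\<lambda>_. 1 - 1 / real (Suc n)) u"
   by (intro meanI_mono[OF u]) (use r in auto)
  also have "\<dots> \<le> (SUP n. meanI I (\<lambda>_. 1 - 1 / real (Suc n)) u)" by (rule SUP_upper) simp
  finally show "meanI I (\<lambda>_. r) u \<le> (SUP n. meanI I (\<lambda>_. 1 - 1 / real (Suc n)) u)" .
 qed
 show "(SUP n. meanI I (\<lambda>_. 1 - 1 / real (Suc n)) u) \<le> NI I u"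
  by (rule SUP_least, rule meanI_le_NI[OF u]) auto
qed

lemma meanI_upd_measurable:
 fixes u :: "('i::finite \<Rightarrow> complex) \<Rightarrow> real"
 assumes u: "slice_mod (insert k I) u" and \<rho>: "\<forall>i. 0 \<le> \<rho> i \<and> \<rho> i < 1"
 shows "(\<lambda>w. meanI I \<rho> (\<lambda>x. u (x(k := of_real (\<rho> k) * w)))) \<in> borel_measurable circ"
proof -
 interpret C: sigma_finite_measure "PiM I (\<lambda>_. circ)" by (rule circs.sigma_finite) simp
 have "(\<lambda>(w, x). ennreal (u (dil \<rho> (x(k := w))))) \<in> borel_measurable (circ \<Otimes>\<^sub>M PiM I (\<lambda>_. circ))"
  using measurable_compose[OF measurable_pair_swap' meanI_insert_measurable(1)[OF u \<rho>]] by (simp add: case_prod_beta')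
 from C.borel_measurable_nn_integral[OF this] show ?thesis by (simp add: meanI_def dil_upd)
qed

lemma tensor_step:
 fixes u :: "nat \<Rightarrow> ('i::finite \<Rightarrow> complex) \<Rightarrow> real"
 assumes k: "k \<notin> I" and u: "\<And>j. j \<in> {1..m} \<Longrightarrow> slice_mod (insert k I) (u j)" and \<rho>: "\<forall>i. 0 \<le> \<rho> i \<and> \<rho> i < 1"
  and IH: "\<And>u. (\<And>j. j \<in> {1..m} \<Longrightarrow> slice_mod I (u j)) \<Longrightarrow>
   (\<integral>\<^sup>+x. (\<Prod>j=1..m. ennreal (u j (dil \<rho> x))) \<partial>PiM I (\<lambda>_. berg q)) \<le> (\<Prod>j=1..m. meanI I \<rho> (u j))"
 shows "(\<integral>\<^sup>+x. (\<Prod>j=1..m. \<integral>\<^sup>+w. ennreal (u j ((dil \<rho> x)(k := of_real (\<rho> k) * w))) \<partial>circ) \<partial>PiM I (\<lambda>_. berg q)) \<le> (\<Prod>j=1..m. meanI (insert k I) \<rho> (u j))"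
proof -
 have "(\<integral>\<^sup>+x. (\<Prod>j=1..m. \<integral>\<^sup>+w. ennreal (u j ((dil \<rho> x)(k := of_real (\<rho> k) * w))) \<partial>circ) \<partial>PiM I (\<lambda>_. berg q))
  \<le> (\<Prod>j=1..m. \<integral>\<^sup>+w. meanI I \<rho> (\<lambda>x. u j (x(k := of_real (\<rho> k) * w))) \<partial>circ)"
 proof (rule tensor(1))
  show "sigma_finite_measure (PiM I (\<lambda>_. berg q))" by (rule bergs.sigma_finite) simp
  show "sigma_finite_measure circ" by (rule circ.sigma_finite_measure_axioms)
  show "(\<lambda>(x, w). ennreal (u j ((dil \<rho> x)(k := of_real (\<rho> k) * w)))) \<in> borel_measurable (PiM I (\<lambda>_. berg q) \<Otimes>\<^sub>M circ)"
   if "j \<in> {1..m}" for j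
   using meanI_insert_measurable(2)[OF u[OF that] \<rho>] by (simp add: case_prod_beta')
  show "(\<lambda>w. meanI I \<rho> (\<lambda>x. u j (x(k := of_real (\<rho> k) * w)))) \<in> borel_measurable circ" if "j \<in> {1..m}" for j
   by (rule meanI_upd_measurable[OF u[OF that] \<rho>])
  show "(\<integral>\<^sup>+x. (\<Prod>j=1..m. ennreal (u j ((dil \<rho> x)(k := of_real (\<rho> k) * \<omega> j)))) \<partial>PiM I (\<lambda>_. berg q))
   \<le> (\<Prod>j=1..m. meanI I \<rho> (\<lambda>x. u j (x(k := of_real (\<rho> k) * \<omega> j))))"
   if "\<And>j. j \<in> {1..m} \<Longrightarrow> \<omega> j \<in> space circ" for \<omega>
  proof (rule IH)
   fix j assume j: "j \<in> {1..m}"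
   have "norm (of_real (\<rho> k) * \<omega> j) < 1" using that[OF j] \<rho>[rule_format, of k] by (simp add: norm_mult)
   then show "slice_mod I (\<lambda>x. u j (x(k := of_real (\<rho> k) * \<omega> j)))" by (rule slice_mod_upd[OF u[OF j] k])
  qed
 qed simp
 also have "\<dots> = (\<Prod>j=1..m. meanI (insert k I) \<rho> (u j))"
  by (rule prod.cong[OF refl]) (simp add: meanI_insert(2)[OF u k \<rho>])
 finally show ?thesis .
qed

text \<open>The last coordinate is treated by the one-variable theorem for fixed values of the others, which
leaves means over circles; the other coordinates are treated by induction after tensorizing
these means.\<close>

theorem tensor_ineq:
 fixes u :: "nat \<Rightarrow> ('i::finite \<Rightarrow> complex) \<Rightarrow> real"
 assumes m: "m \<ge> 2" and u: "\<And>j. j \<in> {1..m} \<Longrightarrow> slice_mod I (u j)" and \<rho>: "\<forall>i. 0 \<le> \<rho> i \<and> \<rho> i < 1"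
 shows "(\<integral>\<^sup>+x. (\<Prod>j=1..m. ennreal (u j (dil \<rho> x))) \<partial>PiM I (\<lambda>_. berg (m - 2))) \<le> (\<Prod>j=1..m. meanI I \<rho> (u j))"
 using finite[of I] u
proof (induction I arbitrary: u rule: finite_induct)
 case empty
 then show ?case by (simp add: meanI_def circs.nn_integral_empty bergs.nn_integral_empty)
next
 case (insert k I)
 note u = insert.prems
 have "(\<integral>\<^sup>+x. (\<Prod>j=1..m. ennreal (u j (dil \<rho> x))) \<partial>PiM (insert k I) (\<lambda>_. berg (m - 2)))
  = (\<integral>\<^sup>+x. \<integral>\<^sup>+w. (\<Prod>j=1..m. ennreal (u j ((dil \<rho> x)(k := of_real (\<rho> k) * w)))) \<partial>berg (m - 2) \<partial>PiM I (\<lambda>_. berg (m - 2)))"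
  by (subst bergs.product_nn_integral_insert[OF finite insert.hyps(2)])
   (auto intro!: borel_measurable_prod_ennreal meanI_insert_measurable(4)[OF u \<rho>] simp: dil_upd)
 also have "\<dots> \<le> (\<integral>\<^sup>+x. (\<Prod>j=1..m. \<integral>\<^sup>+w. ennreal (u j ((dil \<rho> x)(k := of_real (\<rho> k) * w))) \<partial>circ) \<partial>PiM I (\<lambda>_. berg (m - 2)))"
 proof (rule nn_integral_mono)
  fix x assume "x \<in> space (PiM I (\<lambda>_. berg (m - 2)))"
  then have x: "dil \<rho> x \<in> polyd I" by (intro polyd_dil polyd_bergs) (use \<rho> in \<open>auto simp: less_imp_le\<close>)
  show "(\<integral>\<^sup>+w. (\<Prod>j=1..m. ennreal (u j ((dil \<rho> x)(k := of_real (\<rho> k) * w)))) \<partial>berg (m - 2))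
   \<le> (\<Prod>j=1..m. \<integral>\<^sup>+w. ennreal (u j ((dil \<rho> x)(k := of_real (\<rho> k) * w))) \<partial>circ)"
   by (rule disc_slice_ineq[OF m slice_mod_slice[OF u x], of _ "\<rho> k"]) (use \<rho>[rule_format, of k] in auto)
 qed
 also have "\<dots> \<le> (\<Prod>j=1..m. meanI (insert k I) \<rho> (u j))"
  by (rule tensor_step[OF insert.hyps(2) u \<rho> insert.IH])
 finally show ?case .
qed

section \<open>Removing the dilation\<close>

lemma LIMSEQ_funI:
 fixes X :: "nat \<Rightarrow> 'i \<Rightarrow> complex"
 assumes "\<And>i. (\<lambda>n. X n i) \<longlonglongrightarrow> x i"
 shows "X \<longlonglongrightarrow> x"
proof -
 have "limitin (product_topology (\<lambda>i::'i. euclidean :: complex topology) UNIV) X x sequentially"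
  using assms by (simp add: limitin_componentwise limitin_canonical_iff)
 then show ?thesis by (simp add: euclidean_product_topology limitin_canonical_iff)
qed

lemma polyd_lim:
 fixes u :: "('i \<Rightarrow> complex) \<Rightarrow> 'b :: topological_space"
 assumes "continuous_on (polyd I) u" "\<And>i. (\<lambda>n. X n i) \<longlonglongrightarrow> x i" "x \<in> polyd I" "\<And>n. X n \<in> polyd I"
 shows "(\<lambda>n. u (X n)) \<longlonglongrightarrow> u x"
 by (rule continuous_on_tendsto_compose[OF assms(1) LIMSEQ_funI[OF assms(2)] assms(3)]) (use assms(4) in auto)

definition rr :: "nat \<Rightarrow> real" where "rr n = 1 - 1 / real (Suc n)"

lemma rr: "0 \<le> rr n" "rr n < 1" "rr n \<le> 1"
 by (auto simp: rr_def)

lemma rr_mono: "n \<le> k \<Longrightarrow> rr n \<le> rr k"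
 by (simp add: rr_def frac_le)

lemma rr_lim: "rr \<longlonglongrightarrow> 1"
 using approach_one[of 1] by (simp add: rr_def[abs_def])

lemma dil_lim:
 assumes "slice_mod I u" "x \<in> polyd I"
 shows "(\<lambda>n. u (dil (\<lambda>_. rr n) x)) \<longlonglongrightarrow> u x"
proof (rule polyd_lim[OF slice_modD(1)[OF assms(1)] _ assms(2)])
 show "(\<lambda>n. dil (\<lambda>_. rr n) x i) \<longlonglongrightarrow> x i" for i
  unfolding dil_def using tendsto_mult[OF tendsto_of_real[OF rr_lim] tendsto_const[of "x i"]] by simp
 show "dil (\<lambda>_. rr n) x \<in> polyd I" for n by (rule polyd_dil[OF assms(2)]) (simp add: rr)
qed

lemma slice_mod_measurable_bergs:
 fixes u :: "('i::finite \<Rightarrow> complex) \<Rightarrow> real"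
 assumes u: "slice_mod I u"
 shows "(\<lambda>x. ennreal (u x)) \<in> borel_measurable (PiM I (\<lambda>_. berg q))"
proof -
 have "u \<in> borel_measurable (PiM I (\<lambda>_. berg q))"
  by (rule measurable_polyd[OF slice_modD(1)[OF u]]) (auto intro: polyd_bergs)
 then show ?thesis by measurable
qed

text \<open>Dilate and use Fatou's lemma on the left; the means on the right increase with the radius.\<close>

theorem NI_ineq:
 fixes u :: "nat \<Rightarrow> ('i::finite \<Rightarrow> complex) \<Rightarrow> real"
 assumes m: "m \<ge> 2" and u: "\<And>j. j \<in> {1..m} \<Longrightarrow> slice_mod I (u j)"
 shows "(\<integral>\<^sup>+x. (\<Prod>j=1..m. ennreal (u j x)) \<partial>PiM I (\<lambda>_. berg (m - 2))) \<le> (\<Prod>j=1..m. NI I (u j))"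
proof -
 have r: "\<forall>i. 0 \<le> (\<lambda>_::'i. rr n) i \<and> (\<lambda>_::'i. rr n) i < 1" for n by (simp add: rr)
 have meas: "(\<lambda>x. ennreal (u j (dil (\<lambda>_. rr n) x))) \<in> borel_measurable (PiM I (\<lambda>_. berg (m - 2)))" if "j \<in> {1..m}" for j n
 proof -
  have "(\<lambda>x. u j (dil (\<lambda>_. rr n) x)) \<in> borel_measurable (PiM I (\<lambda>_. berg (m - 2)))"
  proof (rule measurable_polyd[OF slice_modD(1)[OF u[OF that]]])
   show "dil (\<lambda>_. rr n) x \<in> polyd I" if "x \<in> space (PiM I (\<lambda>_. berg (m - 2)))" for x
    by (rule polyd_dil[OF polyd_bergs[OF that]]) (simp add: rr)
  qed (simp add: dil_def)
  then show ?thesis by measurable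
 qed
 have "(\<integral>\<^sup>+x. (\<Prod>j=1..m. ennreal (u j x)) \<partial>PiM I (\<lambda>_. berg (m - 2)))
  = (\<integral>\<^sup>+x. liminf (\<lambda>n. \<Prod>j=1..m. ennreal (u j (dil (\<lambda>_. rr n) x))) \<partial>PiM I (\<lambda>_. berg (m - 2)))"
 proof (rule nn_integral_cong)
  fix x assume "x \<in> space (PiM I (\<lambda>_. berg (m - 2)))"
  then have x: "x \<in> polyd I" by (rule polyd_bergs)
  have nn: "0 \<le> u j y" if "j \<in> {1..m}" "y \<in> polyd I" for j y by (rule slice_modD(2)[OF u[OF that(1)] that(2)])
  have d: "dil (\<lambda>_. rr n) x \<in> polyd I" for n by (rule polyd_dil[OF x]) (simp add: rr)
  have "(\<lambda>n. ennreal (\<Prod>j=1..m. u j (dil (\<lambda>_. rr n) x))) \<longlonglongrightarrow> ennreal (\<Prod>j=1..m. u j x)"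
   by (intro tendsto_ennrealI tendsto_prod dil_lim[OF u x])
  moreover have "(\<Prod>j=1..m. ennreal (u j y)) = ennreal (\<Prod>j=1..m. u j y)" if "y \<in> polyd I" for y
   by (rule prod_ennreal) (use nn that in auto)
  ultimately have "(\<lambda>n. \<Prod>j=1..m. ennreal (u j (dil (\<lambda>_. rr n) x))) \<longlonglongrightarrow> (\<Prod>j=1..m. ennreal (u j x))"
   using d x by simp
  then show "(\<Prod>j=1..m. ennreal (u j x)) = liminf (\<lambda>n. \<Prod>j=1..m. ennreal (u j (dil (\<lambda>_. rr n) x)))"
   by (intro lim_imp_Liminf[symmetric]) auto
 qed
 also have "\<dots> \<le> liminf (\<lambda>n. \<integral>\<^sup>+x. (\<Prod>j=1..m. ennreal (u j (dil (\<lambda>_. rr n) x))) \<partial>PiM I (\<lambda>_. berg (m - 2)))"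
  by (rule nn_integral_liminf) (use meas in \<open>intro borel_measurable_prod_ennreal; auto\<close>)
 also have "\<dots> \<le> (\<Prod>j=1..m. NI I (u j))"
 proof (rule Liminf_le)
  show "\<forall>\<^sub>F n in sequentially. (\<integral>\<^sup>+x. (\<Prod>j=1..m. ennreal (u j (dil (\<lambda>_. rr n) x))) \<partial>PiM I (\<lambda>_. berg (m - 2))) \<le> (\<Prod>j=1..m. NI I (u j))"
  proof (intro always_eventually allI)
   fix n
   have "(\<integral>\<^sup>+x. (\<Prod>j=1..m. ennreal (u j (dil (\<lambda>_. rr n) x))) \<partial>PiM I (\<lambda>_. berg (m - 2))) \<le> (\<Prod>j=1..m. meanI I (\<lambda>_. rr n) (u j))"
    by (rule tensor_ineq[OF m u r])
   also have "\<dots> \<le> (\<Prod>j=1..m. NI I (u j))"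
    by (intro prod_mono_ennreal meanI_le_NI u r)
   finally show "(\<integral>\<^sup>+x. (\<Prod>j=1..m. ennreal (u j (dil (\<lambda>_. rr n) x))) \<partial>PiM I (\<lambda>_. berg (m - 2))) \<le> (\<Prod>j=1..m. NI I (u j))" .
  qed
 qed simp
 finally show ?thesis .
qed

definition CM :: "'i \<Rightarrow> real \<Rightarrow> (('i \<Rightarrow> complex) \<Rightarrow> real) \<Rightarrow> ('i \<Rightarrow> complex) \<Rightarrow> ennreal" where
 "CM k s u x = (\<integral>\<^sup>+w. ennreal (u (x(k := of_real s * w))) \<partial>circ)"

definition SL :: "'i \<Rightarrow> (('i \<Rightarrow> complex) \<Rightarrow> real) \<Rightarrow> ('i \<Rightarrow> complex) \<Rightarrow> ennreal" where
 "SL k u x = (SUP n. CM k (rr n) u x)"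

lemma CM_measurable:
 fixes u :: "('i::finite \<Rightarrow> complex) \<Rightarrow> real"
 assumes u: "slice_mod (insert k I) u" and s: "0 \<le> s" "s < 1" and t: "0 \<le> t" "t \<le> 1"
 shows "(\<lambda>x. CM k s u (dil (\<lambda>_. t) x)) \<in> borel_measurable (PiM I (\<lambda>_. berg q))"
proof -
 have "(\<lambda>p. u ((dil (\<lambda>_. t) (fst p))(k := of_real s * snd p))) \<in> borel_measurable (PiM I (\<lambda>_. berg q) \<Otimes>\<^sub>M circ)"
 proof (rule measurable_polyd[OF slice_modD(1)[OF u]])
  show "(\<lambda>p. ((dil (\<lambda>_. t) (fst p))(k := of_real s * snd p)) i) \<in> borel_measurable (PiM I (\<lambda>_. berg q) \<Otimes>\<^sub>M circ)" for i
   by (cases "i = k") (simp_all add: dil_def)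
  show "(dil (\<lambda>_. t) (fst p))(k := of_real s * snd p) \<in> polyd (insert k I)" if "p \<in> space (PiM I (\<lambda>_. berg q) \<Otimes>\<^sub>M circ)" for p
   by (rule polyd_upd[OF polyd_dil[OF polyd_bergs]])
    (use that s t in \<open>auto simp: space_pair_measure intro!: norm_less_one_mult\<close>)
 qed
 then have "(\<lambda>(x, w). ennreal (u ((dil (\<lambda>_. t) x)(k := of_real s * w)))) \<in> borel_measurable (PiM I (\<lambda>_. berg q) \<Otimes>\<^sub>M circ)"
  unfolding case_prod_beta' by measurable
 from circ.borel_measurable_nn_integral[OF this] show ?thesis by (simp add: CM_def)
qed

lemma dil_one: "dil (\<lambda>_. 1) x = x" by (simp add: dil_def)

lemma CM_measurable1:
 fixes u :: "('i::finite \<Rightarrow> complex) \<Rightarrow> real"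
 assumes u: "slice_mod (insert k I) u" and s: "0 \<le> s" "s < 1"
 shows "(\<lambda>x. CM k s u x) \<in> borel_measurable (PiM I (\<lambda>_. berg q))"
 using CM_measurable[OF u s, of 1 q] by (simp add: dil_one)

lemma CM_incseq:
 assumes u: "slice_mod (insert k I) u" and x: "x \<in> polyd I"
 shows "incseq (\<lambda>n. CM k (rr n) u x)"
 unfolding incseq_def CM_def
 by (intro allI impI slice_mean_mono[where v="\<lambda>w. u (x(k := w))", OF slice_mod_slice[OF u x]])
  (simp_all add: rr rr_mono)

lemma slice_circ_measurable:
 assumes u: "slice_mod (insert k I) u" and x: "x \<in> polyd I" and s: "0 \<le> s" "s < 1"
 shows "(\<lambda>w. ennreal (u (x(k := of_real s * w)))) \<in> borel_measurable circ"
proof -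
 obtain h p where hp: "h holomorphic_on ball 0 1" "p > 0" "\<And>w. w \<in> ball 0 1 \<Longrightarrow> u (x(k := w)) = norm (h w) powr p"
  using slice_mod_slice[OF u x] by auto
 have "(\<lambda>w. ennreal (norm (h (of_real s * w)) powr p)) \<in> borel_measurable circ"
  using measurable_dilate_circ[OF holomorphic_on_imp_continuous_on[OF hp(1)] s] by measurable
 then show ?thesis
  by (rule measurable_cong[THEN iffD1, rotated]) (use hp(3) s norm_less_one_mult[OF s] in auto)
qed

text \<open>Fatou's lemma on the torus that carries one variable for each factor.\<close>

lemma CM_prod_liminf:
 fixes u :: "nat \<Rightarrow> ('i::finite \<Rightarrow> complex) \<Rightarrow> real"
 assumes k: "k \<notin> I" and u: "\<And>j. j \<in> {1..m} \<Longrightarrow> slice_mod (insert k I) (u j)" and s: "0 \<le> s" "s < 1" and x: "x \<in> polyd I"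
 shows "(\<Prod>j=1..m. CM k s (u j) x) \<le> liminf (\<lambda>n. \<Prod>j=1..m. CM k s (u j) (dil (\<lambda>_. rr n) x))"
proof -
 have expand: "(\<Prod>j=1..m. CM k s (u j) y) = (\<integral>\<^sup>+\<omega>. (\<Prod>j=1..m. ennreal (u j (y(k := of_real s * \<omega> j)))) \<partial>PiM {1..m} (\<lambda>_. circ))"
  if y: "y \<in> polyd I" for y
  unfolding CM_def
  by (rule circs.product_nn_integral_prod[symmetric]) (use slice_circ_measurable[OF u y s] in auto)
 have d: "dil (\<lambda>_. rr n) x \<in> polyd I" for n by (rule polyd_dil[OF x]) (simp add: rr)
 have "(\<Prod>j=1..m. CM k s (u j) x) = (\<integral>\<^sup>+\<omega>. liminf (\<lambda>n. \<Prod>j=1..m. ennreal (u j ((dil (\<lambda>_. rr n) x)(k := of_real s * \<omega> j)))) \<partial>PiM {1..m} (\<lambda>_. circ))"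
  unfolding expand[OF x]
 proof (rule nn_integral_cong)
  fix \<omega> assume om: "\<omega> \<in> space (PiM {1..m} (\<lambda>_. circ))"
  have no: "norm (of_real s * \<omega> j) < 1" if "j \<in> {1..m}" for j
  proof -
   have "norm (\<omega> j) = 1" using om that by (auto simp: space_PiM PiE_iff)
   then show ?thesis using s by (simp add: norm_mult)
  qed
  have nn: "0 \<le> u j (y(k := of_real s * \<omega> j))" if "j \<in> {1..m}" "y \<in> polyd I" for j y
   by (rule slice_modD(2)[OF u[OF that(1)] polyd_upd[OF that(2) no[OF that(1)]]])
  have "(\<lambda>n. ennreal (\<Prod>j=1..m. u j ((dil (\<lambda>_. rr n) x)(k := of_real s * \<omega> j)))) \<longlonglongrightarrow> ennreal (\<Prod>j=1..m. u j (x(k := of_real s * \<omega> j)))"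
   by (intro tendsto_ennrealI tendsto_prod dil_lim[OF slice_mod_upd[OF u k no] x])
  moreover have "(\<Prod>j=1..m. ennreal (u j (y(k := of_real s * \<omega> j)))) = ennreal (\<Prod>j=1..m. u j (y(k := of_real s * \<omega> j)))" if "y \<in> polyd I" for y
   by (rule prod_ennreal) (use nn that in auto)
  ultimately have "(\<lambda>n. \<Prod>j=1..m. ennreal (u j ((dil (\<lambda>_. rr n) x)(k := of_real s * \<omega> j)))) \<longlonglongrightarrow> (\<Prod>j=1..m. ennreal (u j (x(k := of_real s * \<omega> j))))"
   using d x by simp
  then show "(\<Prod>j=1..m. ennreal (u j (x(k := of_real s * \<omega> j)))) = liminf (\<lambda>n. \<Prod>j=1..m. ennreal (u j ((dil (\<lambda>_. rr n) x)(k := of_real s * \<omega> j))))"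
   by (intro lim_imp_Liminf[symmetric]) auto
 qed
 also have "\<dots> \<le> liminf (\<lambda>n. \<integral>\<^sup>+\<omega>. (\<Prod>j=1..m. ennreal (u j ((dil (\<lambda>_. rr n) x)(k := of_real s * \<omega> j)))) \<partial>PiM {1..m} (\<lambda>_. circ))"
 proof (rule nn_integral_liminf)
  fix n
  show "(\<lambda>\<omega>. \<Prod>j=1..m. ennreal (u j ((dil (\<lambda>_. rr n) x)(k := of_real s * \<omega> j)))) \<in> borel_measurable (PiM {1..m} (\<lambda>_. circ))"
  proof (rule borel_measurable_prod_ennreal)
   fix j assume j: "j \<in> {1..m}"
   show "(\<lambda>\<omega>. ennreal (u j ((dil (\<lambda>_. rr n) x)(k := of_real s * \<omega> j)))) \<in> borel_measurable (PiM {1..m} (\<lambda>_. circ))"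
    by (rule measurable_compose[OF measurable_component_singleton[OF j] slice_circ_measurable[OF u[OF j] d s]])
  qed
 qed
 also have "\<dots> = liminf (\<lambda>n. \<Prod>j=1..m. CM k s (u j) (dil (\<lambda>_. rr n) x))"
  by (simp only: expand[OF d])
 finally show ?thesis .
qed

text \<open>A refinement of the inequality that integrates the area measure over all coordinates but one and
keeps the slice norms in coordinate \<open>k\<close>. It lies between the two sides of the
inequality, so equality splits into equality on slices and equality here.\<close>

theorem SL_ineq:
 fixes u :: "nat \<Rightarrow> ('i::finite \<Rightarrow> complex) \<Rightarrow> real"
 assumes m: "m \<ge> 2" and k: "k \<notin> I" and u: "\<And>j. j \<in> {1..m} \<Longrightarrow> slice_mod (insert k I) (u j)"
 shows "(\<integral>\<^sup>+x. (\<Prod>j=1..m. SL k (u j) x) \<partial>PiM I (\<lambda>_. berg (m - 2))) \<le> (\<Prod>j=1..m. NI (insert k I) (u j))"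
proof -
 let ?M = "PiM I (\<lambda>_. berg (m - 2))"
 have fixed: "(\<integral>\<^sup>+x. (\<Prod>j=1..m. CM k s (u j) x) \<partial>?M) \<le> (\<Prod>j=1..m. NI (insert k I) (u j))" if s: "0 \<le> s" "s < 1" for s
 proof -
  have "(\<integral>\<^sup>+x. (\<Prod>j=1..m. CM k s (u j) x) \<partial>?M) \<le> (\<integral>\<^sup>+x. liminf (\<lambda>n. \<Prod>j=1..m. CM k s (u j) (dil (\<lambda>_. rr n) x)) \<partial>?M)"
   by (intro nn_integral_mono CM_prod_liminf[OF k u s] polyd_bergs)
  also have "\<dots> \<le> liminf (\<lambda>n. \<integral>\<^sup>+x. (\<Prod>j=1..m. CM k s (u j) (dil (\<lambda>_. rr n) x)) \<partial>?M)"
   by (rule nn_integral_liminf) (intro borel_measurable_prod_ennreal CM_measurable u s rr)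
  also have "\<dots> \<le> (\<Prod>j=1..m. NI (insert k I) (u j))"
  proof (rule Liminf_le)
   show "\<forall>\<^sub>F n in sequentially. (\<integral>\<^sup>+x. (\<Prod>j=1..m. CM k s (u j) (dil (\<lambda>_. rr n) x)) \<partial>?M) \<le> (\<Prod>j=1..m. NI (insert k I) (u j))"
   proof (intro always_eventually allI)
    fix n
    define \<rho> where "\<rho> = (\<lambda>_::'i. rr n)(k := s)"
    have r: "\<forall>i. 0 \<le> \<rho> i \<and> \<rho> i < 1" using s by (simp add: \<rho>_def rr)
    have e: "(dil (\<lambda>_. rr n) x)(k := of_real s * w) = (dil \<rho> x)(k := of_real (\<rho> k) * w)" for x w
     by (auto simp: \<rho>_def dil_def)
    have "(\<integral>\<^sup>+x. (\<Prod>j=1..m. CM k s (u j) (dil (\<lambda>_. rr n) x)) \<partial>?M) = (\<integral>\<^sup>+x. (\<Prod>j=1..m. \<integral>\<^sup>+w. ennreal (u j ((dil \<rho> x)(k := of_real (\<rho> k) * w))) \<partial>circ) \<partial>?M)"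
     unfolding CM_def e ..
    also have "\<dots> \<le> (\<Prod>j=1..m. meanI (insert k I) \<rho> (u j))"
     by (rule tensor_step[OF k u r tensor_ineq[OF m _ r]])
    also have "\<dots> \<le> (\<Prod>j=1..m. NI (insert k I) (u j))"
     by (intro prod_mono_ennreal meanI_le_NI u r)
    finally show "(\<integral>\<^sup>+x. (\<Prod>j=1..m. CM k s (u j) (dil (\<lambda>_. rr n) x)) \<partial>?M) \<le> (\<Prod>j=1..m. NI (insert k I) (u j))" .
   qed
  qed simp
  finally show ?thesis .
 qed
 have inc: "incseq (\<lambda>n. \<Prod>j=1..m. CM k (rr n) (u j) x)" if "x \<in> polyd I" for x
  by (intro incseq_prod_ennreal CM_incseq[OF u that])
 have "(\<integral>\<^sup>+x. (\<Prod>j=1..m. SL k (u j) x) \<partial>?M) = (\<integral>\<^sup>+x. (SUP n. \<Prod>j=1..m. CM k (rr n) (u j) x) \<partial>?M)"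
  unfolding SL_def by (intro nn_integral_cong prod_SUP_incseq CM_incseq[OF u] polyd_bergs) auto
 also have "\<dots> = (SUP n. \<integral>\<^sup>+x. (\<Prod>j=1..m. CM k (rr n) (u j) x) \<partial>?M)"
 proof (rule nn_integral_monotone_convergence_SUP_AE)
  show "AE x in ?M. (\<Prod>j=1..m. CM k (rr n) (u j) x) \<le> (\<Prod>j=1..m. CM k (rr (Suc n)) (u j) x)" for n
   by (rule AE_I2) (use inc[OF polyd_bergs] in \<open>auto simp: incseq_def\<close>)
  show "(\<lambda>x. \<Prod>j=1..m. CM k (rr n) (u j) x) \<in> borel_measurable ?M" for n
   by (intro borel_measurable_prod_ennreal CM_measurable1 u rr)
 qed
 also have "\<dots> \<le> (\<Prod>j=1..m. NI (insert k I) (u j))"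
  by (intro SUP_least fixed rr)
 finally show ?thesis .
qed

section \<open>Separately holomorphic functions\<close>

text \<open>Continuity and holomorphy in each variable are all that the slicing arguments use.\<close>

definition sep_hol :: "'i set \<Rightarrow> (('i \<Rightarrow> complex) \<Rightarrow> complex) \<Rightarrow> bool" where
 "sep_hol I F \<longleftrightarrow> continuous_on (polyd I) F \<and> (\<forall>x y. (\<forall>i\<in>I. x i = y i) \<longrightarrow> F x = F y) \<and>
  (\<forall>x\<in>polyd I. \<forall>i\<in>I. (\<lambda>w. F (x(i := w))) holomorphic_on ball 0 1)"

lemma sep_holD:
 assumes "sep_hol I F"
 shows "continuous_on (polyd I) F" "(\<And>i. i \<in> I \<Longrightarrow> x i = y i) \<Longrightarrow> F x = F y"
  "x \<in> polyd I \<Longrightarrow> i \<in> I \<Longrightarrow> (\<lambda>w. F (x(i := w))) holomorphic_on ball 0 1"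
 using assms by (auto simp: sep_hol_def)

lemma sep_hol_slice:
 assumes F: "sep_hol (insert k I) F" and x: "x \<in> polyd I"
 shows "(\<lambda>w. F (x(k := w))) holomorphic_on ball 0 1"
 using sep_holD(3)[OF F polyd_upd[OF x, of 0], of k] by simp

lemma sep_hol_imp_slice_mod:
 assumes F: "sep_hol I F" and p: "p > 0"
 shows "slice_mod I (\<lambda>x. norm (F x) powr p)"
 unfolding slice_mod_def
proof (intro conjI ballI allI impI)
 show "continuous_on (polyd I) (\<lambda>x. norm (F x) powr p)"
  using p by (intro continuous_on_powr' continuous_intros sep_holD(1)[OF F]) auto
 show "norm (F x) powr p = norm (F y) powr p" if "\<forall>i\<in>I. x i = y i" for x y
  using sep_holD(2)[OF F, of x y] that by simp
 show "\<exists>h q. h holomorphic_on ball 0 1 \<and> q > 0 \<and> (\<forall>w\<in>ball 0 1. norm (F (x(i := w))) powr p = norm (h w) powr q)"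
  if "x \<in> polyd I" "i \<in> I" for x i
  using sep_holD(3)[OF F that] p by blast
qed simp

lemma sep_hol_upd:
 assumes F: "sep_hol (insert k I) F" and k: "k \<notin> I" and a: "norm a < 1"
 shows "sep_hol I (\<lambda>x. F (x(k := a)))"
 unfolding sep_hol_def
proof (intro conjI ballI allI impI)
 show "continuous_on (polyd I) (\<lambda>x. F (x(k := a)))"
  by (rule continuous_on_compose2[OF sep_holD(1)[OF F] continuous_on_upd]) (use a in \<open>auto intro: polyd_upd\<close>)
 show "F (x(k := a)) = F (y(k := a))" if "\<forall>i\<in>I. x i = y i" for x y
  by (rule sep_holD(2)[OF F]) (use that in auto)
 fix x i assume x: "x \<in> polyd I" and i: "i \<in> I"
 have "(\<lambda>w. F ((x(k := a))(i := w))) holomorphic_on ball 0 1"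
  by (rule sep_holD(3)[OF F polyd_upd[OF x a]]) (use i in simp)
 moreover have "(x(k := a))(i := w) = (x(i := w))(k := a)" for w using i k by (auto simp: fun_upd_twist)
 ultimately show "(\<lambda>w. F ((x(i := w))(k := a))) holomorphic_on ball 0 1" by simp
qed

lemma sep_hol_measurable:
 fixes F :: "('i::finite \<Rightarrow> complex) \<Rightarrow> complex"
 assumes "sep_hol I F" shows "F \<in> borel_measurable (PiM I (\<lambda>_. berg q))"
 by (rule measurable_polyd[OF sep_holD(1)[OF assms]]) (auto intro: polyd_bergs)

lemma AE_berg_hol_nonzero:
 assumes f: "f holomorphic_on ball 0 1" "\<exists>w\<in>ball 0 1. f w \<noteq> 0"
 shows "(\<integral>\<^sup>+w. indicator {0} (f w) \<partial>berg q) = 0"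
proof -
 define Z where "Z = {w \<in> ball 0 1. f w = 0}"
 have "countable Z"
 proof (cases "f constant_on ball 0 1")
  case True
  then have "Z = {}" using f(2) unfolding Z_def constant_on_def by auto
  then show ?thesis by simp
 next
  case False
  have fin: "finite {w \<in> cball 0 (rr n). f w = 0}" for n
   by (rule holomorphic_compact_finite_zeros[OF f(1) open_ball connected_ball compact_cball _ False])
    (auto dest: le_less_trans[OF _ rr(2)])
  have "Z \<subseteq> (\<Union>n. {w \<in> cball 0 (rr n). f w = 0})"
  proof
   fix w assume w: "w \<in> Z"
   then have "norm w < 1" by (simp add: Z_def)
   with rr_lim have "\<forall>\<^sub>F n in sequentially. norm w < rr n" by (rule order_tendstoD(1))
   then obtain n where "norm w < rr n" unfolding eventually_sequentially by blast
   then show "w \<in> (\<Union>n. {w \<in> cball 0 (rr n). f w = 0})" using w by (intro UN_I[of n]) (auto simp: Z_def)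
  qed
  then show ?thesis by (rule countable_subset) (use fin in \<open>auto intro: countable_finite\<close>)
 qed
 then have Zn: "emeasure lborel Z = 0" by (rule countable_imp_null_set_lborel[THEN null_setsD1])
 have Zm: "Z \<in> sets borel" using \<open>countable Z\<close> by (simp add: sets.countable)
 define D where "D = (\<lambda>z::complex. ennreal ((real q + 1) / pi * (1 - (norm z)\<^sup>2) ^ q))"
 have fm: "f \<in> borel_measurable (berg q)"
  unfolding measurable_cong_sets[OF sets_berg refl]
  by (rule borel_measurable_continuous_on_restrict[OF holomorphic_on_imp_continuous_on[OF f(1)]])
 have "(\<integral>\<^sup>+w. indicator {0} (f w) \<partial>berg q) = (\<integral>\<^sup>+z. D z * indicator {0} (f z) * indicator (ball 0 1) z \<partial>lborel)"
  unfolding D_def by (rule nn_integral_berg) (use fm in measurable)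
 also have "\<dots> = (\<integral>\<^sup>+z. D z * indicator Z z \<partial>lborel)"
  by (rule nn_integral_cong) (auto simp: Z_def indicator_def)
 also have "\<dots> = 0"
 proof -
  have "AE z in lborel. z \<notin> Z" by (rule AE_not_in) (use Zn Zm in \<open>simp add: null_sets_def\<close>)
  then have "AE z in lborel. D z * indicator Z z = 0" by eventually_elim simp
  then show ?thesis by (subst nn_integral_cong_AE[of _ "\<lambda>_. 0"]) auto
 qed
 finally show ?thesis .
qed

text \<open>The zero set is null by Fubini, because a nonzero function of one variable has countably many
zeros.\<close>

lemma AE_sep_hol_nonzero:
 fixes F :: "('i::finite \<Rightarrow> complex) \<Rightarrow> complex"
 assumes "sep_hol I F" "x1 \<in> polyd I" "F x1 \<noteq> 0"
 shows "AE x in PiM I (\<lambda>_. berg q). F x \<noteq> 0"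
proof -
 have main: "(\<integral>\<^sup>+x. indicator {0} (F x) \<partial>PiM I (\<lambda>_. berg q)) = 0"
  using finite[of I] assms
 proof (induction I arbitrary: F x1 rule: finite_induct)
  case empty
  have "F (\<lambda>k. undefined) = F x1" by (rule sep_holD(2)[OF empty(1)]) simp
  then show ?case using empty(3) by (simp add: bergs.nn_integral_empty)
 next
  case (insert k I)
  have Fm[measurable]: "F \<in> borel_measurable (PiM (insert k I) (\<lambda>_. berg q))" by (rule sep_hol_measurable[OF insert.prems(1)])
  have "(\<integral>\<^sup>+x. indicator {0} (F x) \<partial>PiM (insert k I) (\<lambda>_. berg q))
   = (\<integral>\<^sup>+x. \<integral>\<^sup>+w. indicator {0} (F (x(k := w))) \<partial>berg q \<partial>PiM I (\<lambda>_. berg q))"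
   by (rule bergs.product_nn_integral_insert[OF finite insert.hyps(2)]) measurable
  also have "\<dots> = (\<integral>\<^sup>+x. 0 \<partial>PiM I (\<lambda>_. berg q))"
  proof (rule nn_integral_cong_AE)
   have nk: "norm (x1 k) < 1" using insert.prems(2) by (simp add: polyd_def)
   have G: "sep_hol I (\<lambda>x. F (x(k := x1 k)))" by (rule sep_hol_upd[OF insert.prems(1) insert.hyps(2) nk])
   have "(\<integral>\<^sup>+x. indicator {0} (F (x(k := x1 k))) \<partial>PiM I (\<lambda>_. berg q)) = 0"
    by (rule insert.IH[OF G, of x1]) (use insert.prems in \<open>auto simp: polyd_def\<close>)
   moreover have [measurable]: "(\<lambda>x. F (x(k := x1 k))) \<in> borel_measurable (PiM I (\<lambda>_. berg q))" by (rule sep_hol_measurable[OF G])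
   ultimately have "AE x in PiM I (\<lambda>_. berg q). indicator {0} (F (x(k := x1 k))) = (0::ennreal)"
    by (subst (asm) nn_integral_0_iff_AE) auto
   then show "AE x in PiM I (\<lambda>_. berg q). (\<integral>\<^sup>+w. indicator {0} (F (x(k := w))) \<partial>berg q) = 0"
   proof (rule AE_mp, intro AE_I2 impI)
    fix x assume x: "x \<in> space (PiM I (\<lambda>_. berg q))" "indicator {0} (F (x(k := x1 k))) = (0::ennreal)"
    show "(\<integral>\<^sup>+w. indicator {0} (F (x(k := w))) \<partial>berg q) = 0"
    proof (rule AE_berg_hol_nonzero[OF sep_hol_slice[OF insert.prems(1) polyd_bergs[OF x(1)]]])
     show "\<exists>w\<in>ball 0 1. F (x(k := w)) \<noteq> 0"
      by (rule bexI[of _ "x1 k"]) (use x(2) nk in \<open>auto simp: indicator_def split: if_splits\<close>)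
    qed
   qed
  qed
  finally show ?case by simp
 qed
 have [measurable]: "F \<in> borel_measurable (PiM I (\<lambda>_. berg q))" by (rule sep_hol_measurable[OF assms(1)])
 from main have "AE x in PiM I (\<lambda>_. berg q). indicator {0} (F x) = (0::ennreal)"
  by (subst (asm) nn_integral_0_iff_AE) auto
 then show ?thesis by eventually_elim (auto simp: indicator_def split: if_splits)
qed

section \<open>Slices of extremal functions\<close>

lemma N1_eq_SUP_rr:
 assumes f: "f holomorphic_on ball 0 1" and p: "p > 0"
 shows "N1 p f = (SUP n. mean1 p f (rr n))"
proof (rule antisym)
 show "N1 p f \<le> (SUP n. mean1 p f (rr n))"
  unfolding N1_def
 proof (rule SUP_least)
  fix r :: real assume r: "r \<in> {0..<1}"
  have "\<forall>\<^sub>F n in sequentially. r < rr n" using rr_lim r by (intro order_tendstoD(1)) auto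
  then obtain n where "r < rr n" unfolding eventually_sequentially by blast
  then have "mean1 p f r \<le> mean1 p f (rr n)" by (intro mean1_mono[OF f p]) (use r rr in auto)
  also have "\<dots> \<le> (SUP n. mean1 p f (rr n))" by (rule SUP_upper) simp
  finally show "mean1 p f r \<le> (SUP n. mean1 p f (rr n))" .
 qed
 show "(SUP n. mean1 p f (rr n)) \<le> N1 p f" by (intro SUP_least mean1_le_N1 rr)
qed

lemma CM_norm: "CM k s (\<lambda>x. norm (F x) powr p) x = mean1 p (\<lambda>w. F (x(k := w))) s"
 by (simp add: CM_def mean1_def)

lemma SL_norm:
 assumes "sep_hol (insert k I) F" "x \<in> polyd I" "p > 0"
 shows "SL k (\<lambda>x. norm (F x) powr p) x = N1 p (\<lambda>w. F (x(k := w)))"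
 unfolding SL_def CM_norm by (rule N1_eq_SUP_rr[OF sep_hol_slice[OF assms(1,2)] assms(3), symmetric])

lemma AE_bergs_box:
 fixes x0 :: "'i::finite \<Rightarrow> complex"
 assumes ae: "AE x in PiM I (\<lambda>_. berg q). P x" and x0: "x0 \<in> polyd I" and e: "e > 0"
 shows "\<exists>x\<in>polyd I. P x \<and> (\<forall>i\<in>I. dist (x i) (x0 i) < e)"
proof -
 define U where "U = (\<lambda>i. ball 0 1 \<inter> ball (x0 i) e)"
 have Um: "U i \<in> sets (berg q)" for i
  unfolding sets_berg sets_restrict_space U_def by (rule imageI) simp
 have pos: "emeasure (berg q) (U i) > 0" if "i \<in> I" for i
 proof (rule emeasure_berg_open_pos)
  have "x0 i \<in> U i" using x0 that e by (simp add: U_def polyd_def)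
  then show "U i \<noteq> {}" by blast
 qed (simp_all add: U_def open_Int)
 have v: "emeasure (PiM I (\<lambda>_. berg q)) (PiE I U) = (\<Prod>i\<in>I. emeasure (berg q) (U i))"
  by (rule bergs.emeasure_PiM) (use Um in auto)
 have "emeasure (berg q) (U i) \<noteq> 0" if "i \<in> I" for i using pos[OF that] by simp
 then have ne: "emeasure (PiM I (\<lambda>_. berg q)) (PiE I U) \<noteq> 0" unfolding v by (simp add: prod_zero_iff)
 have sets: "PiE I U \<in> sets (PiM I (\<lambda>_. berg q))" by (rule sets_PiM_I_finite) (use Um in auto)
 have "\<exists>x\<in>PiE I U. P x"
 proof (rule ccontr)
  assume "\<not> (\<exists>x\<in>PiE I U. P x)"
  then have n: "\<And>x. P x \<Longrightarrow> x \<notin> PiE I U" by blast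
  have "AE x in PiM I (\<lambda>_. berg q). x \<notin> PiE I U" by (rule eventually_mono[OF ae n])
  then have "PiE I U \<in> null_sets (PiM I (\<lambda>_. berg q))" by (simp only: AE_iff_null_sets[OF sets])
  then show False using ne by (auto simp: null_sets_def)
 qed
 then obtain x where "x \<in> PiE I U" "P x" by blast
 then have "x i \<in> U i" if "i \<in> I" for i using that by (simp add: PiE_iff)
 then have "norm (x i) < 1 \<and> dist (x0 i) (x i) < e" if "i \<in> I" for i using that by (simp add: U_def)
 then show ?thesis using \<open>P x\<close> by (intro bexI[of _ x]) (auto simp: polyd_def dist_commute[of _ "x0 _"])
qed

definition slice_kernel :: "nat \<Rightarrow> (nat \<Rightarrow> real) \<Rightarrow> 'i \<Rightarrow> (nat \<Rightarrow> ('i \<Rightarrow> complex) \<Rightarrow> complex) \<Rightarrow> ('i \<Rightarrow> complex) \<Rightarrow> complex \<Rightarrow> bool" where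
 "slice_kernel m p k F x b \<longleftrightarrow> (\<forall>j\<in>{1..m}. \<forall>w\<in>ball 0 1.
  F j (x(k := w)) = F j (x(k := 0)) * (1 - b * w) powr (- of_real (2 / p j)))"

text \<open>The data for which the inequality in the coordinates \<open>I\<close> is a nontrivial equality.\<close>

definition extremal :: "nat \<Rightarrow> (nat \<Rightarrow> real) \<Rightarrow> 'i::finite set \<Rightarrow> (nat \<Rightarrow> ('i \<Rightarrow> complex) \<Rightarrow> complex) \<Rightarrow> bool" where
 "extremal m p I F \<longleftrightarrow>
  (\<forall>j\<in>{1..m}. p j > 0 \<and> sep_hol I (F j) \<and> (\<exists>x\<in>polyd I. F j x \<noteq> 0) \<and> NI I (\<lambda>x. norm (F j x) powr p j) < \<infinity>) \<and>
  (\<integral>\<^sup>+x. (\<Prod>j=1..m. ennreal (norm (F j x) powr p j)) \<partial>PiM I (\<lambda>_. berg (m - 2)))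
   = (\<Prod>j=1..m. NI I (\<lambda>x. norm (F j x) powr p j))"

text \<open>The integral of the slices over the disc is at most the product of the slice norms, whose
integral is bounded by \<open>SL_ineq\<close>. In case of equality both estimates are sharp, so
almost every slice is a kernel. By compactness the same holds for every slice, where the limit
of the parameters could a priori have modulus one.\<close>

lemma extremal_slices:
 fixes F :: "nat \<Rightarrow> ('i::finite \<Rightarrow> complex) \<Rightarrow> complex"
 assumes m: "m \<ge> 2" and k: "k \<notin> I" and E: "extremal m p (insert k I) F"
 shows "(\<integral>\<^sup>+x. (\<Prod>j=1..m. SL k (\<lambda>x. norm (F j x) powr p j) x) \<partial>PiM I (\<lambda>_. berg (m - 2))) = (\<Prod>j=1..m. NI (insert k I) (\<lambda>x. norm (F j x) powr p j))"
  and "\<exists>x\<in>polyd I. \<exists>b. norm b < 1 \<and> slice_kernel m p k F x b"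
  and "\<forall>x\<in>polyd I. \<exists>b. norm b \<le> 1 \<and> slice_kernel m p k F x b"
proof -
 have p: "\<And>j. j \<in> {1..m} \<Longrightarrow> p j > 0"
  and F: "\<And>j. j \<in> {1..m} \<Longrightarrow> sep_hol (insert k I) (F j)"
  and nz: "\<And>j. j \<in> {1..m} \<Longrightarrow> \<exists>x\<in>polyd (insert k I). F j x \<noteq> 0"
  and fin: "\<And>j. j \<in> {1..m} \<Longrightarrow> NI (insert k I) (\<lambda>x. norm (F j x) powr p j) < \<infinity>"
  and eq: "(\<integral>\<^sup>+x. (\<Prod>j=1..m. ennreal (norm (F j x) powr p j)) \<partial>PiM (insert k I) (\<lambda>_. berg (m - 2)))
   = (\<Prod>j=1..m. NI (insert k I) (\<lambda>x. norm (F j x) powr p j))"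
  using E unfolding extremal_def by blast+
 let ?M = "PiM I (\<lambda>_::'i. berg (m - 2))"
 define u where "u = (\<lambda>j x. norm (F j x) powr p j)"
 have us: "slice_mod (insert k I) (u j)" if "j \<in> {1..m}" for j
  unfolding u_def by (rule sep_hol_imp_slice_mod[OF F[OF that] p[OF that]])
 define A where "A = (\<lambda>x. \<integral>\<^sup>+w. (\<Prod>j=1..m. ennreal (u j (x(k := w)))) \<partial>berg (m - 2))"
 define S where "S = (\<lambda>x. \<Prod>j=1..m. SL k (u j) x)"
 have um: "(\<lambda>x. \<Prod>j=1..m. ennreal (u j x)) \<in> borel_measurable (PiM (insert k I) (\<lambda>_. berg (m - 2)))"
  by (intro borel_measurable_prod_ennreal slice_mod_measurable_bergs us)
 have EA: "(\<integral>\<^sup>+x. (\<Prod>j=1..m. ennreal (u j x)) \<partial>PiM (insert k I) (\<lambda>_. berg (m - 2))) = (\<integral>\<^sup>+x. A x \<partial>?M)"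
  unfolding A_def by (rule bergs.product_nn_integral_insert[OF finite k um])
 have Am: "A \<in> borel_measurable ?M"
 proof -
  have "(\<lambda>p. (fst p)(k := snd p)) \<in> measurable (?M \<Otimes>\<^sub>M berg (m - 2)) (PiM (insert k I) (\<lambda>_. berg (m - 2)))"
   using measurable_add_dim[of k I "\<lambda>_. berg (m - 2)"] by (simp add: case_prod_beta')
  from measurable_compose[OF this um]
  have "(\<lambda>(x, w). \<Prod>j=1..m. ennreal (u j (x(k := w)))) \<in> borel_measurable (?M \<Otimes>\<^sub>M berg (m - 2))"
   by (simp add: case_prod_beta')
  from berg.borel_measurable_nn_integral[OF this] show ?thesis by (simp add: A_def)
 qed
 have Sm: "S \<in> borel_measurable ?M"
  unfolding S_def SL_def by (intro borel_measurable_prod_ennreal borel_measurable_SUP countableI_type CM_measurable1 us rr)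
 have SLN: "SL k (u j) x = N1 (p j) (\<lambda>w. F j (x(k := w)))" if "j \<in> {1..m}" "x \<in> polyd I" for j x
  unfolding u_def by (rule SL_norm[OF F[OF that(1)] that(2) p[OF that(1)]])
 have hol: "(\<lambda>w. F j (x(k := w))) holomorphic_on ball 0 1" if "j \<in> {1..m}" "x \<in> polyd I" for j x
  by (rule sep_hol_slice[OF F[OF that(1)] that(2)])
 have A_eq: "A x = (\<integral>\<^sup>+w. ennreal (\<Prod>j=1..m. norm (F j (x(k := w))) powr p j) \<partial>berg (m - 2))" for x
  unfolding A_def u_def by (rule nn_integral_cong) (simp add: prod_ennreal)
 have S_eq: "S x = (\<Prod>j=1..m. N1 (p j) (\<lambda>w. F j (x(k := w))))" if "x \<in> polyd I" for x
  unfolding S_def by (rule prod.cong[OF refl]) (rule SLN[OF _ that])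
 \<comment> \<open>The integral over the disc is compared with the slice norms pointwise, and these are compared with the norms on average.\<close>
 have AS: "A x \<le> S x" if "x \<in> space ?M" for x
  unfolding A_eq S_eq[OF polyd_bergs[OF that]]
  by (rule burbea_disc_le[OF m p hol[OF _ polyd_bergs[OF that]]])
 have SN: "(\<integral>\<^sup>+x. S x \<partial>?M) \<le> (\<Prod>j=1..m. NI (insert k I) (u j))"
  unfolding S_def by (rule SL_ineq[OF m k us])
 have AN: "(\<integral>\<^sup>+x. A x \<partial>?M) = (\<Prod>j=1..m. NI (insert k I) (u j))"
  using eq EA by (simp add: u_def)
 have "(\<integral>\<^sup>+x. A x \<partial>?M) \<le> (\<integral>\<^sup>+x. S x \<partial>?M)" by (rule nn_integral_mono[OF AS])
 with SN AN have iS: "(\<integral>\<^sup>+x. S x \<partial>?M) = (\<Prod>j=1..m. NI (insert k I) (u j))" by (metis antisym)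
 then show "(\<integral>\<^sup>+x. (\<Prod>j=1..m. SL k (\<lambda>x. norm (F j x) powr p j) x) \<partial>?M) = (\<Prod>j=1..m. NI (insert k I) (\<lambda>x. norm (F j x) powr p j))"
  by (simp add: S_def u_def)
 have Sfin: "(\<integral>\<^sup>+x. S x \<partial>?M) < \<infinity>"
  unfolding iS using fin by (simp add: u_def ennreal_prod_eq_top less_top[symmetric])
 have ae1: "AE x in ?M. A x = S x"
  by (rule nn_integral_le_eq_imp_AE_eq[OF Am Sm AS]) (use AN iS Sfin in auto)
 have ae2: "AE x in ?M. S x \<noteq> \<infinity>"
  by (rule nn_integral_PInf_AE[OF Sm]) (use Sfin in auto)
 have ae3: "AE x in ?M. \<forall>j\<in>{1..m}. \<exists>w\<in>ball 0 1. F j (x(k := w)) \<noteq> 0"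
 proof (rule AE_finite_allI)
  fix j assume j: "j \<in> {1..m}"
  obtain x1 where x1: "x1 \<in> polyd (insert k I)" "F j x1 \<noteq> 0" using nz[OF j] by blast
  have n1: "norm (x1 k) < 1" using x1(1) by (simp add: polyd_def)
  have "AE x in ?M. F j (x(k := x1 k)) \<noteq> 0"
   by (rule AE_sep_hol_nonzero[OF sep_hol_upd[OF F[OF j] k n1], of x1]) (use x1 in \<open>auto simp: polyd_def\<close>)
  then show "AE x in ?M. \<exists>w\<in>ball 0 1. F j (x(k := w)) \<noteq> 0"
   by eventually_elim (rule bexI[of _ "x1 k"], use n1 in auto)
 qed simp
 have good: "AE x in ?M. \<exists>b. norm b < 1 \<and> slice_kernel m p k F x b"
  using ae1 ae2 ae3
 proof (rule AE_mp[OF AE_conjI[OF _ AE_conjI]], intro AE_I2 impI, elim conjE)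
  fix x assume "x \<in> space ?M" and x: "A x = S x" "S x \<noteq> \<infinity>" "\<forall>j\<in>{1..m}. \<exists>w\<in>ball 0 1. F j (x(k := w)) \<noteq> 0"
  then have xp: "x \<in> polyd I" by (intro polyd_bergs)
  define h where "h = (\<lambda>j w. F j (x(k := w)))"
  have hh: "h j holomorphic_on ball 0 1" if "j \<in> {1..m}" for j unfolding h_def by (rule hol[OF that xp])
  have hnz: "\<exists>w\<in>ball 0 1. h j w \<noteq> 0" if "j \<in> {1..m}" for j using x(3) that by (simp add: h_def)
  have N0: "N1 (p j) (h j) \<noteq> 0" if "j \<in> {1..m}" for j
   using N1_eq_0_imp[OF hh[OF that] p[OF that]] hnz[OF that] by blast
  have "(\<Prod>j=1..m. N1 (p j) (h j)) \<noteq> \<infinity>" using x(2) unfolding S_eq[OF xp] h_def .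
  then have Nf: "N1 (p j) (h j) < \<infinity>" if "j \<in> {1..m}" for j
   using N0 that by (auto simp: ennreal_prod_eq_top less_top)
  have e: "(\<integral>\<^sup>+w. ennreal (\<Prod>j=1..m. norm (h j w) powr p j) \<partial>berg (m - 2)) = (\<Prod>j=1..m. N1 (p j) (h j))"
   using x(1) unfolding A_eq S_eq[OF xp] h_def .
  obtain b where b: "norm b < 1" "\<forall>j\<in>{1..m}. \<exists>C. \<forall>z\<in>ball 0 1. h j z = C * (1 - b * z) powr (- of_real (2 / p j))"
   using burbea_disc_eq[OF m p hh hnz Nf e] by blast
  have "slice_kernel m p k F x b"
   unfolding slice_kernel_def
  proof (intro ballI)
   fix j w assume j: "j \<in> {1..m}" and w: "w \<in> ball (0::complex) 1"
   obtain C where C: "\<And>z. z \<in> ball 0 1 \<Longrightarrow> h j z = C * (1 - b * z) powr (- of_real (2 / p j))" using b(2) j by blast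
   have "h j 0 = C" using C[of 0] by simp
   then show "F j (x(k := w)) = F j (x(k := 0)) * (1 - b * w) powr (- of_real (2 / p j))"
    using C[OF w] by (simp add: h_def)
  qed
  then show "\<exists>b. norm b < 1 \<and> slice_kernel m p k F x b" using b(1) by blast
 qed
 show "\<exists>x\<in>polyd I. \<exists>b. norm b < 1 \<and> slice_kernel m p k F x b"
  using AE_bergs_box[OF good, of "\<lambda>_. 0" 1] by (auto simp: polyd_def)
 show "\<forall>x\<in>polyd I. \<exists>b. norm b \<le> 1 \<and> slice_kernel m p k F x b"
 proof
  fix x assume x: "x \<in> polyd I"
  have "\<exists>y b. y \<in> polyd I \<and> norm b < 1 \<and> slice_kernel m p k F y b \<and> (\<forall>i\<in>I. dist (y i) (x i) < 1 / real (Suc n))" for n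
   using AE_bergs_box[OF good x, of "1 / real (Suc n)"] by auto
  then obtain y b where yb: "\<And>n. y n \<in> polyd I" "\<And>n. norm (b n) < 1" "\<And>n. slice_kernel m p k F (y n) (b n)"
   "\<And>n i. i \<in> I \<Longrightarrow> dist (y n i) (x i) < 1 / real (Suc n)"
   by metis
  define X where "X = (\<lambda>n i. if i \<in> I then y n i else x i)"
  have XI: "X n \<in> polyd I" for n using yb(1)[of n] by (simp add: X_def polyd_def)
  have Xl: "(\<lambda>n. X n i) \<longlonglongrightarrow> x i" for i
  proof (cases "i \<in> I")
   case True
   have "(\<lambda>n. dist (y n i) (x i)) \<longlonglongrightarrow> 0"
    by (rule tendsto_sandwich[OF _ _ tendsto_const LIMSEQ_Suc[OF lim_const_over_n[of 1]]])
     (use yb(4)[OF True] in \<open>auto simp: less_imp_le\<close>)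
   then have "(\<lambda>n. y n i) \<longlonglongrightarrow> x i" by (subst tendsto_dist_iff)
   then show ?thesis using True by (simp add: X_def)
  qed (simp add: X_def)
  have FX: "F j ((y n)(k := w)) = F j ((X n)(k := w))" if "j \<in> {1..m}" for j n w
   by (rule sep_holD(2)[OF F[OF that]]) (auto simp: X_def)
  have "compact (cball (0::complex) 1)" by simp
  then have "seq_compact (cball (0::complex) 1)" by (simp add: compact_eq_seq_compact_metric)
  then obtain c \<sigma> where c: "c \<in> cball 0 1" "strict_mono (\<sigma> :: nat \<Rightarrow> nat)" "(b \<circ> \<sigma>) \<longlonglongrightarrow> c"
   by (rule seq_compactE[of _ b]) (use yb(2) in \<open>auto intro: less_imp_le\<close>)
  have "slice_kernel m p k F x c"
   unfolding slice_kernel_def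
  proof (intro ballI)
   fix j w assume j: "j \<in> {1..m}" and w: "w \<in> ball (0::complex) 1"
   have lim: "(\<lambda>n. F j ((X (\<sigma> n))(k := a))) \<longlonglongrightarrow> F j (x(k := a))" if "norm a < 1" for a
    by (rule polyd_lim[OF sep_holD(1)[OF sep_hol_upd[OF F[OF j] k that]] _ x XI])
     (rule LIMSEQ_subseq_LIMSEQ[OF Xl c(2), unfolded o_def])
   have re: "Re (1 - c * w) > 0"
   proof -
    have "norm (c * w) \<le> 1 * norm w" unfolding norm_mult using c(1) by (intro mult_right_mono) auto
    then show ?thesis using complex_Re_le_cmod[of "c * w"] w by simp
   qed
   have "(\<lambda>n. F j ((X (\<sigma> n))(k := 0)) * (1 - b (\<sigma> n) * w) powr (- of_real (2 / p j))) \<longlonglongrightarrow> F j (x(k := 0)) * (1 - c * w) powr (- of_real (2 / p j))"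
    by (intro tendsto_intros lim c(3)[unfolded o_def]) (use re in \<open>auto simp: complex_nonpos_Reals_iff less_le_not_le\<close>)
   moreover have "(\<lambda>n. F j ((X (\<sigma> n))(k := w))) \<longlonglongrightarrow> F j (x(k := w))" by (rule lim) (use w in simp)
   moreover have "F j ((X (\<sigma> n))(k := w)) = F j ((X (\<sigma> n))(k := 0)) * (1 - b (\<sigma> n) * w) powr (- of_real (2 / p j))" for n
    using yb(3)[of "\<sigma> n"] j w unfolding slice_kernel_def FX[OF j, symmetric] by blast
   ultimately show "F j (x(k := w)) = F j (x(k := 0)) * (1 - c * w) powr (- of_real (2 / p j))"
    using LIMSEQ_unique by simp
  qed
  then show "\<exists>b. norm b \<le> 1 \<and> slice_kernel m p k F x b" using c(1) by (intro exI[of _ c]) simp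
 qed
qed

text \<open>A slice that vanishes at one point vanishes identically. Moving the coordinates one by one to
those of a point where the function is not zero gives a contradiction.\<close>

lemma extremal_zero_free:
 fixes F :: "nat \<Rightarrow> ('i::finite \<Rightarrow> complex) \<Rightarrow> complex"
 assumes m: "m \<ge> 2" and E: "extremal m p J F" and j: "j \<in> {1..m}" and x: "x \<in> polyd J"
 shows "F j x \<noteq> 0"
proof
 assume F0: "F j x = 0"
 obtain x1 where x1: "x1 \<in> polyd J" "F j x1 \<noteq> 0" using E j unfolding extremal_def by blast
 have F: "sep_hol J (F j)" using E j unfolding extremal_def by blast
 have step: "F j (y(i := w)) = 0" if i: "i \<in> J" and y: "y \<in> polyd J" "F j y = 0" and w: "norm w < 1" for i y w
 proof -
  have J: "insert i (J - {i}) = J" using i by blast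
  have y': "y \<in> polyd (J - {i})" using y(1) by (auto simp: polyd_def)
  have "extremal m p (insert i (J - {i})) F" using E by (simp only: J)
  from extremal_slices(3)[OF m _ this] y' obtain b where b: "norm b \<le> 1" "slice_kernel m p i F y b" by blast
  have e: "F j (y(i := v)) = F j (y(i := 0)) * (1 - b * v) powr (- of_real (2 / p j))" if "norm v < 1" for v
   by (rule b(2)[unfolded slice_kernel_def, rule_format, OF j]) (use that in simp)
  have "norm (y i) < 1" using y(1) i by (simp add: polyd_def)
  have "F j y = F j (y(i := 0)) * (1 - b * y i) powr (- of_real (2 / p j))" using e[OF \<open>norm (y i) < 1\<close>] by (simp only: fun_upd_triv)
  then have "F j (y(i := 0)) = 0" using y(2) one_minus_mult_nz[OF b(1) \<open>norm (y i) < 1\<close>] by simp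
  then show ?thesis using e[OF w] by (simp only: mult_zero_left)
 qed
 have "F j (\<lambda>i. if i \<in> S then x1 i else x i) = 0" if "S \<subseteq> J" for S
  using finite[of S] that
 proof (induction S rule: finite_induct)
  case (insert i S)
  let ?y = "\<lambda>i. if i \<in> S then x1 i else x i"
  have "F j (?y(i := x1 i)) = 0"
   by (rule step) (use insert x x1(1) in \<open>auto simp: polyd_def\<close>)
  moreover have "?y(i := x1 i) = (\<lambda>a. if a \<in> insert i S then x1 a else x a)" by auto
  ultimately show ?case by simp
 qed (use F0 in simp)
 from this[of J] have "F j (\<lambda>i. if i \<in> J then x1 i else x i) = 0" by simp
 moreover have "F j (\<lambda>i. if i \<in> J then x1 i else x i) = F j x1" by (rule sep_holD(2)[OF F]) simp
 ultimately show False using x1(2) by simp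
qed

text \<open>The point \<open>w0\<close> is so close to zero that the value of the kernel power there stays
in the right half plane and the principal branch of the logarithm undoes the power. The
parameter is thus a holomorphic function of a value of the slice.\<close>

lemma kernel_parameter:
 assumes q: "q > 0" and b: "norm b \<le> 1"
 defines "w0 \<equiv> min (1/4) (1 / (2 * q))"
 shows "Re ((1 - b * of_real w0) powr (- of_real q)) > 0"
  and "(1 - exp (- of_real (1 / q) * Ln ((1 - b * of_real w0) powr (- of_real q)))) / of_real w0 = b"
proof -
 have w0: "0 < w0" "w0 \<le> 1/4" "w0 \<le> 1 / (2 * q)" using q by (auto simp: w0_def)
 have nb: "norm (b * of_real w0) \<le> w0" using b w0 by (simp add: norm_mult mult_left_le_one_le)
 have n1: "norm (Ln (1 - b * of_real w0)) \<le> 2 * w0"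
  using norm_Ln_le[of "- (b * of_real w0)"] nb w0 by simp
 have nz: "1 - b * of_real w0 \<noteq> 0" by (rule one_minus_mult_nz[OF b]) (use w0 in simp)
 define z where "z = - of_real q * Ln (1 - b * of_real w0)"
 have "norm z \<le> q * (2 * w0)" unfolding z_def using n1 q by (simp add: norm_mult)
 also have "\<dots> \<le> q * (2 * (1 / (2 * q)))" using q w0(3) by (intro mult_left_mono) auto
 also have "\<dots> = 1" using q by simp
 finally have nz1: "norm z \<le> 1" .
 have im: "\<bar>Im z\<bar> \<le> 1" using abs_Im_le_cmod[of z] nz1 by linarith
 have pw: "(1 - b * of_real w0) powr (- of_real q) = exp z" using nz by (simp add: powr_def z_def)
 have "cos (Im z) > 0" by (rule cos_gt_zero_pi) (use im pi_gt3 in linarith)+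
 then show "Re ((1 - b * of_real w0) powr (- of_real q)) > 0" unfolding pw by (simp add: Re_exp)
 have "Ln (exp z) = z" by (rule Ln_exp) (use im pi_gt3 in linarith)+
 then have "exp (- of_real (1 / q) * Ln ((1 - b * of_real w0) powr (- of_real q))) = 1 - b * of_real w0"
  unfolding pw using q nz by (simp add: z_def)
 then show "(1 - exp (- of_real (1 / q) * Ln ((1 - b * of_real w0) powr (- of_real q)))) / of_real w0 = b"
  using w0(1) by (simp add: field_simps)
qed

lemma kernel_power_norm':
 fixes b z :: complex
 assumes "norm b \<le> 1" "norm z < 1" "p > 0"
 shows "norm ((1 - b * z) powr (- of_real (2 / p))) powr p = 1 / (norm (1 - b * z))\<^sup>2"
proof -
 have nz: "1 - b * z \<noteq> 0" by (rule one_minus_mult_nz) (use assms in auto)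
 have "norm ((1 - b * z) powr (- of_real (2 / p))) powr p = (norm (1 - b * z) powr (- (2 / p))) powr p"
  using norm_powr_of_real[OF nz, of "- (2 / p)"] by simp
 also have "\<dots> = norm (1 - b * z) powr (- 2)" using assms by (simp add: powr_powr)
 also have "\<dots> = 1 / (norm (1 - b * z))\<^sup>2" using nz by (simp add: powr_minus divide_inverse)
 finally show ?thesis .
qed

lemma circ_kernel_mean:
 assumes a: "norm a < 1"
 shows "(\<integral>\<^sup>+w. ennreal (1 / (norm (1 - a * w))\<^sup>2) \<partial>circ) = (\<Sum>l. ennreal (((norm a)\<^sup>2) ^ l))"
proof -
 have "(\<integral>\<^sup>+w. ennreal (1 / (norm (1 - a * w))\<^sup>2) \<partial>circ) = (\<integral>\<^sup>+w. ennreal ((norm (\<Sum>l. a ^ l * w ^ l))\<^sup>2) \<partial>circ)"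
 proof (rule nn_integral_cong)
  fix w assume "w \<in> space circ"
  then have "norm (a * w) < 1" using a by (simp add: norm_mult)
  then have "(\<Sum>l. a ^ l * w ^ l) = 1 / (1 - a * w)" by (simp add: suminf_geometric flip: power_mult_distrib)
  then show "ennreal (1 / (norm (1 - a * w))\<^sup>2) = ennreal ((norm (\<Sum>l. a ^ l * w ^ l))\<^sup>2)"
   by (simp add: norm_divide power_divide)
 qed
 also have "\<dots> = (\<Sum>l. ennreal ((norm (a ^ l))\<^sup>2))"
  by (rule parseval_abs_summable) (use a in \<open>simp add: norm_power summable_geometric\<close>)
 also have "\<dots> = (\<Sum>l. ennreal (((norm a)\<^sup>2) ^ l))"
  by (simp add: norm_power mult.commute flip: power_mult)
 finally show ?thesis .
qed

text \<open>Comparing the moduli for \<open>w\<close> and \<open>-w\<close> isolates the real part of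
\<open>a * w\<close>.\<close>

lemma kernel_unique:
 fixes a b C C' :: complex
 assumes "C \<noteq> 0" "norm a < 1" "norm b < 1"
  and eq: "\<And>w. norm w < 1 \<Longrightarrow> C' * (1 - a * w) powr (- of_real q) = C * (1 - b * w) powr (- of_real q)" and q: "q > 0"
 shows "a = b"
proof -
 have "C' = C" using eq[of 0] by simp
 have n: "norm (1 - a * w) = norm (1 - b * w)" if w: "norm w < 1" for w
 proof -
  have nz: "1 - a * w \<noteq> 0" "1 - b * w \<noteq> 0"
   by (simp_all only: one_minus_mult_nz[OF less_imp_le[OF assms(2)] w] one_minus_mult_nz[OF less_imp_le[OF assms(3)] w] not_False_eq_True)
  have "(1 - a * w) powr (- of_real q) = (1 - b * w) powr (- of_real q)" using eq[OF w] \<open>C' = C\<close> assms(1) by simp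
  then have "norm (1 - a * w) powr (- q) = norm (1 - b * w) powr (- q)"
   using norm_powr_of_real[OF nz(1), of "- q"] norm_powr_of_real[OF nz(2), of "- q"] by simp
  then have "(norm (1 - a * w) powr (- q)) powr (- 1 / q) = (norm (1 - b * w) powr (- q)) powr (- 1 / q)" by (simp only:)
  then show ?thesis using q nz by (simp add: powr_powr)
 qed
 have sq: "(norm (1 - a * w))\<^sup>2 = 1 - 2 * Re (a * w) + (norm (a * w))\<^sup>2" for a w
  by (simp only: cmod_power2) (simp add: power2_eq_square algebra_simps)
 have re: "Re (a * w) = Re (b * w)" if w: "norm w < 1" for w
 proof -
  have "1 - 2 * Re (a * w) + (norm (a * w))\<^sup>2 = 1 - 2 * Re (b * w) + (norm (b * w))\<^sup>2"
   using n[OF w] sq[of a w] sq[of b w] by simp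
  moreover have "1 - 2 * Re (a * - w) + (norm (a * - w))\<^sup>2 = 1 - 2 * Re (b * - w) + (norm (b * - w))\<^sup>2"
   using n[of "- w"] sq[of a "- w"] sq[of b "- w"] w by simp
  ultimately show ?thesis by simp
 qed
 show "a = b" using re[of "1/2"] re[of "\<i>/2"] by (simp add: complex_eq_iff norm_divide)
qed

lemma continuous_on_coord: "continuous_on S (\<lambda>x. x i :: complex)"
 by (rule continuous_on_subset[OF continuous_on_product_coordinates subset_UNIV])

lemma sep_hol_mult:
 assumes "sep_hol I F" "sep_hol I G" shows "sep_hol I (\<lambda>x. F x * G x)"
 unfolding sep_hol_def
proof (intro conjI ballI allI impI)
 show "continuous_on (polyd I) (\<lambda>x. F x * G x)" by (intro continuous_intros sep_holD(1) assms)
 show "F x * G x = F y * G y" if "\<forall>i\<in>I. x i = y i" for x y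
  using sep_holD(2)[OF assms(1), of x y] sep_holD(2)[OF assms(2), of x y] that by simp
 show "(\<lambda>w. F (x(i := w)) * G (x(i := w))) holomorphic_on ball 0 1" if "x \<in> polyd I" "i \<in> I" for x i
  by (intro holomorphic_intros sep_holD(3)[OF assms(1)] sep_holD(3)[OF assms(2)] that)
qed

lemma sep_hol_kernel:
 fixes \<zeta> :: "'i::finite \<Rightarrow> complex"
 assumes z: "\<zeta> \<in> polyd I" shows "sep_hol I (\<lambda>x. C * (\<Prod>i\<in>I. 1 / (1 - \<zeta> i * x i)))"
proof -
 have nz: "1 - \<zeta> i * w \<noteq> 0" if "i \<in> I" "norm w < 1" for i w
  by (rule one_minus_mult_nz) (use z that in \<open>auto simp: polyd_def less_imp_le\<close>)
 show ?thesis
  unfolding sep_hol_def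
 proof (intro conjI ballI allI impI)
  show "continuous_on (polyd I) (\<lambda>x. C * (\<Prod>i\<in>I. 1 / (1 - \<zeta> i * x i)))"
   by (intro continuous_intros continuous_on_coord ballI) (use nz in \<open>auto simp: polyd_def\<close>)
  show "C * (\<Prod>i\<in>I. 1 / (1 - \<zeta> i * x i)) = C * (\<Prod>i\<in>I. 1 / (1 - \<zeta> i * y i))" if "\<forall>i\<in>I. x i = y i" for x y
   by (rule arg_cong[where f="\<lambda>t. C * t"], rule prod.cong[OF refl]) (use that in simp)
  fix x i assume x: "x \<in> polyd I" "i \<in> I"
  have "(\<lambda>w. 1 / (1 - \<zeta> i' * (x(i := w)) i')) holomorphic_on ball 0 1" if "i' \<in> I" for i'
  proof (cases "i' = i")
   case True
   then show ?thesis using nz[OF x(2)] by (auto intro!: holomorphic_intros)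
  qed simp
  then have "(\<lambda>w. \<Prod>i'\<in>I. 1 / (1 - \<zeta> i' * (x(i := w)) i')) holomorphic_on ball 0 1"
   by (rule holomorphic_on_prod)
  then show "(\<lambda>w. C * (\<Prod>i'\<in>I. 1 / (1 - \<zeta> i' * (x(i := w)) i'))) holomorphic_on ball 0 1"
   by (rule holomorphic_on_mult[OF holomorphic_on_const])
 qed
qed

section \<open>Rigidity in several variables\<close>

lemma suminf_SUP_incseq:
 fixes h :: "nat \<Rightarrow> nat \<Rightarrow> ennreal"
 assumes "\<And>l. incseq (h l)"
 shows "(\<Sum>l. SUP n. h l n) = (SUP n. \<Sum>l. h l n)"
proof (rule ennreal_suminf_SUP_eq_directed[where f="\<lambda>n l. h l n"])
 fix N :: "nat set" and i j :: nat
 show "\<exists>k\<in>UNIV. \<forall>l\<in>N. h l i \<le> h l k \<and> h l j \<le> h l k"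
  using assms by (intro bexI[of _ "max i j"]) (auto simp: incseq_def)
qed

lemma rr_power_incseq: "incseq (\<lambda>n. ennreal (((rr n)\<^sup>2) ^ l))"
 unfolding incseq_def by (auto intro!: ennreal_leI power_mono rr rr_mono)

lemma rr_power_SUP: "(SUP n. ennreal (((rr n)\<^sup>2) ^ l)) = 1"
proof -
 have "(\<lambda>n. ennreal (((rr n)\<^sup>2) ^ l)) \<longlonglongrightarrow> ennreal ((1\<^sup>2) ^ l)"
  by (intro tendsto_ennrealI tendsto_power rr_lim)
 then show ?thesis using LIMSEQ_SUP[OF rr_power_incseq[of l]] LIMSEQ_unique by fastforce
qed

text \<open>The Parseval identity for a geometric series; the powers of the modulus of the parameter
separate from the powers of the radius.\<close>

lemma CM_kernel:
 assumes a: "norm a \<le> 1" and s: "0 \<le> s" "s < 1" and p: "p > 0"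
  and F: "\<forall>w\<in>ball 0 1. F (x(k := w)) = A * (1 - a * w) powr (- of_real (2 / p))"
 shows "CM k s (\<lambda>x. norm (F x) powr p) x = (\<Sum>l. ennreal (norm A powr p * ((norm a)\<^sup>2) ^ l) * ennreal ((s\<^sup>2) ^ l))"
proof -
 have as: "norm (a * of_real s) < 1"
  using a s mult_left_le_one_le[of s "norm a"] by (simp add: norm_mult)
 have "CM k s (\<lambda>x. norm (F x) powr p) x = (\<integral>\<^sup>+w. ennreal (norm A powr p) * ennreal (1 / (norm (1 - a * of_real s * w))\<^sup>2) \<partial>circ)"
  unfolding CM_def
 proof (rule nn_integral_cong)
  fix w assume w: "w \<in> space circ"
  then have sw: "norm (of_real s * w) < 1" using s by (simp add: norm_mult)
  then have "F (x(k := of_real s * w)) = A * (1 - a * (of_real s * w)) powr (- of_real (2 / p))" using F by simp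
  then have "norm (F (x(k := of_real s * w))) powr p = norm A powr p * (norm ((1 - a * (of_real s * w)) powr (- of_real (2 / p))) powr p)"
   by (simp add: norm_mult powr_mult)
  also have "\<dots> = norm A powr p * (1 / (norm (1 - a * (of_real s * w)))\<^sup>2)"
   by (simp only: kernel_power_norm'[OF a sw p])
  finally show "ennreal (norm (F (x(k := of_real s * w))) powr p) = ennreal (norm A powr p) * ennreal (1 / (norm (1 - a * of_real s * w))\<^sup>2)"
   by (simp add: mult.assoc flip: ennreal_mult')
 qed
 also have "\<dots> = ennreal (norm A powr p) * (\<integral>\<^sup>+w. ennreal (1 / (norm (1 - a * of_real s * w))\<^sup>2) \<partial>circ)"
  by (rule nn_integral_cmult) (rule borel_measurable_circI, measurable)
 also have "\<dots> = ennreal (norm A powr p) * (\<Sum>l. ennreal (((norm (a * of_real s))\<^sup>2) ^ l))"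
  by (simp only: circ_kernel_mean[OF as])
 also have "\<dots> = (\<Sum>l. ennreal (norm A powr p) * ennreal (((norm (a * of_real s))\<^sup>2) ^ l))" by simp
 also have "\<dots> = (\<Sum>l. ennreal (norm A powr p * ((norm a)\<^sup>2) ^ l) * ennreal ((s\<^sup>2) ^ l))"
 proof (rule suminf_cong)
  fix l
  have "((norm (a * of_real s))\<^sup>2) ^ l = ((norm a)\<^sup>2) ^ l * (s\<^sup>2) ^ l"
   by (simp add: norm_mult power_mult_distrib)
  then show "ennreal (norm A powr p) * ennreal (((norm (a * of_real s))\<^sup>2) ^ l) = ennreal (norm A powr p * ((norm a)\<^sup>2) ^ l) * ennreal ((s\<^sup>2) ^ l)"
   by (simp only:) (simp add: mult.assoc flip: ennreal_mult')
 qed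
 finally show ?thesis .
qed

lemma SL_kernel:
 assumes a: "norm a \<le> 1" and p: "p > 0"
  and F: "\<forall>w\<in>ball 0 1. F (x(k := w)) = A * (1 - a * w) powr (- of_real (2 / p))"
 shows "SL k (\<lambda>x. norm (F x) powr p) x = (\<Sum>l. ennreal (norm A powr p * ((norm a)\<^sup>2) ^ l))"
proof -
 let ?v = "\<lambda>l. ennreal (norm A powr p * ((norm a)\<^sup>2) ^ l)"
 have "SL k (\<lambda>x. norm (F x) powr p) x = (SUP n. \<Sum>l. ?v l * ennreal (((rr n)\<^sup>2) ^ l))"
  unfolding SL_def CM_kernel[where F=F and x=x, OF a rr(1) rr(2) p F] ..
 also have "\<dots> = (\<Sum>l. SUP n. ?v l * ennreal (((rr n)\<^sup>2) ^ l))"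
  by (rule suminf_SUP_incseq[symmetric]) (use rr_power_incseq in \<open>auto simp: incseq_def intro!: mult_left_mono\<close>)
 also have "\<dots> = (\<Sum>l. ?v l)"
  by (simp only: SUP_mult_left_ennreal[symmetric] rr_power_SUP mult_1_right)
 finally show ?thesis .
qed

lemma meanI_incseq:
 fixes u :: "('i::finite \<Rightarrow> complex) \<Rightarrow> real"
 assumes "slice_mod I u" shows "incseq (\<lambda>n. meanI I (\<lambda>_. rr n) u)"
 unfolding incseq_def by (auto intro!: meanI_mono[OF assms] rr rr_mono)

lemma slice_mod_dil_measurable:
 fixes u :: "('i::finite \<Rightarrow> complex) \<Rightarrow> real"
 assumes u: "slice_mod I u"
 shows "(\<lambda>x. ennreal (u (dil (\<lambda>_. rr n) x))) \<in> borel_measurable (PiM I (\<lambda>_. circ))"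
proof -
 have "(\<lambda>x. u (dil (\<lambda>_. rr n) x)) \<in> borel_measurable (PiM I (\<lambda>_. circ))"
 proof (rule measurable_polyd[OF slice_modD(1)[OF u]])
  show "(\<lambda>a. dil (\<lambda>_. rr n) a i) \<in> borel_measurable (PiM I (\<lambda>_. circ))" for i
   unfolding dil_def by (intro borel_measurable_times measurable_coord_circ) simp
  show "dil (\<lambda>_. rr n) a \<in> polyd I" if "a \<in> space (PiM I (\<lambda>_. circ))" for a
   by (rule polyd_circs[OF that]) (simp add: rr)
 qed
 then show ?thesis by (rule measurable_compose) simp
qed

text \<open>Both sides are limits of means with increasing radii, so the expansion of the slices can be
summed term by term.\<close>

lemma NI_series:
 fixes u :: "('i::finite \<Rightarrow> complex) \<Rightarrow> real"
 assumes k: "k \<notin> I" and u: "slice_mod (insert k I) u" and v: "\<And>l. slice_mod I (v l)"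
  and CM: "\<And>x n. x \<in> polyd I \<Longrightarrow> CM k (rr n) u x = (\<Sum>l. ennreal (v l x) * ennreal (((rr n)\<^sup>2) ^ l))"
 shows "NI (insert k I) u = (\<Sum>l. NI I (v l))"
proof -
 have r: "\<forall>i::'i. 0 \<le> rr n \<and> rr n < 1" for n by (simp add: rr)
 have M: "meanI (insert k I) (\<lambda>_. rr n) u = (\<Sum>l. meanI I (\<lambda>_. rr n) (v l) * ennreal (((rr n)\<^sup>2) ^ l))" for n
 proof -
  have "meanI (insert k I) (\<lambda>_. rr n) u = (\<integral>\<^sup>+x. CM k (rr n) u (dil (\<lambda>_. rr n) x) \<partial>PiM I (\<lambda>_. circ))"
   unfolding CM_def by (rule meanI_insert(1)[OF u k r])
  also have "\<dots> = (\<integral>\<^sup>+x. (\<Sum>l. ennreal (v l (dil (\<lambda>_. rr n) x)) * ennreal (((rr n)\<^sup>2) ^ l)) \<partial>PiM I (\<lambda>_. circ))"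
   by (rule nn_integral_cong) (rule CM[OF polyd_circs[OF _ r]])
  also have "\<dots> = (\<Sum>l. \<integral>\<^sup>+x. ennreal (v l (dil (\<lambda>_. rr n) x)) * ennreal (((rr n)\<^sup>2) ^ l) \<partial>PiM I (\<lambda>_. circ))"
   by (rule nn_integral_suminf) (intro borel_measurable_times_ennreal slice_mod_dil_measurable v borel_measurable_const)
  also have "\<dots> = (\<Sum>l. meanI I (\<lambda>_. rr n) (v l) * ennreal (((rr n)\<^sup>2) ^ l))"
   unfolding meanI_def by (rule suminf_cong) (rule nn_integral_multc[OF slice_mod_dil_measurable[OF v]])
  finally show ?thesis .
 qed
 have "NI (insert k I) u = (SUP n. \<Sum>l. meanI I (\<lambda>_. rr n) (v l) * ennreal (((rr n)\<^sup>2) ^ l))"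
  unfolding NI_eq_SUP_seq[OF u, folded rr_def] M ..
 also have "\<dots> = (\<Sum>l. SUP n. meanI I (\<lambda>_. rr n) (v l) * ennreal (((rr n)\<^sup>2) ^ l))"
 proof (rule suminf_SUP_incseq[symmetric])
  fix l
  show "incseq (\<lambda>n. meanI I (\<lambda>_. rr n) (v l) * ennreal (((rr n)\<^sup>2) ^ l))"
   using meanI_incseq[OF v[of l]] rr_power_incseq[of l] by (auto simp: incseq_def intro!: mult_mono)
 qed
 also have "\<dots> = (\<Sum>l. NI I (v l))"
 proof (rule suminf_cong)
  fix l
  show "(SUP n. meanI I (\<lambda>_. rr n) (v l) * ennreal (((rr n)\<^sup>2) ^ l)) = NI I (v l)"
   by (simp only: SUP_mult_incseq[OF meanI_incseq[OF v] rr_power_incseq, symmetric] rr_power_SUP mult_1_right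
     NI_eq_SUP_seq[OF v, folded rr_def])
 qed
 finally show ?thesis .
qed

text \<open>Tensorization with counting measure: nonempty sets of exponents are not null, so equality holds
for every choice of exponents.\<close>

lemma tensor_series_eq:
 fixes v :: "nat \<Rightarrow> nat \<Rightarrow> ('i::finite \<Rightarrow> complex) \<Rightarrow> real"
 assumes m: "m \<ge> 2" and v: "\<And>j l. j \<in> {1..m} \<Longrightarrow> slice_mod I (v j l)"
  and eq: "(\<integral>\<^sup>+x. (\<Prod>j=1..m. \<Sum>l. ennreal (v j l x)) \<partial>PiM I (\<lambda>_. berg (m - 2))) = (\<Prod>j=1..m. \<Sum>l. NI I (v j l))"
  and fin: "(\<Prod>j=1..m. \<Sum>l. NI I (v j l)) < \<infinity>"
 shows "(\<integral>\<^sup>+x. (\<Prod>j=1..m. ennreal (v j (\<omega> j) x)) \<partial>PiM I (\<lambda>_. berg (m - 2))) = (\<Prod>j=1..m. NI I (v j (\<omega> j)))"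
proof -
 let ?M = "PiM I (\<lambda>_::'i. berg (m - 2))" and ?N = "count_space (UNIV :: nat set)"
 have sM: "sigma_finite_measure ?M" by (rule bergs.sigma_finite) simp
 have sN: "sigma_finite_measure ?N" by (rule sigma_finite_measure_count_space)
 have meas: "(\<lambda>(x, l). ennreal (v j l x)) \<in> borel_measurable (?M \<Otimes>\<^sub>M ?N)" if j: "j \<in> {1..m}" for j
 proof -
  have "(\<lambda>(l, x). ennreal (v j l x)) \<in> borel_measurable (?N \<Otimes>\<^sub>M ?M)"
  proof (rule measurable_pair_measure_countable1)
   fix l
   show "(\<lambda>x. case (l, x) of (l, x) \<Rightarrow> ennreal (v j l x)) \<in> borel_measurable ?M"
    unfolding prod.case by (rule slice_mod_measurable_bergs[OF v[OF j]])
  qed simp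
  from measurable_compose[OF measurable_pair_swap' this]
  show ?thesis by (simp add: case_prod_beta')
 qed
 have le: "(\<integral>\<^sup>+x. (\<Prod>j\<in>{1..m}. ennreal (v j (\<omega> j) x)) \<partial>?M) \<le> (\<Prod>j\<in>{1..m}. NI I (v j (\<omega> j)))" for \<omega>
  by (rule NI_ineq[OF m v])
 have "AE \<omega> in PiM {1..m} (\<lambda>_. ?N). (\<integral>\<^sup>+x. (\<Prod>j=1..m. ennreal (v j (\<omega> j) x)) \<partial>?M) = (\<Prod>j=1..m. NI I (v j (\<omega> j)))"
  by (rule tensor(2)[where u="\<lambda>j x l. ennreal (v j l x)" and c="\<lambda>j l. NI I (v j l)", OF sM sN _ meas _ le])
   (use eq fin in \<open>simp_all add: nn_integral_count_space_nat\<close>)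
 moreover have "PiM {1..m} (\<lambda>_. ?N) = count_space (PiE {1..m} (\<lambda>_. UNIV))" by (rule count_space_PiM_finite) auto
 ultimately have all: "\<forall>\<omega>\<in>PiE {1..m} (\<lambda>_. UNIV). (\<integral>\<^sup>+x. (\<Prod>j=1..m. ennreal (v j (\<omega> j) x)) \<partial>?M) = (\<Prod>j=1..m. NI I (v j (\<omega> j)))"
  by (simp only: AE_count_space)
 have "restrict \<omega> {1..m} \<in> PiE {1..m} (\<lambda>_. UNIV)" by simp
 from all[rule_format, OF this]
 have e: "(\<integral>\<^sup>+x. (\<Prod>j=1..m. ennreal (v j (restrict \<omega> {1..m} j) x)) \<partial>?M) = (\<Prod>j=1..m. NI I (v j (restrict \<omega> {1..m} j)))" .
 have "(\<Prod>j=1..m. ennreal (v j (restrict \<omega> {1..m} j) x)) = (\<Prod>j=1..m. ennreal (v j (\<omega> j) x))" for x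
  by (rule prod.cong) auto
 moreover have "(\<Prod>j=1..m. NI I (v j (restrict \<omega> {1..m} j))) = (\<Prod>j=1..m. NI I (v j (\<omega> j)))"
  by (rule prod.cong) auto
 ultimately show ?thesis using e by (simp only:)
qed

text \<open>On each slice \<open>|F|\<^sup>p\<close> is the square of a modulus because \<open>F\<close> is
zero free, so a power of \<open>\<alpha>\<close> can be multiplied into it.\<close>

lemma slice_mod_twist:
 assumes F: "sep_hol I F" and F0: "\<forall>x\<in>polyd I. F x \<noteq> 0" and \<alpha>: "sep_hol I \<alpha>" and p: "p > 0"
 shows "slice_mod I (\<lambda>x. norm (F x) powr p * ((norm (\<alpha> x))\<^sup>2) ^ l)"
 unfolding slice_mod_def
proof (intro conjI ballI allI impI)
 show "continuous_on (polyd I) (\<lambda>x. norm (F x) powr p * ((norm (\<alpha> x))\<^sup>2) ^ l)"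
  using p by (intro continuous_on_powr' continuous_intros sep_holD(1) F \<alpha>) auto
 show "norm (F x) powr p * ((norm (\<alpha> x))\<^sup>2) ^ l = norm (F y) powr p * ((norm (\<alpha> y))\<^sup>2) ^ l" if "\<forall>i\<in>I. x i = y i" for x y
  using sep_holD(2)[OF F, of x y] sep_holD(2)[OF \<alpha>, of x y] that by simp
 fix x i assume x: "x \<in> polyd I" "i \<in> I"
 have "(\<lambda>w. F (x(i := w))) holomorphic_on ball 0 1" by (rule sep_holD(3)[OF F x])
 moreover have "F (x(i := w)) \<noteq> 0" if "w \<in> ball 0 1" for w using F0 polyd_upd'[OF x(1), of w i] that by simp
 ultimately obtain h where h: "h holomorphic_on ball 0 1" "\<forall>z\<in>ball 0 1. norm (F (x(i := z))) powr p = (norm (h z))\<^sup>2"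
  using half_power by blast
 show "\<exists>h q. h holomorphic_on ball 0 1 \<and> q > 0 \<and> (\<forall>w\<in>ball 0 1. norm (F (x(i := w))) powr p * ((norm (\<alpha> (x(i := w))))\<^sup>2) ^ l = norm (h w) powr q)"
 proof (intro exI[of _ "\<lambda>w. h w * \<alpha> (x(i := w)) ^ l"] exI[of _ 2] conjI ballI)
  show "(\<lambda>w. h w * \<alpha> (x(i := w)) ^ l) holomorphic_on ball 0 1"
   by (intro holomorphic_intros h(1) sep_holD(3)[OF \<alpha> x])
  fix w :: complex assume w: "w \<in> ball 0 1"
  have "norm (h w * \<alpha> (x(i := w)) ^ l) powr 2 = (norm (h w * \<alpha> (x(i := w)) ^ l))\<^sup>2" by simp
  also have "\<dots> = (norm (h w))\<^sup>2 * ((norm (\<alpha> (x(i := w))))\<^sup>2) ^ l"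
   by (simp add: norm_mult norm_power power_mult_distrib mult.commute flip: power_mult)
  finally show "norm (F (x(i := w))) powr p * ((norm (\<alpha> (x(i := w))))\<^sup>2) ^ l = norm (h w * \<alpha> (x(i := w)) ^ l) powr 2"
   using h(2) w by simp
 qed simp
qed simp

lemma sep_hol_compose:
 assumes R: "sep_hol I R" "\<And>x. x \<in> polyd I \<Longrightarrow> R x \<in> S" and G: "G holomorphic_on S"
 shows "sep_hol I (\<lambda>x. G (R x))"
 unfolding sep_hol_def
proof (intro conjI ballI allI impI)
 show "continuous_on (polyd I) (\<lambda>x. G (R x))"
  by (rule continuous_on_compose2[OF holomorphic_on_imp_continuous_on[OF G] sep_holD(1)[OF R(1)]]) (use R(2) in auto)
 show "G (R x) = G (R y)" if "\<forall>i\<in>I. x i = y i" for x y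
  using sep_holD(2)[OF R(1), of x y] that by simp
 show "(\<lambda>w. G (R (x(i := w)))) holomorphic_on ball 0 1" if x: "x \<in> polyd I" "i \<in> I" for x i
  using holomorphic_on_compose_gen[OF sep_holD(3)[OF R(1) x] G] R(2) polyd_upd'[OF x(1), of _ i] by (auto simp: o_def image_subset_iff)
qed

text \<open>The parameters of the slices are recovered holomorphically from the values of the first function
at two points of the slice.\<close>

lemma extremal_parameter:
 assumes m: "m \<ge> 2" and k: "k \<notin> I" and E: "extremal m p (insert k I) F"
 shows "\<exists>\<alpha>. sep_hol I \<alpha> \<and> (\<forall>x\<in>polyd I. norm (\<alpha> x) \<le> 1 \<and> slice_kernel m p k F x (\<alpha> x)) \<and> (\<exists>x\<in>polyd I. norm (\<alpha> x) < 1)"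
proof -
 have j1: "1 \<in> {1..m}" using m by simp
 have p1: "p 1 > 0" and F1: "sep_hol (insert k I) (F 1)" using E j1 unfolding extremal_def by blast+
 define q where "q = 2 / p 1"
 have q: "q > 0" using p1 by (simp add: q_def)
 define w0 where "w0 = min (1/4) (1 / (2 * q))"
 have w0: "0 < w0" "w0 \<le> 1/4" using q by (auto simp: w0_def)
 have nw: "norm (complex_of_real w0) < 1" using w0 by simp
 define R where "R = (\<lambda>x. F 1 (x(k := of_real w0)) * inverse (F 1 (x(k := 0))))"
 define G where "G = (\<lambda>z. (1 - exp (- of_real (1 / q) * Ln z)) / of_real w0)"
 have nz: "F 1 (x(k := 0)) \<noteq> 0" if "x \<in> polyd I" for x
  using extremal_zero_free[OF m E] j1 polyd_upd[OF that, of 0 k] by auto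
 have par: "Re (R x) > 0 \<and> G (R x) = b" if x: "x \<in> polyd I" and b: "norm b \<le> 1" "slice_kernel m p k F x b" for x b
 proof -
  have "F 1 (x(k := of_real w0)) = F 1 (x(k := 0)) * (1 - b * of_real w0) powr (- of_real q)"
   unfolding q_def by (rule b(2)[unfolded slice_kernel_def, rule_format, OF j1]) (use nw in simp)
  then have "R x = (1 - b * of_real w0) powr (- of_real q)" using nz[OF x] by (simp add: R_def)
  then show ?thesis
   using kernel_parameter[OF q b(1), folded w0_def] by (simp add: G_def)
 qed
 have F0: "sep_hol I (\<lambda>x. F 1 (x(k := 0)))" by (rule sep_hol_upd[OF F1 k]) simp
 have "sep_hol I R"
  unfolding R_def
  by (intro sep_hol_mult sep_hol_upd[OF F1 k nw] sep_hol_compose[OF F0, where S="- {0}" and G=inverse])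
   (use nz in \<open>auto intro!: holomorphic_intros\<close>)
 moreover have "R x \<in> {z. Re z > 0}" if x: "x \<in> polyd I" for x
  using extremal_slices(3)[OF m k E] par[OF x] x by blast
 moreover have "G holomorphic_on {z. Re z > 0}"
  unfolding G_def using w0 by (intro holomorphic_intros) (auto simp: complex_nonpos_Reals_iff)
 ultimately have "sep_hol I (\<lambda>x. G (R x))" by (rule sep_hol_compose)
 moreover have "norm (G (R x)) \<le> 1 \<and> slice_kernel m p k F x (G (R x))" if x: "x \<in> polyd I" for x
  using extremal_slices(3)[OF m k E] par[OF x] x by blast
 moreover have "\<exists>x\<in>polyd I. norm (G (R x)) < 1"
 proof -
  obtain x b where xb: "x \<in> polyd I" "norm b < 1" "slice_kernel m p k F x b" using extremal_slices(2)[OF m k E] by blast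
  then have "G (R x) = b" using par[OF xb(1) less_imp_le[OF xb(2)] xb(3)] by blast
  then show ?thesis using xb by blast
 qed
 ultimately show ?thesis by (intro exI[of _ "\<lambda>x. G (R x)"]) blast
qed

text \<open>Equality survives if each function on the slice at zero is multiplied by an arbitrary power of
\<open>\<alpha>\<close>, with independent exponents for the factors.\<close>

lemma extremal_twist:
 fixes F :: "nat \<Rightarrow> ('i::finite \<Rightarrow> complex) \<Rightarrow> complex"
 assumes m: "m \<ge> 2" and k: "k \<notin> I" and E: "extremal m p (insert k I) F" and \<alpha>: "sep_hol I \<alpha>"
  and \<alpha>K: "\<forall>x\<in>polyd I. norm (\<alpha> x) \<le> 1 \<and> slice_kernel m p k F x (\<alpha> x)"
 defines "v \<equiv> (\<lambda>j l x. norm (F j (x(k := 0))) powr p j * ((norm (\<alpha> x))\<^sup>2) ^ l)"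
 shows "(\<integral>\<^sup>+x. (\<Prod>j=1..m. ennreal (v j (\<omega> j) x)) \<partial>PiM I (\<lambda>_. berg (m - 2))) = (\<Prod>j=1..m. NI I (v j (\<omega> j)))"
  and "j \<in> {1..m} \<Longrightarrow> NI I (v j l) < \<infinity>"
proof -
 have p: "p j > 0" and F: "sep_hol (insert k I) (F j)"
  and fin: "NI (insert k I) (\<lambda>x. norm (F j x) powr p j) < \<infinity>" if "j \<in> {1..m}" for j
  using E that unfolding extremal_def by blast+
 have nz: "\<forall>x\<in>polyd I. F j (x(k := 0)) \<noteq> 0" if "j \<in> {1..m}" for j
  using extremal_zero_free[OF m E] that polyd_upd[of _ I 0 k] by auto
 have vs: "slice_mod I (v j l)" if "j \<in> {1..m}" for j l
  unfolding v_def by (rule slice_mod_twist[OF _ nz[OF that] \<alpha> p[OF that]]) (rule sep_hol_upd[OF F[OF that] k], simp)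
 have ker: "\<forall>w\<in>ball 0 1. F j (x(k := w)) = F j (x(k := 0)) * (1 - \<alpha> x * w) powr (- of_real (2 / p j))"
  if "j \<in> {1..m}" "x \<in> polyd I" for j x
  using \<alpha>K that unfolding slice_kernel_def by blast
 have SL: "SL k (\<lambda>x. norm (F j x) powr p j) x = (\<Sum>l. ennreal (v j l x))" if "j \<in> {1..m}" "x \<in> polyd I" for j x
  unfolding v_def by (rule SL_kernel[OF _ p[OF that(1)] ker[OF that]]) (use \<alpha>K that in blast)
 have N: "NI (insert k I) (\<lambda>x. norm (F j x) powr p j) = (\<Sum>l. NI I (v j l))" if j: "j \<in> {1..m}" for j
 proof (rule NI_series[OF k sep_hol_imp_slice_mod[OF F[OF j] p[OF j]] vs[OF j]])
  fix x n assume x: "x \<in> polyd I"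
  show "CM k (rr n) (\<lambda>x. norm (F j x) powr p j) x = (\<Sum>l. ennreal (v j l x) * ennreal (((rr n)\<^sup>2) ^ l))"
   unfolding v_def by (rule CM_kernel[OF _ rr(1) rr(2) p[OF j] ker[OF j x]]) (use \<alpha>K x in blast)
 qed
 have "(\<integral>\<^sup>+x. (\<Prod>j=1..m. \<Sum>l. ennreal (v j l x)) \<partial>PiM I (\<lambda>_. berg (m - 2)))
   = (\<integral>\<^sup>+x. (\<Prod>j=1..m. SL k (\<lambda>x. norm (F j x) powr p j) x) \<partial>PiM I (\<lambda>_. berg (m - 2)))"
  by (intro nn_integral_cong prod.cong refl SL[symmetric] polyd_bergs)
 also have "\<dots> = (\<Prod>j=1..m. NI (insert k I) (\<lambda>x. norm (F j x) powr p j))" by (rule extremal_slices(1)[OF m k E])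
 also have "\<dots> = (\<Prod>j=1..m. \<Sum>l. NI I (v j l))" by (rule prod.cong[OF refl N])
 finally have eq: "(\<integral>\<^sup>+x. (\<Prod>j=1..m. \<Sum>l. ennreal (v j l x)) \<partial>PiM I (\<lambda>_. berg (m - 2))) = (\<Prod>j=1..m. \<Sum>l. NI I (v j l))" .
 have sf: "(\<Sum>l. NI I (v j l)) < \<infinity>" if "j \<in> {1..m}" for j using fin[OF that] N[OF that] by simp
 then have pf: "(\<Prod>j=1..m. \<Sum>l. NI I (v j l)) < \<infinity>" by (auto simp: ennreal_prod_eq_top less_top[symmetric])
 show "(\<integral>\<^sup>+x. (\<Prod>j=1..m. ennreal (v j (\<omega> j) x)) \<partial>PiM I (\<lambda>_. berg (m - 2))) = (\<Prod>j=1..m. NI I (v j (\<omega> j)))"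
  by (rule tensor_series_eq[OF m vs eq pf])
 have "NI I (v j l) \<le> (\<Sum>l. NI I (v j l))" for j
  using sum_le_suminf[OF summableI, of "{l}" "\<lambda>l. NI I (v j l)"] by simp
 then show "NI I (v j l) < \<infinity>" if "j \<in> {1..m}" using sf[OF that] le_less_trans by blast
qed

text \<open>Set all other coordinates to zero.\<close>

lemma kernel_unique_polyd:
 fixes \<zeta> \<zeta>' :: "'i::finite \<Rightarrow> complex"
 assumes z: "\<zeta> \<in> polyd I" "\<zeta>' \<in> polyd I" and q: "q > 0" and C: "C \<noteq> 0" and i: "i \<in> I"
  and eq: "\<forall>x\<in>polyd I. C' * (\<Prod>i\<in>I. (1 - \<zeta>' i * x i) powr (- of_real q)) = C * (\<Prod>i\<in>I. (1 - \<zeta> i * x i) powr (- of_real q))"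
 shows "\<zeta>' i = \<zeta> i"
proof (rule kernel_unique[OF C _ _ _ q])
 show "norm (\<zeta>' i) < 1" "norm (\<zeta> i) < 1" using z i by (auto simp: polyd_def)
 fix w :: complex assume w: "norm w < 1"
 have P: "(\<Prod>j\<in>I. (1 - \<xi> j * (if j = i then w else 0)) powr (- of_real q)) = (1 - \<xi> i * w) powr (- of_real q)" for \<xi> :: "'i \<Rightarrow> complex"
 proof -
  have "(\<Prod>j\<in>I. (1 - \<xi> j * (if j = i then w else 0)) powr (- of_real q)) = (\<Prod>j\<in>I. if j = i then (1 - \<xi> i * w) powr (- of_real q) else 1)"
   by (rule prod.cong) auto
  then show ?thesis using i by simp
 qed
 have "(\<lambda>j. if j = i then w else 0) \<in> polyd I" using w by (auto simp: polyd_def)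
 from eq[rule_format, OF this]
 show "C' * (1 - \<zeta>' i * w) powr (- of_real q) = C * (1 - \<zeta> i * w) powr (- of_real q)"
  by (simp only: P)
qed

definition kernel_form :: "nat \<Rightarrow> (nat \<Rightarrow> real) \<Rightarrow> 'i::finite set \<Rightarrow> (nat \<Rightarrow> ('i \<Rightarrow> complex) \<Rightarrow> complex) \<Rightarrow> ('i \<Rightarrow> complex) \<Rightarrow> bool" where
 "kernel_form m p I F \<zeta> \<longleftrightarrow> \<zeta> \<in> polyd I \<and> (\<forall>j\<in>{1..m}. \<exists>C. \<forall>x\<in>polyd I.
  F j x = C * (\<Prod>i\<in>I. (1 - \<zeta> i * x i) powr (- of_real (2 / p j))))"

text \<open>With all exponents zero, the induction hypothesis determines the functions at \<open>x k =
0\<close>. With exponent one for the first factor and zero for the others, it applies to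
\<open>\<alpha>\<close> times a kernel; since the second factor has not changed, its parameters
have not changed either, and the kernel cancels. At least two factors are essential here.\<close>

lemma extremal_step:
 fixes F :: "nat \<Rightarrow> ('i::finite \<Rightarrow> complex) \<Rightarrow> complex"
 assumes m: "m \<ge> 2" and k: "k \<notin> I" and E: "extremal m p (insert k I) F"
  and IH: "\<And>p G. extremal m p I G \<Longrightarrow> \<exists>\<zeta>. kernel_form m p I G \<zeta>"
 shows "\<exists>\<zeta>. kernel_form m p (insert k I) F \<zeta>"
proof -
 obtain \<alpha> where \<alpha>: "sep_hol I \<alpha>" and \<alpha>K: "\<forall>x\<in>polyd I. norm (\<alpha> x) \<le> 1 \<and> slice_kernel m p k F x (\<alpha> x)"
  and \<alpha>1: "\<exists>x\<in>polyd I. norm (\<alpha> x) < 1"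
  using extremal_parameter[OF m k E] by blast
 define F0 where "F0 = (\<lambda>j x. F j (x(k := 0)))"
 define v where "v = (\<lambda>j l x. norm (F0 j x) powr p j * ((norm (\<alpha> x))\<^sup>2) ^ l)"
 have tw: "(\<integral>\<^sup>+x. (\<Prod>j=1..m. ennreal (v j (\<omega> j) x)) \<partial>PiM I (\<lambda>_. berg (m - 2))) = (\<Prod>j=1..m. NI I (v j (\<omega> j)))" for \<omega>
  unfolding v_def F0_def by (rule extremal_twist(1)[OF m k E \<alpha> \<alpha>K])
 have twf: "NI I (v j l) < \<infinity>" if "j \<in> {1..m}" for j l
  unfolding v_def F0_def by (rule extremal_twist(2)[OF m k E \<alpha> \<alpha>K that])
 have p: "p j > 0" and F: "sep_hol (insert k I) (F j)" if "j \<in> {1..m}" for j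
  using E that unfolding extremal_def by blast+
 have j12: "1 \<in> {1..m}" "2 \<in> {1..m}" using m by auto
 have F0: "sep_hol I (F0 j)" if "j \<in> {1..m}" for j
  unfolding F0_def by (rule sep_hol_upd[OF F[OF that] k]) simp
 have nz: "F0 j x \<noteq> 0" if "j \<in> {1..m}" "x \<in> polyd I" for j x
  using extremal_zero_free[OF m E] that polyd_upd[OF that(2), of 0 k] by (auto simp: F0_def)
 have zero: "(\<lambda>_. 0) \<in> polyd I" by (simp add: polyd_def)
 have v0: "v j 0 = (\<lambda>x. norm (F0 j x) powr p j)" for j by (simp add: v_def)
 have E0: "extremal m p I F0"
  unfolding extremal_def
 proof (intro conjI ballI)
  fix j assume j: "j \<in> {1..m}"
  show "p j > 0" by (rule p[OF j])
  show "sep_hol I (F0 j)" by (rule F0[OF j])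
  show "\<exists>x\<in>polyd I. F0 j x \<noteq> 0" using nz[OF j zero] zero by blast
  show "NI I (\<lambda>x. norm (F0 j x) powr p j) < \<infinity>" using twf[OF j, of 0] by (simp only: v0)
 next
  show "(\<integral>\<^sup>+x. (\<Prod>j=1..m. ennreal (norm (F0 j x) powr p j)) \<partial>PiM I (\<lambda>_. berg (m - 2))) = (\<Prod>j=1..m. NI I (\<lambda>x. norm (F0 j x) powr p j))"
   using tw[of "\<lambda>_. 0"] by (simp only: v0)
 qed
 obtain \<zeta> where \<zeta>: "\<zeta> \<in> polyd I" and K0: "\<forall>j\<in>{1..m}. \<exists>C. \<forall>x\<in>polyd I. F0 j x = C * (\<Prod>i\<in>I. (1 - \<zeta> i * x i) powr (- of_real (2 / p j)))"
  using IH[OF E0] unfolding kernel_form_def by blast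
 have K: "\<forall>x\<in>polyd I. F0 j x = F0 j (\<lambda>_. 0) * (\<Prod>i\<in>I. (1 - \<zeta> i * x i) powr (- of_real (2 / p j)))" if j: "j \<in> {1..m}" for j
 proof -
  obtain C where C: "\<forall>x\<in>polyd I. F0 j x = C * (\<Prod>i\<in>I. (1 - \<zeta> i * x i) powr (- of_real (2 / p j)))" using K0 j by blast
  have "F0 j (\<lambda>_. 0) = C" using C[rule_format, OF zero] by simp
  then show ?thesis using C by simp
 qed
 have nzk: "1 - \<zeta> i * x i \<noteq> 0" if "i \<in> I" "x \<in> polyd I" for i x
  by (rule one_minus_mult_nz) (use \<zeta> that in \<open>auto simp: polyd_def intro: less_imp_le\<close>)
 have pw1: "z powr (- of_real (2 / 2)) = 1 / z" if "z \<noteq> 0" for z :: complex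
  using that by (simp add: powr_minus divide_inverse)
 have "\<exists>a. norm a < 1 \<and> (\<forall>x\<in>polyd I. \<alpha> x = a)"
 proof (cases "\<exists>x\<in>polyd I. \<alpha> x \<noteq> 0")
  case False
  then show ?thesis by (intro exI[of _ 0]) auto
 next
  case True
  \<comment> \<open>With exponent two this constant reproduces the modulus of the first function at the origin.\<close>
  define c where "c = sqrt (norm (F0 1 (\<lambda>_. 0)) powr p 1)"
  have c: "c > 0" using nz[OF j12(1) zero] by (simp add: c_def)
  define G1 where "G1 = (\<lambda>x. of_real c * (\<Prod>i\<in>I. 1 / (1 - \<zeta> i * x i)) * \<alpha> x)"
  define G where "G = F0(1 := G1)"
  define p' where "p' = p(1 := 2)"
  \<comment> \<open>Only the first factor is multiplied by the parameter; its exponent becomes two, the others keep theirs.\<close>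
  define \<omega> :: "nat \<Rightarrow> nat" where "\<omega> = (\<lambda>j. if j = 1 then 1 else 0)"
  have G1h: "sep_hol I G1" unfolding G1_def by (intro sep_hol_mult sep_hol_kernel \<zeta> \<alpha>)
  have G1v: "norm (G1 x) powr 2 = v 1 1 x" if x: "x \<in> polyd I" for x
  proof -
   have "norm (F0 1 x) powr p 1 = norm (F0 1 (\<lambda>_. 0)) powr p 1 * (\<Prod>i\<in>I. norm ((1 - \<zeta> i * x i) powr (- of_real (2 / p 1))) powr p 1)"
    by (subst K[OF j12(1), rule_format, OF x]) (simp add: norm_mult powr_mult flip: prod_norm prod_powr_distrib)
   also have "(\<Prod>i\<in>I. norm ((1 - \<zeta> i * x i) powr (- of_real (2 / p 1))) powr p 1) = (\<Prod>i\<in>I. 1 / (norm (1 - \<zeta> i * x i))\<^sup>2)"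
    by (intro prod.cong refl kernel_power_norm'[OF _ _ p[OF j12(1)]]) (use \<zeta> x in \<open>auto simp: polyd_def intro: less_imp_le\<close>)
   finally have e: "norm (F0 1 x) powr p 1 = c\<^sup>2 * (\<Prod>i\<in>I. 1 / (norm (1 - \<zeta> i * x i))\<^sup>2)" by (simp add: c_def)
   have "norm (G1 x) powr 2 = (norm (G1 x))\<^sup>2" by simp
   also have "\<dots> = c\<^sup>2 * (\<Prod>i\<in>I. 1 / (norm (1 - \<zeta> i * x i))\<^sup>2) * (norm (\<alpha> x))\<^sup>2"
    using c by (simp add: G1_def norm_mult power_mult_distrib norm_divide power_divide prod_power_distrib flip: prod_norm)
   finally show ?thesis unfolding v_def e by simp
  qed
  have Gv: "norm (G j x) powr p' j = v j (\<omega> j) x" if "x \<in> polyd I" for j x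
   using G1v[OF that] by (cases "j = 1") (simp_all add: G_def p'_def \<omega>_def v0)
  have NIv: "NI I (\<lambda>x. norm (G j x) powr p' j) = NI I (v j (\<omega> j))" for j
   unfolding NI_def meanI_def
  proof (intro SUP_cong refl nn_integral_cong)
   fix r :: real and x assume r: "r \<in> {0..<1}" and x: "x \<in> space (PiM I (\<lambda>_. circ))"
   have "dil (\<lambda>_. r) x \<in> polyd I" by (rule polyd_circs[OF x]) (use r in auto)
   then show "ennreal (norm (G j (dil (\<lambda>_. r) x)) powr p' j) = ennreal (v j (\<omega> j) (dil (\<lambda>_. r) x))" by (simp only: Gv)
  qed
  have "extremal m p' I G"
   unfolding extremal_def
  proof (intro conjI ballI)
   fix j assume j: "j \<in> {1..m}"
   show "p' j > 0" using p[OF j] by (simp add: p'_def)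
   show "sep_hol I (G j)" using F0[OF j] G1h by (simp add: G_def)
   show "\<exists>x\<in>polyd I. G j x \<noteq> 0"
   proof (cases "j = 1")
    case True
    obtain x where x: "x \<in> polyd I" "\<alpha> x \<noteq> 0" using \<open>\<exists>x\<in>polyd I. \<alpha> x \<noteq> 0\<close> by blast
    have "G1 x \<noteq> 0" using x(2) c nzk[OF _ x(1)] by (simp add: G1_def)
    then show ?thesis using x(1) True by (auto simp: G_def)
   qed (use nz[OF j zero] zero in \<open>auto simp: G_def\<close>)
   show "NI I (\<lambda>x. norm (G j x) powr p' j) < \<infinity>" unfolding NIv by (rule twf[OF j])
  next
   have "(\<integral>\<^sup>+x. (\<Prod>j=1..m. ennreal (norm (G j x) powr p' j)) \<partial>PiM I (\<lambda>_. berg (m - 2))) = (\<integral>\<^sup>+x. (\<Prod>j=1..m. ennreal (v j (\<omega> j) x)) \<partial>PiM I (\<lambda>_. berg (m - 2)))"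
    by (rule nn_integral_cong) (simp only: Gv[OF polyd_bergs])
   then show "(\<integral>\<^sup>+x. (\<Prod>j=1..m. ennreal (norm (G j x) powr p' j)) \<partial>PiM I (\<lambda>_. berg (m - 2))) = (\<Prod>j=1..m. NI I (\<lambda>x. norm (G j x) powr p' j))"
    unfolding NIv tw[of \<omega>] .
  qed
  from IH[OF this] obtain \<zeta>' where \<zeta>': "\<zeta>' \<in> polyd I"
   and K': "\<forall>j\<in>{1..m}. \<exists>C. \<forall>x\<in>polyd I. G j x = C * (\<Prod>i\<in>I. (1 - \<zeta>' i * x i) powr (- of_real (2 / p' j)))"
   unfolding kernel_form_def by blast
  have zz: "\<zeta>' i = \<zeta> i" if i: "i \<in> I" for i
  proof -
   obtain C' where C': "\<forall>x\<in>polyd I. G 2 x = C' * (\<Prod>i\<in>I. (1 - \<zeta>' i * x i) powr (- of_real (2 / p' 2)))" using K' j12(2) by blast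
   have "\<forall>x\<in>polyd I. C' * (\<Prod>i\<in>I. (1 - \<zeta>' i * x i) powr (- of_real (2 / p 2))) = F0 2 (\<lambda>_. 0) * (\<Prod>i\<in>I. (1 - \<zeta> i * x i) powr (- of_real (2 / p 2)))"
    using C' K[OF j12(2)] by (auto simp: G_def p'_def)
   moreover have "2 / p 2 > 0" using p[OF j12(2)] by simp
   ultimately show ?thesis using kernel_unique_polyd[OF \<zeta> \<zeta>' _ nz[OF j12(2) zero] i] by blast
  qed
  obtain C' where C': "\<forall>x\<in>polyd I. G 1 x = C' * (\<Prod>i\<in>I. (1 - \<zeta>' i * x i) powr (- of_real (2 / p' 1)))" using K' j12(1) by blast
  have ac: "\<alpha> x = C' / of_real c" if x: "x \<in> polyd I" for x
  proof -
   have "(\<Prod>i\<in>I. (1 - \<zeta>' i * x i) powr (- of_real (2 / p' 1))) = (\<Prod>i\<in>I. 1 / (1 - \<zeta> i * x i))"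
    by (rule prod.cong[OF refl]) (simp only: zz p'_def fun_upd_same pw1[OF nzk[OF _ x]])
   moreover have "(\<Prod>i\<in>I. 1 / (1 - \<zeta> i * x i)) \<noteq> 0" using nzk[OF _ x] by simp
   ultimately show ?thesis using C'[rule_format, OF x] c by (simp add: G_def G1_def field_simps)
  qed
  then show ?thesis using \<alpha>1 by (intro exI[of _ "C' / of_real c"]) auto
 qed
 then obtain a where a: "norm a < 1" "\<forall>x\<in>polyd I. \<alpha> x = a" by blast
 have "kernel_form m p (insert k I) F (\<zeta>(k := a))"
  unfolding kernel_form_def
 proof (intro conjI ballI)
  show "\<zeta>(k := a) \<in> polyd (insert k I)" by (rule polyd_upd[OF \<zeta> a(1)])
  fix j assume j: "j \<in> {1..m}"
  show "\<exists>C. \<forall>x\<in>polyd (insert k I). F j x = C * (\<Prod>i\<in>insert k I. (1 - (\<zeta>(k := a)) i * x i) powr (- of_real (2 / p j)))"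
  proof (intro exI ballI)
   fix x assume x: "x \<in> polyd (insert k I)"
   then have xI: "x \<in> polyd I" and xk: "x k \<in> ball 0 1" by (auto simp: polyd_def)
   have "slice_kernel m p k F x a" using \<alpha>K a(2) xI by metis
   then have "F j (x(k := x k)) = F0 j x * (1 - a * x k) powr (- of_real (2 / p j))"
    using j xk unfolding slice_kernel_def F0_def by blast
   then have "F j x = F0 j x * (1 - a * x k) powr (- of_real (2 / p j))" by (simp only: fun_upd_triv)
   also have "F0 j x = F0 j (\<lambda>_. 0) * (\<Prod>i\<in>I. (1 - \<zeta> i * x i) powr (- of_real (2 / p j)))"
    using K[OF j] xI by blast
   also have "(\<Prod>i\<in>I. (1 - \<zeta> i * x i) powr (- of_real (2 / p j))) = (\<Prod>i\<in>I. (1 - (\<zeta>(k := a)) i * x i) powr (- of_real (2 / p j)))"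
    by (rule prod.cong[OF refl]) (use k in auto)
   finally show "F j x = F0 j (\<lambda>_. 0) * (\<Prod>i\<in>insert k I. (1 - (\<zeta>(k := a)) i * x i) powr (- of_real (2 / p j)))"
    using k by simp
  qed
 qed
 then show ?thesis by blast
qed

theorem extremal_kernel:
 fixes F :: "nat \<Rightarrow> ('i::finite \<Rightarrow> complex) \<Rightarrow> complex"
 assumes m: "m \<ge> 2" and E: "extremal m p I F"
 shows "\<exists>\<zeta>. kernel_form m p I F \<zeta>"
 using finite[of I] E
proof (induction I arbitrary: F p rule: finite_induct)
 case empty
 have "\<exists>C. \<forall>x\<in>polyd {}. F j x = C * (\<Prod>i\<in>{}. (1 - 0 * x i) powr (- of_real (2 / p j)))" if "j \<in> {1..m}" for j
 proof -
  have "sep_hol {} (F j)" using empty that unfolding extremal_def by blast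
  then have "F j x = F j (\<lambda>_. 0)" for x by (rule sep_holD(2)) simp
  then show ?thesis by (intro exI[of _ "F j (\<lambda>_. 0)"]) auto
 qed
 then show ?case unfolding kernel_form_def by (intro exI[of _ "\<lambda>_. 0"]) (simp add: polyd_def)
next
 case (insert k I)
 show ?case by (rule extremal_step[OF m insert.hyps(2) insert.prems insert.IH])
qed

section \<open>Boundary values on the torus\<close>

abbreviation torusP :: "('i::finite \<Rightarrow> complex) measure" where
 "torusP \<equiv> PiM UNIV (\<lambda>_. circ)"

lemma rotate_measurable:
 assumes c: "norm c = 1" shows "(\<lambda>x i. c * x i) \<in> measurable torusP (torusP :: ('i::finite \<Rightarrow> complex) measure)"
proof (rule measurable_PiM_single')
 show "(\<lambda>x. c * x i) \<in> measurable torusP circ" for i :: 'i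
  by (rule measurable_compose[where f="\<lambda>x. x i" and g="\<lambda>z. c * z" and N=circ, OF measurable_component_singleton circle_rotation_measurable[OF c]]) simp
qed (use c in \<open>auto simp: space_PiM norm_mult\<close>)

lemma distr_torusP_rotate:
 assumes c: "norm c = 1" shows "distr torusP torusP (\<lambda>x i. c * x i) = (torusP :: ('i::finite \<Rightarrow> complex) measure)"
proof (rule circs.PiM_eqI)
 fix A :: "'i \<Rightarrow> complex set" assume A: "\<And>i. i \<in> UNIV \<Longrightarrow> A i \<in> sets circ"
 define A' where "A' = (\<lambda>i. (\<lambda>z. c * z) -` A i \<inter> space circ)"
 have A': "A' i \<in> sets circ" for i
  unfolding A'_def by (rule measurable_sets[OF circle_rotation_measurable[OF c] A]) simp
 have e: "emeasure circ (A' i) = emeasure circ (A i)" for i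
  unfolding A'_def using emeasure_distr[OF circle_rotation_measurable[OF c], of "A i"] A[of i] distr_circ_rotate[OF c] by simp
 have "emeasure (distr torusP torusP (\<lambda>x i. c * x i)) (PiE UNIV A) = emeasure torusP ((\<lambda>x i. c * x i) -` PiE UNIV A \<inter> space torusP)"
  by (rule emeasure_distr[OF rotate_measurable[OF c] sets_PiM_I_finite]) (use A in auto)
 also have "(\<lambda>x i. c * x i) -` PiE UNIV A \<inter> space (torusP :: ('i \<Rightarrow> complex) measure) = PiE UNIV A'"
  by (auto simp: A'_def space_PiM PiE_iff)
 also have "emeasure torusP (PiE UNIV A') = (\<Prod>i\<in>UNIV. emeasure circ (A' i))"
  by (rule circs.emeasure_PiM) (use A' in auto)
 finally show "emeasure (distr torusP torusP (\<lambda>x i. c * x i)) (PiE UNIV A) = (\<Prod>i\<in>UNIV. emeasure circ (A i))"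
  by (simp only: e)
qed simp_all

lemma nn_integral_torusP_rotate:
 assumes "norm c = 1" "v \<in> borel_measurable torusP"
 shows "(\<integral>\<^sup>+x. v (\<lambda>i. c * x i) \<partial>torusP) = (\<integral>\<^sup>+x. v x \<partial>(torusP :: ('i::finite \<Rightarrow> complex) measure))"
 using nn_integral_distr[OF rotate_measurable[OF assms(1)], of v] assms(2) distr_torusP_rotate[OF assms(1), where 'i='i] by simp

lemma diag_measurable:
 "(\<lambda>p i. snd p * fst p i) \<in> measurable (torusP \<Otimes>\<^sub>M circ) (torusP :: ('i::finite \<Rightarrow> complex) measure)"
proof (rule measurable_PiM_single')
 fix i :: 'i
 have 1: "(\<lambda>p. fst p i) \<in> borel_measurable (torusP \<Otimes>\<^sub>M circ)"
  by (rule measurable_compose[OF measurable_fst measurable_coord_circ])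
 have 2: "(\<lambda>p. snd p) \<in> borel_measurable ((torusP :: ('i \<Rightarrow> complex) measure) \<Otimes>\<^sub>M circ)"
  by (rule measurable_compose[OF measurable_snd measurable_id_circ'])
 have "(\<lambda>p. snd p * fst p i) \<in> borel_measurable (torusP \<Otimes>\<^sub>M circ)"
  by (rule borel_measurable_times[OF 2 1])
 then have "(\<lambda>p. snd p * fst p i) \<in> measurable (torusP \<Otimes>\<^sub>M circ) (restrict_space borel (sphere 0 1))"
  by (rule measurable_restrict_space2[rotated]) (auto simp: space_pair_measure space_PiM norm_mult)
 then show "(\<lambda>p. snd p * fst p i) \<in> measurable (torusP \<Otimes>\<^sub>M circ) circ"
  unfolding measurable_cong_sets[OF refl sets_circ] .
qed (auto simp: space_pair_measure space_PiM norm_mult)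

text \<open>Integration over the torus can be preceded by an average over the circle that acts diagonally,
which brings in the one-variable slices.\<close>

lemma nn_integral_torusP_diag:
 fixes v :: "('i::finite \<Rightarrow> complex) \<Rightarrow> ennreal"
 assumes v: "v \<in> borel_measurable torusP"
 shows "(\<integral>\<^sup>+x. \<integral>\<^sup>+w. v (\<lambda>i. w * x i) \<partial>circ \<partial>torusP) = (\<integral>\<^sup>+x. v x \<partial>torusP)"
  and "(\<lambda>x. \<integral>\<^sup>+w. v (\<lambda>i. w * x i) \<partial>circ) \<in> borel_measurable torusP"
  and "x \<in> space torusP \<Longrightarrow> (\<lambda>w. v (\<lambda>i. w * x i)) \<in> borel_measurable circ"
proof -
 interpret T: sigma_finite_measure "torusP :: ('i \<Rightarrow> complex) measure" by (rule circs.sigma_finite) simp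
 interpret TC: pair_sigma_finite "torusP :: ('i \<Rightarrow> complex) measure" circ by standard
 have vm: "(\<lambda>p. v (\<lambda>i. snd p * fst p i)) \<in> borel_measurable (torusP \<Otimes>\<^sub>M circ)"
  by (rule measurable_compose[OF diag_measurable v])
 then have vm': "(\<lambda>(x, w). v (\<lambda>i. w * x i)) \<in> borel_measurable (torusP \<Otimes>\<^sub>M circ)" by (simp add: case_prod_beta')
 show "(\<lambda>x. \<integral>\<^sup>+w. v (\<lambda>i. w * x i) \<partial>circ) \<in> borel_measurable torusP"
  by (rule circ.borel_measurable_nn_integral[OF vm'])
 show "(\<lambda>w. v (\<lambda>i. w * x i)) \<in> borel_measurable circ" if "x \<in> space torusP"
  using measurable_Pair2[OF vm that] by simp
 have "(\<integral>\<^sup>+x. \<integral>\<^sup>+w. v (\<lambda>i. w * x i) \<partial>circ \<partial>torusP) = (\<integral>\<^sup>+w. \<integral>\<^sup>+x. v (\<lambda>i. w * x i) \<partial>torusP \<partial>circ)"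
  by (rule TC.Fubini'[symmetric, OF vm'])
 also have "\<dots> = (\<integral>\<^sup>+w. (\<integral>\<^sup>+x. v x \<partial>torusP) \<partial>circ)"
  by (intro nn_integral_cong nn_integral_torusP_rotate v) simp
 also have "\<dots> = (\<integral>\<^sup>+x. v x \<partial>torusP)"
  using emeasure_circ_space by (simp add: nn_integral_const)
 finally show "(\<integral>\<^sup>+x. \<integral>\<^sup>+w. v (\<lambda>i. w * x i) \<partial>circ \<partial>torusP) = (\<integral>\<^sup>+x. v x \<partial>torusP)" .
qed

definition radial_osc :: "(('i \<Rightarrow> complex) \<Rightarrow> complex) \<Rightarrow> nat \<Rightarrow> rat \<Rightarrow> rat \<Rightarrow> ('i \<Rightarrow> complex) \<Rightarrow> real" where
 "radial_osc F n r s x = (if rr n < of_rat r \<and> of_rat r < (1::real) \<and> rr n < of_rat s \<and> of_rat s < (1::real)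
  then norm (F (dil (\<lambda>_. of_rat r) x) - F (dil (\<lambda>_. of_rat s) x)) else 0)"

text \<open>The Cauchy criterion along rational radii. It describes the points with a radial limit by
countably many conditions, which makes the set of these points measurable.\<close>

definition radial_good :: "(('i \<Rightarrow> complex) \<Rightarrow> complex) \<Rightarrow> ('i \<Rightarrow> complex) \<Rightarrow> bool" where
 "radial_good F x \<longleftrightarrow> (\<forall>k. \<exists>n. \<forall>r s. radial_osc F n r s x \<le> 1 / real (Suc k))"

lemma dil_measurable_torusP:
 fixes F :: "('i::finite \<Rightarrow> complex) \<Rightarrow> complex"
 assumes F: "continuous_on (polyd UNIV) F" and r: "0 \<le> r" "r < 1"
 shows "(\<lambda>x. F (dil (\<lambda>_. r) x)) \<in> borel_measurable torusP"
proof (rule measurable_polyd[OF F])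
 show "(\<lambda>a. dil (\<lambda>_. r) a i) \<in> borel_measurable torusP" for i :: 'i
  unfolding dil_def by (intro borel_measurable_times measurable_coord_circ) simp
 show "dil (\<lambda>_. r) a \<in> polyd UNIV" if "a \<in> space torusP" for a :: "'i \<Rightarrow> complex"
  by (rule polyd_circs[OF that]) (simp add: r)
qed

lemma radial_good_measurable:
 fixes F :: "('i::finite \<Rightarrow> complex) \<Rightarrow> complex"
 assumes F: "continuous_on (polyd UNIV) F"
 shows "{x \<in> space torusP. radial_good F x} \<in> sets torusP"
proof -
 have osc: "radial_osc F n r s \<in> borel_measurable torusP" for n r s
 proof (cases "rr n < of_rat r \<and> of_rat r < (1::real) \<and> rr n < of_rat s \<and> of_rat s < (1::real)")
  case True
  then have r0: "0 \<le> (of_rat r :: real)" "0 \<le> (of_rat s :: real)" using rr(1)[of n] by linarith+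
  have "(\<lambda>x. F (dil (\<lambda>_. of_rat r) x) - F (dil (\<lambda>_. of_rat s) x)) \<in> borel_measurable torusP"
   by (intro borel_measurable_diff dil_measurable_torusP F) (use True r0 in \<open>simp_all del: of_rat_less_1_iff zero_le_of_rat_iff\<close>)
  then have "(\<lambda>x. norm (F (dil (\<lambda>_. of_rat r) x) - F (dil (\<lambda>_. of_rat s) x))) \<in> borel_measurable torusP"
   by (rule measurable_compose[where g=norm]) simp
  then show ?thesis using True by (simp add: radial_osc_def[abs_def])
 next
  case False
  then have "radial_osc F n r s = (\<lambda>_. 0)" by (auto simp: radial_osc_def fun_eq_iff)
  then show ?thesis by simp
 qed
 have "{x \<in> space torusP. radial_osc F n r s x \<le> 1 / real (Suc k)} \<in> sets torusP" for n r s k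
  by (rule borel_measurable_le[OF osc]) simp
 then show ?thesis
  unfolding radial_good_def
  by (intro sets.sets_Collect_countable_All sets.sets_Collect_countable_Ex)
qed

lemma radial_good_iff:
 fixes F :: "('i::finite \<Rightarrow> complex) \<Rightarrow> complex"
 assumes g: "continuous_on {0..<1} (\<lambda>r. F (dil (\<lambda>_. r) x))"
 shows "radial_good F x \<longleftrightarrow> (\<exists>L. ((\<lambda>r. F (dil (\<lambda>_. r) x)) \<longlongrightarrow> L) (at_left 1))"
proof
 let ?g = "\<lambda>r. F (dil (\<lambda>_. r) x)"
 assume G: "radial_good F x"
 show "\<exists>L. (?g \<longlongrightarrow> L) (at_left 1)"
 proof (rule radial_cauchy_limit)
  fix e :: real assume e: "e > 0"
  obtain k where k: "1 / real (Suc k) < e" using nat_approx_posE[OF e] by blast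
  obtain n where n: "\<And>r s. radial_osc F n r s x \<le> 1 / real (Suc k)" using G unfolding radial_good_def by blast
  have rat: "\<exists>q::rat. rr n < of_rat q \<and> of_rat q < (1::real) \<and> norm (?g (of_rat q) - ?g r) < d"
   if r: "rr n < r" "r < 1" and d: "d > 0" for r d
  proof -
   have r0: "0 \<le> r" using r rr(1)[of n] by linarith
   obtain \<delta> where \<delta>: "\<delta> > 0" "\<And>s. s \<in> {0..<1} \<Longrightarrow> dist s r < \<delta> \<Longrightarrow> dist (?g s) (?g r) < d"
    using g d r r0 unfolding continuous_on_iff by (metis atLeastLessThan_iff)
   have "max (rr n) (r - \<delta>) < r" using r \<delta>(1) by simp
   then obtain q where q: "max (rr n) (r - \<delta>) < of_rat q" "of_rat q < r" using of_rat_dense by blast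
   have "(of_rat q :: real) \<in> {0..<1}"
    unfolding atLeastLessThan_iff using q r rr(1)[of n] by linarith
   then have "dist (?g (of_rat q)) (?g r) < d"
    by (rule \<delta>(2)) (use q in \<open>simp add: dist_real_def\<close>)
   moreover have "rr n < of_rat q" "of_rat q < (1::real)" using q r by linarith+
   ultimately show ?thesis unfolding dist_norm by blast
  qed
  show "\<exists>d<1. \<forall>r s. d < r \<and> r < 1 \<and> d < s \<and> s < 1 \<longrightarrow> norm (?g r - ?g s) \<le> e"
  proof (intro exI[of _ "rr n"] conjI allI impI rr(2))
   fix r s assume rs: "rr n < r \<and> r < 1 \<and> rr n < s \<and> s < 1"
   show "norm (?g r - ?g s) \<le> e"
   proof (rule field_le_epsilon)
    fix d :: real assume d: "d > 0"
    obtain q1 where q1: "rr n < of_rat q1" "of_rat q1 < (1::real)" "norm (?g (of_rat q1) - ?g r) < d / 2"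
     using rat[of r "d / 2"] rs d by auto
    obtain q2 where q2: "rr n < of_rat q2" "of_rat q2 < (1::real)" "norm (?g (of_rat q2) - ?g s) < d / 2"
     using rat[of s "d / 2"] rs d by auto
    have "norm (?g (of_rat q1) - ?g (of_rat q2)) \<le> 1 / real (Suc k)"
     using n[of q1 q2] q1 q2 by (simp add: radial_osc_def)
    moreover have "norm (?g r - ?g s) = norm ((?g (of_rat q1) - ?g (of_rat q2)) - (?g (of_rat q1) - ?g r) + (?g (of_rat q2) - ?g s))" by simp
    ultimately show "norm (?g r - ?g s) \<le> e + d"
     using q1(3) q2(3) k norm_triangle_ineq[of "(?g (of_rat q1) - ?g (of_rat q2)) - (?g (of_rat q1) - ?g r)" "?g (of_rat q2) - ?g s"]
      norm_triangle_ineq4[of "?g (of_rat q1) - ?g (of_rat q2)" "?g (of_rat q1) - ?g r"] by linarith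
   qed
  qed
 qed
next
 let ?g = "\<lambda>r. F (dil (\<lambda>_. r) x)"
 assume "\<exists>L. (?g \<longlongrightarrow> L) (at_left 1)"
 then obtain L where L: "(?g \<longlongrightarrow> L) (at_left 1)" by blast
 show "radial_good F x"
  unfolding radial_good_def
 proof
  fix k
  have "\<forall>\<^sub>F r in at_left 1. dist (?g r) L < 1 / real (Suc k) / 2" by (rule tendstoD[OF L]) simp
  then obtain d where d: "d < 1" "\<And>r. d < r \<Longrightarrow> r < 1 \<Longrightarrow> dist (?g r) L < 1 / real (Suc k) / 2"
   unfolding eventually_at_left[OF zero_less_one] by blast
  have "\<forall>\<^sub>F n in sequentially. d < rr n" using rr_lim d(1) by (rule order_tendstoD(1))
  then obtain n where n: "d < rr n" unfolding eventually_sequentially by blast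
  show "\<exists>n. \<forall>r s. radial_osc F n r s x \<le> 1 / real (Suc k)"
  proof (intro exI[of _ n] allI)
   fix r s
   show "radial_osc F n r s x \<le> 1 / real (Suc k)"
   proof (cases "rr n < of_rat r \<and> of_rat r < (1::real) \<and> rr n < of_rat s \<and> of_rat s < (1::real)")
    case True
    have "dist (?g (of_rat r)) L < 1 / real (Suc k) / 2" "dist (?g (of_rat s)) L < 1 / real (Suc k) / 2"
     by (rule d(2); use True n in linarith)+
    then have "dist (?g (of_rat r)) (?g (of_rat s)) < 1 / real (Suc k)" by (rule dist_triangle_half_l)
    then show ?thesis using True by (simp add: radial_osc_def dist_norm)
   next
    case False
    then have "radial_osc F n r s x = 0" unfolding radial_osc_def by argo
    then show ?thesis by simp
   qed
  qed
 qed
qed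

text \<open>The radial boundary value is replaced by a lower limit along the radii \<open>rr n\<close>,
which is measurable and agrees with it wherever the radial limit exists. Its integral is
averaged over diagonal circles, on almost every one of which \<open>hardy_boundary_disc\<close>
applies.\<close>

theorem hardy_boundary_torus:
 fixes F :: "('i::finite \<Rightarrow> complex) \<Rightarrow> complex"
 assumes F: "sep_hol UNIV F" and diag: "\<forall>x\<in>space torusP. (\<lambda>w. F (\<lambda>i. w * x i)) holomorphic_on ball 0 1"
  and p: "p > 0" and fin: "NI UNIV (\<lambda>x. norm (F x) powr p) < \<infinity>"
 defines "B \<equiv> (\<lambda>x. liminf (\<lambda>n. ennreal (norm (F (dil (\<lambda>_. rr n) x)) powr p)))"
 shows "B \<in> borel_measurable torusP" "(\<integral>\<^sup>+x. B x \<partial>torusP) = NI UNIV (\<lambda>x. norm (F x) powr p)"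
  "{x \<in> space torusP. radial_good F x} \<in> sets torusP" "AE x in torusP. radial_good F x"
  "\<And>x. x \<in> space torusP \<Longrightarrow> radial_good F x \<Longrightarrow>
   ennreal (norm (Lim (at_left 1) (\<lambda>r. F (dil (\<lambda>_. r) x))) powr p) = B x"
proof -
 interpret T: sigma_finite_measure "torusP :: ('i \<Rightarrow> complex) measure" by (rule circs.sigma_finite) simp
 interpret TC: pair_sigma_finite "torusP :: ('i \<Rightarrow> complex) measure" circ by standard
 define u where "u = (\<lambda>x. norm (F x) powr p)"
 have us: "slice_mod UNIV u" unfolding u_def by (rule sep_hol_imp_slice_mod[OF F p])
 have Bm: "B \<in> borel_measurable torusP"
  unfolding B_def u_def[symmetric] using slice_mod_dil_measurable[OF us] by (intro borel_measurable_liminf) (simp add: u_def)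
 then show "B \<in> borel_measurable torusP" .
 have Gm: "{x \<in> space torusP. radial_good F x} \<in> sets torusP"
  by (rule radial_good_measurable[OF sep_holD(1)[OF F]])
 then show "{x \<in> space torusP. radial_good F x} \<in> sets torusP" .
 define g where "g = (\<lambda>x w. F (\<lambda>i. w * x i))"
 have g: "g x holomorphic_on ball 0 1" if "x \<in> space torusP" for x unfolding g_def by (rule diag[rule_format, OF that])
 have gd: "F (dil (\<lambda>_. r) (\<lambda>i. w * x i)) = g x (of_real r * w)" for r w x
  by (simp add: g_def dil_def mult.assoc)
 have gd1: "F (dil (\<lambda>_. r) x) = g x (of_real r)" for r x by (simp add: g_def dil_def)
 have rot: "(\<lambda>i. w * x i) \<in> space torusP" if "w \<in> space circ" "x \<in> space torusP" for w and x :: "'i \<Rightarrow> complex"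
  using that by (auto simp: space_PiM norm_mult)
 have cont: "continuous_on {0..<1} (\<lambda>r. F (dil (\<lambda>_. r) x))" if "x \<in> space torusP" for x
  unfolding gd1
  by (rule continuous_on_compose2[OF holomorphic_on_imp_continuous_on[OF g[OF that]]]) (auto intro!: continuous_intros)
 have good_lim: "ennreal (norm (Lim (at_left 1) (\<lambda>r. F (dil (\<lambda>_. r) x))) powr p) = B x"
  if x: "x \<in> space torusP" "radial_good F x" for x
 proof -
  obtain L where L: "((\<lambda>r. F (dil (\<lambda>_. r) x)) \<longlongrightarrow> L) (at_left 1)"
   using x(2) radial_good_iff[OF cont[OF x(1)]] by blast
  have LL: "Lim (at_left 1) (\<lambda>r. F (dil (\<lambda>_. r) x)) = L" by (rule tendsto_Lim[OF _ L]) simp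
  have "filterlim rr (at_left 1) sequentially"
   unfolding filterlim_at using rr_lim rr(2) by (auto intro!: always_eventually simp: less_imp_neq)
  from filterlim_compose[OF L this]
  have "(\<lambda>n. F (dil (\<lambda>_. rr n) x)) \<longlonglongrightarrow> L" .
  then have "(\<lambda>n. ennreal (norm (F (dil (\<lambda>_. rr n) x)) powr p)) \<longlonglongrightarrow> ennreal (norm L powr p)"
   using p by (intro tendsto_ennrealI tendsto_powr2 tendsto_norm tendsto_const) auto
  then have "B x = ennreal (norm L powr p)" unfolding B_def by (intro lim_imp_Liminf) simp_all
  then show ?thesis by (simp only: LL)
 qed
 then show "\<And>x. x \<in> space torusP \<Longrightarrow> radial_good F x \<Longrightarrow>
   ennreal (norm (Lim (at_left 1) (\<lambda>r. F (dil (\<lambda>_. r) x))) powr p) = B x" .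
 have um: "(\<lambda>x. ennreal (u (dil (\<lambda>_. rr n) x))) \<in> borel_measurable torusP" for n by (rule slice_mod_dil_measurable[OF us])
 have N1g: "N1 p (g x) = (SUP n. \<integral>\<^sup>+w. ennreal (u (dil (\<lambda>_. rr n) (\<lambda>i. w * x i))) \<partial>circ)" if x: "x \<in> space torusP" for x
  unfolding N1_eq_SUP_rr[OF g[OF x] p] mean1_def u_def gd ..
 have N1int: "(\<integral>\<^sup>+x. N1 p (g x) \<partial>torusP) = NI UNIV u"
 proof -
  have "(\<integral>\<^sup>+x. N1 p (g x) \<partial>torusP) = (\<integral>\<^sup>+x. (SUP n. \<integral>\<^sup>+w. ennreal (u (dil (\<lambda>_. rr n) (\<lambda>i. w * x i))) \<partial>circ) \<partial>torusP)"
   by (rule nn_integral_cong) (rule N1g)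
  also have "\<dots> = (SUP n. \<integral>\<^sup>+x. \<integral>\<^sup>+w. ennreal (u (dil (\<lambda>_. rr n) (\<lambda>i. w * x i))) \<partial>circ \<partial>torusP)"
  proof (rule nn_integral_monotone_convergence_SUP_AE)
   show "AE x in torusP. (\<integral>\<^sup>+w. ennreal (u (dil (\<lambda>_. rr n) (\<lambda>i. w * x i))) \<partial>circ) \<le> (\<integral>\<^sup>+w. ennreal (u (dil (\<lambda>_. rr (Suc n)) (\<lambda>i. w * x i))) \<partial>circ)" for n
   proof (rule AE_I2)
    fix x :: "'i \<Rightarrow> complex" assume x: "x \<in> space torusP"
    show "(\<integral>\<^sup>+w. ennreal (u (dil (\<lambda>_. rr n) (\<lambda>i. w * x i))) \<partial>circ) \<le> (\<integral>\<^sup>+w. ennreal (u (dil (\<lambda>_. rr (Suc n)) (\<lambda>i. w * x i))) \<partial>circ)"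
     unfolding u_def gd mean1_def[symmetric] by (rule mean1_mono[OF g[OF x] p]) (simp_all add: rr rr_mono)
   qed
   show "(\<lambda>x. \<integral>\<^sup>+w. ennreal (u (dil (\<lambda>_. rr n) (\<lambda>i. w * x i))) \<partial>circ) \<in> borel_measurable torusP" for n
    by (rule nn_integral_torusP_diag(2)[OF um])
  qed
  also have "\<dots> = (SUP n. meanI UNIV (\<lambda>_. rr n) u)"
   unfolding nn_integral_torusP_diag(1)[OF um] meanI_def ..
  also have "\<dots> = NI UNIV u" by (rule NI_eq_SUP_seq[OF us, folded rr_def, symmetric])
  finally show ?thesis .
 qed
 have N1m: "(\<lambda>x. SUP n. \<integral>\<^sup>+w. ennreal (u (dil (\<lambda>_. rr n) (\<lambda>i. w * x i))) \<partial>circ) \<in> borel_measurable torusP"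
  by (intro borel_measurable_SUP countableI_type nn_integral_torusP_diag(2)[OF um])
 have "AE x in torusP. (SUP n. \<integral>\<^sup>+w. ennreal (u (dil (\<lambda>_. rr n) (\<lambda>i. w * x i))) \<partial>circ) \<noteq> \<infinity>"
 proof (rule nn_integral_PInf_AE[OF N1m])
  have "(\<integral>\<^sup>+x. (SUP n. \<integral>\<^sup>+w. ennreal (u (dil (\<lambda>_. rr n) (\<lambda>i. w * x i))) \<partial>circ) \<partial>torusP) = (\<integral>\<^sup>+x. N1 p (g x) \<partial>torusP)"
   by (rule nn_integral_cong) (rule N1g[symmetric])
  then show "(\<integral>\<^sup>+x. (SUP n. \<integral>\<^sup>+w. ennreal (u (dil (\<lambda>_. rr n) (\<lambda>i. w * x i))) \<partial>circ) \<partial>torusP) \<noteq> \<infinity>"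
   using N1int fin by (simp add: u_def)
 qed
 then have N1fin: "AE x in torusP. N1 p (g x) < \<infinity>"
 proof (rule AE_mp, intro AE_I2 impI)
  fix x :: "'i \<Rightarrow> complex" assume x: "x \<in> space torusP"
   and "(SUP n. \<integral>\<^sup>+w. ennreal (u (dil (\<lambda>_. rr n) (\<lambda>i. w * x i))) \<partial>circ) \<noteq> \<infinity>"
  then show "N1 p (g x) < \<infinity>" unfolding N1g[OF x] infinity_ennreal_def less_top[symmetric] by blast
 qed
 have sl: "AE w in circ. radial_good F (\<lambda>i. w * x i)" if x: "x \<in> space torusP" "N1 p (g x) < \<infinity>" for x
 proof -
  have "AE w in circ. \<exists>L. ((\<lambda>r. g x (of_real r * w)) \<longlongrightarrow> L) (at_left 1)" by (rule fatou_Hp[OF g[OF x(1)] p x(2)])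
  then show ?thesis
   by (rule AE_mp) (rule AE_I2, simp add: radial_good_iff[OF cont[OF rot[OF _ x(1)]]] gd)
 qed
 have indm: "indicator (- {x. radial_good F x}) \<in> borel_measurable (torusP :: ('i \<Rightarrow> complex) measure)"
 proof (rule borel_measurable_indicator')
  have "{x \<in> space torusP. x \<in> - {x. radial_good F x}} = space torusP - {x \<in> space torusP. radial_good F x}" by auto
  then show "{x \<in> space torusP. x \<in> - {x. radial_good F x}} \<in> sets torusP" using Gm by simp
 qed
 have "(\<integral>\<^sup>+x. indicator (- {x. radial_good F x}) x \<partial>torusP) = (\<integral>\<^sup>+x. \<integral>\<^sup>+w. indicator (- {x. radial_good F x}) (\<lambda>i. w * x i) \<partial>circ \<partial>torusP)"
  by (rule nn_integral_torusP_diag(1)[OF indm, symmetric])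
 also have "\<dots> = (\<integral>\<^sup>+x. 0 \<partial>(torusP :: ('i \<Rightarrow> complex) measure))"
 proof (rule nn_integral_cong_AE, rule AE_mp[OF N1fin], rule AE_I2, rule impI)
  fix x :: "'i \<Rightarrow> complex" assume x: "x \<in> space torusP" "N1 p (g x) < \<infinity>"
  have "(\<integral>\<^sup>+w. indicator (- {x. radial_good F x}) (\<lambda>i. w * x i) \<partial>circ) = (\<integral>\<^sup>+w. 0 \<partial>circ)"
   by (rule nn_integral_cong_AE) (use sl[OF x] in \<open>eventually_elim, simp\<close>)
  then show "(\<integral>\<^sup>+w. indicator (- {x. radial_good F x}) (\<lambda>i. w * x i) \<partial>circ) = 0" by simp
 qed
 finally have "(\<integral>\<^sup>+x. indicator (- {x. radial_good F x}) x \<partial>(torusP :: ('i \<Rightarrow> complex) measure)) = 0" by simp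
 then have "AE x in (torusP :: ('i \<Rightarrow> complex) measure). indicator (- {x. radial_good F x}) x = (0::ennreal)"
  by (subst (asm) nn_integral_0_iff_AE[OF indm]) simp
 then show "AE x in torusP. radial_good F x" by eventually_elim (auto simp: indicator_def split: if_splits)
 have "(\<integral>\<^sup>+x. B x \<partial>torusP) = (\<integral>\<^sup>+x. \<integral>\<^sup>+w. B (\<lambda>i. w * x i) \<partial>circ \<partial>torusP)"
  by (rule nn_integral_torusP_diag(1)[OF Bm, symmetric])
 also have "\<dots> = (\<integral>\<^sup>+x. N1 p (g x) \<partial>torusP)"
 proof (rule nn_integral_cong_AE, rule AE_mp[OF N1fin], rule AE_I2, rule impI)
  fix x :: "'i \<Rightarrow> complex" assume x: "x \<in> space torusP" "N1 p (g x) < \<infinity>"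
  have "(\<integral>\<^sup>+w. B (\<lambda>i. w * x i) \<partial>circ) = (\<integral>\<^sup>+w. ennreal (norm (Lim (at_left 1) (\<lambda>r. g x (of_real r * w))) powr p) \<partial>circ)"
  proof (rule nn_integral_cong_AE, rule AE_mp[OF sl[OF x]], rule AE_I2, rule impI)
   fix w assume w: "w \<in> space circ" and gw: "radial_good F (\<lambda>i. w * x i)"
   show "B (\<lambda>i. w * x i) = ennreal (norm (Lim (at_left 1) (\<lambda>r. g x (of_real r * w))) powr p)"
    using good_lim[OF rot[OF w x(1)] gw] by (simp only: gd)
  qed
  also have "\<dots> = N1 p (g x)" by (rule hardy_boundary_disc[OF g[OF x(1)] p x(2)])
  finally show "(\<integral>\<^sup>+w. B (\<lambda>i. w * x i) \<partial>circ) = N1 p (g x)" .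
 qed
 finally show "(\<integral>\<^sup>+x. B x \<partial>torusP) = NI UNIV (\<lambda>x. norm (F x) powr p)" using N1int by (simp only: u_def)
qed

section \<open>Measures on vectors as product measures\<close>

lemma sets_berg_le: "A \<in> sets (berg q) \<Longrightarrow> A \<in> sets borel \<and> A \<subseteq> ball 0 1"
 by (auto simp: sets_berg sets_restrict_space)

lemma sets_circ_le: "A \<in> sets circ \<Longrightarrow> A \<in> sets borel \<and> A \<subseteq> sphere 0 1"
 by (auto simp: sets_circ sets_restrict_space)

interpretation lb: product_sigma_finite "\<lambda>_. lborel :: 'a::euclidean_space measure"
 by standard

lemma vec_lambda_measurable:
 "(\<lambda>x. \<chi> i. x i) \<in> borel_measurable (PiM UNIV (\<lambda>_::'n::finite. lborel :: 'a::euclidean_space measure))"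
proof (rule borel_measurable_euclidean_space[THEN iffD2], rule ballI)
 fix b :: "'a ^ 'n" assume "b \<in> Basis"
 then obtain i u where b: "b = axis i u" "u \<in> Basis" unfolding Basis_vec_def by auto
 have "(\<lambda>x. x i \<bullet> u) \<in> borel_measurable (PiM UNIV (\<lambda>_::'n. lborel :: 'a measure))"
  by (rule measurable_compose[where f="\<lambda>x. x i" and g="\<lambda>z. z \<bullet> u" and N=lborel, OF measurable_component_singleton]) simp_all
 then show "(\<lambda>x. (\<chi> i. x i) \<bullet> b) \<in> borel_measurable (PiM UNIV (\<lambda>_::'n. lborel :: 'a measure))"
  by (simp add: b inner_axis)
qed

lemma lborel_vec_eq_PiM:
 "(lborel :: ('a::euclidean_space ^ 'n) measure) = distr (PiM UNIV (\<lambda>_. lborel)) borel (\<lambda>x. \<chi> i. x i)"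
proof (rule lborel_eqI)
 fix l u :: "'a ^ 'n" assume lu: "\<And>b. b \<in> Basis \<Longrightarrow> l \<bullet> b \<le> u \<bullet> b"
 have lui: "l $ i \<bullet> b \<le> u $ i \<bullet> b" if "b \<in> Basis" for i b
  using lu[of "axis i b"] that by (simp add: inner_axis)
 have "emeasure (distr (PiM UNIV (\<lambda>_. lborel)) borel (\<lambda>x. \<chi> i. x i)) (box l u)
   = emeasure (PiM UNIV (\<lambda>_. lborel)) ((\<lambda>x. \<chi> i. x i) -` box l u \<inter> space (PiM UNIV (\<lambda>_::'n. lborel :: 'a measure)))"
  by (rule emeasure_distr[OF vec_lambda_measurable]) simp
 also have "(\<lambda>x. \<chi> i. x i) -` box l u \<inter> space (PiM UNIV (\<lambda>_::'n. lborel :: 'a measure)) = PiE UNIV (\<lambda>i. box (l $ i) (u $ i))"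
  by (auto simp: space_PiM mem_box Basis_vec_def inner_axis PiE_iff)
 also have "emeasure (PiM UNIV (\<lambda>_. lborel)) \<dots> = (\<Prod>i\<in>UNIV. emeasure lborel (box (l $ i) (u $ i)))"
  by (rule lb.emeasure_PiM) auto
 also have "\<dots> = (\<Prod>i\<in>UNIV. ennreal (\<Prod>b\<in>Basis. (u $ i - l $ i) \<bullet> b))"
  by (intro prod.cong refl emeasure_lborel_box) (use lui in \<open>auto\<close>)
 also have "\<dots> = ennreal (\<Prod>i\<in>UNIV. \<Prod>b\<in>Basis. (u $ i - l $ i) \<bullet> b)"
  by (rule prod_ennreal) (auto intro!: prod_nonneg simp: inner_diff_left lui)
 also have "(\<Prod>i\<in>UNIV. \<Prod>b\<in>Basis. (u $ i - l $ i) \<bullet> b) = (\<Prod>b\<in>Basis. (u - l) \<bullet> b)"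
 proof -
  have "(\<Prod>b\<in>(Basis :: ('a ^ 'n) set). (u - l) \<bullet> b) = (\<Prod>i\<in>UNIV. \<Prod>b\<in>(\<Union>v\<in>Basis. {axis i v}). (u - l) \<bullet> b)"
   unfolding Basis_vec_def by (rule prod.UNION_disjoint) (auto simp: axis_eq_axis nonzero_Basis)
  also have "\<dots> = (\<Prod>i\<in>UNIV. \<Prod>b\<in>Basis. (u $ i - l $ i) \<bullet> b)"
  proof (rule prod.cong[OF refl])
   fix i :: 'n
   have "(\<Union>v\<in>Basis. {axis i v}) = axis i ` (Basis :: 'a set)" by auto
   then show "(\<Prod>b\<in>(\<Union>v\<in>Basis. {axis i v}). (u - l) \<bullet> b) = (\<Prod>b\<in>Basis. (u $ i - l $ i) \<bullet> b)"
    by (simp add: prod.reindex inj_on_def axis_eq_axis inner_axis)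
  qed
  finally show ?thesis by simp
 qed
 finally show "emeasure (distr (PiM UNIV (\<lambda>_. lborel)) borel (\<lambda>x. \<chi> i. x i)) (box l u) = ennreal (\<Prod>b\<in>Basis. (u - l) \<bullet> b)" .
qed simp

lemma nn_integral_lborel_vec:
 fixes v :: "'a::euclidean_space ^ 'n \<Rightarrow> ennreal"
 assumes v: "v \<in> borel_measurable borel"
 shows "(\<integral>\<^sup>+z. v z \<partial>lborel) = (\<integral>\<^sup>+x. v (\<chi> i. x i) \<partial>PiM UNIV (\<lambda>_. lborel))"
 unfolding lborel_vec_eq_PiM by (rule nn_integral_distr[OF vec_lambda_measurable]) (use v in simp)

lemma measurable_vec_nth: "(\<lambda>z. z $ i) \<in> borel_measurable (borel :: ('a::euclidean_space ^ 'n) measure)"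
 by (intro borel_measurable_continuous_onI continuous_intros)

lemma nn_integral_lborel_vec_prod:
 fixes g :: "'n::finite \<Rightarrow> 'a::euclidean_space \<Rightarrow> ennreal"
 assumes g: "\<And>i. g i \<in> borel_measurable borel"
 shows "(\<integral>\<^sup>+z. (\<Prod>i\<in>UNIV. g i (z $ i)) \<partial>(lborel :: ('a ^ 'n) measure)) = (\<Prod>i\<in>UNIV. \<integral>\<^sup>+z. g i z \<partial>lborel)"
proof -
 have "(\<lambda>z. \<Prod>i\<in>UNIV. g i (z $ i)) \<in> borel_measurable (borel :: ('a ^ 'n) measure)"
  by (intro borel_measurable_prod_ennreal measurable_compose[OF measurable_vec_nth g])
 from nn_integral_lborel_vec[OF this]
 have "(\<integral>\<^sup>+z. (\<Prod>i\<in>UNIV. g i (z $ i)) \<partial>(lborel :: ('a ^ 'n) measure)) = (\<integral>\<^sup>+x. (\<Prod>i\<in>UNIV. g i (x i)) \<partial>PiM UNIV (\<lambda>_. lborel))" by simp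
 also have "\<dots> = (\<Prod>i\<in>UNIV. \<integral>\<^sup>+z. g i z \<partial>lborel)"
  by (rule lb.product_nn_integral_prod) (use g in auto)
 finally show ?thesis .
qed

lemma ennreal_indicator_prod:
 "indicator {z. \<forall>i. z $ i \<in> E i} z = (\<Prod>i\<in>UNIV. indicator (E i) (z $ i) :: ennreal)" for z :: "'a ^ 'n"
proof (cases "\<forall>i. z $ i \<in> E i")
 case False
 then obtain i where "z $ i \<notin> E i" by blast
 then have "(\<Prod>i\<in>UNIV. indicator (E i) (z $ i) :: ennreal) = 0" by (intro prod_zero bexI[of _ i]) auto
 then show ?thesis using False by (auto simp: indicator_def)
qed (simp add: indicator_def)

lemma vec_box_sets:
 fixes E :: "'n::finite \<Rightarrow> 'a::euclidean_space set"
 assumes "\<And>i. E i \<in> sets borel" shows "{z :: 'a ^ 'n. \<forall>i. z $ i \<in> E i} \<in> sets borel"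
proof -
 have "{z :: 'a ^ 'n. \<forall>i. z $ i \<in> E i} = (\<Inter>i. (\<lambda>z. z $ i) -` E i \<inter> space borel)" by auto
 also have "\<dots> \<in> sets borel"
  by (intro sets.countable_INT'' countableI_type measurable_sets[OF measurable_vec_nth assms]) simp
 finally show ?thesis .
qed

lemma emeasure_lborel_vec_box:
 fixes E :: "'n::finite \<Rightarrow> 'a::euclidean_space set"
 assumes "\<And>i. E i \<in> sets borel"
 shows "emeasure lborel {z :: 'a ^ 'n. \<forall>i. z $ i \<in> E i} = (\<Prod>i\<in>UNIV. emeasure lborel (E i))"
proof -
 have "emeasure lborel {z :: 'a ^ 'n. \<forall>i. z $ i \<in> E i} = (\<integral>\<^sup>+z. indicator {z :: 'a ^ 'n. \<forall>i. z $ i \<in> E i} z \<partial>lborel)"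
  by (rule nn_integral_indicator[symmetric]) (use vec_box_sets[of E, OF assms] in simp)
 also have "\<dots> = (\<Prod>i\<in>UNIV. \<integral>\<^sup>+z. indicator (E i) z \<partial>lborel)"
  unfolding ennreal_indicator_prod by (rule nn_integral_lborel_vec_prod) (use assms in simp)
 finally show ?thesis using assms by simp
qed

lemma space_torus_measure: "space (torus_measure :: (complex ^ 'n) measure) = torus"
 by (simp add: torus_measure_def space_restrict_space)

lemma cis_vec_measurable:
 "(\<lambda>\<theta>. \<chi> k. cis (\<theta> $ k)) \<in> measurable (borel :: (real ^ 'n) measure) (restrict_space borel torus)"
proof -
 have "continuous_on UNIV (\<lambda>\<theta> :: real ^ 'n. \<chi> k. cis (\<theta> $ k))"
  unfolding cis_conv_exp by (intro continuous_intros)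
 from borel_measurable_continuous_onI[OF this] show ?thesis
  by (intro measurable_restrict_space2) (auto simp: torus_def)
qed

lemma torus_coord_measurable:
 "vec_nth \<in> measurable (torus_measure :: (complex ^ 'n) measure) torusP"
proof (rule measurable_PiM_single')
 fix i :: 'n
 have "(\<lambda>z. z $ i) \<in> borel_measurable (restrict_space borel (torus :: (complex ^ 'n) set))"
  by (rule measurable_restrict_space1[OF measurable_vec_nth])
 then have "(\<lambda>z. z $ i) \<in> measurable (restrict_space borel (torus :: (complex ^ 'n) set)) (restrict_space borel (sphere 0 1))"
  by (rule measurable_restrict_space2[rotated]) (auto simp: space_restrict_space torus_def)
 then show "(\<lambda>z. z $ i) \<in> measurable (torus_measure :: (complex ^ 'n) measure) circ"
  unfolding torus_measure_def measurable_cong_sets[OF refl sets_circ] by simp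
qed (auto simp: space_torus_measure torus_def)

text \<open>Both measures agree on products of sets, where the uniform measure on a cube factors.\<close>

lemma torusP_eq_distr: "torusP = distr (torus_measure :: (complex ^ 'n) measure) torusP vec_nth"
proof (rule circs.PiM_eqI[symmetric])
 fix A :: "'n \<Rightarrow> complex set" assume A: "\<And>i. i \<in> UNIV \<Longrightarrow> A i \<in> sets circ"
 define Bx where "Bx = (cbox 0 (\<chi> k. 2 * pi) :: (real ^ 'n) set)"
 define E where "E = (\<lambda>i. {0..2*pi} \<inter> cis -` A i)"
 have Em: "E i \<in> sets borel" for i
  unfolding E_def using measurable_sets[OF borel_measurable_cis, of "A i"] sets_circ_le[OF A[of i]] by auto
 have A1: "norm w = 1" if "w \<in> A i" for w i using sets_circ_le[OF A[of i]] that by auto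
 have box: "Bx = {\<theta>. \<forall>i. \<theta> $ i \<in> {0..2*pi}}"
  by (auto simp: Bx_def mem_box_cart)
 have pre1: "vec_nth -` PiE UNIV A \<inter> space (torus_measure :: (complex ^ 'n) measure) = {z. \<forall>i. z $ i \<in> A i}"
  using A1 by (auto simp: space_torus_measure torus_def PiE_iff)
 have "emeasure (distr (torus_measure :: (complex ^ 'n) measure) torusP vec_nth) (PiE UNIV A) = emeasure torus_measure {z :: complex ^ 'n. \<forall>i. z $ i \<in> A i}"
  unfolding pre1[symmetric] by (rule emeasure_distr[OF torus_coord_measurable sets_PiM_I_finite]) (use A in auto)
 also have "\<dots> = emeasure (uniform_measure lborel Bx) {\<theta>. \<forall>i. cis (\<theta> $ i) \<in> A i}"
 proof -
  have s: "{z :: complex ^ 'n. \<forall>i. z $ i \<in> A i} \<in> sets (restrict_space borel torus)"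
  proof -
   have "{z :: complex ^ 'n. \<forall>i. z $ i \<in> A i} \<in> sets borel" by (rule vec_box_sets) (use sets_circ_le[OF A] in blast)
   moreover have "{z :: complex ^ 'n. \<forall>i. z $ i \<in> A i} \<subseteq> torus" using A1 by (auto simp: torus_def)
   ultimately show ?thesis by (auto simp: sets_restrict_space)
  qed
  have "(\<lambda>\<theta>. \<chi> k. cis (\<theta> $ k)) \<in> measurable (uniform_measure lborel Bx) (restrict_space borel torus)"
   using cis_vec_measurable by (simp add: measurable_cong_sets[OF sets_uniform_measure refl])
  from emeasure_distr[OF this s] show ?thesis
   unfolding torus_measure_def Bx_def[symmetric] by (simp add: vimage_def)
 qed
 also have "\<dots> = emeasure lborel (Bx \<inter> {\<theta>. \<forall>i. cis (\<theta> $ i) \<in> A i}) / emeasure lborel Bx"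
 proof (rule emeasure_uniform_measure)
  show "Bx \<in> sets lborel" by (simp add: Bx_def)
  have "{\<theta> :: real ^ 'n. \<forall>i. \<theta> $ i \<in> cis -` A i} \<in> sets borel"
   by (rule vec_box_sets) (use measurable_sets[OF borel_measurable_cis] sets_circ_le[OF A] in auto)
  then show "{\<theta> :: real ^ 'n. \<forall>i. cis (\<theta> $ i) \<in> A i} \<in> sets lborel" by simp
 qed
 also have "Bx \<inter> {\<theta>. \<forall>i. cis (\<theta> $ i) \<in> A i} = {\<theta>. \<forall>i. \<theta> $ i \<in> E i}" unfolding box E_def by auto
 also have "emeasure lborel {\<theta> :: real ^ 'n. \<forall>i. \<theta> $ i \<in> E i} = (\<Prod>i\<in>UNIV. emeasure lborel (E i))"
  by (rule emeasure_lborel_vec_box[OF Em])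
 also have "emeasure lborel Bx = (\<Prod>i\<in>(UNIV :: 'n set). ennreal (2 * pi))"
  unfolding box by (subst emeasure_lborel_vec_box) auto
 also have "(\<Prod>i\<in>UNIV. emeasure lborel (E i)) / (\<Prod>i\<in>(UNIV :: 'n set). ennreal (2 * pi)) = (\<Prod>i\<in>UNIV. emeasure lborel (E i) / ennreal (2 * pi))"
 proof -
  have "inverse (\<Prod>i\<in>(UNIV :: 'n set). ennreal (2 * pi)) = (\<Prod>i\<in>(UNIV :: 'n set). inverse (ennreal (2 * pi)))"
   by (simp add: ennreal_power inverse_ennreal power_inverse[symmetric] power_divide)
  then show ?thesis by (simp only: divide_ennreal_def prod.distrib)
 qed
 also have "\<dots> = (\<Prod>i\<in>UNIV. emeasure circ (A i))"
 proof (rule prod.cong[OF refl])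
  fix i
  have Ai: "A i \<in> sets circ" using A by simp
  have "emeasure circ (A i) = (\<integral>\<^sup>+z. indicator (A i) z \<partial>circ)" using Ai by simp
  also have "\<dots> = (\<integral>\<^sup>+t. indicator (A i) (cis t) * indicator {0..2*pi} t \<partial>lborel) / (2 * pi)"
   by (rule nn_integral_circ) (use Ai in simp)
  also have "(\<integral>\<^sup>+t. indicator (A i) (cis t) * indicator {0..2*pi} t \<partial>lborel) = (\<integral>\<^sup>+t. indicator (E i) t \<partial>lborel)"
   by (rule nn_integral_cong) (auto simp: E_def indicator_def)
  finally show "emeasure lborel (E i) / ennreal (2 * pi) = emeasure circ (A i)" using Em[of i] by simp
 qed
 finally show "emeasure (distr (torus_measure :: (complex ^ 'n) measure) torusP vec_nth) (PiE UNIV A) = (\<Prod>i\<in>UNIV. emeasure circ (A i))" .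
qed simp_all

lemma nn_integral_torus_measure:
 assumes "v \<in> borel_measurable torusP"
 shows "(\<integral>\<^sup>+w. v (vec_nth w) \<partial>(torus_measure :: (complex ^ 'n) measure)) = (\<integral>\<^sup>+x. v x \<partial>torusP)"
proof -
 have "(\<integral>\<^sup>+x. v x \<partial>distr (torus_measure :: (complex ^ 'n) measure) torusP vec_nth) = (\<integral>\<^sup>+w. v (vec_nth w) \<partial>torus_measure)"
  by (rule nn_integral_distr[OF torus_coord_measurable]) (use assms in simp)
 then show ?thesis by (simp only: torusP_eq_distr[symmetric])
qed

lemma AE_torus_measure:
 assumes "{x \<in> space torusP. P x} \<in> sets torusP" "AE x in torusP. P x"
 shows "AE w in (torus_measure :: (complex ^ 'n) measure). P (vec_nth w)"
proof -
 have "AE x in distr (torus_measure :: (complex ^ 'n) measure) torusP vec_nth. P x"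
  using assms(2) by (simp only: torusP_eq_distr[symmetric])
 then show ?thesis using AE_distr_iff[OF torus_coord_measurable assms(1)] by blast
qed

abbreviation bergP :: "nat \<Rightarrow> ('i::finite \<Rightarrow> complex) measure" where
 "bergP q \<equiv> PiM UNIV (\<lambda>_. berg q)"

lemma space_bergman_measure: "space (bergman_measure q :: (complex ^ 'n) measure) = polydisc"
 by (simp add: bergman_measure_def space_restrict_space)

lemma sets_bergman_measure: "sets (bergman_measure q :: (complex ^ 'n) measure) = sets (restrict_space borel polydisc)"
 unfolding bergman_measure_def by (simp add: sets_restrict_space)

lemma bergman_coord_measurable:
 "vec_nth \<in> measurable (bergman_measure q :: (complex ^ 'n) measure) (bergP q)"
proof (rule measurable_PiM_single')
 fix i :: 'n
 have "(\<lambda>z. z $ i) \<in> borel_measurable (restrict_space borel (polydisc :: (complex ^ 'n) set))"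
  by (rule measurable_restrict_space1[OF measurable_vec_nth])
 then have "(\<lambda>z. z $ i) \<in> measurable (restrict_space borel (polydisc :: (complex ^ 'n) set)) (restrict_space borel (ball 0 1))"
  by (rule measurable_restrict_space2[rotated]) (auto simp: space_restrict_space polydisc_def)
 then show "(\<lambda>z. z $ i) \<in> measurable (bergman_measure q :: (complex ^ 'n) measure) (berg q)"
  unfolding measurable_cong_sets[OF sets_bergman_measure sets_berg] .
qed (auto simp: space_bergman_measure polydisc_def)

text \<open>On products of sets the density is a product of densities of the coordinates.\<close>

lemma bergP_eq_distr: "bergP q = distr (bergman_measure q :: (complex ^ 'n) measure) (bergP q) vec_nth"
proof (rule bergs.PiM_eqI[symmetric])
 fix A :: "'n \<Rightarrow> complex set" assume A: "\<And>i. i \<in> UNIV \<Longrightarrow> A i \<in> sets (berg q)"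
 have AB: "A i \<in> sets borel" "A i \<subseteq> ball 0 1" for i using sets_berg_le[OF A[of i]] by auto
 have A1: "norm w < 1" if "w \<in> A i" for w i using AB(2)[of i] that by auto
 let ?A = "{z :: complex ^ 'n. \<forall>i. z $ i \<in> A i}"
 define d where "d = (\<lambda>z::complex. ennreal ((real q + 1) / pi * (1 - (norm z)\<^sup>2) ^ q))"
 define D where "D = (\<lambda>z::complex ^ 'n. ennreal ((real q + 1) ^ CARD('n) / pi ^ CARD('n) * (\<Prod>k\<in>UNIV. (1 - (norm (z $ k))\<^sup>2) ^ q)))"
 have Am: "?A \<in> sets borel" by (rule vec_box_sets[OF AB(1)])
 have Ap: "?A \<subseteq> polydisc" using A1 by (auto simp: polydisc_def)
 have pm: "polydisc \<in> sets (borel :: (complex ^ 'n) measure)"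
 proof -
  have "polydisc = {z :: complex ^ 'n. \<forall>i. z $ i \<in> ball 0 1}" by (auto simp: polydisc_def)
  then show ?thesis using vec_box_sets[of "\<lambda>_::'n. ball (0::complex) 1"] by simp
 qed
 have Dm: "D \<in> borel_measurable borel"
 proof -
  have "(\<lambda>z. (real q + 1) ^ CARD('n) / pi ^ CARD('n) * (\<Prod>k\<in>UNIV. (1 - (norm (z $ k))\<^sup>2) ^ q)) \<in> borel_measurable (borel :: (complex ^ 'n) measure)"
   by (intro borel_measurable_continuous_onI continuous_intros)
  then show ?thesis unfolding D_def by (rule measurable_compose) simp
 qed
 have dm: "d \<in> borel_measurable borel"
 proof -
  have "(\<lambda>z::complex. (real q + 1) / pi * (1 - (norm z)\<^sup>2) ^ q) \<in> borel_measurable borel"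
   by (intro borel_measurable_continuous_onI continuous_intros)
  then show ?thesis unfolding d_def by (rule measurable_compose) simp
 qed
 have pre: "vec_nth -` PiE UNIV A \<inter> space (bergman_measure q :: (complex ^ 'n) measure) = ?A"
  using A1 by (auto simp: space_bergman_measure polydisc_def PiE_iff)
 have Dd: "D z * indicator ?A z = (\<Prod>i\<in>UNIV. d (z $ i) * indicator (A i) (z $ i))" for z
 proof (cases "z \<in> ?A")
  case True
  have nn: "0 \<le> (1 - (norm (z $ i))\<^sup>2) ^ q" for i
   using True AB(2)[of i] by (intro zero_le_power) (auto simp: abs_square_le_1 less_imp_le subset_iff)
  have "(\<Prod>i\<in>UNIV. d (z $ i)) = ennreal (\<Prod>i\<in>UNIV. (real q + 1) / pi * (1 - (norm (z $ i))\<^sup>2) ^ q)"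
   unfolding d_def by (rule prod_ennreal) (use nn in simp)
  also have "\<dots> = D z" unfolding D_def by (simp only: prod.distrib prod_constant power_divide)
  finally show ?thesis using True by (simp add: ennreal_indicator_prod[symmetric] prod.distrib)
 next
  case False
  then obtain i where "z $ i \<notin> A i" by blast
  then have "(\<Prod>i\<in>UNIV. d (z $ i) * indicator (A i) (z $ i)) = 0" by (intro prod_zero bexI[of _ i]) auto
  then show ?thesis using False by simp
 qed
 have "emeasure (distr (bergman_measure q :: (complex ^ 'n) measure) (bergP q) vec_nth) (PiE UNIV A) = emeasure (bergman_measure q) ?A"
  unfolding pre[symmetric] by (rule emeasure_distr[OF bergman_coord_measurable sets_PiM_I_finite]) (use A in auto)
 also have "\<dots> = (\<integral>\<^sup>+z. D z * indicator ?A z \<partial>restrict_space lborel polydisc)"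
  unfolding bergman_measure_def D_def[symmetric]
 proof (rule emeasure_density)
  show "D \<in> borel_measurable (restrict_space lborel polydisc)" by (rule measurable_restrict_space1) (use Dm in simp)
  show "?A \<in> sets (restrict_space lborel polydisc)" using Am Ap by (auto simp: sets_restrict_space)
 qed
 also have "\<dots> = (\<integral>\<^sup>+z. D z * indicator ?A z * indicator polydisc z \<partial>lborel)"
  by (rule nn_integral_restrict_space) (use pm in simp)
 also have "\<dots> = (\<integral>\<^sup>+z. (\<Prod>i\<in>UNIV. d (z $ i) * indicator (A i) (z $ i)) \<partial>lborel)"
  unfolding Dd[symmetric] by (rule nn_integral_cong) (use Ap in \<open>auto simp: indicator_def\<close>)
 also have "\<dots> = (\<Prod>i\<in>UNIV. \<integral>\<^sup>+z. d z * indicator (A i) z \<partial>lborel)"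
  by (rule nn_integral_lborel_vec_prod) (intro borel_measurable_times_ennreal dm borel_measurable_indicator AB)
 also have "\<dots> = (\<Prod>i\<in>UNIV. emeasure (berg q) (A i))"
 proof (rule prod.cong[OF refl])
  fix i
  have Ai: "A i \<in> sets (berg q)" using A by simp
  have "emeasure (berg q) (A i) = (\<integral>\<^sup>+z. indicator (A i) z \<partial>berg q)" using Ai by simp
  also have "\<dots> = (\<integral>\<^sup>+z. d z * indicator (A i) z * indicator (ball 0 1) z \<partial>lborel)"
   unfolding d_def by (rule nn_integral_berg) (use Ai in simp)
  also have "\<dots> = (\<integral>\<^sup>+z. d z * indicator (A i) z \<partial>lborel)"
   by (rule nn_integral_cong) (use AB(2)[of i] in \<open>auto simp: indicator_def\<close>)
  finally show "(\<integral>\<^sup>+z. d z * indicator (A i) z \<partial>lborel) = emeasure (berg q) (A i)" ..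
 qed
 finally show "emeasure (distr (bergman_measure q :: (complex ^ 'n) measure) (bergP q) vec_nth) (PiE UNIV A) = (\<Prod>i\<in>UNIV. emeasure (berg q) (A i))" .
qed simp_all

lemma nn_integral_bergman_measure:
 assumes "v \<in> borel_measurable (bergP q)"
 shows "(\<integral>\<^sup>+z. v (vec_nth z) \<partial>(bergman_measure q :: (complex ^ 'n) measure)) = (\<integral>\<^sup>+x. v x \<partial>bergP q)"
proof -
 have "(\<integral>\<^sup>+x. v x \<partial>distr (bergman_measure q :: (complex ^ 'n) measure) (bergP q) vec_nth) = (\<integral>\<^sup>+z. v (vec_nth z) \<partial>bergman_measure q)"
  by (rule nn_integral_distr[OF bergman_coord_measurable]) (use assms in simp)
 then show ?thesis by (simp only: bergP_eq_distr[symmetric])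
qed

section \<open>Hardy spaces of the polydisc\<close>

text \<open>A complex linear derivative restricts to a complex derivative along every complex line.\<close>

lemma holomorphic_on_vec_affine:
 fixes f :: "complex ^ 'n \<Rightarrow> complex"
 assumes f: "holomorphic_on_vec f S" and S: "\<And>w. w \<in> U \<Longrightarrow> a + w *s v \<in> S"
 shows "(\<lambda>w. f (a + w *s v)) holomorphic_on U"
proof (rule holomorphic_onI)
 fix w assume w: "w \<in> U"
 obtain D where D: "(f has_derivative D) (at (a + w *s v))" "\<forall>c v. D (c *s v) = c * D v"
  using f S[OF w] unfolding holomorphic_on_vec_def by blast
 have "linear (\<lambda>w. w *s v)"
  by (rule linearI) (simp_all add: vec_eq_iff algebra_simps)
 then have "bounded_linear (\<lambda>w. w *s v)" by (rule linear_conv_bounded_linear[THEN iffD1])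
 then have "((\<lambda>w. w *s v) has_derivative (\<lambda>w. w *s v)) (at w)" by (rule bounded_linear_imp_has_derivative)
 then have "((\<lambda>w. a + w *s v) has_derivative (\<lambda>w. w *s v)) (at w)"
  by (rule has_derivative_add_const[where c=a, simplified add.commute])
 from has_derivative_compose[OF this D(1)]
 have "((\<lambda>w. f (a + w *s v)) has_derivative (\<lambda>h. D v * h)) (at w)"
  using D(2) by (simp add: mult.commute)
 then have "((\<lambda>w. f (a + w *s v)) has_field_derivative D v) (at w)"
  by (simp add: has_field_derivative_def)
 then show "(\<lambda>w. f (a + w *s v)) field_differentiable at w within U"
  unfolding field_differentiable_def by (blast intro: has_field_derivative_at_within)
qed

lemma sep_hol_vec:
 fixes f :: "complex ^ 'n \<Rightarrow> complex"
 assumes f: "holomorphic_on_vec f polydisc"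
 shows "sep_hol UNIV (\<lambda>x. f (\<chi> i. x i))"
 unfolding sep_hol_def
proof (intro conjI ballI allI impI)
 have fc: "continuous_on polydisc f"
  using f unfolding holomorphic_on_vec_def
  by (intro continuous_at_imp_continuous_on ballI) (blast intro: has_derivative_continuous)
 have "continuous_on (polyd UNIV) (\<lambda>x. (\<chi> i. x i) :: complex ^ 'n)"
  by (intro continuous_on_vec_lambda continuous_on_coord)
 then show "continuous_on (polyd UNIV) (\<lambda>x. f (\<chi> i. x i))"
  by (rule continuous_on_compose2[OF fc]) (auto simp: polyd_def polydisc_def)
 show "f (\<chi> i. x i) = f (\<chi> i. y i)" if "\<forall>i\<in>UNIV. x i = y i" for x y
  using that by (intro arg_cong[where f=f]) (simp add: vec_eq_iff)
 fix x :: "'n \<Rightarrow> complex" and k :: 'n assume x: "x \<in> polyd UNIV"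
 define a :: "complex ^ 'n" where "a = (\<chi> i. (x(k := 0)) i)"
 have e: "(\<chi> i. (x(k := w)) i) = a + w *s axis k 1" for w
  by (simp add: a_def vec_eq_iff axis_def)
 show "(\<lambda>w. f (\<chi> i. (x(k := w)) i)) holomorphic_on ball 0 1"
  unfolding e
 proof (rule holomorphic_on_vec_affine[OF f])
  fix w :: complex assume "w \<in> ball 0 1"
  then show "a + w *s axis k 1 \<in> polydisc"
   unfolding e[symmetric] using x by (auto simp: polyd_def polydisc_def)
 qed
qed

lemma vec_diag: "(\<chi> i. (of_real r :: complex) * x i) = r *\<^sub>R (\<chi> i. x i)"
 by (simp add: vec_eq_iff scaleR_conv_of_real[where 'a=complex])

lemma hardy_norm_powr_eq_NI:
 fixes f :: "complex ^ 'n \<Rightarrow> complex"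
 assumes f: "holomorphic_on_vec f polydisc" and p: "p > 0"
 shows "hardy_norm_powr p f = NI UNIV (\<lambda>x. norm (f (\<chi> i. x i)) powr p)"
 unfolding hardy_norm_powr_def NI_def
proof (rule SUP_cong[OF refl])
 fix r :: real assume r: "r \<in> {0..<1}"
 have m: "(\<lambda>x. ennreal (norm (f (\<chi> i. (dil (\<lambda>_. r) x) i)) powr p)) \<in> borel_measurable torusP"
 proof -
  have "slice_mod UNIV (\<lambda>x. norm (f (\<chi> i. x i)) powr p)" by (rule sep_hol_imp_slice_mod[OF sep_hol_vec[OF f] p])
  then have "continuous_on (polyd UNIV) (\<lambda>x. norm (f (\<chi> i. x i)) powr p)" by (rule slice_modD(1))
  then have "(\<lambda>x. norm (f (\<chi> i. (dil (\<lambda>_. r) x) i)) powr p) \<in> borel_measurable torusP"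
  proof (rule measurable_polyd)
   show "(\<lambda>a. dil (\<lambda>_. r) a i) \<in> borel_measurable torusP" for i :: 'n
    unfolding dil_def by (intro borel_measurable_times measurable_coord_circ) simp
   show "dil (\<lambda>_. r) a \<in> polyd UNIV" if "a \<in> space torusP" for a :: "'n \<Rightarrow> complex"
    by (rule polyd_circs[OF that]) (use r in auto)
  qed
  then show ?thesis by (rule measurable_compose) simp
 qed
 have "(\<integral>\<^sup>+w. ennreal (norm (f (r *\<^sub>R w)) powr p) \<partial>torus_measure) = (\<integral>\<^sup>+w. ennreal (norm (f (\<chi> i. (dil (\<lambda>_. r) (vec_nth w)) i)) powr p) \<partial>(torus_measure :: (complex ^ 'n) measure))"
  by (simp add: dil_def vec_diag)
 also have "\<dots> = meanI UNIV (\<lambda>_. r) (\<lambda>x. norm (f (\<chi> i. x i)) powr p)"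
  unfolding meanI_def by (rule nn_integral_torus_measure[OF m])
 finally show "(\<integral>\<^sup>+w. ennreal (norm (f (r *\<^sub>R w)) powr p) \<partial>torus_measure) = meanI UNIV (\<lambda>_. r) (\<lambda>x. norm (f (\<chi> i. x i)) powr p)" .
qed

lemma radial_boundary_integral:
 fixes f :: "complex ^ 'n \<Rightarrow> complex"
 assumes f: "f \<in> hardy_space p" and p: "p > 0"
 shows "(\<integral>\<^sup>+w. ennreal (norm (radial_boundary f w) powr p) \<partial>torus_measure) = NI UNIV (\<lambda>x. norm (f (\<chi> i. x i)) powr p)"
proof -
 have fh: "holomorphic_on_vec f polydisc" and fin: "NI UNIV (\<lambda>x. norm (f (\<chi> i. x i)) powr p) < \<infinity>"
  using f hardy_norm_powr_eq_NI[OF _ p, of f] by (auto simp: hardy_space_def)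
 define F where "F = (\<lambda>x. f (\<chi> i. x i))"
 have diag: "\<forall>x\<in>space torusP. (\<lambda>w. F (\<lambda>i. w * x i)) holomorphic_on ball 0 1"
 proof
  fix x :: "'n \<Rightarrow> complex" assume x: "x \<in> space torusP"
  have "norm (x i) = 1" for i using x by (auto simp: space_PiM PiE_iff)
  then have "(\<lambda>w. f (0 + w *s (\<chi> i. x i))) holomorphic_on ball 0 1"
   by (intro holomorphic_on_vec_affine[OF fh]) (simp add: polydisc_def norm_mult)
  moreover have "0 + w *s (\<chi> i. x i) = (\<chi> i. w * x i)" for w by (simp add: vec_eq_iff)
  ultimately show "(\<lambda>w. F (\<lambda>i. w * x i)) holomorphic_on ball 0 1" by (simp add: F_def)
 qed
 define B where "B = (\<lambda>x. liminf (\<lambda>n. ennreal (norm (F (dil (\<lambda>_. rr n) x)) powr p)))"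
 note H = hardy_boundary_torus[OF sep_hol_vec[OF fh] diag[unfolded F_def] p fin, folded F_def, folded B_def]
 have ae: "AE w in (torus_measure :: (complex ^ 'n) measure). radial_good F (vec_nth w)"
  by (rule AE_torus_measure[where P="radial_good F", OF H(3) H(4)])
 have "(\<integral>\<^sup>+w. ennreal (norm (radial_boundary f w) powr p) \<partial>torus_measure) = (\<integral>\<^sup>+w. B (vec_nth w) \<partial>(torus_measure :: (complex ^ 'n) measure))"
 proof (rule nn_integral_cong_AE, rule AE_mp[OF ae], rule AE_I2, rule impI)
  fix w :: "complex ^ 'n" assume w: "w \<in> space torus_measure" "radial_good F (vec_nth w)"
  have "vec_nth w \<in> space torusP" using w(1) by (auto simp: space_torus_measure torus_def space_PiM)
  from H(5)[OF this w(2)] show "ennreal (norm (radial_boundary f w) powr p) = B (vec_nth w)"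
   by (simp add: radial_boundary_def B_def F_def dil_def vec_diag)
 qed
 also have "\<dots> = NI UNIV (\<lambda>x. norm (f (\<chi> i. x i)) powr p)"
  using nn_integral_torus_measure[OF H(1)] H(2) by (simp add: B_def F_def)
 finally show ?thesis .
qed

lemma kernel_holomorphic:
 assumes "norm b < 1" shows "(\<lambda>w. (1 - b * w) powr s) holomorphic_on ball 0 1"
proof -
 have "Re (1 - b * w) > 0" if "norm w < 1" for w
 proof -
  have "norm (b * w) \<le> norm w" unfolding norm_mult by (rule mult_left_le_one_le) (use assms in auto)
  then show ?thesis using that complex_Re_le_cmod[of "b * w"] by simp
 qed
 then show ?thesis by (intro holomorphic_intros) (auto simp: complex_nonpos_Reals_iff not_le)
qed

text \<open>The mean of a product of functions of separate coordinates is a product of means, each of which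
increases with the radius.\<close>

lemma NI_kernel:
 fixes b :: "'i::finite \<Rightarrow> complex"
 assumes b: "b \<in> polyd UNIV" and p: "p > 0" and K: "K = (\<lambda>i w. (1 - b i * w) powr (- of_real (2 / p)))"
  and F: "\<And>x. x \<in> polyd UNIV \<Longrightarrow> F x = C * (\<Prod>i\<in>UNIV. K i (x i))"
 shows "NI UNIV (\<lambda>x. norm (F x) powr p) = ennreal (norm C powr p) * (\<Prod>i\<in>UNIV. N1 p (K i))"
  and "x \<in> polyd UNIV \<Longrightarrow> ennreal (norm (F x) powr p) = ennreal (norm C powr p) * (\<Prod>i\<in>UNIV. ennreal (norm (K i (x i)) powr p))"
  and "K i holomorphic_on ball 0 1"
proof -
 have Kh: "K i holomorphic_on ball 0 1" for i
  unfolding K by (rule kernel_holomorphic) (use b in \<open>simp add: polyd_def\<close>)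
 then show "K i holomorphic_on ball 0 1" .
 have Fx: "ennreal (norm (F x) powr p) = ennreal (norm C powr p) * (\<Prod>i\<in>UNIV. ennreal (norm (K i (x i)) powr p))" if "x \<in> polyd UNIV" for x
 proof -
  have "norm (F x) powr p = norm C powr p * (\<Prod>i\<in>UNIV. norm (K i (x i)) powr p)"
   unfolding F[OF that] by (simp add: norm_mult powr_mult flip: prod_norm prod_powr_distrib)
  then show ?thesis by (simp add: ennreal_mult prod_nonneg flip: prod_ennreal)
 qed
 then show "x \<in> polyd UNIV \<Longrightarrow> ennreal (norm (F x) powr p) = ennreal (norm C powr p) * (\<Prod>i\<in>UNIV. ennreal (norm (K i (x i)) powr p))" .
 have Km: "(\<lambda>z. ennreal (norm (K i (of_real r * z)) powr p)) \<in> borel_measurable circ" if r: "0 \<le> r" "r < 1" for i r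
 proof -
  have "(\<lambda>z. K i (of_real r * z)) \<in> borel_measurable circ"
   by (rule measurable_dilate_circ[OF holomorphic_on_imp_continuous_on[OF Kh] r])
  then have "(\<lambda>z. norm (K i (of_real r * z)) powr p) \<in> borel_measurable circ" by measurable
  then show ?thesis by (rule measurable_compose) simp
 qed
 have mI: "meanI UNIV (\<lambda>_. r) (\<lambda>x. norm (F x) powr p) = ennreal (norm C powr p) * (\<Prod>i\<in>UNIV. mean1 p (K i) r)" if r: "0 \<le> r" "r < 1" for r
 proof -
  have "meanI UNIV (\<lambda>_. r) (\<lambda>x. norm (F x) powr p) = (\<integral>\<^sup>+x. ennreal (norm C powr p) * (\<Prod>i\<in>UNIV. ennreal (norm (K i (of_real r * x i)) powr p)) \<partial>torusP)"
   unfolding meanI_def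
  proof (rule nn_integral_cong)
   fix x :: "'i \<Rightarrow> complex" assume x: "x \<in> space torusP"
   have "dil (\<lambda>_. r) x \<in> polyd UNIV" by (rule polyd_circs[OF x]) (use r in auto)
   from Fx[OF this] show "ennreal (norm (F (dil (\<lambda>_. r) x)) powr p) = ennreal (norm C powr p) * (\<Prod>i\<in>UNIV. ennreal (norm (K i (of_real r * x i)) powr p))"
    by (simp add: dil_def)
  qed
  also have "\<dots> = ennreal (norm C powr p) * (\<integral>\<^sup>+x. (\<Prod>i\<in>UNIV. ennreal (norm (K i (of_real r * x i)) powr p)) \<partial>torusP)"
  proof (rule nn_integral_cmult, rule borel_measurable_prod_ennreal)
   fix i :: 'i
   show "(\<lambda>x. ennreal (norm (K i (of_real r * x i)) powr p)) \<in> borel_measurable torusP"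
    by (rule measurable_compose[where f="\<lambda>x. x i" and N=circ, OF measurable_component_singleton Km[OF r]]) simp
  qed
  also have "(\<integral>\<^sup>+x. (\<Prod>i\<in>UNIV. ennreal (norm (K i (of_real r * x i)) powr p)) \<partial>torusP) = (\<Prod>i\<in>UNIV. mean1 p (K i) r)"
   unfolding mean1_def by (rule circs.product_nn_integral_prod[OF finite Km[OF r]])
  finally show ?thesis .
 qed
 have inc: "incseq (\<lambda>n. mean1 p (K i) (rr n))" for i
  unfolding incseq_def by (auto intro!: mean1_mono[OF Kh p] rr rr_mono)
 have "NI UNIV (\<lambda>x. norm (F x) powr p) = (SUP r\<in>{0..<1}. ennreal (norm C powr p) * (\<Prod>i\<in>UNIV. mean1 p (K i) r))"
  unfolding NI_def by (rule SUP_cong[OF refl]) (rule mI, auto)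
 also have "\<dots> = (SUP n. ennreal (norm C powr p) * (\<Prod>i\<in>UNIV. mean1 p (K i) (rr n)))"
 proof (rule antisym)
  show "(SUP r\<in>{0..<1}. ennreal (norm C powr p) * (\<Prod>i\<in>UNIV. mean1 p (K i) r)) \<le> (SUP n. ennreal (norm C powr p) * (\<Prod>i\<in>UNIV. mean1 p (K i) (rr n)))"
  proof (rule SUP_least)
   fix r :: real assume r: "r \<in> {0..<1}"
   have "\<forall>\<^sub>F n in sequentially. r < rr n" using rr_lim r by (intro order_tendstoD(1)) auto
   then obtain n where n: "r < rr n" unfolding eventually_sequentially by blast
   have "ennreal (norm C powr p) * (\<Prod>i\<in>UNIV. mean1 p (K i) r) \<le> ennreal (norm C powr p) * (\<Prod>i\<in>UNIV. mean1 p (K i) (rr n))"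
    by (intro mult_left_mono prod_mono_ennreal mean1_mono[OF Kh p]) (use r n rr in auto)
   also have "\<dots> \<le> (SUP n. ennreal (norm C powr p) * (\<Prod>i\<in>UNIV. mean1 p (K i) (rr n)))" by (rule SUP_upper) simp
   finally show "ennreal (norm C powr p) * (\<Prod>i\<in>UNIV. mean1 p (K i) r) \<le> (SUP n. ennreal (norm C powr p) * (\<Prod>i\<in>UNIV. mean1 p (K i) (rr n)))" .
  qed
  show "(SUP n. ennreal (norm C powr p) * (\<Prod>i\<in>UNIV. mean1 p (K i) (rr n))) \<le> (SUP r\<in>{0..<1}. ennreal (norm C powr p) * (\<Prod>i\<in>UNIV. mean1 p (K i) r))"
   by (rule SUP_least, rule SUP_upper) (simp add: rr)
 qed
 also have "\<dots> = ennreal (norm C powr p) * (\<Prod>i\<in>UNIV. N1 p (K i))"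
  unfolding N1_eq_SUP_rr[OF Kh p] prod_SUP_incseq[OF finite inc] by (rule SUP_mult_left_ennreal[symmetric])
 finally show "NI UNIV (\<lambda>x. norm (F x) powr p) = ennreal (norm C powr p) * (\<Prod>i\<in>UNIV. N1 p (K i))" .
qed

lemma kernel_equality:
 fixes F :: "nat \<Rightarrow> ('i::finite \<Rightarrow> complex) \<Rightarrow> complex"
 assumes m: "m \<ge> 2" and p: "\<And>j. j \<in> {1..m} \<Longrightarrow> p j > 0" and b: "b \<in> polyd UNIV"
  and F: "\<And>j x. j \<in> {1..m} \<Longrightarrow> x \<in> polyd UNIV \<Longrightarrow> F j x = C j * (\<Prod>i\<in>UNIV. (1 - b i * x i) powr (- of_real (2 / p j)))"
 shows "(\<integral>\<^sup>+x. (\<Prod>j=1..m. ennreal (norm (F j x) powr p j)) \<partial>bergP (m - 2)) = (\<Prod>j=1..m. NI UNIV (\<lambda>x. norm (F j x) powr p j))"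
proof -
 define K where "K = (\<lambda>j i w. (1 - b i * w) powr (- of_real (2 / p j)))"
 note kern = NI_kernel[OF b p refl F, folded K_def]
 have Km: "(\<lambda>w. \<Prod>j=1..m. ennreal (norm (K j i w) powr p j)) \<in> borel_measurable (berg (m - 2))" for i
 proof (rule borel_measurable_prod_ennreal)
  fix j assume j: "j \<in> {1..m}"
  have Kh: "K j i holomorphic_on ball 0 1" unfolding K_def by (rule kernel_holomorphic) (use b in \<open>simp add: polyd_def\<close>)
  have "K j i \<in> borel_measurable (berg (m - 2))"
   unfolding measurable_cong_sets[OF sets_berg refl]
   by (rule borel_measurable_continuous_on_restrict[OF holomorphic_on_imp_continuous_on[OF Kh]])
  then have "(\<lambda>w. norm (K j i w) powr p j) \<in> borel_measurable (berg (m - 2))" by measurable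
  then show "(\<lambda>w. ennreal (norm (K j i w) powr p j)) \<in> borel_measurable (berg (m - 2))" by (rule measurable_compose) simp
 qed
 have one: "(\<integral>\<^sup>+w. (\<Prod>j=1..m. ennreal (norm (K j i w) powr p j)) \<partial>berg (m - 2)) = (\<Prod>j=1..m. N1 (p j) (K j i))" for i
 proof -
  have "norm (b i) < 1" using b by (simp add: polyd_def)
  from burbea_disc_kernel[where C="\<lambda>_. 1" and p=p and b="b i", OF m p this]
  show ?thesis by (simp add: K_def prod_ennreal)
 qed
 have "(\<integral>\<^sup>+x. (\<Prod>j=1..m. ennreal (norm (F j x) powr p j)) \<partial>bergP (m - 2))
   = (\<integral>\<^sup>+x. (\<Prod>j=1..m. ennreal (norm (C j) powr p j)) * (\<Prod>i\<in>UNIV. \<Prod>j=1..m. ennreal (norm (K j i (x i)) powr p j)) \<partial>bergP (m - 2))"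
 proof (rule nn_integral_cong)
  fix x :: "'i \<Rightarrow> complex" assume "x \<in> space (bergP (m - 2))"
  then have x: "x \<in> polyd UNIV" by (rule polyd_bergs)
  have "(\<Prod>j=1..m. ennreal (norm (F j x) powr p j)) = (\<Prod>j=1..m. ennreal (norm (C j) powr p j) * (\<Prod>i\<in>UNIV. ennreal (norm (K j i (x i)) powr p j)))"
   by (rule prod.cong[OF refl]) (rule NI_kernel(2)[OF b p _ _ x], auto simp: K_def F)
  also have "\<dots> = (\<Prod>j=1..m. ennreal (norm (C j) powr p j)) * (\<Prod>j=1..m. \<Prod>i\<in>UNIV. ennreal (norm (K j i (x i)) powr p j))"
   by (rule prod.distrib)
  also have "(\<Prod>j=1..m. \<Prod>i\<in>UNIV. ennreal (norm (K j i (x i)) powr p j)) = (\<Prod>i\<in>UNIV. \<Prod>j=1..m. ennreal (norm (K j i (x i)) powr p j))"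
   by (rule prod.swap)
  finally show "(\<Prod>j=1..m. ennreal (norm (F j x) powr p j)) = (\<Prod>j=1..m. ennreal (norm (C j) powr p j)) * (\<Prod>i\<in>UNIV. \<Prod>j=1..m. ennreal (norm (K j i (x i)) powr p j))" .
 qed
 also have "\<dots> = (\<Prod>j=1..m. ennreal (norm (C j) powr p j)) * (\<integral>\<^sup>+x. (\<Prod>i\<in>UNIV. \<Prod>j=1..m. ennreal (norm (K j i (x i)) powr p j)) \<partial>bergP (m - 2))"
 proof (rule nn_integral_cmult, rule borel_measurable_prod_ennreal)
  fix i :: 'i
  show "(\<lambda>x. \<Prod>j=1..m. ennreal (norm (K j i (x i)) powr p j)) \<in> borel_measurable (bergP (m - 2))"
   by (rule measurable_compose[where f="\<lambda>x. x i" and N="berg (m - 2)", OF measurable_component_singleton Km]) simp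
 qed
 also have "(\<integral>\<^sup>+x. (\<Prod>i\<in>UNIV. \<Prod>j=1..m. ennreal (norm (K j i (x i)) powr p j)) \<partial>bergP (m - 2)) = (\<Prod>i\<in>UNIV. \<Prod>j=1..m. N1 (p j) (K j i))"
  by (simp only: bergs.product_nn_integral_prod[OF finite Km] one)
 also have "(\<Prod>i\<in>(UNIV :: 'i set). \<Prod>j=1..m. N1 (p j) (K j i)) = (\<Prod>j=1..m. \<Prod>i\<in>UNIV. N1 (p j) (K j i))" by (rule prod.swap)
 also have "(\<Prod>j=1..m. ennreal (norm (C j) powr p j)) * (\<Prod>j=1..m. \<Prod>i\<in>UNIV. N1 (p j) (K j i)) = (\<Prod>j=1..m. ennreal (norm (C j) powr p j) * (\<Prod>i\<in>UNIV. N1 (p j) (K j i)))"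
  by (rule prod.distrib[symmetric])
 also have "\<dots> = (\<Prod>j=1..m. NI UNIV (\<lambda>x. norm (F j x) powr p j))"
  by (rule prod.cong[OF refl], rule NI_kernel(1)[OF b p, symmetric]) (auto simp: K_def F)
 finally show ?thesis .
qed

theorem theorem1p3:
 fixes m :: nat and p :: "nat \<Rightarrow> real" and f :: "nat \<Rightarrow> complex ^ 'n \<Rightarrow> complex"
 assumes "m \<ge> 2"
  and "\<And>j. j \<in> {1..m} \<Longrightarrow> p j > 0"
  and "\<And>j. j \<in> {1..m} \<Longrightarrow> f j \<in> hardy_space (p j)"
 shows "(\<integral>\<^sup>+ z. ennreal (\<Prod>j=1..m. norm (f j z) powr p j) \<partial>bergman_measure (m - 2))
     \<le> (\<Prod>j=1..m. \<integral>\<^sup>+ w. ennreal (norm (radial_boundary (f j) w) powr p j) \<partial>torus_measure)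
   \<and> ((\<integral>\<^sup>+ z. ennreal (\<Prod>j=1..m. norm (f j z) powr p j) \<partial>bergman_measure (m - 2))
     = (\<Prod>j=1..m. \<integral>\<^sup>+ w. ennreal (norm (radial_boundary (f j) w) powr p j) \<partial>torus_measure)
    \<longleftrightarrow> (\<exists>j\<in>{1..m}. \<forall>z\<in>polydisc. f j z = 0)
     \<or> (\<exists>\<zeta>\<in>polydisc. \<exists>C :: nat \<Rightarrow> complex. \<forall>j\<in>{1..m}. C j \<noteq> 0 \<and>
        (\<forall>z\<in>polydisc. f j z = C j * hardy_kernel_powr z \<zeta> (2 / p j))))"
proof -
 note m = assms(1) and p = assms(2)
 define F where "F = (\<lambda>j x. f j (\<chi> i. x i))"
 have fh: "holomorphic_on_vec (f j) polydisc" if "j \<in> {1..m}" for j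
  using assms(3)[OF that] by (simp add: hardy_space_def)
 have Fh: "sep_hol UNIV (F j)" if "j \<in> {1..m}" for j
  unfolding F_def by (rule sep_hol_vec[OF fh[OF that]])
 have us: "slice_mod UNIV (\<lambda>x. norm (F j x) powr p j)" if "j \<in> {1..m}" for j
  by (rule sep_hol_imp_slice_mod[OF Fh[OF that] p[OF that]])
 have fin: "NI UNIV (\<lambda>x. norm (F j x) powr p j) < \<infinity>" if "j \<in> {1..m}" for j
  using assms(3)[OF that] hardy_norm_powr_eq_NI[OF fh[OF that] p[OF that]] by (simp add: hardy_space_def F_def)
 have R: "(\<Prod>j=1..m. \<integral>\<^sup>+ w. ennreal (norm (radial_boundary (f j) w) powr p j) \<partial>torus_measure) = (\<Prod>j=1..m. NI UNIV (\<lambda>x. norm (F j x) powr p j))"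
  unfolding F_def by (intro prod.cong refl radial_boundary_integral assms(3) p)
 have L: "(\<integral>\<^sup>+ z. ennreal (\<Prod>j=1..m. norm (f j z) powr p j) \<partial>bergman_measure (m - 2)) = (\<integral>\<^sup>+x. (\<Prod>j=1..m. ennreal (norm (F j x) powr p j)) \<partial>bergP (m - 2))"
 proof -
  have "(\<lambda>x. \<Prod>j=1..m. ennreal (norm (F j x) powr p j)) \<in> borel_measurable (bergP (m - 2))"
   by (intro borel_measurable_prod_ennreal slice_mod_measurable_bergs us)
  from nn_integral_bergman_measure[OF this] show ?thesis by (simp add: F_def prod_ennreal)
 qed
 have pd: "(\<chi> i. x i) \<in> polydisc \<longleftrightarrow> x \<in> polyd UNIV" for x :: "'n \<Rightarrow> complex" by (simp add: polydisc_def polyd_def)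
 have pd': "vec_nth z \<in> polyd UNIV \<longleftrightarrow> z \<in> polydisc" for z :: "complex ^ 'n" by (simp add: polydisc_def polyd_def)
 have le: "(\<integral>\<^sup>+x. (\<Prod>j=1..m. ennreal (norm (F j x) powr p j)) \<partial>bergP (m - 2)) \<le> (\<Prod>j=1..m. NI UNIV (\<lambda>x. norm (F j x) powr p j))"
  by (rule NI_ineq[OF m us])
 have kp: "hardy_kernel_powr z \<zeta> s = (\<Prod>i\<in>UNIV. (1 - cnj (\<zeta> $ i) * z $ i) powr (- of_real s))" for z \<zeta> :: "complex ^ 'n" and s
  by (simp add: hardy_kernel_powr_def mult.commute)
 have eqv: "(\<integral>\<^sup>+x. (\<Prod>j=1..m. ennreal (norm (F j x) powr p j)) \<partial>bergP (m - 2)) = (\<Prod>j=1..m. NI UNIV (\<lambda>x. norm (F j x) powr p j))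
   \<longleftrightarrow> (\<exists>j\<in>{1..m}. \<forall>z\<in>polydisc. f j z = 0)
     \<or> (\<exists>\<zeta>\<in>polydisc. \<exists>C :: nat \<Rightarrow> complex. \<forall>j\<in>{1..m}. C j \<noteq> 0 \<and>
        (\<forall>z\<in>polydisc. f j z = C j * hardy_kernel_powr z \<zeta> (2 / p j)))" (is "?E \<longleftrightarrow> ?Z \<or> ?K")
 proof (intro iffI)
  assume E: ?E
  show "?Z \<or> ?K"
  proof (cases ?Z)
   case nZ: False
   have nz: "\<exists>x\<in>polyd UNIV. F j x \<noteq> 0" if j: "j \<in> {1..m}" for j
   proof -
    obtain z where z: "z \<in> polydisc" "f j z \<noteq> 0" using nZ j by blast
    then show ?thesis by (intro bexI[of _ "vec_nth z"]) (simp_all add: F_def pd')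
   qed
   have "extremal m p UNIV F" unfolding extremal_def using p Fh nz fin E by blast
   then obtain b where b: "b \<in> polyd UNIV" and
    k: "\<forall>j\<in>{1..m}. \<exists>C. \<forall>x\<in>polyd UNIV. F j x = C * (\<Prod>i\<in>UNIV. (1 - b i * x i) powr (- of_real (2 / p j)))"
    using extremal_kernel[OF m] unfolding kernel_form_def by blast
   obtain C where C: "\<forall>j\<in>{1..m}. \<forall>x\<in>polyd UNIV. F j x = C j * (\<Prod>i\<in>UNIV. (1 - b i * x i) powr (- of_real (2 / p j)))"
    using bchoice[OF k] by blast
   define \<zeta> where "\<zeta> = (\<chi> i. cnj (b i))"
   have "\<zeta> \<in> polydisc" using b by (simp add: \<zeta>_def polydisc_def polyd_def)
   moreover have "C j \<noteq> 0 \<and> (\<forall>z\<in>polydisc. f j z = C j * hardy_kernel_powr z \<zeta> (2 / p j))" if j: "j \<in> {1..m}" for j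
   proof (intro conjI ballI)
    show "C j \<noteq> 0" using nz[OF j] C j by auto
    fix z :: "complex ^ 'n" assume "z \<in> polydisc"
    then have "F j (vec_nth z) = C j * (\<Prod>i\<in>UNIV. (1 - b i * z $ i) powr (- of_real (2 / p j)))" using C j pd' by blast
    then show "f j z = C j * hardy_kernel_powr z \<zeta> (2 / p j)" by (simp add: kp \<zeta>_def F_def)
   qed
   ultimately have ?K by blast
   then show ?thesis ..
  qed (rule disjI1)
 next
  assume "?Z \<or> ?K"
  then show ?E
  proof
   assume ?Z
   then obtain j where j: "j \<in> {1..m}" "\<forall>z\<in>polydisc. f j z = 0" by blast
   have "meanI UNIV (\<lambda>_. r) (\<lambda>x. norm (F j x) powr p j) = 0" if r: "r \<in> {0..<1}" for r
   proof -
    have "meanI UNIV (\<lambda>_. r) (\<lambda>x. norm (F j x) powr p j) = (\<integral>\<^sup>+x. 0 \<partial>(torusP :: ('n \<Rightarrow> complex) measure))"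
     unfolding meanI_def
    proof (rule nn_integral_cong)
     fix x :: "'n \<Rightarrow> complex" assume x: "x \<in> space torusP"
     have "dil (\<lambda>_. r) x \<in> polyd UNIV" by (rule polyd_circs[OF x]) (use r in auto)
     then have "F j (dil (\<lambda>_. r) x) = 0" using j(2) pd unfolding F_def by blast
     then show "ennreal (norm (F j (dil (\<lambda>_. r) x)) powr p j) = 0" by simp
    qed
    then show ?thesis by simp
   qed
   then have "NI UNIV (\<lambda>x. norm (F j x) powr p j) = 0" unfolding NI_def by simp
   then have "(\<Prod>j=1..m. NI UNIV (\<lambda>x. norm (F j x) powr p j)) = 0" using j(1) by (intro prod_zero) auto
   then show ?E using le by (simp only: le_zero_eq)
  next
   assume ?K
   then obtain \<zeta> C where z: "\<zeta> \<in> polydisc" and C: "\<forall>j\<in>{1..m}. \<forall>z\<in>polydisc. f j z = C j * hardy_kernel_powr z \<zeta> (2 / p j)"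
    by blast
   show ?E
   proof (rule kernel_equality[OF m p])
    show "(\<lambda>i. cnj (\<zeta> $ i)) \<in> polyd UNIV" using z by (simp add: polyd_def polydisc_def)
    show "F j x = C j * (\<Prod>i\<in>UNIV. (1 - cnj (\<zeta> $ i) * x i) powr (- of_real (2 / p j)))" if "j \<in> {1..m}" "x \<in> polyd UNIV" for j x
     using C that pd[of x] by (simp add: F_def kp)
   qed
  qed
 qed
 show ?thesis unfolding L R by (intro conjI le eqv)
qed

end
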